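(* $f_{\mathcal{SEG}}(n) = 2^{2^{\Theta(n)}}$; that is, there exist constants $c_1, c_2 > 0$ and $n_0$ such that for all $n \geq n_0$, \[ 2^{2^{c_1 n}} \leq f_{\mathcal{SEG}}(n) \leq 2^{2^{c_2 n}}. \]
   Context: The intersection graph of a tuple of sets $(A(v) : v \in V)$ is the graph with vertex set $V$ in which distinct $u,v$ are adjacent iff $A(u)\cap A(v) \neq \emptyset$; the tuple is then said to realize the graph. A segment graph is a graph that is (isomorphic to) the intersection graph of finitely many closed line segments in $\mathbb{R}^2$. Let $\mathcal{SEG}(n)$ be the set of segment graphs with $n$ vertices. An integer $\mathcal{SEG}$-realization of a segment graph $G$ is a realization of $G$ by closed line segments both of whose endpoints lie in $\mathbb{Z}^2$; every segment graph has one. For a finite collection $\mathcal{A}$ of bounded sets in the plane let $k(\mathcal{A}) := \min\{k \in \mathbb{N} : A \subseteq [-k,k]^2 \text{ for all } A \in \mathcal{A}\}$. Define $f_{\mathcal{SEG}}(G) := \min k(\mathcal{A})$, the minimum being over all integer $\mathcal{SEG}$-realizations $\mathcal{A}$ of $G$, and $f_{\mathcal{SEG}}(n) := \max_{G \in \mathcal{SEG}(n)} f_{\mathcal{SEG}}(G)$. *)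

theory Defs
  imports "HOL-Analysis.Analysis" "Graph_Theory.Graph_Theory"
begin

text \<open>
  Simple undirected graphs are rendered, as in \<open>Graph_Theory\<close>, by symmetric loop-free
  digraphs whose arcs are pairs of vertices. The plane is \<open>real \<times> real\<close>.
\<close>

definition intersection_graph :: "'v set \<Rightarrow> ('v \<Rightarrow> 'p set) \<Rightarrow> 'v pair_pre_digraph" where
  "intersection_graph V A =
     \<lparr> pverts = V, parcs = {(u, v). u \<in> V \<and> v \<in> V \<and> u \<noteq> v \<and> A u \<inter> A v \<noteq> {}} \<rparr>"

text \<open>
  A tuple is a total function of which only the values on the vertex set matter. Distinct vertices
  may receive the same set.
\<close>

definition realizes :: "('v \<Rightarrow> 'p set) \<Rightarrow> 'v pair_pre_digraph \<Rightarrow> bool" where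
  "realizes A G \<longleftrightarrow> intersection_graph (pverts G) A = G"

text \<open>
  Segments are nondegenerate: the library's \<open>closed_segment a a\<close> is a single point, which is
  excluded here.
\<close>

definition is_segment :: "(real \<times> real) set \<Rightarrow> bool" where
  "is_segment S \<longleftrightarrow> (\<exists>a b. a \<noteq> b \<and> S = closed_segment a b)"

definition is_integer_segment :: "(real \<times> real) set \<Rightarrow> bool" where
  "is_integer_segment S \<longleftrightarrow> (\<exists>a \<in> \<int> \<times> \<int>. \<exists>b \<in> \<int> \<times> \<int>. a \<noteq> b \<and> S = closed_segment a b)"

text \<open>
  The existential quantifier cannot range over types, so the finite family is indexed by natural
  numbers; this is no restriction since any finite index set can be relabelled.
\<close>

definition segment_graph :: "'v pair_pre_digraph \<Rightarrow> bool" where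
  "segment_graph G \<longleftrightarrow>
     (\<exists>(I :: nat set) A. finite I \<and> (\<forall>i\<in>I. is_segment (A i)) \<and>
        digraph_iso (with_proj (intersection_graph I A)) (with_proj G))"

text \<open>Every isomorphism type of finite graphs occurs on a vertex set of natural numbers.\<close>

definition SEG :: "nat \<Rightarrow> nat pair_pre_digraph set" where
  "SEG n = {G. segment_graph G \<and> card (pverts G) = n}"

definition integer_SEG_realization ::
    "('v \<Rightarrow> (real \<times> real) set) \<Rightarrow> 'v pair_pre_digraph \<Rightarrow> bool" where
  "integer_SEG_realization A G \<longleftrightarrow>
     realizes A G \<and> (\<forall>v \<in> pverts G. is_integer_segment (A v))"

definition box_size :: "(real \<times> real) set set \<Rightarrow> nat" where
  "box_size \<A> =
     (LEAST k. \<forall>S\<in>\<A>. S \<subseteq> {- real k..real k} \<times> {- real k..real k})"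

definition f_SEG_graph :: "'v pair_pre_digraph \<Rightarrow> nat" where
  "f_SEG_graph G =
     (LEAST m. \<exists>A. integer_SEG_realization A G \<and> m = box_size (A ` pverts G))"

text \<open>
  \<open>SEG n\<close> is infinite for positive \<open>n\<close>, but \<open>f_SEG_graph\<close> is invariant under isomorphism, so that
  the maximum is over a finite set of values.
\<close>

definition f_SEG :: "nat \<Rightarrow> nat" where
  "f_SEG n = Max (f_SEG_graph ` SEG n)"

end

theory Submission
  imports Defs "HOL-Real_Asymp.Real_Asymp"
begin

text \<open>Lower bound. Inside an outer rim, a cycle of segments forces two curves to cross when their
  attachments to the cycle alternate, for otherwise \<open>K\<^sub>5\<close> would be planar. The segments \<open>X\<close>, \<open>Y\<close>, \<open>Z\<close> form
  a triangle, which serves as an affine frame, and \<open>C k\<close> meets the axis \<open>Y\<close> at a point \<open>y k > 0\<close>.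
  Forced crossings and prescribed nonadjacencies make \<open>C (k + 1)\<close> meet \<open>X\<close> and \<open>Z\<close> at coordinates at most
  \<open>y k\<close>, so that \<open>r k = y k / (1 + y k)\<close> satisfies \<open>r (k + 1) \<le> (r k)\<^sup>2\<close>. The start \<open>r 0 \<le> 1/2\<close> is obtained from
  a mirror image of the drawing that shares \<open>Y\<close> and \<open>Z\<close> and exchanges \<open>X\<close> and \<open>H\<close>: in one of the two copies
  the first point of \<open>C\<close> is close enough to \<open>Z\<close>. On the other hand nonzero determinants of integer
  points are at least \<open>1\<close>, so that \<open>r k\<close> is at least the inverse of a polynomial in the size of the box.

  Upper bound. After prolonging and turning the segments a little, all intersecting pairs cross and all
  others are separated, both by strict signs of orientation determinants. These are quadratic inequalities
  with small integer coefficients. The maximal value of the smallest of the quadratic forms on a cube is, by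
  the Karush-Kuhn-Tucker conditions of a generically perturbed problem and Caratheodory's theorem, related
  to few polynomials of degree two; their algebraic dependence makes it a root of an integer polynomial of
  explicit degree and height. It is therefore not too small, and rounding a maximizer to a grid yields integer endpoints.\<close>

subsection \<open>Nonplanarity of the complete graph on five vertices\<close>

text \<open>The squaring is Menelaus' theorem: a line that cuts the extended sides of the frame
  triangle at coordinates u, f and v satisfies v/(1+v) = u/(1+u) * f/(1+f), so that u, f \<le> y
  give a square. Such relations are affine and offer no unit of length, whence the start needs two
  drawings: the parameters p and p' at which H cuts Y in the two copies satisfy p p' = 1, so one of
  them is at most 1. In the upper bound the quadratically many inequalities must stay out of the
  exponent. Caratheodory's theorem leaves at most m + 1 active forms, so that coordinates and
  multipliers together are at most 2 m unknowns. At an unperturbed maximizer all polynomials but one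
  would vanish, and their algebraic dependence might reduce to 0 = 0. The perturbation makes their
  values asymptotic to powers of an infinitesimal whose products are all of different order; the
  term of lowest order survives and is a nonzero polynomial in the maximum. The degree stays singly
  exponential because passing from degree L to 4 L multiplies the number of monomials in M variables
  by at most 4 ^ M.\<close>

definition angle_change :: "(real \<Rightarrow> complex) \<Rightarrow> real \<Rightarrow> bool" where
  "angle_change p w \<longleftrightarrow> (\<exists>g. continuous_on {0..1} g \<and> (\<forall>t\<in>{0..1}. p t = exp (g t)) \<and>
     w = Im (g 1) - Im (g 0))"

text \<open>The difference of two logarithms of \<open>p\<close> is continuous with values in the
  discrete set of multiples of 2 pi i, hence constant.\<close>

lemma angle_change_unique:
  assumes "angle_change p v" "angle_change p w"
  shows "v = w"
proof -
  obtain g h where g: "continuous_on {0..1} g" "\<And>t. t \<in> {0..1} \<Longrightarrow> p t = exp (g t)" "v = Im (g 1) - Im (g 0)"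
    and h: "continuous_on {0..1} h" "\<And>t. t \<in> {0..1} \<Longrightarrow> p t = exp (h t)" "w = Im (h 1) - Im (h 0)"
    using assms unfolding angle_change_def by metis
  have "(\<lambda>t. g t - h t) constant_on {0..1}"
  proof (rule continuous_discrete_range_constant)
    show "Topological_Spaces.connected {0..1::real}" by simp
    show "continuous_on {0..1} (\<lambda>t. g t - h t)" by (intro continuous_intros g h)
    fix x :: real assume x: "x \<in> {0..1}"
    have "2 * pi \<le> norm (g y - h y - (g x - h x))" if y: "y \<in> {0..1}" "g y - h y \<noteq> g x - h x" for y
    proof -
      have *: "\<exists>n::int. g t - h t = of_int (2 * n) * (of_real pi * \<i>)" if "t \<in> {0..1}" for t
      proof -
        have "exp (g t) = exp (h t)" using g(2)[OF that] h(2)[OF that] by simp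
        then obtain n :: int where "g t = h t + (of_int (2 * n) * pi) * \<i>" unfolding exp_eq by blast
        then show ?thesis by (intro exI[of _ n]) simp
      qed
      obtain m :: int where m: "g y - h y = of_int (2 * m) * (of_real pi * \<i>)" using *[OF y(1)] by blast
      obtain n :: int where n: "g x - h x = of_int (2 * n) * (of_real pi * \<i>)" using *[OF x] by blast
      note mn = m n
      have "m \<noteq> n" using y(2) mn by auto
      then have "1 \<le> \<bar>m - n\<bar>" by simp
      then have "1 \<le> \<bar>real_of_int (m - n)\<bar>" by linarith
      moreover have "g y - h y - (g x - h x) = of_real (2 * pi * real_of_int (m - n)) * \<i>"
        unfolding mn by (simp add: algebra_simps)
      then have "norm (g y - h y - (g x - h x)) = \<bar>2 * pi * real_of_int (m - n)\<bar>"
        by (simp only: norm_mult norm_of_real norm_ii mult_1_right)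
      ultimately show ?thesis by (simp add: abs_mult)
    qed
    then show "\<exists>e>0. \<forall>y. y \<in> {0..1} \<and> g y - h y \<noteq> g x - h x \<longrightarrow> e \<le> norm (g y - h y - (g x - h x))"
      by (intro exI[of _ "2 * pi"]) auto
  qed
  then obtain c where c: "\<And>t. t \<in> {0..1} \<Longrightarrow> g t - h t = c" unfolding constant_on_def by blast
  have "g 1 - h 1 = g 0 - h 0" using c[of 0] c[of 1] by simp
  then have "Im (g 1 - h 1) = Im (g 0 - h 0)" by (rule arg_cong)
  then show ?thesis using g(3) h(3) by simp
qed

lemma angle_change_Arg:
  assumes "angle_change p w"
  shows "\<exists>n::int. w = Arg (p 1) - Arg (p 0) + 2 * pi * of_int n"
proof -
  obtain g where g: "\<And>t. t \<in> {0..1} \<Longrightarrow> p t = exp (g t)" "w = Im (g 1) - Im (g 0)"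
    using assms unfolding angle_change_def by metis
  have *: "\<exists>n::int. Im (g t) = Arg (p t) + 2 * pi * of_int n" if "t \<in> {0..1}" for t
  proof -
    have "p t \<noteq> 0" using g(1)[OF that] by simp
    then have "exp (g t) = exp (Ln (p t))" using g(1)[OF that] by simp
    then obtain n :: int where "g t = Ln (p t) + (of_int (2 * n) * pi) * \<i>" unfolding exp_eq by blast
    then have "Im (g t) = Im (Ln (p t)) + 2 * pi * of_int n" by simp
    then show ?thesis unfolding Arg_eq_Im_Ln[OF \<open>p t \<noteq> 0\<close>] by blast
  qed
  have "0 \<in> {0..1::real}" "1 \<in> {0..1::real}" by auto
  from *[OF this(1)] *[OF this(2)] obtain a b :: int
    where "Im (g 1) = Arg (p 1) + 2 * pi * of_int a" "Im (g 0) = Arg (p 0) + 2 * pi * of_int b"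
    by blast
  then have "w = Arg (p 1) - Arg (p 0) + 2 * pi * of_int (a - b)" using g(2) by (simp add: right_diff_distrib)
  then show ?thesis by blast
qed

lemma angle_change_uminus:
  assumes "angle_change p w"
  shows "angle_change (\<lambda>t. - p t) w"
proof -
  obtain g where g: "continuous_on {0..1} g" "\<And>t. t \<in> {0..1} \<Longrightarrow> p t = exp (g t)" "w = Im (g 1) - Im (g 0)"
    using assms unfolding angle_change_def by metis
  have "continuous_on {0..1} (\<lambda>t. g t + \<i> * pi)" by (intro continuous_intros g)
  moreover have "\<forall>t\<in>{0..1}. - p t = exp (g t + \<i> * pi)" using g(2) by (simp add: exp_add mult.commute)
  moreover have "w = Im (g 1 + \<i> * pi) - Im (g 0 + \<i> * pi)" using g(3) by simp
  ultimately show ?thesis unfolding angle_change_def by blast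
qed

text \<open>As the paths are disjoint, \<open>p s - q t\<close> has no zero on the unit square,
  which is contractible, and so has a continuous logarithm there. The equation compares its
  increments along the two ways round the boundary from one corner to the opposite one.\<close>

lemma angle_change_square:
  fixes p q :: "real \<Rightarrow> complex"
  assumes "continuous_on {0..1} p" "continuous_on {0..1} q"
    and ne: "\<And>s t. s \<in> {0..1} \<Longrightarrow> t \<in> {0..1} \<Longrightarrow> p s \<noteq> q t"
  shows "\<exists>a b c d. angle_change (\<lambda>s. p s - q 0) a \<and> angle_change (\<lambda>t. q t - p 1) b \<and>
    angle_change (\<lambda>t. q t - p 0) c \<and> angle_change (\<lambda>s. p s - q 1) d \<and> a + b = c + d"
proof -
  let ?S = "{0..1} \<times> {0..1} :: (real \<times> real) set"
  have c1: "continuous_on ?S (\<lambda>z. p (fst z) - q (snd z))"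
  proof (rule continuous_on_diff)
    show "continuous_on ?S (\<lambda>z. p (fst z))"
      by (rule continuous_on_compose2[OF assms(1) continuous_on_fst[OF continuous_on_id]]) auto
    show "continuous_on ?S (\<lambda>z. q (snd z))"
      by (rule continuous_on_compose2[OF assms(2) continuous_on_snd[OF continuous_on_id]]) auto
  qed
  have c2: "contractible ?S"
    by (intro convex_imp_contractible convex_Times convex_closed_interval)
  have c3: "p (fst z) - q (snd z) \<noteq> 0" if "z \<in> ?S" for z
    using ne[of "fst z" "snd z"] that by (cases z) simp
  have "\<exists>g. continuous_on ?S g \<and> (\<forall>z\<in>?S. p (fst z) - q (snd z) = exp (g z))"
  proof (rule continuous_logarithm_on_contractible[OF c1 c2 c3])
    fix g assume "continuous_on ?S g" "\<And>z. z \<in> ?S \<Longrightarrow> p (fst z) - q (snd z) = exp (g z)"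
    then show "\<exists>g. continuous_on ?S g \<and> (\<forall>z\<in>?S. p (fst z) - q (snd z) = exp (g z))"
      by (intro exI[of _ g] conjI ballI)
  qed
  then obtain g where g: "continuous_on ?S g" "\<And>z. z \<in> ?S \<Longrightarrow> p (fst z) - q (snd z) = exp (g z)"
    by blast
  have sq: "angle_change (\<lambda>s. p (fst (\<gamma> s)) - q (snd (\<gamma> s))) (Im (g (\<gamma> 1)) - Im (g (\<gamma> 0)))"
    if "continuous_on {0..1} \<gamma>" "\<And>s. s \<in> {0..1} \<Longrightarrow> \<gamma> s \<in> ?S" for \<gamma> :: "real \<Rightarrow> real \<times> real"
  proof -
    have "continuous_on {0..1} (\<lambda>s. g (\<gamma> s))"
      by (rule continuous_on_compose2[OF g(1) that(1)]) (use that(2) in blast)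
    moreover have "\<forall>s\<in>{0..1}. p (fst (\<gamma> s)) - q (snd (\<gamma> s)) = exp (g (\<gamma> s))"
      using g(2) that(2) by blast
    ultimately show ?thesis unfolding angle_change_def by blast
  qed
  have 1: "angle_change (\<lambda>s. p s - q 0) (Im (g (1,0)) - Im (g (0,0)))"
    using sq[of "\<lambda>s. (s,0)", OF continuous_on_Pair[OF continuous_on_id continuous_on_const]] by simp
  have 2: "angle_change (\<lambda>s. p s - q 1) (Im (g (1,1)) - Im (g (0,1)))"
    using sq[of "\<lambda>s. (s,1)", OF continuous_on_Pair[OF continuous_on_id continuous_on_const]] by simp
  have "angle_change (\<lambda>t. p 1 - q t) (Im (g (1,1)) - Im (g (1,0)))"
    using sq[of "\<lambda>s. (1,s)", OF continuous_on_Pair[OF continuous_on_const continuous_on_id]] by simp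
  from angle_change_uminus[OF this]
  have 3: "angle_change (\<lambda>t. q t - p 1) (Im (g (1,1)) - Im (g (1,0)))" by simp
  have "angle_change (\<lambda>t. p 0 - q t) (Im (g (0,1)) - Im (g (0,0)))"
    using sq[of "\<lambda>s. (0,s)", OF continuous_on_Pair[OF continuous_on_const continuous_on_id]] by simp
  from angle_change_uminus[OF this]
  have 4: "angle_change (\<lambda>t. q t - p 0) (Im (g (0,1)) - Im (g (0,0)))" by simp
  have "(Im (g (1,0)) - Im (g (0,0))) + (Im (g (1,1)) - Im (g (1,0)))
      = (Im (g (0,1)) - Im (g (0,0))) + (Im (g (1,1)) - Im (g (0,1)))" by simp
  then show ?thesis using 1 2 3 4
    by (intro exI[of _ "Im (g (1,0)) - Im (g (0,0))"] exI[of _ "Im (g (1,1)) - Im (g (1,0))"]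
      exI[of _ "Im (g (0,1)) - Im (g (0,0))"] exI[of _ "Im (g (1,1)) - Im (g (0,1))"] conjI)
qed

text \<open>The fifteen equations belong to the pairs of disjoint edges, and they are added. Each
  \<open>n\<close> occurs in two of them, once for each choice of the fourth vertex, so it
  contributes a multiple of 4. Each \<open>e a b\<close> has an even coefficient in the sum and is
  odd; modulo 4 this leaves the sum of these coefficients, which is 10.\<close>

lemma K5_parity:
  fixes e :: "nat \<Rightarrow> nat \<Rightarrow> int" and n :: "nat \<Rightarrow> nat \<Rightarrow> nat \<Rightarrow> int"
  assumes anti: "\<And>a b. a < b \<Longrightarrow> b < 5 \<Longrightarrow> e b a = - e a b"
    and odd: "\<And>a b. a < b \<Longrightarrow> b < 5 \<Longrightarrow> odd (e a b)"
    and eq: "\<And>i j k l. i < j \<Longrightarrow> k < l \<Longrightarrow> j < 5 \<Longrightarrow> l < 5 \<Longrightarrow> {i,j} \<inter> {k,l} = {} \<Longrightarrow>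
      e k j + e j l + e l i + e i k + 2 * (n k i j + n j k l - n i k l - n l i j) = 0"
  shows False
proof -
  have "\<exists>m. \<forall>a b. a < b \<longrightarrow> b < 5 \<longrightarrow> e a b = 2 * m a b + 1"
    by (intro exI[of _ "\<lambda>a b. e a b div 2"]) (use odd in \<open>auto simp: odd_two_times_div_two_succ\<close>)
  then obtain m where m: "\<And>a b. a < b \<Longrightarrow> b < 5 \<Longrightarrow> e a b = 2 * m a b + 1" by blast
  have M: "e 0 1 = 2 * m 0 1 + 1" "e 0 2 = 2 * m 0 2 + 1" "e 0 3 = 2 * m 0 3 + 1" "e 0 4 = 2 * m 0 4 + 1" "e 1 2 = 2 * m 1 2 + 1" "e 1 3 = 2 * m 1 3 + 1" "e 1 4 = 2 * m 1 4 + 1" "e 2 3 = 2 * m 2 3 + 1" "e 2 4 = 2 * m 2 4 + 1" "e 3 4 = 2 * m 3 4 + 1"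
    using m by auto
  have M': "e 1 0 = - e 0 1" "e 2 0 = - e 0 2" "e 3 0 = - e 0 3" "e 4 0 = - e 0 4" "e 2 1 = - e 1 2" "e 3 1 = - e 1 3" "e 4 1 = - e 1 4" "e 3 2 = - e 2 3" "e 4 2 = - e 2 4" "e 4 3 = - e 3 4"
    using anti by auto
  have E: "e 2 1 + e 1 3 + e 3 0 + e 0 2 + 2 * (n 2 0 1 + n 1 2 3 - n 0 2 3 - n 3 0 1) = 0"
    "e 2 1 + e 1 4 + e 4 0 + e 0 2 + 2 * (n 2 0 1 + n 1 2 4 - n 0 2 4 - n 4 0 1) = 0"
    "e 3 1 + e 1 4 + e 4 0 + e 0 3 + 2 * (n 3 0 1 + n 1 3 4 - n 0 3 4 - n 4 0 1) = 0"
    "e 1 2 + e 2 3 + e 3 0 + e 0 1 + 2 * (n 1 0 2 + n 2 1 3 - n 0 1 3 - n 3 0 2) = 0"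
    "e 1 2 + e 2 4 + e 4 0 + e 0 1 + 2 * (n 1 0 2 + n 2 1 4 - n 0 1 4 - n 4 0 2) = 0"
    "e 3 2 + e 2 4 + e 4 0 + e 0 3 + 2 * (n 3 0 2 + n 2 3 4 - n 0 3 4 - n 4 0 2) = 0"
    "e 1 3 + e 3 2 + e 2 0 + e 0 1 + 2 * (n 1 0 3 + n 3 1 2 - n 0 1 2 - n 2 0 3) = 0"
    "e 1 3 + e 3 4 + e 4 0 + e 0 1 + 2 * (n 1 0 3 + n 3 1 4 - n 0 1 4 - n 4 0 3) = 0"
    "e 2 3 + e 3 4 + e 4 0 + e 0 2 + 2 * (n 2 0 3 + n 3 2 4 - n 0 2 4 - n 4 0 3) = 0"
    "e 1 4 + e 4 2 + e 2 0 + e 0 1 + 2 * (n 1 0 4 + n 4 1 2 - n 0 1 2 - n 2 0 4) = 0"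
    "e 1 4 + e 4 3 + e 3 0 + e 0 1 + 2 * (n 1 0 4 + n 4 1 3 - n 0 1 3 - n 3 0 4) = 0"
    "e 2 4 + e 4 3 + e 3 0 + e 0 2 + 2 * (n 2 0 4 + n 4 2 3 - n 0 2 3 - n 3 0 4) = 0"
    "e 3 2 + e 2 4 + e 4 1 + e 1 3 + 2 * (n 3 1 2 + n 2 3 4 - n 1 3 4 - n 4 1 2) = 0"
    "e 2 3 + e 3 4 + e 4 1 + e 1 2 + 2 * (n 2 1 3 + n 3 2 4 - n 1 2 4 - n 4 1 3) = 0"
    "e 2 4 + e 4 3 + e 3 1 + e 1 2 + 2 * (n 2 1 4 + n 4 2 3 - n 1 2 3 - n 3 1 4) = 0"
    by (rule eq; simp)+
  have S: "(e 2 1 + e 1 3 + e 3 0 + e 0 2 + 2 * (n 2 0 1 + n 1 2 3 - n 0 2 3 - n 3 0 1)) +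
    (e 2 1 + e 1 4 + e 4 0 + e 0 2 + 2 * (n 2 0 1 + n 1 2 4 - n 0 2 4 - n 4 0 1)) +
    (e 3 1 + e 1 4 + e 4 0 + e 0 3 + 2 * (n 3 0 1 + n 1 3 4 - n 0 3 4 - n 4 0 1)) +
    (e 1 2 + e 2 3 + e 3 0 + e 0 1 + 2 * (n 1 0 2 + n 2 1 3 - n 0 1 3 - n 3 0 2)) +
    (e 1 2 + e 2 4 + e 4 0 + e 0 1 + 2 * (n 1 0 2 + n 2 1 4 - n 0 1 4 - n 4 0 2)) +
    (e 3 2 + e 2 4 + e 4 0 + e 0 3 + 2 * (n 3 0 2 + n 2 3 4 - n 0 3 4 - n 4 0 2)) +
    (e 1 3 + e 3 2 + e 2 0 + e 0 1 + 2 * (n 1 0 3 + n 3 1 2 - n 0 1 2 - n 2 0 3)) +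
    (e 1 3 + e 3 4 + e 4 0 + e 0 1 + 2 * (n 1 0 3 + n 3 1 4 - n 0 1 4 - n 4 0 3)) +
    (e 2 3 + e 3 4 + e 4 0 + e 0 2 + 2 * (n 2 0 3 + n 3 2 4 - n 0 2 4 - n 4 0 3)) +
    (e 1 4 + e 4 2 + e 2 0 + e 0 1 + 2 * (n 1 0 4 + n 4 1 2 - n 0 1 2 - n 2 0 4)) +
    (e 1 4 + e 4 3 + e 3 0 + e 0 1 + 2 * (n 1 0 4 + n 4 1 3 - n 0 1 3 - n 3 0 4)) +
    (e 2 4 + e 4 3 + e 3 0 + e 0 2 + 2 * (n 2 0 4 + n 4 2 3 - n 0 2 3 - n 3 0 4)) +
    (e 3 2 + e 2 4 + e 4 1 + e 1 3 + 2 * (n 3 1 2 + n 2 3 4 - n 1 3 4 - n 4 1 2)) +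
    (e 2 3 + e 3 4 + e 4 1 + e 1 2 + 2 * (n 2 1 3 + n 3 2 4 - n 1 2 4 - n 4 1 3)) +
    (e 2 4 + e 4 3 + e 3 1 + e 1 2 + 2 * (n 2 1 4 + n 4 2 3 - n 1 2 3 - n 3 1 4)) = 0"
    unfolding E by simp
  have "\<exists>K. 4 * K + 10 = (0::int)"
    by (rule exI[of _ "m 1 2 + m 1 3 - m 0 3 + m 0 2 + m 1 4 - 3 * m 0 4 + 3 * m 0 1 + 2 * m 2 4
        + n 2 0 1 - n 0 2 3 - n 0 2 4 - n 4 0 1 - n 0 3 4 + n 1 0 2 + n 2 1 3 - n 0 1 3 + n 2 1 4
        - n 0 1 4 - n 4 0 2 + n 2 3 4 + n 1 0 3 + n 3 1 2 - n 0 1 2 - n 4 0 3 + n 3 2 4 + n 1 0 4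
        - n 3 0 4 + n 4 2 3"])
      (use S[unfolded M' M] in \<open>simp add: algebra_simps\<close>)
  then show False by presburger
qed

text \<open>Only edges without a common end are assumed to be disjoint. Seen from a vertex k, the
  angle change along an edge i j is given by the directions \<open>\<theta>\<close> of its ends up
  to the multiple \<open>n k i j\<close> of 2 pi, and opposite directions differ by the odd multiple
  \<open>e a b\<close> of pi. With these numbers the equation of \<open>angle_change_square\<close>
  becomes that of \<open>K5_parity\<close>.\<close>

lemma K5_paths:
  fixes P :: "nat \<Rightarrow> nat \<Rightarrow> real \<Rightarrow> complex" and x :: "nat \<Rightarrow> complex"
  assumes cont: "\<And>i j. i < j \<Longrightarrow> j < 5 \<Longrightarrow> continuous_on {0..1} (P i j)"
    and ends: "\<And>i j. i < j \<Longrightarrow> j < 5 \<Longrightarrow> P i j 0 = x i \<and> P i j 1 = x j"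
    and disj: "\<And>i j k l s t. i < j \<Longrightarrow> k < l \<Longrightarrow> j < 5 \<Longrightarrow> l < 5 \<Longrightarrow> {i,j} \<inter> {k,l} = {} \<Longrightarrow>
      s \<in> {0..1} \<Longrightarrow> t \<in> {0..1} \<Longrightarrow> P i j s \<noteq> P k l t"
    and dist: "\<And>i j. i < j \<Longrightarrow> j < 5 \<Longrightarrow> x i \<noteq> x j"
  shows False
proof -
  define \<theta> where "\<theta> a b = Arg (x b - x a)" for a b
  have e0: "\<exists>m::int. odd m \<and> \<theta> a b - \<theta> b a = pi * of_int m" if "a < b" "b < 5" for a b
  proof -
    have "x b - x a \<noteq> 0" using dist[OF that] by auto
    then have "Arg (x a - x b) = (if Arg (x b - x a) \<le> 0 then Arg (x b - x a) + pi else Arg (x b - x a) - pi)"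
      using Arg_minus[of "x b - x a"] by simp
    then show ?thesis unfolding \<theta>_def
      by (cases "Arg (x b - x a) \<le> 0") (auto intro: exI[of _ "-1"] exI[of _ "1"])
  qed
  define e where "e a b = (if a < b then (SOME m::int. odd m \<and> \<theta> a b - \<theta> b a = pi * of_int m)
     else - (SOME m::int. odd m \<and> \<theta> b a - \<theta> a b = pi * of_int m))" for a b
  have e1: "odd (e a b)" "\<theta> a b - \<theta> b a = pi * of_int (e a b)" if "a < b" "b < 5" for a b
    using someI_ex[OF e0[OF that]] that by (auto simp: e_def)
  have e2: "e b a = - e a b" if "a < b" for a b using that by (auto simp: e_def)
  have e3: "\<theta> a b - \<theta> b a = pi * of_int (e a b)" if "a \<noteq> b" "a < 5" "b < 5" for a b
  proof (cases "a < b")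
    case True then show ?thesis using e1 that by auto
  next
    case False
    then have "b < a" using that by auto
    with e1(2)[OF this] e2[OF this] that show ?thesis by (simp add: algebra_simps)
  qed
  have w0: "\<exists>w. angle_change (\<lambda>s. P i j s - x k) w" if "i < j" "j < 5" "k < 5" "k \<noteq> i" "k \<noteq> j" for i j k
  proof -
    \<comment> \<open>The angle change seen from \<open>x k\<close> is defined through the square of
      the edge i j and a disjoint edge at k, which needs one more vertex.\<close>
    have "\<exists>l. l < 5 \<and> l \<noteq> i \<and> l \<noteq> j \<and> l \<noteq> k"
    proof -
      have "card {i,j,k} \<le> 3" by (simp add: card_insert_if)
      then have "\<not> {..<5} \<subseteq> {i,j,k}" using card_mono[of "{i,j,k}" "{..<5::nat}"] by auto
      then show ?thesis by auto
    qed
    then obtain l where l: "l < 5" "l \<noteq> i" "l \<noteq> j" "l \<noteq> k" by auto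
    show ?thesis
    proof (cases "k < l")
      case True
      with angle_change_square[OF cont cont disj, of i j k l] that l ends[of k l] show ?thesis by auto
    next
      case False
      then have "l < k" using l by auto
      with angle_change_square[OF cont cont disj, of i j l k] that l ends[of l k] show ?thesis by auto
    qed
  qed
  have "\<forall>k i j. \<exists>n::int. i < j \<longrightarrow> j < 5 \<longrightarrow> k < 5 \<longrightarrow> k \<noteq> i \<longrightarrow> k \<noteq> j \<longrightarrow>
      angle_change (\<lambda>s. P i j s - x k) (\<theta> k j - \<theta> k i + 2 * pi * of_int n)"
  proof (intro allI)
    fix i j k
    show "\<exists>n::int. i < j \<longrightarrow> j < 5 \<longrightarrow> k < 5 \<longrightarrow> k \<noteq> i \<longrightarrow> k \<noteq> j \<longrightarrow>
      angle_change (\<lambda>s. P i j s - x k) (\<theta> k j - \<theta> k i + 2 * pi * of_int n)"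
      using w0[of i j k] angle_change_Arg ends[of i j] unfolding \<theta>_def by metis
  qed
  then obtain n :: "nat \<Rightarrow> nat \<Rightarrow> nat \<Rightarrow> int" where
    n: "\<And>k i j. i < j \<Longrightarrow> j < 5 \<Longrightarrow> k < 5 \<Longrightarrow> k \<noteq> i \<Longrightarrow> k \<noteq> j \<Longrightarrow>
      angle_change (\<lambda>s. P i j s - x k) (\<theta> k j - \<theta> k i + 2 * pi * of_int (n k i j))"
    by metis
  show False
  proof (rule K5_parity[of e n])
    show "\<And>a b. a < b \<Longrightarrow> b < 5 \<Longrightarrow> e b a = - e a b" using e2 by auto
    show "\<And>a b. a < b \<Longrightarrow> b < 5 \<Longrightarrow> odd (e a b)" using e1 by auto
    fix i j k l :: nat assume a: "i < j" "k < l" "j < 5" "l < 5" "{i,j} \<inter> {k,l} = {}"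
    then have ne: "k \<noteq> i" "k \<noteq> j" "l \<noteq> i" "l \<noteq> j" "i < 5" "k < 5" by auto
    obtain wa wb wc wd where w: "angle_change (\<lambda>s. P i j s - x k) wa" "angle_change (\<lambda>s. P k l s - x j) wb"
      "angle_change (\<lambda>s. P k l s - x i) wc" "angle_change (\<lambda>s. P i j s - x l) wd" "wa + wb = wc + wd"
      using angle_change_square[OF cont cont disj, of i j k l] a ends[of i j] ends[of k l] by auto
    have "wa = \<theta> k j - \<theta> k i + 2 * pi * of_int (n k i j)" using angle_change_unique[OF w(1) n] a ne by auto
    moreover have "wb = \<theta> j l - \<theta> j k + 2 * pi * of_int (n j k l)" using angle_change_unique[OF w(2) n] a ne by auto
    moreover have "wc = \<theta> i l - \<theta> i k + 2 * pi * of_int (n i k l)" using angle_change_unique[OF w(3) n] a ne by auto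
    moreover have "wd = \<theta> l j - \<theta> l i + 2 * pi * of_int (n l i j)" using angle_change_unique[OF w(4) n] a ne by auto
    ultimately have "(\<theta> k j - \<theta> j k) + (\<theta> j l - \<theta> l j) + (\<theta> l i - \<theta> i l) + (\<theta> i k - \<theta> k i)
      + 2 * pi * (of_int (n k i j) + of_int (n j k l) - of_int (n i k l) - of_int (n l i j)) = 0"
      using w(5) by (simp add: algebra_simps)
    then have "pi * of_int (e k j + e j l + e l i + e i k + 2 * (n k i j + n j k l - n i k l - n l i j)) = 0"
      using a ne by (simp add: e3 algebra_simps)
    then have "real_of_int (e k j + e j l + e l i + e i k + 2 * (n k i j + n j k l - n i k l - n l i j)) = 0"
      using pi_neq_zero mult_eq_0_iff by blast
    then show "e k j + e j l + e l i + e i k + 2 * (n k i j + n j k l - n i k l - n l i j) = 0"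
      unfolding of_int_eq_0_iff .
  qed
qed

text \<open>Each edge set together with its two end sets contains a path between points chosen once
  for each end set, and for disjoint edges these unions are disjoint. Vertices are sets because
  pieces of the ring and the whole outer rim will play their role.\<close>

lemma K5_nonplanar:
  fixes V :: "nat \<Rightarrow> (real \<times> real) set" and E :: "nat \<Rightarrow> nat \<Rightarrow> (real \<times> real) set"
  assumes V: "\<And>i. i < 5 \<Longrightarrow> path_connected (V i)"
    and E: "\<And>i j. i < j \<Longrightarrow> j < 5 \<Longrightarrow> path_connected (E i j)"
    and inc: "\<And>i j. i < j \<Longrightarrow> j < 5 \<Longrightarrow> E i j \<inter> V i \<noteq> {} \<and> E i j \<inter> V j \<noteq> {}"
    and VV: "\<And>i j. i < j \<Longrightarrow> j < 5 \<Longrightarrow> V i \<inter> V j = {}"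
    and EV: "\<And>i j k. i < j \<Longrightarrow> j < 5 \<Longrightarrow> k < 5 \<Longrightarrow> k \<noteq> i \<Longrightarrow> k \<noteq> j \<Longrightarrow> E i j \<inter> V k = {}"
    and EE: "\<And>i j k l. i < j \<Longrightarrow> k < l \<Longrightarrow> j < 5 \<Longrightarrow> l < 5 \<Longrightarrow> {i,j} \<inter> {k,l} = {} \<Longrightarrow> i < k \<Longrightarrow> E i j \<inter> E k l = {}"
  shows False
proof -
  have ne: "V i \<noteq> {}" if "i < 5" for i
    using inc[of i 4] inc[of 0 4] that by (cases "i = 4") auto
  define x where "x i = (SOME p. p \<in> V i)" for i
  have x: "x i \<in> V i" if "i < 5" for i
    using ne[OF that] unfolding x_def by (simp add: some_in_eq)
  let ?U = "\<lambda>i j. V i \<union> E i j \<union> V j"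
  have U: "path_connected (?U i j)" if "i < j" "j < 5" for i j
  proof -
    have "path_connected (V i \<union> E i j)"
      by (rule path_connected_Un) (use V E inc that in \<open>auto simp: Int_commute\<close>)
    then show ?thesis
      by (rule path_connected_Un) (use V inc[OF that] that in auto)
  qed
  have ex: "\<exists>g. path g \<and> path_image g \<subseteq> ?U i j \<and> pathstart g = x i \<and> pathfinish g = x j"
    if "i < j" "j < 5" for i j
  proof -
    have "x i \<in> ?U i j" "x j \<in> ?U i j" using x that by auto
    then show ?thesis using U[OF that] unfolding path_connected_def by blast
  qed
  define g where "g i j = (SOME g. path g \<and> path_image g \<subseteq> ?U i j \<and> pathstart g = x i \<and> pathfinish g = x j)" for i j
  have g: "path (g i j)" "path_image (g i j) \<subseteq> ?U i j" "pathstart (g i j) = x i" "pathfinish (g i j) = x j"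
    if "i < j" "j < 5" for i j
    using someI_ex[OF ex[OF that]] unfolding g_def by auto
  have VV': "V i \<inter> V j = {}" if "i \<noteq> j" "i < 5" "j < 5" for i j
    using VV[of i j] VV[of j i] that by (cases "i < j") auto
  have EE': "E i j \<inter> E k l = {}" if "i < j" "k < l" "j < 5" "l < 5" "{i,j} \<inter> {k,l} = {}" for i j k l
    using EE[of i j k l] EE[of k l i j] that by (cases "i < k") (auto simp: not_less le_less)
  let ?c = "\<lambda>z::real\<times>real. Complex (fst z) (snd z)"
  have cinj: "?c z = ?c w \<longleftrightarrow> z = w" for z w by (auto simp: prod_eq_iff)
  show False
  proof (rule K5_paths[of "\<lambda>i j. ?c \<circ> g i j" "\<lambda>i. ?c (x i)"])
    fix i j :: nat assume ij: "i < j" "j < 5"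
    have "continuous_on {0..1} (g i j)" using g(1)[OF ij] by (simp add: path_def)
    then show "continuous_on {0..1} (?c \<circ> g i j)"
      unfolding o_def by (intro continuous_on_Complex continuous_intros)
    show "(?c \<circ> g i j) 0 = ?c (x i) \<and> (?c \<circ> g i j) 1 = ?c (x j)"
      using g(3,4)[OF ij] by (simp add: pathstart_def pathfinish_def)
    show "?c (x i) \<noteq> ?c (x j)" unfolding cinj using x VV[OF ij] ij by (metis disjoint_iff less_trans)
  next
    fix i j k l :: nat and s t :: real
    assume a: "i < j" "k < l" "j < 5" "l < 5" "{i,j} \<inter> {k,l} = {}" "s \<in> {0..1}" "t \<in> {0..1}"
    have "?U i j \<inter> ?U k l = {}"
    proof -
      have "i < 5" "k < 5" "i \<noteq> k" "i \<noteq> l" "j \<noteq> k" "j \<noteq> l" using a by auto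
      then have "V i \<inter> V k = {}" "V i \<inter> V l = {}" "V j \<inter> V k = {}" "V j \<inter> V l = {}"
        "E i j \<inter> V k = {}" "E i j \<inter> V l = {}" "E k l \<inter> V i = {}" "E k l \<inter> V j = {}" "E i j \<inter> E k l = {}"
        using VV' EV EE' a by auto
      then show ?thesis by blast
    qed
    moreover have "g i j s \<in> path_image (g i j)" "g k l t \<in> path_image (g k l)"
      using a by (auto simp: path_image_def)
    then have "g i j s \<in> ?U i j" "g k l t \<in> ?U k l"
      using g(2)[of i j] g(2)[of k l] a by blast+
    ultimately have "g i j s \<noteq> g k l t" by (metis disjoint_iff)
    then show "(?c \<circ> g i j) s \<noteq> (?c \<circ> g k l) t" unfolding o_def cinj .
  qed
qed

subsection \<open>Crossings inside a wheel\<close>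

text \<open>A spoke may meet the two pieces \<open>q\<close> next to its own \<open>p\<close>, and
  spokes may meet one another: in the complete graph of lemma \<open>crossing\<close> these are
  edges with a common end.\<close>

locale wheel =
  fixes m :: nat and p q r :: "nat \<Rightarrow> (real \<times> real) set" and hub :: "(real \<times> real) set"
  assumes p_conn: "\<And>i. i < m \<Longrightarrow> path_connected (p i)"
    and q_conn: "\<And>i. i < m \<Longrightarrow> path_connected (q i)"
    and r_conn: "\<And>i. i < m \<Longrightarrow> path_connected (r i)"
    and hub_conn: "path_connected hub"
    and pp: "\<And>i j. i < m \<Longrightarrow> j < m \<Longrightarrow> i \<noteq> j \<Longrightarrow> p i \<inter> p j = {}"
    and qp: "\<And>i. i < m \<Longrightarrow> q i \<inter> p i \<noteq> {}" "\<And>i. i < m \<Longrightarrow> q i \<inter> p (Suc i mod m) \<noteq> {}"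
    and qp_disj: "\<And>i j. i < m \<Longrightarrow> j < m \<Longrightarrow> j \<noteq> i \<Longrightarrow> j \<noteq> Suc i mod m \<Longrightarrow> q i \<inter> p j = {}"
    and qq: "\<And>i j. i < m \<Longrightarrow> j < m \<Longrightarrow> i \<noteq> j \<Longrightarrow> q i \<inter> q j = {}"
    and hub_p: "\<And>i. i < m \<Longrightarrow> hub \<inter> p i = {}" and hub_q: "\<And>i. i < m \<Longrightarrow> hub \<inter> q i = {}"
    and rO: "\<And>i. i < m \<Longrightarrow> r i \<inter> hub \<noteq> {}" and rp: "\<And>i. i < m \<Longrightarrow> r i \<inter> p i \<noteq> {}"
    and rp_disj: "\<And>i j. i < m \<Longrightarrow> j < m \<Longrightarrow> i \<noteq> j \<Longrightarrow> r i \<inter> p j = {}"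
    and rq_disj: "\<And>i j. i < m \<Longrightarrow> j < m \<Longrightarrow> j \<noteq> i \<Longrightarrow> Suc j mod m \<noteq> i \<Longrightarrow> r i \<inter> q j = {}"
begin

definition P :: "nat \<Rightarrow> (real \<times> real) set" where "P i = p (i mod m)"
definition Q :: "nat \<Rightarrow> (real \<times> real) set" where "Q i = q (i mod m)"

text \<open>Indices are not reduced, so that the arc closing the ring is
  \<open>arc d (a + m)\<close>. The end pieces \<open>P a\<close> and \<open>P b\<close> are left
  out because they become vertices.\<close>

definition arc :: "nat \<Rightarrow> nat \<Rightarrow> (real \<times> real) set" where
  "arc a b = (\<Union>i\<in>{a..<b}. Q i) \<union> (\<Union>i\<in>{a<..<b}. P i)"

lemma QP_meet: "0 < m \<Longrightarrow> Q i \<inter> P i \<noteq> {}" "0 < m \<Longrightarrow> Q i \<inter> P (Suc i) \<noteq> {}"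
  using qp(1)[of "i mod m"] qp(2)[of "i mod m"] by (auto simp: P_def Q_def mod_Suc_eq)

lemma arc_connected: "0 < m \<Longrightarrow> path_connected (arc a (Suc (a + k)))"
proof (induction k)
  case 0
  have "arc a (Suc a) = Q a" by (auto simp: arc_def)
  then show ?case using q_conn[of "a mod m"] 0 by (simp add: Q_def)
next
  case (Suc k)
  have eq: "arc a (Suc (a + Suc k)) = arc a (Suc (a + k)) \<union> (P (Suc (a + k)) \<union> Q (Suc (a + k)))"
  proof -
    have "{a..<Suc (a + Suc k)} = insert (Suc (a + k)) {a..<Suc (a + k)}"
      "{a<..<Suc (a + Suc k)} = insert (Suc (a + k)) {a<..<Suc (a + k)}" by auto
    then show ?thesis unfolding arc_def by auto
  qed
  have 1: "path_connected (P (Suc (a + k)) \<union> Q (Suc (a + k)))"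
    using p_conn[of "Suc (a + k) mod m"] q_conn[of "Suc (a + k) mod m"] QP_meet[OF Suc.prems, of "Suc (a + k)"] Suc.prems
    by (intro path_connected_Un) (auto simp: P_def Q_def)
  have "Q (a + k) \<subseteq> arc a (Suc (a + k))" by (auto simp: arc_def)
  with QP_meet(2)[OF Suc.prems, of "a + k"]
  have "arc a (Suc (a + k)) \<inter> (P (Suc (a + k)) \<union> Q (Suc (a + k))) \<noteq> {}" by blast
  then show ?case unfolding eq by (rule path_connected_Un[OF Suc.IH[OF Suc.prems] 1])
qed

lemma mod_neq:
  assumes "a \<le> i" "a \<le> j" "i < a + m" "j < a + m" "i \<noteq> j"
  shows "i mod m \<noteq> j mod m"
proof
  assume *: "i mod m = j mod m"
  have "\<not> i < j" if "i mod m = j mod m" "a \<le> i" "j < a + m" for i j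
  proof
    assume "i < j"
    then have "m dvd j - i" using that(1) by (metis mod_eq_dvd_iff_nat nat_less_le)
    then have "m \<le> j - i" using \<open>i < j\<close> by (intro dvd_imp_le) auto
    with that \<open>i < j\<close> show False by linarith
  qed
  from this[OF * assms(1,4)] this[OF *[symmetric] assms(2,3)] assms(5) show False by simp
qed

lemma arc_disjoint_P:
  assumes "c \<le> a" "b < c + m" "c \<le> i" "i < c + m" "i < a \<or> b < i"
  shows "arc a b \<inter> P i = {}"
proof -
  have m: "0 < m" using assms by auto
  have "Q j \<inter> P i = {}" if "a \<le> j" "j < b" for j
  proof -
    have "i mod m \<noteq> j mod m" using mod_neq[of c i j] assms that by auto
    moreover have "i mod m \<noteq> Suc j mod m" using mod_neq[of c i "Suc j"] assms that by auto
    ultimately show ?thesis using qp_disj[of "j mod m" "i mod m"] m by (auto simp: P_def Q_def mod_Suc_eq)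
  qed
  moreover have "P j \<inter> P i = {}" if "a < j" "j < b" for j
    using pp[of "j mod m" "i mod m"] mod_neq[of c i j] assms that m by (auto simp: P_def)
  ultimately show ?thesis unfolding arc_def by fastforce
qed

lemma arc_disjoint_arc:
  assumes "a \<le> b" "b < c" "c \<le> d" "d < a + m"
  shows "arc a b \<inter> arc c d = {}"
proof -
  have m: "0 < m" using assms by auto
  have "Q j \<inter> arc a b = {}" if "c \<le> j" "j < d" for j
  proof -
    have "Q i \<inter> Q j = {}" if "a \<le> i" "i < b" for i
      using qq[of "i mod m" "j mod m"] mod_neq[of a i j] assms that m \<open>c \<le> j\<close> \<open>j < d\<close> by (auto simp: Q_def)
    moreover have "Q j \<inter> P i = {}" if "a < i" "i < b" for i
    proof -
      have "i mod m \<noteq> j mod m" using mod_neq[of a i j] assms that \<open>c \<le> j\<close> \<open>j < d\<close> by auto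
      moreover have "i mod m \<noteq> Suc j mod m" using mod_neq[of a i "Suc j"] assms that \<open>c \<le> j\<close> \<open>j < d\<close> by auto
      ultimately show ?thesis using qp_disj[of "j mod m" "i mod m"] m by (auto simp: P_def Q_def mod_Suc_eq)
    qed
    ultimately show ?thesis unfolding arc_def by fastforce
  qed
  moreover have "P j \<inter> arc a b = {}" if "c < j" "j < d" for j
    using arc_disjoint_P[of a a b j] assms that by auto
  ultimately show ?thesis unfolding arc_def[of c d] by fastforce
qed

lemma r_disjoint_arc:
  assumes "k < m" "a \<le> k" "k < a + m" "c < k \<or> k < b" "a \<le> b" "c < a + m"
  shows "r k \<inter> arc b c = {}"
proof -
  have m: "0 < m" using assms by auto
  have "r k \<inter> Q j = {}" if "b \<le> j" "j < c" for j
  proof -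
    have "k mod m \<noteq> j mod m" by (rule mod_neq[of a]) (use assms that in auto)
    moreover have "k mod m \<noteq> Suc j mod m" by (rule mod_neq[of a]) (use assms that in auto)
    ultimately show ?thesis using rq_disj[of k "j mod m"] m assms(1) by (auto simp: Q_def mod_Suc_eq)
  qed
  moreover have "r k \<inter> P j = {}" if "b < j" "j < c" for j
    using rp_disj[of k "j mod m"] mod_neq[of a k j] assms that m by (auto simp: P_def)
  ultimately show ?thesis unfolding arc_def by fastforce
qed

text \<open>Otherwise the four pieces and the hub are the vertices of a planar
  \<open>K\<^sub>5\<close>: its edges are four arcs of the ring, four spokes, and \<open>s\<close>
  and \<open>t\<close> as the two diagonals.\<close>

lemma crossing:
  assumes abcd: "a < b" "b < c" "c < d" "d < m"
    and s: "path_connected s" "s \<inter> p a \<noteq> {}" "s \<inter> p c \<noteq> {}" "s \<inter> p b = {}" "s \<inter> p d = {}"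
      "s \<inter> hub = {}" "s \<inter> r b = {}" "s \<inter> r d = {}"
    and t: "path_connected t" "t \<inter> p b \<noteq> {}" "t \<inter> p d \<noteq> {}" "t \<inter> p a = {}" "t \<inter> p c = {}"
      "t \<inter> hub = {}" "t \<inter> r a = {}" "t \<inter> r c = {}"
  shows "s \<inter> t \<noteq> {}"
proof
  assume st: "s \<inter> t = {}"
  define V where "V i = (if i = 0 then p a else if i = 1 then p b else if i = 2 then p c else if i = 3 then p d else hub)"
    for i :: nat
  define E where "E i j = (if j = 4 then r (if i = 0 then a else if i = 1 then b else if i = 2 then c else d)
     else if i = 0 \<and> j = 1 then arc a b else if i = 1 \<and> j = 2 then arc b c else if i = 2 \<and> j = 3 then arc c d
     else if i = 0 \<and> j = 3 then arc d (a + m) else if i = 0 \<and> j = 2 then s else t)" for i j :: nat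
  have m: "0 < m" using abcd by auto
  have Pp: "P i = p i" if "i < m" for i using that by (simp add: P_def)
  have Pm: "P (a + m) = p a" using abcd by (simp add: P_def)
  have ac: "path_connected (arc i j)" if "i < j" for i j
    using arc_connected[OF m, of i "j - Suc i"] that by simp
  have am: "arc i j \<inter> P i \<noteq> {} \<and> arc i j \<inter> P j \<noteq> {}" if "i < j" for i j
  proof -
    have "Q i \<subseteq> arc i j" "Q (j - 1) \<subseteq> arc i j" using that by (auto simp: arc_def)
    then show ?thesis using QP_meet(1)[OF m, of i] QP_meet(2)[OF m, of "j - 1"] that by auto
  qed
  have cases5: "(i, j) \<in> {(0,1),(0,2),(0,3),(0,4),(1,2),(1,3),(1,4),(2,3),(2,4),(3,4)}"
    if "i < j" "j < 5" for i j :: nat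
  proof -
    have "j = 1 \<or> j = 2 \<or> j = 3 \<or> j = 4" "i = 0 \<or> i = 1 \<or> i = 2 \<or> i = 3"
      using that by arith+
    then show ?thesis using that by (elim disjE) simp_all
  qed
  have A: "arc a b \<inter> p c = {}" "arc a b \<inter> p d = {}" "arc b c \<inter> p a = {}" "arc b c \<inter> p d = {}"
    "arc c d \<inter> p a = {}" "arc c d \<inter> p b = {}" "arc d (a + m) \<inter> p b = {}" "arc d (a + m) \<inter> p c = {}"
    using arc_disjoint_P[of a a b c] arc_disjoint_P[of a a b d] arc_disjoint_P[of a b c a] arc_disjoint_P[of a b c d]
      arc_disjoint_P[of a c d a] arc_disjoint_P[of a c d b]
      arc_disjoint_P[of b d "a + m" b] arc_disjoint_P[of b d "a + m" c] abcd by (simp_all add: Pp)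
  have "P k \<inter> hub = {}" "Q k \<inter> hub = {}" for k
    using hub_p[of "k mod m"] hub_q[of "k mod m"] m unfolding P_def Q_def by auto
  then have AO: "arc i j \<inter> hub = {}" for i j unfolding arc_def by blast
  have AA: "arc a b \<inter> arc c d = {}" "arc b c \<inter> arc d (a + m) = {}"
    using arc_disjoint_arc[of a b c d] arc_disjoint_arc[of b c d "a + m"] abcd by simp_all
  have rA: "r c \<inter> arc a b = {}" "r d \<inter> arc a b = {}" "r a \<inter> arc b c = {}" "r d \<inter> arc b c = {}"
    "r a \<inter> arc c d = {}" "r b \<inter> arc c d = {}" "r b \<inter> arc d (a + m) = {}" "r c \<inter> arc d (a + m) = {}"
    using r_disjoint_arc[of c a b a] r_disjoint_arc[of d a b a] r_disjoint_arc[of a a c b] r_disjoint_arc[of d a c b]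
      r_disjoint_arc[of a a d c] r_disjoint_arc[of b a d c] r_disjoint_arc[of b b "a + m" d] r_disjoint_arc[of c b "a + m" d]
      abcd by simp_all
  note disj = A AO AA rA st s(4-8) t(4-8)
  note disj' = disj[THEN trans[OF Int_commute]]
  show False
  proof (rule K5_nonplanar[of V E])
    show "path_connected (V i)" for i
      using p_conn[of a] p_conn[of b] p_conn[of c] p_conn[of d] hub_conn abcd by (simp add: V_def)
    show "path_connected (E i j)" if "i < j" "j < 5" for i j
      using cases5[OF that] ac[of a b] ac[of b c] ac[of c d] ac[of d "a + m"] abcd
        r_conn[of a] r_conn[of b] r_conn[of c] r_conn[of d] s(1) t(1)
      by (elim insertE emptyE) (simp_all add: E_def)
    show "E i j \<inter> V i \<noteq> {} \<and> E i j \<inter> V j \<noteq> {}" if "i < j" "j < 5" for i j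
      using cases5[OF that] am[of a b] am[of b c] am[of c d] am[of d "a + m"] abcd
        rO[of a] rO[of b] rO[of c] rO[of d] rp[of a] rp[of b] rp[of c] rp[of d] s(2,3) t(2,3)
      by (elim insertE emptyE) (simp_all add: E_def V_def Pp Pm)
    show "V i \<inter> V j = {}" if "i < j" "j < 5" for i j
      using cases5[OF that] abcd pp[of a b] pp[of a c] pp[of a d] pp[of b c] pp[of b d] pp[of c d]
        hub_p[of a] hub_p[of b] hub_p[of c] hub_p[of d]
      by (elim insertE emptyE) (simp_all add: V_def Int_commute)
    show "E i j \<inter> V k = {}" if "i < j" "j < 5" "k < 5" "k \<noteq> i" "k \<noteq> j" for i j k
    proof -
      have "k = 0 \<or> k = 1 \<or> k = 2 \<or> k = 3 \<or> k = 4" using that(3) by linarith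
      then have k: "k \<in> {0,1,2,3,4}" by blast
      have rd: "r x \<inter> p y = {}" if "x \<in> {a,b,c,d}" "y \<in> {a,b,c,d}" "x \<noteq> y" for x y
        using rp_disj[of x y] that abcd by auto
      show ?thesis
        using cases5[OF that(1,2)] k that(4,5) abcd
        by (elim insertE emptyE) (simp_all add: E_def V_def disj rd)
    qed
    show "E i j \<inter> E k l = {}" if "i < j" "k < l" "j < 5" "l < 5" "{i,j} \<inter> {k,l} = {}" "i < k" for i j k l
    proof -
      have "(i,j,k,l) \<in> {(0,1,2,3),(0,1,2,4),(0,1,3,4),(0,2,1,3),(0,2,1,4),(0,2,3,4),(0,3,1,2),(0,3,1,4),(0,3,2,4),
        (0,4,1,2),(0,4,1,3),(0,4,2,3),(1,2,3,4),(1,3,2,4),(1,4,2,3)}"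
        using cases5[OF that(1,3)] cases5[OF that(2,4)] that(5,6) by (elim insertE emptyE) simp_all
      then show ?thesis
        by (elim insertE emptyE) (simp_all add: E_def disj disj')
    qed
  qed
qed

end

subsection \<open>The configuration for the lower bound\<close>

text \<open>The labels of the segments. \<open>LP\<close> and \<open>LQ\<close> are the alternating pieces of a closed ring of length 36, numbered
  counterclockwise, \<open>LO\<close> are the four sides of the outer rim and \<open>LR\<close> the spokes between ring and rim.
  All other segments lie inside the ring; such a segment \<open>l\<close> is attached to the pieces \<open>LP i\<close> with \<open>i \<in> att l\<close>.
  Each segment \<open>LC k\<close> is tied to the ring by \<open>LT k\<close> and \<open>LU k\<close>, and \<open>LA k\<close>, \<open>LB k\<close> are tied to it by \<open>LD k\<close>, \<open>LE k\<close>.\<close>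

datatype lab = LX | LY | LZ | LH | LJ | LW | LG
  | LA nat | LB nat | LC nat | LD nat | LE nat | LT nat | LU nat
  | LP nat | LQ nat | LR nat | LO nat

fun att :: "lab \<Rightarrow> nat set" where
  "att LX = {0, 11}" | "att LY = {7, 15}" | "att LZ = {1, 12}" | "att LH = {3, 14}"
| "att LJ = {16}" | "att LW = {13}" | "att LG = {4, 17}"
| "att (LA k) = {2}" | "att (LB k) = {10}" | "att (LC k) = {}" | "att (LD k) = {8}"
| "att (LE k) = {6}" | "att (LT k) = {5}" | "att (LU k) = {9}" | "att _ = {}"

fun inner :: "nat \<Rightarrow> lab \<Rightarrow> bool" where
  "inner N (LA k) = (k \<le> N)" | "inner N (LB k) = (k \<le> N)" | "inner N (LC k) = (k \<le> N)"
| "inner N (LD k) = (k \<le> N)" | "inner N (LE k) = (k \<le> N)" | "inner N (LT k) = (k \<le> N)"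
| "inner N (LU k) = (k \<le> N)"
| "inner N (LP k) = False" | "inner N (LQ k) = False" | "inner N (LR k) = False" | "inner N (LO k) = False"
| "inner N _ = True"

fun lab_ok :: "nat \<Rightarrow> lab \<Rightarrow> bool" where
  "lab_ok N (LP k) = (k < 18)" | "lab_ok N (LQ k) = (k < 18)" | "lab_ok N (LR k) = (k < 18)"
| "lab_ok N (LO k) = (k < 4)" | "lab_ok N l = inner N l"

definition side :: "nat \<Rightarrow> nat" where
  "side i = (if i \<le> 3 then 0 else if i \<le> 11 then 1 else if i \<le> 13 then 2 else 3)"

text \<open>The pairs that must be disjoint and those that must meet. Nothing is prescribed for the remaining
  pairs: the crossings needed among them follow from the order of the attachments on the ring.\<close>

inductive far :: "nat \<Rightarrow> lab \<Rightarrow> lab \<Rightarrow> bool" for N where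
  inner_P: "inner N l \<Longrightarrow> i < 18 \<Longrightarrow> i \<notin> att l \<Longrightarrow> far N l (LP i)"
| inner_R: "inner N l \<Longrightarrow> i < 18 \<Longrightarrow> far N l (LR i)"
| inner_O: "inner N l \<Longrightarrow> i < 4 \<Longrightarrow> far N l (LO i)"
| PP: "i < 18 \<Longrightarrow> j < 18 \<Longrightarrow> i \<noteq> j \<Longrightarrow> far N (LP i) (LP j)"
| QP: "i < 18 \<Longrightarrow> j < 18 \<Longrightarrow> j \<noteq> i \<Longrightarrow> j \<noteq> Suc i mod 18 \<Longrightarrow> far N (LQ i) (LP j)"
| QQ: "i < 18 \<Longrightarrow> j < 18 \<Longrightarrow> i \<noteq> j \<Longrightarrow> far N (LQ i) (LQ j)"
| OP: "i < 4 \<Longrightarrow> j < 18 \<Longrightarrow> far N (LO i) (LP j)"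
| OQ: "i < 4 \<Longrightarrow> j < 18 \<Longrightarrow> far N (LO i) (LQ j)"
| RP: "i < 18 \<Longrightarrow> j < 18 \<Longrightarrow> i \<noteq> j \<Longrightarrow> far N (LR i) (LP j)"
| RQ: "i < 18 \<Longrightarrow> j < 18 \<Longrightarrow> j \<noteq> i \<Longrightarrow> Suc j mod 18 \<noteq> i \<Longrightarrow> far N (LR i) (LQ j)"
| JX: "far N LJ LX" | JY: "far N LJ LY" | WH: "far N LW LH"
| WC: "far N LW (LC 0)" | WT: "far N LW (LT 0)" | WU: "far N LW (LU 0)"
| DY: "k \<le> N \<Longrightarrow> far N (LD k) LY" | EY: "k \<le> N \<Longrightarrow> far N (LE k) LY"
| TX: "k \<le> N \<Longrightarrow> far N (LT k) LX" | TY: "k \<le> N \<Longrightarrow> far N (LT k) LY" | TG: "k \<le> N \<Longrightarrow> far N (LT k) LG"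
| TA: "k \<le> N \<Longrightarrow> far N (LT k) (LA k)" | TD: "k \<le> N \<Longrightarrow> far N (LT k) (LD k)"
| UY: "k \<le> N \<Longrightarrow> far N (LU k) LY" | UZ: "k \<le> N \<Longrightarrow> far N (LU k) LZ"
| UA: "k \<le> N \<Longrightarrow> far N (LU k) (LA k)" | UB: "k \<le> N \<Longrightarrow> far N (LU k) (LB k)"
| CA: "k \<le> N \<Longrightarrow> far N (LC k) (LA k)" | CB: "k \<le> N \<Longrightarrow> far N (LC k) (LB k)"
| TB: "k \<le> N \<Longrightarrow> far N (LT k) (LB k)"
| CA': "k < N \<Longrightarrow> far N (LC k) (LA (Suc k))" | UA': "k < N \<Longrightarrow> far N (LU k) (LA (Suc k))"
| CD': "k < N \<Longrightarrow> far N (LC k) (LD (Suc k))" | UD': "k < N \<Longrightarrow> far N (LU k) (LD (Suc k))"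
| TD': "k < N \<Longrightarrow> far N (LT k) (LD (Suc k))"
| CB': "k < N \<Longrightarrow> far N (LC k) (LB (Suc k))" | TB': "k < N \<Longrightarrow> far N (LT k) (LB (Suc k))"
| CE': "k < N \<Longrightarrow> far N (LC k) (LE (Suc k))" | TE': "k < N \<Longrightarrow> far N (LT k) (LE (Suc k))"
| DB': "k < N \<Longrightarrow> far N (LD (Suc k)) (LB k)" | DE': "k < N \<Longrightarrow> far N (LD (Suc k)) (LE k)"

inductive near :: "nat \<Rightarrow> lab \<Rightarrow> lab \<Rightarrow> bool" for N where
  inner_P: "inner N l \<Longrightarrow> i \<in> att l \<Longrightarrow> near N l (LP i)"
| QP: "i < 18 \<Longrightarrow> near N (LQ i) (LP i)" | QP': "i < 18 \<Longrightarrow> near N (LQ i) (LP (Suc i mod 18))"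
| RP: "i < 18 \<Longrightarrow> near N (LR i) (LP i)" | RO: "i < 18 \<Longrightarrow> near N (LR i) (LO (side i))"
| OO: "i < 3 \<Longrightarrow> near N (LO i) (LO (Suc i))"
| JZ: "near N LJ LZ" | WY: "near N LW LY"
| TC: "k \<le> N \<Longrightarrow> near N (LT k) (LC k)" | CU: "k \<le> N \<Longrightarrow> near N (LC k) (LU k)"
| AD: "k \<le> N \<Longrightarrow> near N (LA k) (LD k)" | BE: "k \<le> N \<Longrightarrow> near N (LB k) (LE k)"
| TZ: "k \<le> N \<Longrightarrow> near N (LT k) LZ"

section \<open>Points on segments, and polygonal tracks inside the ring\<close>

lemma seg_det:
  fixes p q r :: "real \<times> real"
  assumes "p \<in> closed_segment a b" "q \<in> closed_segment a b" "r \<in> closed_segment a b"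
  shows "(fst q - fst p) * (snd r - snd p) = (snd q - snd p) * (fst r - fst p)"
proof -
  obtain s where s: "p = (1 - s) *\<^sub>R a + s *\<^sub>R b" using assms(1) unfolding in_segment by blast
  obtain t where t: "q = (1 - t) *\<^sub>R a + t *\<^sub>R b" using assms(2) unfolding in_segment by blast
  obtain u where u: "r = (1 - u) *\<^sub>R a + u *\<^sub>R b" using assms(3) unfolding in_segment by blast
  show ?thesis unfolding s t u by (simp add: algebra_simps)
qed

lemma segment_fst:
  assumes "z \<in> closed_segment p (q :: real \<times> real)"
  shows "min (fst p) (fst q) \<le> fst z" "fst z \<le> max (fst p) (fst q)"
proof -
  have "fst z \<in> fst ` closed_segment p q" using assms by blast
  then have "fst z \<in> closed_segment (fst p) (fst q)"
    by (simp add: closed_segment_linear_image linear_fst)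
  then show "min (fst p) (fst q) \<le> fst z" "fst z \<le> max (fst p) (fst q)"
    by (auto simp: closed_segment_eq_real_ivl split: if_splits)
qed

lemma segment_snd:
  assumes "z \<in> closed_segment p (q :: real \<times> real)"
  shows "min (snd p) (snd q) \<le> snd z" "snd z \<le> max (snd p) (snd q)"
proof -
  have "snd z \<in> snd ` closed_segment p q" using assms by blast
  then have "snd z \<in> closed_segment (snd p) (snd q)"
    by (simp add: closed_segment_linear_image linear_snd)
  then show "min (snd p) (snd q) \<le> snd z" "snd z \<le> max (snd p) (snd q)"
    by (auto simp: closed_segment_eq_real_ivl split: if_splits)
qed

lemma vertical_segmentI:
  "min a b \<le> (h::real) \<Longrightarrow> h \<le> max a b \<Longrightarrow> (x, h) \<in> closed_segment (x::real, a) (x, b)"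
  by (subst closed_segment_same_fst) (auto simp: closed_segment_eq_real_ivl min_def max_def split: if_splits)

lemma horizontal_segmentI:
  "min a b \<le> (h::real) \<Longrightarrow> h \<le> max a b \<Longrightarrow> (h, y) \<in> closed_segment (a, y::real) (b, y)"
  by (subst closed_segment_same_snd) (auto simp: closed_segment_eq_real_ivl min_def max_def split: if_splits)

locale config =
  fixes N :: nat and S :: "lab \<Rightarrow> (real \<times> real) set"
  assumes seg: "\<And>l. lab_ok N l \<Longrightarrow> \<exists>a b. S l = closed_segment a b"
    and far: "\<And>a b. far N a b \<Longrightarrow> S a \<inter> S b = {}"
    and near: "\<And>a b. near N a b \<Longrightarrow> S a \<inter> S b \<noteq> {}"
begin

lemma inner_ok: "inner N l \<Longrightarrow> lab_ok N l" by (cases l) auto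

lemma conv: "lab_ok N l \<Longrightarrow> convex (S l)" using seg[of l] by auto
lemma pconn: "lab_ok N l \<Longrightarrow> path_connected (S l)" using conv convex_imp_path_connected by blast

lemma det0:
  assumes "lab_ok N l" "p \<in> S l" "q \<in> S l" "r \<in> S l"
  shows "(fst q - fst p) * (snd r - snd p) = (snd q - snd p) * (fst r - fst p)"
  using seg[OF assms(1)] seg_det assms(2-) by metis

lemma sub: "lab_ok N l \<Longrightarrow> p \<in> S l \<Longrightarrow> q \<in> S l \<Longrightarrow> closed_segment p q \<subseteq> S l"
  using conv closed_segment_subset by blast

lemma subD: "z \<in> closed_segment p q \<Longrightarrow> lab_ok N l \<Longrightarrow> p \<in> S l \<Longrightarrow> q \<in> S l \<Longrightarrow> z \<in> S l"
  using sub by blast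

lemma farD: "far N a b \<Longrightarrow> z \<in> S a \<Longrightarrow> z \<in> S b \<Longrightarrow> False"
  using far by blast

lemma side_less: "side i < 4" by (simp add: side_def)

sublocale wheel 18 "\<lambda>i. S (LP i)" "\<lambda>i. S (LQ i)" "\<lambda>i. S (LR i)" "\<Union>i<4. S (LO i)"
proof
  have "path_connected (S (LO 0) \<union> S (LO 1) \<union> S (LO 2) \<union> S (LO 3))"
  proof (intro path_connected_Un pconn)
    show "S (LO 0) \<inter> S (LO 1) \<noteq> {}" "(S (LO 0) \<union> S (LO 1)) \<inter> S (LO 2) \<noteq> {}"
      "(S (LO 0) \<union> S (LO 1) \<union> S (LO 2)) \<inter> S (LO 3) \<noteq> {}"
      using near[OF near.OO[of 0]] near[OF near.OO[of 1]] near[OF near.OO[of 2]]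
      by (auto simp: numeral_2_eq_2 numeral_3_eq_3)
  qed auto
  also have "S (LO 0) \<union> S (LO 1) \<union> S (LO 2) \<union> S (LO 3) = (\<Union>i<4. S (LO i))"
    by (auto simp: numeral_eq_Suc lessThan_Suc)
  finally show "path_connected (\<Union>i<4. S (LO i))" .
  show "S (LR i) \<inter> (\<Union>i<4. S (LO i)) \<noteq> {}" if "i < 18" for i
    using near[OF near.RO[OF that]] side_less by blast
  show "path_connected (S (LP i))" "path_connected (S (LQ i))" "path_connected (S (LR i))" if "i < 18" for i
    using that by (simp_all add: pconn)
  show "S (LP i) \<inter> S (LP j) = {}" if "i < 18" "j < 18" "i \<noteq> j" for i j by (rule far[OF far.PP[OF that]])
  show "S (LQ i) \<inter> S (LP i) \<noteq> {}" "S (LQ i) \<inter> S (LP (Suc i mod 18)) \<noteq> {}" if "i < 18" for i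
    by (rule near[OF near.QP[OF that]] near[OF near.QP'[OF that]])+
  show "S (LQ i) \<inter> S (LP j) = {}" if "i < 18" "j < 18" "j \<noteq> i" "j \<noteq> Suc i mod 18" for i j
    by (rule far[OF far.QP[OF that]])
  show "S (LQ i) \<inter> S (LQ j) = {}" if "i < 18" "j < 18" "i \<noteq> j" for i j by (rule far[OF far.QQ[OF that]])
  show "(\<Union>i<4. S (LO i)) \<inter> S (LP i) = {}" "(\<Union>i<4. S (LO i)) \<inter> S (LQ i) = {}" if "i < 18" for i
    using far[OF far.OP[OF _ that]] far[OF far.OQ[OF _ that]] by blast+
  show "S (LR i) \<inter> S (LP i) \<noteq> {}" if "i < 18" for i by (rule near[OF near.RP[OF that]])
  show "S (LR i) \<inter> S (LP j) = {}" if "i < 18" "j < 18" "i \<noteq> j" for i j by (rule far[OF far.RP[OF that]])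
  show "S (LR i) \<inter> S (LQ j) = {}" if "i < 18" "j < 18" "j \<noteq> i" "Suc j mod 18 \<noteq> i" for i j
    by (rule far[OF far.RQ[OF that]])
qed

text \<open>Unions of inner segments avoid rim and spokes, so that of the hypotheses of
  \<open>crossing\<close> only those on the four ring pieces remain.\<close>

lemma cross:
  assumes abcd: "a < b" "b < c" "c < d" "d < 18"
    and s: "path_connected s" "s \<subseteq> (\<Union>l\<in>Ls. S l)" "\<And>l. l \<in> Ls \<Longrightarrow> inner N l" "s \<inter> S (LP a) \<noteq> {}" "s \<inter> S (LP c) \<noteq> {}"
      "s \<inter> S (LP b) = {}" "s \<inter> S (LP d) = {}"
    and t: "path_connected t" "t \<subseteq> (\<Union>l\<in>Lt. S l)" "\<And>l. l \<in> Lt \<Longrightarrow> inner N l" "t \<inter> S (LP b) \<noteq> {}" "t \<inter> S (LP d) \<noteq> {}"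
      "t \<inter> S (LP a) = {}" "t \<inter> S (LP c) = {}"
  shows "\<exists>z. z \<in> s \<and> z \<in> t"
proof -
  have O: "S l \<inter> (\<Union>i<4. S (LO i)) = {}" if "inner N l" for l
    using far[OF far.inner_O[OF that]] by blast
  have R: "S l \<inter> S (LR i) = {}" if "inner N l" "i < 18" for l i
    by (rule far[OF far.inner_R[OF that]])
  have sO: "s \<inter> (\<Union>i<4. S (LO i)) = {}" "t \<inter> (\<Union>i<4. S (LO i)) = {}" using O s(2,3) t(2,3) by blast+
  have sR: "s \<inter> S (LR i) = {}" if "i < 18" for i using R[OF s(3) that] s(2) by blast
  have tR: "t \<inter> S (LR i) = {}" if "i < 18" for i using R[OF t(3) that] t(2) by blast
  have "s \<inter> t \<noteq> {}"
    by (rule crossing[OF abcd s(1,4-7) sO(1) sR sR t(1,4-7) sO(2) tR tR]) (use abcd in auto)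
  then show ?thesis by blast
qed

fun path_set :: "(real \<times> real) list \<Rightarrow> (real \<times> real) set" where
  "path_set (p # q # ps) = closed_segment p q \<union> path_set (q # ps)"
| "path_set _ = {}"

text \<open>Consecutive points lie on a common inner segment, named by the second list. By convexity
  the polygonal path stays within these segments, and their prescribed nonadjacencies apply to
  it.\<close>

fun track :: "(real \<times> real) list \<Rightarrow> lab list \<Rightarrow> bool" where
  "track (p # q # ps) (l # ls) = (inner N l \<and> p \<in> S l \<and> q \<in> S l \<and> (ps = [] \<and> ls = [] \<or> track (q # ps) ls))"
| "track _ _ = False"

lemma track_subset: "track ps ls \<Longrightarrow> path_set ps \<subseteq> (\<Union>l\<in>set ls. S l)"
proof (induction ps ls rule: track.induct)
  case (1 p q ps l ls)
  have "closed_segment p q \<subseteq> S l" using sub[of l p q] 1(2) inner_ok by auto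
  then show ?case using 1 by auto
qed auto

lemma track_inner: "track ps ls \<Longrightarrow> l \<in> set ls \<Longrightarrow> inner N l"
  by (induction ps ls rule: track.induct) auto

lemma track_set: "track ps ls \<Longrightarrow> set ps \<subseteq> path_set ps"
  by (induction ps ls rule: track.induct) auto

lemma track_connected: "track ps ls \<Longrightarrow> path_connected (path_set ps)"
proof (induction ps ls rule: track.induct)
  case (1 p q ps l ls)
  show ?case
  proof (cases "ps = []")
    case False
    with 1(2) have t: "track (q # ps) ls" by simp
    then have "q \<in> path_set (q # ps)" using track_set by fastforce
    then show ?thesis using 1(1)[OF t] by (auto intro!: path_connected_Un)
  qed simp
qed auto

text \<open>The disjointness from ring pieces is a hypothesis here, for tracks that use only a part
  of a segment whose other end is attached to a forbidden piece; \<open>C_facts\<close> needs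
  this.\<close>

lemma cross_tracks':
  assumes "a < b" "b < c" "c < d" "d < 18" "track ps ls" "track qs ms"
    and "x \<in> set ps" "x \<in> S (LP a)" "y \<in> set ps" "y \<in> S (LP c)" "path_set ps \<inter> S (LP b) = {}" "path_set ps \<inter> S (LP d) = {}"
    and "u \<in> set qs" "u \<in> S (LP b)" "v \<in> set qs" "v \<in> S (LP d)" "path_set qs \<inter> S (LP a) = {}" "path_set qs \<inter> S (LP c) = {}"
  shows "\<exists>z. z \<in> path_set ps \<and> z \<in> path_set qs"
  by (rule cross[OF assms(1-4) track_connected[OF assms(5)] track_subset[OF assms(5)] track_inner[OF assms(5)] _ _
     assms(11,12) track_connected[OF assms(6)] track_subset[OF assms(6)] track_inner[OF assms(6)] _ _ assms(17,18)])
    (use track_set[OF assms(5)] track_set[OF assms(6)] assms(7-10,13-16) in auto)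

lemma track_avoid:
  assumes "track ps ls" "i < 18" "\<forall>l\<in>set ls. i \<notin> att l"
  shows "path_set ps \<inter> S (LP i) = {}"
  using track_subset[OF assms(1)] far[OF far.inner_P[OF track_inner[OF assms(1)] assms(2)]] assms(3) by blast

lemma cross_tracks:
  assumes "a < b" "b < c" "c < d" "d < 18" "track ps ls" "track qs ms"
    and "x \<in> set ps" "x \<in> S (LP a)" "y \<in> set ps" "y \<in> S (LP c)" "\<forall>l\<in>set ls. b \<notin> att l \<and> d \<notin> att l"
    and "u \<in> set qs" "u \<in> S (LP b)" "v \<in> set qs" "v \<in> S (LP d)" "\<forall>l\<in>set ms. a \<notin> att l \<and> c \<notin> att l"
  shows "\<exists>z. z \<in> path_set ps \<and> z \<in> path_set qs"
  using cross_tracks'[OF assms(1-10) _ _ assms(12-15)] track_avoid[OF assms(5)] track_avoid[OF assms(6)] assms(1-4,11,16)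
  by auto

definition pt :: "lab \<Rightarrow> nat \<Rightarrow> real \<times> real" where "pt l i = (SOME z. z \<in> S l \<and> z \<in> S (LP i))"
definition mt :: "lab \<Rightarrow> lab \<Rightarrow> real \<times> real" where "mt l l' = (SOME z. z \<in> S l \<and> z \<in> S l')"

lemma pt: "inner N l \<Longrightarrow> i \<in> att l \<Longrightarrow> pt l i \<in> S l \<and> pt l i \<in> S (LP i)"
  using near[OF near.inner_P[of N l i]] unfolding pt_def by (intro someI_ex[of "\<lambda>z. z \<in> S l \<and> z \<in> S (LP i)"]) blast

lemma mt: "near N l l' \<Longrightarrow> mt l l' \<in> S l \<and> mt l l' \<in> S l'"
  using near[of l l'] unfolding mt_def by (intro someI_ex[of "\<lambda>z. z \<in> S l \<and> z \<in> S l'"]) blast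

lemma meet:
  assumes "a < b" "b < c" "c < d" "d < 18" "inner N l" "inner N l'" "a \<in> att l" "c \<in> att l" "b \<in> att l'" "d \<in> att l'"
    "b \<notin> att l" "d \<notin> att l" "a \<notin> att l'" "c \<notin> att l'"
  shows "\<exists>z. z \<in> S l \<and> z \<in> S l' \<and> z \<in> closed_segment (pt l a) (pt l c) \<and> z \<in> closed_segment (pt l' b) (pt l' d)"
proof -
  have "\<exists>z. z \<in> path_set [pt l a, pt l c] \<and> z \<in> path_set [pt l' b, pt l' d]"
    by (rule cross_tracks[OF assms(1-4), of _ "[l]" _ "[l']" "pt l a" "pt l c" "pt l' b" "pt l' d"])
      (use assms pt in auto)
  then obtain z where z: "z \<in> closed_segment (pt l a) (pt l c)" "z \<in> closed_segment (pt l' b) (pt l' d)" by auto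
  then have "z \<in> S l" "z \<in> S l'"
    using subD[OF z(1) inner_ok] subD[OF z(2) inner_ok] pt assms by blast+
  with z show ?thesis by blast
qed

lemmas meet_XY = meet[of 0 7 11 15 LX LY, simplified]
lemmas meet_XZ = meet[of 0 1 11 12 LX LZ, simplified]
lemmas meet_ZY = meet[of 1 7 12 15 LZ LY, simplified]
lemmas meet_ZG = meet[of 1 4 12 17 LZ LG, simplified]

end

subsection \<open>Squaring of the heights\<close>

text \<open>The affine frame in which \<open>X\<close>, \<open>Y\<close>, \<open>Z\<close> lie on the lines \<open>y = x + 1\<close>, \<open>y = 0\<close> and \<open>x = 0\<close>.\<close>

locale normal_config = config +
  assumes P0: "(-1, 0) \<in> S LX" "(-1, 0) \<in> S LY" and Q0: "(0, 0) \<in> S LY" "(0, 0) \<in> S LZ"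
    and R0: "(0, 1) \<in> S LX" "(0, 1) \<in> S LZ"
begin

lemma Z0: "z \<in> S LZ \<Longrightarrow> fst z = 0"
  using det0[of LZ "(0,0)" "(0,1)" z] Q0 R0 by simp

lemma Y0: "z \<in> S LY \<Longrightarrow> snd z = 0"
  using det0[of LY "(-1,0)" "(0,0)" z] Q0 P0 by simp

lemma X0: "z \<in> S LX \<Longrightarrow> snd z = fst z + 1"
  using det0[of LX "(-1,0)" "(0,1)" z] R0 P0 by simp

lemma XZ: "z \<in> S LX \<Longrightarrow> z \<in> S LZ \<Longrightarrow> z = (0, 1)"
  using X0[of z] Z0[of z] by (simp add: prod_eq_iff)
lemma YZ: "z \<in> S LY \<Longrightarrow> z \<in> S LZ \<Longrightarrow> z = (0, 0)"
  using Y0[of z] Z0[of z] by (simp add: prod_eq_iff)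
lemma XY: "z \<in> S LX \<Longrightarrow> z \<in> S LY \<Longrightarrow> z = (-1, 0)"
  using X0[of z] Y0[of z] by (simp add: prod_eq_iff)

abbreviation "zt \<equiv> pt LZ 1"
abbreviation "zb \<equiv> pt LZ 12"
abbreviation "xr \<equiv> pt LX 0"
abbreviation "xl \<equiv> pt LX 11"
abbreviation "yl \<equiv> pt LY 7"
abbreviation "yr \<equiv> pt LY 15"

lemma frame_pts: "zt \<in> S LZ" "zb \<in> S LZ" "xr \<in> S LX" "xl \<in> S LX" "yl \<in> S LY" "yr \<in> S LY"
  "zt \<in> S (LP 1)" "zb \<in> S (LP 12)" "xr \<in> S (LP 0)" "xl \<in> S (LP 11)" "yl \<in> S (LP 7)" "yr \<in> S (LP 15)"
  using pt[of LZ 1] pt[of LZ 12] pt[of LX 0] pt[of LX 11] pt[of LY 7] pt[of LY 15] by auto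

lemma segD: "z \<in> closed_segment p q \<Longrightarrow> inner N l \<Longrightarrow> p \<in> S l \<Longrightarrow> q \<in> S l \<Longrightarrow> z \<in> S l"
  using subD inner_ok by blast

lemma ZI: "w \<in> S LZ \<Longrightarrow> z \<in> S LZ \<Longrightarrow> z' \<in> S LZ \<Longrightarrow> min (snd z) (snd z') \<le> snd w \<Longrightarrow> snd w \<le> max (snd z) (snd z')
    \<Longrightarrow> w \<in> closed_segment z z'"
  using vertical_segmentI[of "snd z" "snd z'" "snd w" 0] Z0[of w] Z0[of z] Z0[of z'] by (metis prod.collapse)

text \<open>\<open>LJ\<close> decides which end of \<open>LZ\<close> is the upper one. It meets
  \<open>LZ\<close>, avoids \<open>LX\<close> and \<open>LY\<close> and ends on piece 16, which the
  chord \<open>LX\<close> separates from piece 1 and the chord \<open>LY\<close> from piece 12. So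
  (0, 1) lies between \<open>zt\<close> and the crossing with \<open>LJ\<close>, and (0, 0) between
  that crossing and \<open>zb\<close>.\<close>

lemma Z_ends: "1 \<le> snd zt" "snd zb \<le> 0"
proof -
  let ?j = "mt LJ LZ" let ?jr = "pt LJ 16"
  have j: "?j \<in> S LJ" "?j \<in> S LZ" "?jr \<in> S LJ" "?jr \<in> S (LP 16)" using mt[OF near.JZ] pt[of LJ 16] by auto
  have "\<exists>z. z \<in> path_set [xr, xl] \<and> z \<in> path_set [zt, ?j, ?jr]"
    by (rule cross_tracks[of 0 1 11 16 _ "[LX]" _ "[LZ, LJ]" xr xl zt ?jr]) (use j frame_pts in auto)
  then obtain z where z: "z \<in> closed_segment xr xl" "z \<in> closed_segment zt ?j \<or> z \<in> closed_segment ?j ?jr" by auto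
  have zX: "z \<in> S LX" using segD[OF z(1), of LX] frame_pts by auto
  have "z \<notin> closed_segment ?j ?jr" using segD[of z ?j ?jr LJ] j farD[OF far.JX, of z] zX by auto
  then have z2: "z \<in> closed_segment zt ?j" using z by blast
  then have "z = (0,1)" using XZ[OF zX] segD[of z zt ?j LZ] j frame_pts by auto
  with segment_snd[OF z2] have 1: "min (snd zt) (snd ?j) \<le> 1" "1 \<le> max (snd zt) (snd ?j)" by auto
  have "\<exists>z. z \<in> path_set [yl, yr] \<and> z \<in> path_set [zb, ?j, ?jr]"
    by (rule cross_tracks[of 7 12 15 16 _ "[LY]" _ "[LZ, LJ]" yl yr zb ?jr]) (use j frame_pts in auto)
  then obtain z where z: "z \<in> closed_segment yl yr" "z \<in> closed_segment zb ?j \<or> z \<in> closed_segment ?j ?jr" by auto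
  have zY: "z \<in> S LY" using segD[OF z(1), of LY] frame_pts by auto
  have "z \<notin> closed_segment ?j ?jr" using segD[of z ?j ?jr LJ] j farD[OF far.JY, of z] zY by auto
  then have z2: "z \<in> closed_segment zb ?j" using z by blast
  then have "z = (0,0)" using YZ[OF zY] segD[of z zb ?j LZ] j frame_pts by auto
  with segment_snd[OF z2] have 2: "min (snd zb) (snd ?j) \<le> 0" "0 \<le> max (snd zb) (snd ?j)" by auto
  obtain z where z: "z \<in> S LX" "z \<in> S LZ" "z \<in> closed_segment zt zb" using meet_XZ by auto
  then have "z = (0,1)" using XZ by auto
  with segment_snd[OF z(3)] have 3: "1 \<le> max (snd zt) (snd zb)" by auto
  obtain z where z: "z \<in> S LZ" "z \<in> S LY" "z \<in> closed_segment zt zb" using meet_ZY by auto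
  then have "z = (0,0)" using YZ by auto
  with segment_snd[OF z(3)] have 4: "min (snd zt) (snd zb) \<le> 0" by auto
  show "1 \<le> snd zt" "snd zb \<le> 0" using 1 2 3 4 by (auto simp: min_def max_def split: if_splits)
qed

text \<open>Here and in the next three lemmas a path that bends at a corner of the triangle has to
  cross a side. One leg of the path cannot meet that side, hence the crossing is on the other leg,
  and this locates the end of that leg.\<close>

lemma yl: "fst yl \<le> -1"
proof -
  have "\<exists>z. z \<in> path_set [xr, xl] \<and> z \<in> path_set [yl, (0,0), zb]"
    by (rule cross_tracks[of 0 7 11 12 _ "[LX]" _ "[LY, LZ]" xr xl yl zb]) (use Q0 frame_pts in auto)
  then obtain z where z: "z \<in> closed_segment xr xl" "z \<in> closed_segment yl (0,0) \<or> z \<in> closed_segment (0,0) zb" by auto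
  have zX: "z \<in> S LX" using segD[OF z(1), of LX] frame_pts by auto
  have "z \<notin> closed_segment (0,0) zb"
    using segD[of z "(0,0)" zb LZ] Q0 frame_pts XZ[OF zX] segment_snd[of z "(0,0)" zb] Z_ends by fastforce
  with z have z2: "z \<in> closed_segment yl (0,0)" by blast
  then have "z = (-1,0)" using XY[OF zX] segD[of z yl "(0,0)" LY] Q0 frame_pts by auto
  with segment_fst[OF z2] show ?thesis by (auto simp: min_def split: if_splits)
qed

lemma xl: "fst xl \<le> -1"
proof -
  have "\<exists>z. z \<in> path_set [zt, (0,1), xl] \<and> z \<in> path_set [yl, yr]"
    by (rule cross_tracks[of 1 7 11 15 _ "[LZ, LX]" _ "[LY]" zt xl yl yr]) (use R0 frame_pts in auto)
  then obtain z where z: "z \<in> closed_segment yl yr" "z \<in> closed_segment zt (0,1) \<or> z \<in> closed_segment (0,1) xl" by auto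
  have zY: "z \<in> S LY" using segD[OF z(1), of LY] frame_pts by auto
  have "z \<notin> closed_segment zt (0,1)"
    using segD[of z zt "(0,1)" LZ] R0 frame_pts Y0[OF zY] segment_snd[of z zt "(0,1)"] Z_ends by fastforce
  with z have z2: "z \<in> closed_segment (0,1) xl" by blast
  then have "z = (-1,0)" using XY[OF _ zY] segD[of z "(0,1)" xl LX] R0 frame_pts by auto
  with segment_fst[OF z2] show ?thesis by (auto simp: min_def split: if_splits)
qed

lemma yr: "0 < fst yr"
proof -
  have "\<exists>z. z \<in> path_set [zt, zb] \<and> z \<in> path_set [xl, (-1,0), yr]"
    by (rule cross_tracks[of 1 11 12 15 _ "[LZ]" _ "[LX, LY]" zt zb xl yr]) (use P0 frame_pts in auto)
  then obtain z where z: "z \<in> closed_segment zt zb" "z \<in> closed_segment xl (-1,0) \<or> z \<in> closed_segment (-1,0) yr" by auto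
  have zZ: "z \<in> S LZ" using segD[OF z(1), of LZ] frame_pts by auto
  have "z \<notin> closed_segment xl (-1,0)"
    using Z0[OF zZ] segment_fst[of z xl "(-1,0)"] xl by fastforce
  with z have z2: "z \<in> closed_segment (-1,0) yr" by blast
  have "0 \<le> fst yr" using segment_fst[OF z2] Z0[OF zZ] by auto
  moreover have "fst yr \<noteq> 0"
  proof
    assume "fst yr = 0"
    then have "yr = (0,0)" using Y0[of yr] frame_pts by (simp add: prod_eq_iff)
    then show False using farD[OF far.inner_P[of N LZ 15], of yr] Q0 frame_pts by auto
  qed
  ultimately show ?thesis by simp
qed

lemma xr: "0 \<le> fst xr"
proof -
  have "\<exists>z. z \<in> path_set [xr, (-1,0), yl] \<and> z \<in> path_set [zt, zb]"
    by (rule cross_tracks[of 0 1 7 12 _ "[LX, LY]" _ "[LZ]" xr yl zt zb]) (use P0 frame_pts in auto)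
  then obtain z where z: "z \<in> closed_segment zt zb" "z \<in> closed_segment xr (-1,0) \<or> z \<in> closed_segment (-1,0) yl" by auto
  have zZ: "z \<in> S LZ" using segD[OF z(1), of LZ] frame_pts by auto
  have "z \<notin> closed_segment (-1,0) yl"
    using Z0[OF zZ] segment_fst[of z "(-1,0)" yl] yl by fastforce
  with z have z2: "z \<in> closed_segment xr (-1,0)" by blast
  show "0 \<le> fst xr" using segment_fst[OF z2] Z0[OF zZ] by auto
qed

lemma label_pts:
  assumes "k \<le> N"
  shows "pt (LA k) 2 \<in> S (LA k)" "pt (LA k) 2 \<in> S (LP 2)" "pt (LB k) 10 \<in> S (LB k)" "pt (LB k) 10 \<in> S (LP 10)"
    "pt (LD k) 8 \<in> S (LD k)" "pt (LD k) 8 \<in> S (LP 8)" "pt (LE k) 6 \<in> S (LE k)" "pt (LE k) 6 \<in> S (LP 6)"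
    "pt (LT k) 5 \<in> S (LT k)" "pt (LT k) 5 \<in> S (LP 5)" "pt (LU k) 9 \<in> S (LU k)" "pt (LU k) 9 \<in> S (LP 9)"
    "mt (LT k) (LC k) \<in> S (LT k)" "mt (LT k) (LC k) \<in> S (LC k)" "mt (LC k) (LU k) \<in> S (LC k)" "mt (LC k) (LU k) \<in> S (LU k)"
    "mt (LA k) (LD k) \<in> S (LA k)" "mt (LA k) (LD k) \<in> S (LD k)" "mt (LB k) (LE k) \<in> S (LB k)" "mt (LB k) (LE k) \<in> S (LE k)"
    "mt (LT k) LZ \<in> S (LT k)" "mt (LT k) LZ \<in> S LZ"
  using pt[of "LA k" 2] pt[of "LB k" 10] pt[of "LD k" 8] pt[of "LE k" 6] pt[of "LT k" 5] pt[of "LU k" 9]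
    mt[OF near.TC[OF assms]] mt[OF near.CU[OF assms]] mt[OF near.AD[OF assms]] mt[OF near.BE[OF assms]]
    mt[OF near.TZ[OF assms]] assms by simp_all

lemma cross_Y:
  assumes "track qs ms" "u \<in> set qs" "u \<in> S (LP b)" "v \<in> set qs" "v \<in> S (LP d)"
    "b < 7 \<or> 15 < b" "7 < d" "d < 15" "b < 18" "\<forall>l\<in>set ms. 7 \<notin> att l \<and> 15 \<notin> att l"
  shows "\<exists>z. z \<in> path_set qs \<and> z \<in> S LY"
proof -
  have "\<exists>z. z \<in> path_set qs \<and> z \<in> path_set [yl, yr]"
  proof (cases "b < 7")
    case True
    show ?thesis
      by (rule cross_tracks[of b 7 d 15 qs ms _ "[LY]" u v yl yr]) (use assms frame_pts True in auto)
  next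
    case False
    have "\<exists>z. z \<in> path_set [yl, yr] \<and> z \<in> path_set qs"
      by (rule cross_tracks[of 7 d 15 b _ "[LY]" qs ms yl yr v u]) (use assms frame_pts False in auto)
    then show ?thesis by blast
  qed
  then show ?thesis using segD[of _ yl yr LY] frame_pts by fastforce
qed

lemma avoid:
  assumes "far N l l' \<or> far N l' l" "z \<in> S l'" "inner N l" "p \<in> S l" "q \<in> S l"
  shows "z \<notin> closed_segment p q"
  using segD[of z p q l] assms far by blast

text \<open>Pieces 1 and 8 are on different sides of the chord \<open>LY\<close>, which
  \<open>LD k\<close> avoids. So the way from \<open>zt\<close> through g to piece 8 crosses
  \<open>LY\<close> while still on \<open>LZ\<close>, that is in (0, 0). The next four lemmas vary
  this argument.\<close>

lemma D_Z:
  assumes "k \<le> N" "g \<in> S (LD k)" "g \<in> S LZ"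
  shows "snd g < 0"
proof -
  obtain z where z: "z \<in> path_set [zt, g, pt (LD k) 8]" "z \<in> S LY"
    using cross_Y[of "[zt, g, pt (LD k) 8]" "[LZ, LD k]" zt 1 "pt (LD k) 8" 8] assms frame_pts label_pts[OF assms(1)] by auto
  have "z \<notin> closed_segment g (pt (LD k) 8)"
    by (rule avoid[OF disjI1[OF far.DY[OF assms(1)]] z(2)]) (use assms label_pts[OF assms(1)] in auto)
  with z have z2: "z \<in> closed_segment zt g" by auto
  then have "z = (0,0)" using YZ[OF z(2)] segD[of z zt g LZ] assms frame_pts by auto
  then have "snd g \<le> 0" using segment_snd[OF z2] Z_ends by (auto simp: min_def split: if_splits)
  moreover have "g \<noteq> (0,0)" using farD[OF far.DY[OF assms(1)], of g] assms Q0 by auto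
  ultimately show ?thesis using Z0[OF assms(3)] by (cases g) auto
qed

lemma D_X:
  assumes "k \<le> N" "x \<in> S (LD k)" "x \<in> S LX"
  shows "fst x < -1"
proof -
  obtain z where z: "z \<in> path_set [xr, x, pt (LD k) 8]" "z \<in> S LY"
    using cross_Y[of "[xr, x, pt (LD k) 8]" "[LX, LD k]" xr 0 "pt (LD k) 8" 8] assms frame_pts label_pts[OF assms(1)] by auto
  have "z \<notin> closed_segment x (pt (LD k) 8)"
    by (rule avoid[OF disjI1[OF far.DY[OF assms(1)]] z(2)]) (use assms label_pts[OF assms(1)] in auto)
  with z have z2: "z \<in> closed_segment xr x" by auto
  then have "z = (-1,0)" using XY[OF _ z(2)] segD[of z xr x LX] assms frame_pts by auto
  then have "fst x \<le> -1" using segment_fst[OF z2] xr by (auto simp: min_def split: if_splits)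
  moreover have "x \<noteq> (-1,0)" using farD[OF far.DY[OF assms(1)], of x] assms P0 by auto
  ultimately show ?thesis using X0[OF assms(3)] by (cases x) auto
qed

lemma U_X:
  assumes "k \<le> N" "x \<in> S (LU k)" "x \<in> S LX"
  shows "fst x < -1"
proof -
  obtain z where z: "z \<in> path_set [xr, x, pt (LU k) 9]" "z \<in> S LY"
    using cross_Y[of "[xr, x, pt (LU k) 9]" "[LX, LU k]" xr 0 "pt (LU k) 9" 9] assms frame_pts label_pts[OF assms(1)] by auto
  have "z \<notin> closed_segment x (pt (LU k) 9)"
    by (rule avoid[OF disjI1[OF far.UY[OF assms(1)]] z(2)]) (use assms label_pts[OF assms(1)] in auto)
  with z have z2: "z \<in> closed_segment xr x" by auto
  then have "z = (-1,0)" using XY[OF _ z(2)] segD[of z xr x LX] assms frame_pts by auto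
  then have "fst x \<le> -1" using segment_fst[OF z2] xr by (auto simp: min_def split: if_splits)
  moreover have "x \<noteq> (-1,0)" using farD[OF far.UY[OF assms(1)], of x] assms P0 by auto
  ultimately show ?thesis using X0[OF assms(3)] by (cases x) auto
qed

lemma E_Z:
  assumes "k \<le> N" "g \<in> S (LE k)" "g \<in> S LZ"
  shows "0 < snd g"
proof -
  obtain z where z: "z \<in> path_set [pt (LE k) 6, g, zb]" "z \<in> S LY"
    using cross_Y[of "[pt (LE k) 6, g, zb]" "[LE k, LZ]" "pt (LE k) 6" 6 zb 12] assms frame_pts label_pts[OF assms(1)] by auto
  have "z \<notin> closed_segment (pt (LE k) 6) g"
    by (rule avoid[OF disjI1[OF far.EY[OF assms(1)]] z(2)]) (use assms label_pts[OF assms(1)] in auto)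
  with z have z2: "z \<in> closed_segment g zb" by auto
  then have "z = (0,0)" using YZ[OF z(2)] segD[of z g zb LZ] assms frame_pts by auto
  then have "0 \<le> snd g" using segment_snd[OF z2] Z_ends farD[OF far.inner_P[of N LY 12], of zb] frame_pts Q0 Z0[of zb]
    by (cases zb) (auto simp: max_def split: if_splits)
  moreover have "g \<noteq> (0,0)" using farD[OF far.EY[OF assms(1)], of g] assms Q0 by auto
  ultimately show ?thesis using Z0[OF assms(3)] by (cases g) auto
qed

lemma E_X:
  assumes "k \<le> N" "x \<in> S (LE k)" "x \<in> S LX"
  shows "-1 < fst x"
proof -
  obtain z where z: "z \<in> path_set [pt (LE k) 6, x, xl]" "z \<in> S LY"
    using cross_Y[of "[pt (LE k) 6, x, xl]" "[LE k, LX]" "pt (LE k) 6" 6 xl 11] assms frame_pts label_pts[OF assms(1)] by auto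
  have "z \<notin> closed_segment (pt (LE k) 6) x"
    by (rule avoid[OF disjI1[OF far.EY[OF assms(1)]] z(2)]) (use assms label_pts[OF assms(1)] in auto)
  with z have z2: "z \<in> closed_segment x xl" by auto
  then have "z = (-1,0)" using XY[OF _ z(2)] segD[of z x xl LX] assms frame_pts by auto
  then have "-1 \<le> fst x" using segment_fst[OF z2] xl farD[OF far.inner_P[of N LY 11], of xl] frame_pts P0 X0[of xl]
    by (cases xl) (auto simp: max_def split: if_splits)
  moreover have "x \<noteq> (-1,0)" using farD[OF far.EY[OF assms(1)], of x] assms P0 by auto
  ultimately show ?thesis using X0[OF assms(3)] by (cases x) auto
qed

lemma T_Z:
  assumes "k \<le> N" "t \<in> S (LT k)" "t \<in> S LZ"
  shows "1 < snd t" "snd t \<le> snd zt"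
proof -
  have "\<exists>z. z \<in> path_set [xr, xl] \<and> z \<in> path_set [pt (LT k) 5, t, zb]"
    by (rule cross_tracks[of 0 5 11 12 _ "[LX]" _ "[LT k, LZ]" xr xl "pt (LT k) 5" zb])
      (use assms frame_pts label_pts[OF assms(1)] in auto)
  then obtain z where z: "z \<in> closed_segment xr xl" "z \<in> closed_segment (pt (LT k) 5) t \<or> z \<in> closed_segment t zb" by auto
  have zX: "z \<in> S LX" using segD[OF z(1), of LX] frame_pts by auto
  have "z \<notin> closed_segment (pt (LT k) 5) t"
    by (rule avoid[OF disjI1[OF far.TX[OF assms(1)]] zX]) (use assms label_pts[OF assms(1)] in auto)
  with z have z2: "z \<in> closed_segment t zb" by auto
  then have "z = (0,1)" using XZ[OF zX] segD[of z t zb LZ] assms frame_pts by auto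
  then have "1 \<le> snd t" using segment_snd[OF z2] Z_ends by (auto simp: max_def split: if_splits)
  moreover have "t \<noteq> (0,1)" using farD[OF far.TX[OF assms(1)], of t] assms R0 by auto
  ultimately show "1 < snd t" using Z0[OF assms(3)] by (cases t) auto
  \<comment> \<open>If t were above \<open>zt\<close>, then \<open>LG\<close>, which separates piece
    1 from piece 5, would meet \<open>LZ\<close> on both sides of \<open>zt\<close> and by convexity
    contain it. But \<open>LG\<close> avoids piece 1.\<close>
  show "snd t \<le> snd zt"
  proof (rule ccontr)
    assume *: "\<not> snd t \<le> snd zt"
    obtain z1 where z1: "z1 \<in> S LZ" "z1 \<in> S LG" "z1 \<in> closed_segment zt zb" using meet_ZG by auto
    have g: "pt LG 4 \<in> S LG" "pt LG 4 \<in> S (LP 4)" "pt LG 17 \<in> S LG" "pt LG 17 \<in> S (LP 17)" using pt[of LG] by auto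
    have "\<exists>z. z \<in> path_set [zt, t, pt (LT k) 5] \<and> z \<in> path_set [pt LG 4, pt LG 17]"
      by (rule cross_tracks[of 1 4 5 17 _ "[LZ, LT k]" _ "[LG]" zt "pt (LT k) 5" "pt LG 4" "pt LG 17"])
        (use assms frame_pts g label_pts[OF assms(1)] in auto)
    then obtain z2 where z2: "z2 \<in> closed_segment (pt LG 4) (pt LG 17)" "z2 \<in> closed_segment t (pt (LT k) 5) \<or> z2 \<in> closed_segment zt t"
      by auto
    have zG: "z2 \<in> S LG" using segD[OF z2(1), of LG] g by auto
    have "z2 \<notin> closed_segment t (pt (LT k) 5)"
      by (rule avoid[OF disjI1[OF far.TG[OF assms(1)]] zG]) (use assms label_pts[OF assms(1)] in auto)
    with z2 have z3: "z2 \<in> closed_segment zt t" by auto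
    have "z2 \<in> S LZ" using segD[OF z3, of LZ] assms frame_pts by auto
    then have "zt \<in> closed_segment z1 z2"
      using segment_snd[OF z3] segment_snd[OF z1(3)] Z_ends * z1 frame_pts by (intro ZI) (auto simp: min_def max_def split: if_splits)
    then have "zt \<in> S LG" using segD[of zt z1 z2 LG] z1 zG by auto
    then show False using farD[OF far.inner_P[of N LG 1], of zt] frame_pts by auto
  qed
qed


text \<open>\<open>LA k\<close> and \<open>LD k\<close> together are a chord from piece 2 to piece
  8. It separates piece 1 from piece 5, so the path along \<open>LZ\<close> and \<open>LT k\<close>
  crosses it; \<open>LT k\<close> avoids it, and \<open>LD k\<close> meets \<open>LZ\<close> only
  below \<open>LY\<close>.\<close>

lemma A_Z_ex:
  assumes k: "k \<le> N"
  obtains \<alpha> where "\<alpha> \<in> S (LA k)" "\<alpha> \<in> S LZ" "snd (mt (LT k) LZ) < snd \<alpha>"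
proof -
  note lp = label_pts[OF k] frame_pts
  let ?t = "mt (LT k) LZ" let ?tl = "pt (LT k) 5" let ?at = "pt (LA k) 2" let ?i = "mt (LA k) (LD k)" let ?dl = "pt (LD k) 8"
  have "\<exists>z. z \<in> path_set [zt, ?t, ?tl] \<and> z \<in> path_set [?at, ?i, ?dl]"
    by (rule cross_tracks[of 1 2 5 8 _ "[LZ, LT k]" _ "[LA k, LD k]" zt ?tl ?at ?dl]) (use k lp in auto)
  then obtain z where z: "z \<in> closed_segment zt ?t \<or> z \<in> closed_segment ?t ?tl" "z \<in> closed_segment ?at ?i \<or> z \<in> closed_segment ?i ?dl"
    by auto
  have zAD: "z \<in> S (LA k) \<or> z \<in> S (LD k)"
    using segD[of z ?at ?i "LA k"] segD[of z ?i ?dl "LD k"] z(2) k lp by auto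
  have "z \<notin> closed_segment ?t ?tl"
    using zAD avoid[OF disjI1[OF far.TA[OF k]], of z ?t ?tl] avoid[OF disjI1[OF far.TD[OF k]], of z ?t ?tl] k lp by auto
  then have z1: "z \<in> closed_segment zt ?t" using z by blast
  then have zZ: "z \<in> S LZ" using segD[of z zt ?t LZ] k lp by auto
  have ge: "snd ?t \<le> snd z" using segment_snd[OF z1] T_Z[OF k, of ?t] lp by auto
  then have "z \<notin> S (LD k)" using D_Z[OF k, of z] zZ T_Z[OF k, of ?t] lp by auto
  then have zA: "z \<in> S (LA k)" using zAD by blast
  have "z \<noteq> ?t" using farD[OF far.TA[OF k], of z] zA lp by auto
  then have "snd z \<noteq> snd ?t" using Z0[OF zZ] Z0[of ?t] lp by (auto simp: prod_eq_iff)
  with ge that[OF zA zZ] show thesis by auto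
qed

text \<open>By convexity, a lower point of \<open>LA k\<close> on \<open>LZ\<close> would put the
  crossing of \<open>LZ\<close> with \<open>LT k\<close> onto \<open>LA k\<close>.\<close>

lemma A_Z:
  assumes k: "k \<le> N" and b: "\<beta> \<in> S (LA k)" "\<beta> \<in> S LZ"
  shows "snd (mt (LT k) LZ) < snd \<beta>" "1 < snd \<beta>"
proof -
  note lp = label_pts[OF k] frame_pts
  let ?t = "mt (LT k) LZ"
  obtain \<alpha> where a: "\<alpha> \<in> S (LA k)" "\<alpha> \<in> S LZ" "snd ?t < snd \<alpha>" by (rule A_Z_ex[OF k])
  show *: "snd ?t < snd \<beta>"
  proof (rule ccontr)
    assume "\<not> snd ?t < snd \<beta>"
    then have "?t \<in> closed_segment \<beta> \<alpha>" using a b lp by (intro ZI) auto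
    moreover have "?t \<notin> closed_segment \<beta> \<alpha>"
      by (rule avoid[OF disjI2[OF far.TA[OF k]]]) (use a b lp k in auto)
    ultimately show False by blast
  qed
  then show "1 < snd \<beta>" using T_Z[OF k, of ?t] lp by auto
qed

text \<open>The chord of \<open>A_Z_ex\<close> also separates piece 5 from piece 15; the path
  between them turns from \<open>LT k\<close> into \<open>LZ\<close> and at the corner (0, 0) into
  \<open>LY\<close>. For \<open>A_X_ex\<close> it turns at (0, 1) into \<open>LX\<close>, towards
  piece 0.\<close>

lemma A_Y_ex:
  assumes k: "k \<le> N"
  obtains a where "a \<in> S (LA k)" "a \<in> S LY" "0 < fst a"
proof -
  note lp = label_pts[OF k] frame_pts
  let ?t = "mt (LT k) LZ" let ?tl = "pt (LT k) 5" let ?at = "pt (LA k) 2" let ?i = "mt (LA k) (LD k)" let ?dl = "pt (LD k) 8"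
  have "\<exists>z. z \<in> path_set [?at, ?i, ?dl] \<and> z \<in> path_set [?tl, ?t, (0,0), yr]"
    by (rule cross_tracks[of 2 5 8 15 _ "[LA k, LD k]" _ "[LT k, LZ, LY]" ?at ?dl ?tl yr]) (use k lp Q0 in auto)
  then obtain z where z: "z \<in> closed_segment ?tl ?t \<or> z \<in> closed_segment ?t (0,0) \<or> z \<in> closed_segment (0,0) yr"
    "z \<in> closed_segment ?at ?i \<or> z \<in> closed_segment ?i ?dl"
    by auto
  have zAD: "z \<in> S (LA k) \<or> z \<in> S (LD k)"
    using segD[of z ?at ?i "LA k"] segD[of z ?i ?dl "LD k"] z(2) k lp by auto
  have "z \<notin> closed_segment ?tl ?t"
    using zAD avoid[OF disjI1[OF far.TA[OF k]], of z ?tl ?t] avoid[OF disjI1[OF far.TD[OF k]], of z ?tl ?t] k lp by auto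
  moreover have "z \<notin> closed_segment ?t (0,0)"
  proof
    assume z1: "z \<in> closed_segment ?t (0,0)"
    then have zZ: "z \<in> S LZ" using segD[of z ?t "(0,0)" LZ] lp Q0 by auto
    have "0 \<le> snd z" "snd z \<le> snd ?t" using segment_snd[OF z1] T_Z[OF k, of ?t] lp by auto
    then show False using zAD D_Z[OF k _ zZ] A_Z(1)[OF k _ zZ] by force
  qed
  ultimately have z1: "z \<in> closed_segment (0,0) yr" using z by blast
  then have zY: "z \<in> S LY" using segD[of z "(0,0)" yr LY] lp Q0 by auto
  then have zA: "z \<in> S (LA k)" using zAD farD[OF far.DY[OF k], of z] by blast
  have "0 \<le> fst z" using segment_fst[OF z1] yr by auto
  moreover have "fst z \<noteq> 0"
  proof
    assume "fst z = 0"
    then have "z = (0,0)" using Y0[OF zY] by (simp add: prod_eq_iff)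
    then show False using A_Z(2)[OF k, of z] zA Q0 by auto
  qed
  ultimately show thesis using that[OF zA zY] by auto
qed

lemma A_X_ex:
  assumes k: "k \<le> N"
  obtains d where "d \<in> S (LA k)" "d \<in> S LX" "0 \<le> fst d"
proof -
  note lp = label_pts[OF k] frame_pts
  let ?t = "mt (LT k) LZ" let ?tl = "pt (LT k) 5" let ?at = "pt (LA k) 2" let ?i = "mt (LA k) (LD k)" let ?dl = "pt (LD k) 8"
  have "\<exists>z. z \<in> path_set [?tl, ?t, (0,1), xr] \<and> z \<in> path_set [?at, ?i, ?dl]"
    by (rule cross_tracks[of 0 2 5 8 _ "[LT k, LZ, LX]" _ "[LA k, LD k]" xr ?tl ?at ?dl]) (use k lp R0 in auto)
  then obtain z where z: "z \<in> closed_segment ?tl ?t \<or> z \<in> closed_segment ?t (0,1) \<or> z \<in> closed_segment (0,1) xr"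
    "z \<in> closed_segment ?at ?i \<or> z \<in> closed_segment ?i ?dl"
    by auto
  have zAD: "z \<in> S (LA k) \<or> z \<in> S (LD k)"
    using segD[of z ?at ?i "LA k"] segD[of z ?i ?dl "LD k"] z(2) k lp by auto
  have "z \<notin> closed_segment ?tl ?t"
    using zAD avoid[OF disjI1[OF far.TA[OF k]], of z ?tl ?t] avoid[OF disjI1[OF far.TD[OF k]], of z ?tl ?t] k lp by auto
  moreover have "z \<notin> closed_segment ?t (0,1)"
  proof
    assume z1: "z \<in> closed_segment ?t (0,1)"
    then have zZ: "z \<in> S LZ" using segD[of z ?t "(0,1)" LZ] lp R0 by auto
    have "1 \<le> snd z" "snd z \<le> snd ?t" using segment_snd[OF z1] T_Z[OF k, of ?t] lp by auto
    then show False using zAD D_Z[OF k _ zZ] A_Z(1)[OF k _ zZ] by force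
  qed
  ultimately have z1: "z \<in> closed_segment (0,1) xr" using z by blast
  then have zX: "z \<in> S LX" using segD[of z "(0,1)" xr LX] lp R0 by auto
  have ge: "0 \<le> fst z" using segment_fst[OF z1] xr by auto
  then have zA: "z \<in> S (LA k)" using zAD D_X[OF k _ zX] by force
  show thesis using that[OF zA zX ge] .
qed

lemma A_Y_unique:
  assumes k: "k \<le> N" and "a \<in> S (LA k)" "a \<in> S LY" "b \<in> S (LA k)" "b \<in> S LY"
  shows "a = b"
proof -
  obtain \<alpha> where al: "\<alpha> \<in> S (LA k)" "\<alpha> \<in> S LZ" by (rule A_Z_ex[OF k])
  have "(fst b - fst a) * snd \<alpha> = 0" using det0[of "LA k" a b \<alpha>] assms al Y0[of a] Y0[of b] by auto
  then have "fst a = fst b" using A_Z(2)[OF k al] by auto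
  then show ?thesis using Y0[of a] Y0[of b] assms by (simp add: prod_eq_iff)
qed

text \<open>\<open>LA k\<close> passes a bound on \<open>LY\<close> on to \<open>LX\<close>. If its
  line meets \<open>LZ\<close> at height h > 1 and \<open>LY\<close> at a > 0, then its abscissa d
  on \<open>LX\<close> satisfies d (h + a) = a (h - 1), hence d \<le> a.\<close>

lemma A_le:
  assumes k: "k \<le> N" and "a \<in> S (LA k)" "a \<in> S LY" "d \<in> S (LA k)" "d \<in> S LX" "0 \<le> fst d"
  shows "fst d \<le> fst a"
proof -
  obtain a' where a': "a' \<in> S (LA k)" "a' \<in> S LY" "0 < fst a'" by (rule A_Y_ex[OF k])
  then have ap: "0 < fst a" using A_Y_unique[OF k assms(2,3) a'(1,2)] by simp
  obtain \<alpha> where al: "\<alpha> \<in> S (LA k)" "\<alpha> \<in> S LZ" by (rule A_Z_ex[OF k])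
  define h where "h = snd \<alpha>"
  have h: "1 < h" using A_Z(2)[OF k al] by (simp add: h_def)
  have "(fst d - 0) * (0 - h) = ((fst d + 1) - h) * (fst a - 0)"
    using det0[of "LA k" \<alpha> d a] assms al Z0[OF al(2)] X0[OF assms(5)] Y0[OF assms(3)] by (simp add: h_def)
  then have eq: "fst d * (h + fst a) = fst a * (h - 1)" by (simp add: algebra_simps)
  also have "\<dots> \<le> fst a * (h + fst a)" using ap by (intro mult_left_mono) auto
  finally show ?thesis using h ap by (simp add: mult_le_cancel_right)
qed

text \<open>The crossing of \<open>LD k\<close> with the lower part of \<open>LZ\<close> is a
  barrier for \<open>LB\<close> and \<open>LC\<close> of the preceding index, which have to pass
  below it; see \<open>C_facts\<close> and \<open>B_facts\<close>.\<close>

lemma D_guard: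
  assumes k: "k \<le> N"
  obtains g where "g \<in> S (LD k)" "g \<in> S LZ" "snd zb \<le> snd g" "snd g < 0"
proof -
  note lp = label_pts[OF k] frame_pts
  let ?at = "pt (LA k) 2" let ?i = "mt (LA k) (LD k)" let ?dl = "pt (LD k) 8"
  obtain a where a: "a \<in> S (LA k)" "a \<in> S LY" "0 < fst a" by (rule A_Y_ex[OF k])
  have "\<exists>z. z \<in> path_set [zt, zb] \<and> z \<in> path_set [?dl, ?i, a, yr]"
    by (rule cross_tracks[of 1 8 12 15 _ "[LZ]" _ "[LD k, LA k, LY]" zt zb ?dl yr]) (use k lp a in auto)
  then obtain z where z: "z \<in> closed_segment zt zb" "z \<in> closed_segment ?dl ?i \<or> z \<in> closed_segment ?i a \<or> z \<in> closed_segment a yr"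
    by auto
  have zZ: "z \<in> S LZ" using segD[OF z(1), of LZ] lp by auto
  have "z \<notin> closed_segment a yr" using segment_fst[of z a yr] Z0[OF zZ] a yr by auto
  moreover have "z \<notin> closed_segment ?i a"
  proof
    assume z1: "z \<in> closed_segment ?i a"
    then have zA: "z \<in> S (LA k)" using segD[of z ?i a "LA k"] k lp a by auto
    have zs: "1 < snd z" by (rule A_Z[OF k zA zZ])
    obtain w where w: "w \<in> path_set [zt, z, ?i, ?dl]" "w \<in> S LY"
      using cross_Y[of "[zt, z, ?i, ?dl]" "[LZ, LA k, LD k]" zt 1 ?dl 8] k lp zA zZ by auto
    have "w \<notin> closed_segment ?i ?dl" by (rule avoid[OF disjI1[OF far.DY[OF k]] w(2)]) (use k lp in auto)
    moreover have "w \<notin> closed_segment zt z" using segment_snd[of w zt z] zs Z_ends Y0[OF w(2)] by auto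
    ultimately have w1: "w \<in> closed_segment z ?i" using w by auto
    then have "w \<in> S (LA k)" using segD[of w z ?i "LA k"] k lp zA by auto
    then have "w = a" using A_Y_unique[OF k _ w(2) a(1,2)] by blast
    with w1 have "a \<in> closed_segment z ?i" by simp
    \<comment> \<open>Now \<open>a\<close> is between \<open>z\<close> and \<open>?i\<close>, while
      \<open>z\<close> is between \<open>?i\<close> and \<open>a\<close>; adding the distances gives
      \<open>z = a\<close>.\<close>
    then have "dist z ?i = dist z a + dist a ?i" by (simp add: between_mem_segment[symmetric] between)
    moreover have "dist ?i a = dist ?i z + dist z a" using z1 by (simp add: between_mem_segment[symmetric] between)
    ultimately have "dist z a = 0" by (simp add: dist_commute)
    then show False using zs Y0[OF a(2)] by simp
  qed
  ultimately have "z \<in> closed_segment ?dl ?i" using z by blast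
  then have zD: "z \<in> S (LD k)" using segD[of z ?dl ?i "LD k"] k lp by auto
  have "snd zb \<le> snd z" using segment_snd[OF z(1)] Z_ends by (auto simp: min_def split: if_splits)
  with that[OF zD zZ] D_Z[OF k zD zZ] show thesis by blast
qed

end

lemma disjE3: "P \<or> Q \<or> R \<Longrightarrow> (P \<Longrightarrow> T) \<Longrightarrow> (Q \<Longrightarrow> T) \<Longrightarrow> (R \<Longrightarrow> T) \<Longrightarrow> T" by blast

context normal_config begin

text \<open>\<open>LT k\<close>, \<open>LC k\<close> and \<open>LU k\<close> are a chord from piece
  5 to piece 9, which separates piece 8 from piece 12. The barrier of \<open>LD (Suc k)\<close>
  forces \<open>LC k\<close> to cross \<open>LZ\<close> below (0, 0). The crossings with
  \<open>LY\<close> and \<open>LX\<close> are then found on the part of \<open>LC k\<close> between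
  \<open>LT k\<close> and this point.\<close>

lemma C_facts:
  assumes kN: "k < N"
  obtains z y c where "z \<in> S (LC k)" "z \<in> S LZ" "snd z < 0" "y \<in> S (LC k)" "y \<in> S LY" "0 < fst y" "fst y \<le> fst yr"
    "c \<in> S (LC k)" "c \<in> S LX" "0 \<le> fst c"
proof -
  have k: "k \<le> N" and k': "Suc k \<le> N" using kN by auto
  note lp = label_pts[OF k] label_pts[OF k'] frame_pts
  let ?tl = "pt (LT k) 5" let ?j1 = "mt (LT k) (LC k)" let ?j2 = "mt (LC k) (LU k)" let ?ul = "pt (LU k) 9"
  let ?dl = "pt (LD (Suc k)) 8"
  obtain g where g: "g \<in> S (LD (Suc k))" "g \<in> S LZ" "snd zb \<le> snd g" "snd g < 0" by (rule D_guard[OF k'])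
  have "\<exists>z. z \<in> path_set [?tl, ?j1, ?j2, ?ul] \<and> z \<in> path_set [?dl, g, zb]"
    by (rule cross_tracks[of 5 8 9 12 _ "[LT k, LC k, LU k]" _ "[LD (Suc k), LZ]" ?tl ?ul ?dl zb]) (use k k' lp g in auto)
  then obtain z where z: "z \<in> closed_segment ?dl g \<or> z \<in> closed_segment g zb"
    "z \<in> closed_segment ?tl ?j1 \<or> z \<in> closed_segment ?j1 ?j2 \<or> z \<in> closed_segment ?j2 ?ul" by auto
  have zT: "z \<in> S (LT k) \<or> z \<in> S (LC k) \<or> z \<in> S (LU k)"
    using segD[of z ?tl ?j1 "LT k"] segD[of z ?j1 ?j2 "LC k"] segD[of z ?j2 ?ul "LU k"] z(2) k lp by auto
  have "z \<notin> closed_segment ?dl g"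
    using zT avoid[OF disjI2[OF far.TD'[OF kN]], of z ?dl g] avoid[OF disjI2[OF far.CD'[OF kN]], of z ?dl g]
      avoid[OF disjI2[OF far.UD'[OF kN]], of z ?dl g] k' lp g by auto
  then have z1: "z \<in> closed_segment g zb" using z by blast
  have zZ: "z \<in> S LZ" using segD[OF z1, of LZ] g lp by auto
  have zg: "snd z \<le> snd g" using segment_snd[OF z1] g by auto
  have "z \<notin> S (LT k)" using T_Z(1)[OF k _ zZ] zg g by auto
  moreover have "z \<notin> S (LU k)" using farD[OF far.UZ[OF k], of z] zZ by blast
  ultimately have zC: "z \<in> S (LC k)" using zT by blast
  have "z \<noteq> g" using farD[OF far.CD'[OF kN], of z] zC g by auto
  then have zg': "snd z < snd g" using zg Z0[OF zZ] Z0[OF g(2)] by (auto simp: prod_eq_iff)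
  have zneg: "snd z < 0" using zg g by simp
  have zbz: "snd zb \<le> snd z" using segment_snd[OF z1] g by auto
  have CZ: "snd w < snd g" if "w \<in> S (LC k)" "w \<in> S LZ" for w
  proof (rule ccontr)
    assume "\<not> snd w < snd g"
    then have "g \<in> closed_segment z w" using that zg' zZ g by (intro ZI) auto
    moreover have "g \<notin> closed_segment z w"
      by (rule avoid[OF disjI1[OF far.CD'[OF kN]]]) (use that zC g k in auto)
    ultimately show False by blast
  qed
  have path: "track [?tl, ?j1, z, zb] [LT k, LC k, LZ]" using k lp zC zZ by auto
  have "\<exists>w. w \<in> path_set [?tl, ?j1, z, zb] \<and> w \<in> path_set [yl, yr]"
    by (rule cross_tracks[of 5 7 12 15 _ "[LT k, LC k, LZ]" _ "[LY]" ?tl zb yl yr]) (use path lp in auto)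
  then obtain y where y: "y \<in> closed_segment yl yr" "y \<in> closed_segment ?tl ?j1 \<or> y \<in> closed_segment ?j1 z \<or> y \<in> closed_segment z zb"
    by auto
  have yY: "y \<in> S LY" using segD[OF y(1), of LY] lp by auto
  have "y \<notin> closed_segment ?tl ?j1" by (rule avoid[OF disjI1[OF far.TY[OF k]] yY]) (use k lp in auto)
  moreover have "y \<notin> closed_segment z zb" using segment_snd[of y z zb] Y0[OF yY] zneg zbz by auto
  ultimately have y1: "y \<in> closed_segment ?j1 z" using y by blast
  then have yC: "y \<in> S (LC k)" using segD[of y ?j1 z "LC k"] k lp zC by auto
  have "\<exists>w. w \<in> path_set [xr, xl] \<and> w \<in> path_set [?tl, ?j1, z, zb]"
    by (rule cross_tracks[of 0 5 11 12 _ "[LX]" _ "[LT k, LC k, LZ]" xr xl ?tl zb]) (use path lp in auto)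
  then obtain c where c: "c \<in> closed_segment xr xl" "c \<in> closed_segment ?tl ?j1 \<or> c \<in> closed_segment ?j1 z \<or> c \<in> closed_segment z zb"
    by auto
  have cX: "c \<in> S LX" using segD[OF c(1), of LX] lp by auto
  have "c \<notin> closed_segment ?tl ?j1" by (rule avoid[OF disjI1[OF far.TX[OF k]] cX]) (use k lp in auto)
  moreover have "c \<notin> closed_segment z zb"
  proof
    assume c: "c \<in> closed_segment z zb"
    have "c \<in> S LZ" using segD[OF c, of LZ] zZ lp by auto
    then show False using XZ[OF cX] segment_snd[OF c] zneg zbz by auto
  qed
  ultimately have c1: "c \<in> closed_segment ?j1 z" using c by blast
  then have cC: "c \<in> S (LC k)" using segD[of c ?j1 z "LC k"] k lp zC by auto
  have Yun: "w = y" if "w \<in> S (LC k)" "w \<in> S LY" for w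
  proof -
    have "(fst w - fst y) * snd z = 0" using det0[of "LC k" y w z] that yC zC k Y0[of w] Y0[OF yY] by auto
    then show ?thesis using zneg Y0[of w] Y0[OF yY] that by (simp add: prod_eq_iff)
  qed
  \<comment> \<open>If \<open>LC k\<close> crossed \<open>LY\<close> on the left of (0, 0), two
    paths would have to meet: one along \<open>LY\<close> from piece 7 to \<open>y\<close>, then
    along \<open>LC k\<close> and \<open>LZ\<close> to piece 12, the other from piece 8 through the
    barrier \<open>g\<close> and (0, 0) along \<open>LY\<close> to piece 15. Their parts turn out to
    be disjoint.\<close>
  have "0 \<le> fst y"
  proof (rule ccontr)
    assume neg: "\<not> 0 \<le> fst y"
    have tr1: "track [yl, y, z, zb] [LY, LC k, LZ]" using k lp zC zZ yY yC by auto
    have tr2: "track [?dl, g, (0,0), yr] [LD (Suc k), LZ, LY]" using k' lp g Q0 by auto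
    \<comment> \<open>A ring piece is convex, so if it met \<open>LY\<close> on both sides of (0, 0)
      it would contain this point, which lies on \<open>LZ\<close>; but \<open>LZ\<close> is
      attached neither to piece 7 nor to piece 15.\<close>
    have YPside: "\<not> (min (fst p) (fst q) \<le> 0 \<and> 0 \<le> max (fst p) (fst q))"
      if "p \<in> S LY" "q \<in> S LY" "p \<in> S (LP i)" "q \<in> S (LP i)" "i = 7 \<or> i = 15" for p q i
    proof
      assume *: "min (fst p) (fst q) \<le> 0 \<and> 0 \<le> max (fst p) (fst q)"
      have "(0,0) \<in> closed_segment p q"
        using horizontal_segmentI[of "fst p" "fst q" 0 0] * Y0[of p] Y0[of q] that by (metis prod.collapse)
      then have "(0,0) \<in> S (LP i)" using subD[of "(0,0)" p q "LP i"] that by auto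
      then show False using farD[OF far.inner_P[of N LZ i], of "(0,0)"] Q0 that by auto
    qed
    have a1: "path_set [yl, y, z, zb] \<inter> S (LP 15) = {}"
    proof -
      have "w \<notin> S (LP 15)" if "w \<in> closed_segment yl y" for w
      proof
        assume "w \<in> S (LP 15)"
        moreover have "w \<in> S LY" "fst w < 0" using segD[OF that, of LY] lp yY segment_fst[OF that] yl neg by auto
        ultimately show False using YPside[of w yr 15] lp yr by auto
      qed
      moreover have "path_set [y, z, zb] \<inter> S (LP 15) = {}"
        by (rule track_avoid[of _ "[LC k, LZ]"]) (use k lp zC zZ yC in auto)
      ultimately show ?thesis by auto
    qed
    have a2: "path_set [?dl, g, (0,0), yr] \<inter> S (LP 7) = {}"
    proof -
      have "w \<notin> S (LP 7)" if "w \<in> closed_segment (0,0) yr" for w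
      proof
        assume "w \<in> S (LP 7)"
        moreover have "w \<in> S LY" "0 \<le> fst w" using segD[OF that, of LY] lp Q0 segment_fst[OF that] yr by auto
        ultimately show False using YPside[of w yl 7] lp yl by auto
      qed
      moreover have "path_set [?dl, g, (0,0)] \<inter> S (LP 7) = {}"
        by (rule track_avoid[of _ "[LD (Suc k), LZ]"]) (use k' lp g Q0 in auto)
      ultimately show ?thesis by auto
    qed
    have a3: "path_set [?dl, g, (0,0), yr] \<inter> S (LP 12) = {}"
    proof -
      have "w \<notin> S (LP 12)" if "w \<in> closed_segment g (0,0)" for w
      proof
        assume w: "w \<in> S (LP 12)"
        moreover have wZ: "w \<in> S LZ" and "snd g \<le> snd w" using segD[OF that, of LZ] g Q0 segment_snd[OF that] by auto
        then have "g \<in> closed_segment zb w" using g lp by (intro ZI) auto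
        then have "g \<in> S (LP 12)" using subD[of g zb w "LP 12"] w lp by auto
        then show False using farD[OF far.inner_P[of N "LD (Suc k)" 12], of g] g k' by auto
      qed
      moreover have "path_set [?dl, g] \<inter> S (LP 12) = {}"
        by (rule track_avoid[of _ "[LD (Suc k)]"]) (use k' lp g Q0 in auto)
      moreover have "path_set [(0,0), yr] \<inter> S (LP 12) = {}"
        by (rule track_avoid[of _ "[LY]"]) (use lp Q0 in auto)
      ultimately show ?thesis by auto
    qed
    have a4: "path_set [yl, y, z, zb] \<inter> S (LP 8) = {}" by (rule track_avoid[OF tr1]) auto
    have "\<exists>w. w \<in> path_set [yl, y, z, zb] \<and> w \<in> path_set [?dl, g, (0,0), yr]"
      by (rule cross_tracks'[of 7 8 12 15, OF _ _ _ _ tr1 tr2 _ _ _ _ a4 a1 _ _ _ _ a2 a3, of yl zb ?dl yr]) (use lp in auto)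
    then obtain w where w: "w \<in> closed_segment yl y \<or> w \<in> closed_segment y z \<or> w \<in> closed_segment z zb"
      "w \<in> closed_segment ?dl g \<or> w \<in> closed_segment g (0,0) \<or> w \<in> closed_segment (0,0) yr" by auto
    have wY: "w \<in> S LY \<and> fst w < 0" if "w \<in> closed_segment yl y"
      using segD[OF that, of LY] lp yY segment_fst[OF that] yl neg by auto
    have wC: "w \<in> S (LC k)" if "w \<in> closed_segment y z" using segD[OF that, of "LC k"] yC zC k by auto
    have wz: "w \<in> S LZ \<and> snd w \<le> snd z" if "w \<in> closed_segment z zb"
      using segD[OF that, of LZ] segment_snd[OF that] zbz zZ lp by auto
    have vD: "w \<in> S (LD (Suc k))" if "w \<in> closed_segment ?dl g" using segD[OF that, of "LD (Suc k)"] g k' lp by auto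
    have vZ: "w \<in> S LZ \<and> snd g \<le> snd w" if "w \<in> closed_segment g (0,0)"
      using segD[OF that, of LZ] segment_snd[OF that] g Q0 by auto
    have vY: "w \<in> S LY \<and> 0 \<le> fst w" if "w \<in> closed_segment (0,0) yr"
      using segD[OF that, of LY] segment_fst[OF that] yr lp Q0 by auto
    show False
    proof (cases "w \<in> closed_segment ?dl g")
      case True
      then have wD: "w \<in> S (LD (Suc k))" by (rule vD)
      have "w \<notin> S LY" "w \<notin> S (LC k)" using farD[OF far.DY[OF k'], of w] farD[OF far.CD'[OF kN], of w] wD by auto
      then have "w \<in> closed_segment z zb" using w(1) wY wC by blast
      then have wZ: "w \<in> S LZ" "snd w \<le> snd z" using wz by auto
      then have "z \<in> closed_segment w g" using zg' zZ g by (intro ZI) auto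
      moreover have "z \<notin> closed_segment w g"
        by (rule avoid[OF disjI2[OF far.CD'[OF kN]] zC]) (use wD g k' in auto)
      ultimately show False by blast
    next
      case False
      then consider "w \<in> S LZ" "snd g \<le> snd w" | "w \<in> S LY" "0 \<le> fst w" using w(2) vZ vY by blast
      then show False
      proof cases
        case 1
        show False
        proof (rule disjE3[OF w(1)])
          assume "w \<in> closed_segment yl y" then show False using wY Z0[OF 1(1)] by auto
        next
          assume "w \<in> closed_segment y z" then show False using CZ[OF wC 1(1)] 1(2) by auto
        next
          assume "w \<in> closed_segment z zb" then show False using wz 1(2) zg' by auto
        qed
      next
        case 2
        show False
        proof (rule disjE3[OF w(1)])
          assume "w \<in> closed_segment yl y" then show False using wY 2(2) by auto
        next
          assume "w \<in> closed_segment y z" then show False using Yun[OF wC 2(1)] 2(2) neg by auto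
        next
          assume "w \<in> closed_segment z zb" then show False using wz Y0[OF 2(1)] zneg by auto
        qed
      qed
    qed
  qed
  moreover have "fst y \<noteq> 0"
  proof
    assume "fst y = 0"
    then have "y = (0,0)" using Y0[OF yY] by (simp add: prod_eq_iff)
    then show False using CZ[OF yC] Q0 g by auto
  qed
  ultimately have ypos: "0 < fst y" by simp
  have yle: "fst y \<le> fst yr" using segment_fst[OF y(1)] yl ypos by (auto simp: max_def split: if_splits)
  have "0 \<le> fst c"
  proof -
    have zx: "fst z = 0" by (rule Z0[OF zZ])
    have "0 < fst ?j1" using segment_fst[OF y1] ypos zx by (auto simp: max_def split: if_splits)
    then show ?thesis using segment_fst[OF c1] zx by auto
  qed
  with that[OF zC zZ zneg yC yY ypos yle cC cX] show thesis .
qed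

lemma C_Y_unique:
  assumes "k < N" "a \<in> S (LC k)" "a \<in> S LY" "b \<in> S (LC k)" "b \<in> S LY"
  shows "a = b"
proof -
  obtain z where z: "z \<in> S (LC k)" "z \<in> S LZ" "snd z < 0" using C_facts[OF assms(1)] by blast
  have "(fst b - fst a) * snd z = 0" using det0[of "LC k" a b z] assms z Y0[of a] Y0[of b] by auto
  then show ?thesis using z Y0[of a] Y0[of b] assms by (simp add: prod_eq_iff)
qed

lemma C_X_unique:
  assumes "k < N" "a \<in> S (LC k)" "a \<in> S LX" "b \<in> S (LC k)" "b \<in> S LX"
  shows "a = b"
proof -
  obtain z where z: "z \<in> S (LC k)" "z \<in> S LZ" "snd z < 0" using C_facts[OF assms(1)] by blast
  have "(fst b - fst a) * (snd z - snd a) = (fst b - fst a) * (fst z - fst a)"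
    using det0[of "LC k" a b z] assms z X0[of a] X0[of b] by auto
  then have "fst b = fst a \<or> snd z - snd a = fst z - fst a" by auto
  then show ?thesis using z X0[of a] X0[of b] Z0[OF z(2)] assms by (auto simp: prod_eq_iff)
qed

lemma C_Z_unique:
  assumes "k < N" "a \<in> S (LC k)" "a \<in> S LZ" "b \<in> S (LC k)" "b \<in> S LZ"
  shows "a = b"
proof -
  obtain y where y: "y \<in> S (LC k)" "y \<in> S LY" "0 < fst y" using C_facts[OF assms(1)] by blast
  have "0 = (snd b - snd a) * fst y" using det0[of "LC k" a b y] assms y Z0[of a] Z0[of b] by auto
  then show ?thesis using y Z0[of a] Z0[of b] assms by (simp add: prod_eq_iff)
qed

text \<open>Menelaus' theorem for the frame triangle and the line of \<open>LC k\<close>, before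
  division.\<close>

lemma C_relation:
  assumes "k < N" "z \<in> S (LC k)" "z \<in> S LZ" "y \<in> S (LC k)" "y \<in> S LY" "c \<in> S (LC k)" "c \<in> S LX"
  shows "fst y * (1 + fst c - snd z) = fst c * (- snd z)"
  using det0[of "LC k" z y c] assms Z0[of z] Y0[of y] X0[of c] by (simp add: algebra_simps)

text \<open>From piece 7 along \<open>LY\<close> to the corner (-1, 0), along \<open>LX\<close> to
  \<open>LA k\<close> and along \<open>LA k\<close> to piece 2 runs a barrier between pieces 5 and
  9. The chord through \<open>LC k\<close> crosses it; nonadjacencies and the known position of
  \<open>LC k\<close> and \<open>LU k\<close> leave only \<open>LC k\<close> crossing the part on
  \<open>LX\<close>.\<close>

lemma C_le_A:
  assumes kN: "k < N" and c: "c \<in> S (LC k)" "c \<in> S LX" and d: "d \<in> S (LA k)" "d \<in> S LX" "0 \<le> fst d"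
  shows "fst c \<le> fst d"
proof -
  have k: "k \<le> N" using kN by auto
  note lp = label_pts[OF k] frame_pts
  let ?tl = "pt (LT k) 5" let ?j1 = "mt (LT k) (LC k)" let ?j2 = "mt (LC k) (LU k)" let ?ul = "pt (LU k) 9" let ?at = "pt (LA k) 2"
  have "\<exists>w. w \<in> path_set [yl, (-1,0), d, ?at] \<and> w \<in> path_set [?tl, ?j1, ?j2, ?ul]"
    by (rule cross_tracks[of 2 5 7 9 _ "[LY, LX, LA k]" _ "[LT k, LC k, LU k]" ?at yl ?tl ?ul]) (use k lp d P0 in auto)
  then obtain w where w: "w \<in> closed_segment yl (-1,0) \<or> w \<in> closed_segment (-1,0) d \<or> w \<in> closed_segment d ?at"
    "w \<in> closed_segment ?tl ?j1 \<or> w \<in> closed_segment ?j1 ?j2 \<or> w \<in> closed_segment ?j2 ?ul" by auto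
  have wT: "w \<in> S (LT k) \<or> w \<in> S (LC k) \<or> w \<in> S (LU k)"
    using segD[of w ?tl ?j1 "LT k"] segD[of w ?j1 ?j2 "LC k"] segD[of w ?j2 ?ul "LU k"] w(2) k lp by auto
  have 1: "w \<in> S LY" "fst w \<le> -1" if "w \<in> closed_segment yl (-1,0)"
    using segD[OF that, of LY] segment_fst[OF that] yl lp P0 by auto
  have 2: "w \<in> S LX" "-1 \<le> fst w" "fst w \<le> fst d" if "w \<in> closed_segment (-1,0) d"
    using segD[OF that, of LX] segment_fst[OF that] d P0 by auto
  have 3: "w \<in> S (LA k)" if "w \<in> closed_segment d ?at" using segD[OF that, of "LA k"] d lp k by auto
  have "w \<in> closed_segment (-1,0) d \<and> w \<in> S (LC k)"
  proof (intro conjI)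
    have nT: "w \<notin> S (LT k)" using w(1) 1(1) 2(1) 3 farD[OF far.TY[OF k]] farD[OF far.TX[OF k]] farD[OF far.TA[OF k]] by blast
    have nU: "w \<notin> S (LU k)"
    proof
      assume wU: "w \<in> S (LU k)"
      from w(1) show False
      proof (rule disjE3)
        assume "w \<in> closed_segment yl (-1,0)" then show False using 1(1) farD[OF far.UY[OF k] wU] by blast
      next
        assume a: "w \<in> closed_segment (-1,0) d" show False using 2(1,2)[OF a] U_X[OF k wU] by simp
      next
        assume "w \<in> closed_segment d ?at" then show False using 3 farD[OF far.UA[OF k] wU] by blast
      qed
    qed
    show wC: "w \<in> S (LC k)" using wT nT nU by blast
    obtain y where y: "y \<in> S (LC k)" "y \<in> S LY" "0 < fst y" using C_facts[OF kN] by blast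
    have "w \<notin> closed_segment yl (-1,0)"
    proof
      assume a: "w \<in> closed_segment yl (-1,0)"
      show False using 1[OF a] C_Y_unique[OF kN y(1,2) wC] y(3) by simp
    qed
    moreover have "w \<notin> closed_segment d ?at" using 3 farD[OF far.CA[OF k] wC] by blast
    ultimately show "w \<in> closed_segment (-1,0) d" using w by blast
  qed
  then show ?thesis using 2 C_X_unique[OF kN c, of w] by auto
qed

text \<open>\<open>LE k\<close> and \<open>LB k\<close> are a chord from piece 6 to piece 10. It
  separates piece 8 from pieces 12 and 15, and piece 7 from piece 11; this gives the crossings with
  \<open>LZ\<close>, \<open>LY\<close> and \<open>LX\<close>. As for \<open>LC k\<close>, the
  barrier of \<open>LD (Suc k)\<close> decides on which side they lie.\<close>

lemma B_facts:
  assumes kN: "k < N"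
  obtains e t x where "e \<in> S (LB k)" "e \<in> S LZ" "snd e < 0" "t \<in> S (LB k)" "t \<in> S LY" "0 < fst t"
    "x \<in> S (LB k)" "x \<in> S LX" "fst x \<le> -1"
proof -
  have k: "k \<le> N" and k': "Suc k \<le> N" using kN by auto
  note lp = label_pts[OF k] label_pts[OF k'] frame_pts
  let ?bl = "pt (LB k) 10" let ?i = "mt (LB k) (LE k)" let ?el = "pt (LE k) 6" let ?dl = "pt (LD (Suc k)) 8"
  obtain g where g: "g \<in> S (LD (Suc k))" "g \<in> S LZ" "snd zb \<le> snd g" "snd g < 0" by (rule D_guard[OF k'])
  have tr: "track [?el, ?i, ?bl] [LE k, LB k]" using k lp by auto
  have BE: "w \<in> S (LB k) \<or> w \<in> S (LE k)" if "w \<in> path_set [?el, ?i, ?bl]" for w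
    using that segD[of w ?el ?i "LE k"] segD[of w ?i ?bl "LB k"] k lp by auto
  have noD: "w \<notin> closed_segment ?dl g" if "w \<in> path_set [?el, ?i, ?bl]" for w
    using BE[OF that] avoid[OF disjI1[OF far.DB'[OF kN]], of w ?dl g] avoid[OF disjI1[OF far.DE'[OF kN]], of w ?dl g]
      k' lp g by auto
  have "\<exists>z. z \<in> path_set [?el, ?i, ?bl] \<and> z \<in> path_set [?dl, g, zb]"
    by (rule cross_tracks[of 6 8 10 12 _ "[LE k, LB k]" _ "[LD (Suc k), LZ]" ?el ?bl ?dl zb]) (use k k' lp g in auto)
  then obtain z where z: "z \<in> path_set [?el, ?i, ?bl]" "z \<in> closed_segment g zb" using noD by auto
  have zZ: "z \<in> S LZ" using segD[OF z(2), of LZ] g lp by auto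
  have zg: "snd z \<le> snd g" using segment_snd[OF z(2)] g by auto
  have "z \<notin> S (LE k)" using E_Z[OF k _ zZ] zg g(4) by fastforce
  then have zB: "z \<in> S (LB k)" using BE[OF z(1)] by blast
  have BZ: "snd w < snd g" if "w \<in> S (LB k)" "w \<in> S LZ" for w
  proof (rule ccontr)
    assume "\<not> snd w < snd g"
    then have "g \<in> closed_segment z w" using that zg zZ g by (intro ZI) auto
    moreover have "g \<notin> closed_segment z w"
      by (rule avoid[OF disjI2[OF far.DB'[OF kN]]]) (use that zB g k in auto)
    ultimately show False by blast
  qed
  have zneg: "snd z < 0" using zg g by simp
  have "\<exists>z. z \<in> path_set [?el, ?i, ?bl] \<and> z \<in> path_set [?dl, g, (0,0), yr]"
    by (rule cross_tracks[of 6 8 10 15 _ "[LE k, LB k]" _ "[LD (Suc k), LZ, LY]" ?el ?bl ?dl yr]) (use k k' lp g Q0 in auto)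
  then obtain t where t: "t \<in> path_set [?el, ?i, ?bl]" "t \<in> closed_segment g (0,0) \<or> t \<in> closed_segment (0,0) yr" using noD by auto
  have "t \<notin> closed_segment g (0,0)"
  proof
    assume t1: "t \<in> closed_segment g (0,0)"
    then have "t \<in> S LZ" "snd g \<le> snd t" "snd t \<le> 0"
      using segD[OF t1, of LZ] segment_snd[OF t1] g Q0 by auto
    then show False using BE[OF t(1)] BZ[of t] E_Z[OF k, of t] by linarith
  qed
  then have t1: "t \<in> closed_segment (0,0) yr" using t by blast
  have tY: "t \<in> S LY" using segD[OF t1, of LY] lp Q0 by auto
  have tB: "t \<in> S (LB k)" using BE[OF t(1)] farD[OF far.EY[OF k], of t] tY by blast
  have "0 \<le> fst t" using segment_fst[OF t1] yr by auto
  moreover have "fst t \<noteq> 0"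
  proof
    assume "fst t = 0"
    then have "t = (0,0)" using Y0[OF tY] by (simp add: prod_eq_iff)
    then show False using BZ[OF tB] Q0 g by auto
  qed
  ultimately have tpos: "0 < fst t" by simp
  have Bun: "w = t" if "w \<in> S (LB k)" "w \<in> S LY" for w
  proof -
    have "(fst w - fst t) * snd z = 0" using det0[of "LB k" t w z] that tB zB k Y0[of w] Y0[OF tY] by auto
    then show ?thesis using zneg Y0[of w] Y0[OF tY] that by (simp add: prod_eq_iff)
  qed
  have "\<exists>z. z \<in> path_set [?el, ?i, ?bl] \<and> z \<in> path_set [yl, (-1,0), xl]"
    by (rule cross_tracks[of 6 7 10 11 _ "[LE k, LB k]" _ "[LY, LX]" ?el ?bl yl xl]) (use k lp P0 in auto)
  then obtain x where x: "x \<in> path_set [?el, ?i, ?bl]" "x \<in> closed_segment yl (-1,0) \<or> x \<in> closed_segment (-1,0) xl" by auto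
  have "x \<notin> closed_segment yl (-1,0)"
  proof
    assume x1: "x \<in> closed_segment yl (-1,0)"
    have "x \<in> S LY" "fst x \<le> -1" using segD[OF x1, of LY] segment_fst[OF x1] yl lp P0 by auto
    then show False using BE[OF x(1)] Bun[of x] farD[OF far.EY[OF k], of x] tpos by (cases "x = t") auto
  qed
  then have x1: "x \<in> closed_segment (-1,0) xl" using x by blast
  have xX: "x \<in> S LX" "fst x \<le> -1" using segD[OF x1, of LX] segment_fst[OF x1] xl lp P0 by auto
  have "x \<notin> S (LE k)" using E_X[OF k _ xX(1)] xX(2) by fastforce
  then have xB: "x \<in> S (LB k)" using BE[OF x(1)] by blast
  show thesis by (rule that[OF zB zZ zneg tB tY tpos xB xX])
qed

lemma B_Y_unique:
  assumes "k < N" "a \<in> S (LB k)" "a \<in> S LY" "b \<in> S (LB k)" "b \<in> S LY"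
  shows "a = b"
proof -
  obtain z where z: "z \<in> S (LB k)" "z \<in> S LZ" "snd z < 0" using B_facts[OF assms(1)] by blast
  have "(fst b - fst a) * snd z = 0" using det0[of "LB k" a b z] assms z Y0[of a] Y0[of b] by auto
  then show ?thesis using z Y0[of a] Y0[of b] assms by (simp add: prod_eq_iff)
qed

text \<open>\<open>LB k\<close> passes a bound on \<open>LY\<close> on to \<open>LZ\<close>. If its
  line meets \<open>LX\<close> at abscissa - s with s \<ge> 1, then f = - \<open>snd e\<close>
  satisfies f (s + t) = t (s - 1), where t is the abscissa on \<open>LY\<close>.\<close>

lemma B_le:
  assumes k: "k < N" and e: "e \<in> S (LB k)" "e \<in> S LZ" "snd e < 0" and t: "t \<in> S (LB k)" "t \<in> S LY"
  shows "- snd e \<le> fst t"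
proof -
  obtain t' x where x: "t' \<in> S (LB k)" "t' \<in> S LY" "0 < fst t'" "x \<in> S (LB k)" "x \<in> S LX" "fst x \<le> -1" using B_facts[OF k] by blast
  have tp: "0 < fst t" using B_Y_unique[OF k t x(1,2)] x(3) by simp
  define s f where "s = - fst x" and "f = - snd e"
  have s: "1 \<le> s" using x by (simp add: s_def)
  have "(fst t - 0) * (snd x - snd e) = (0 - snd e) * (fst x - 0)"
    using det0[of "LB k" e t x] k e t x Z0[OF e(2)] Y0[OF t(2)] by simp
  then have eq: "f * (s + fst t) = fst t * (s - 1)" using X0[OF x(5)] by (simp add: s_def f_def algebra_simps)
  also have "\<dots> \<le> fst t * (s + fst t)" using tp by (intro mult_left_mono) auto
  finally have "f \<le> fst t" using s tp by (simp add: mult_le_cancel_right)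
  then show ?thesis by (simp add: f_def)
qed

text \<open>The counterpart of \<open>C_le_A\<close>, with the barrier from piece 7 along
  \<open>LY\<close> to (0, 0), along \<open>LZ\<close> to \<open>LB k\<close> and along
  \<open>LB k\<close> to piece 10.\<close>

lemma C_le_B:
  assumes kN: "k < N" and z: "z \<in> S (LC k)" "z \<in> S LZ" and e: "e \<in> S (LB k)" "e \<in> S LZ" "snd e < 0"
  shows "snd e \<le> snd z"
proof -
  have k: "k \<le> N" using kN by auto
  note lp = label_pts[OF k] frame_pts
  let ?tl = "pt (LT k) 5" let ?j1 = "mt (LT k) (LC k)" let ?j2 = "mt (LC k) (LU k)" let ?ul = "pt (LU k) 9" let ?bl = "pt (LB k) 10"
  have "\<exists>w. w \<in> path_set [?tl, ?j1, ?j2, ?ul] \<and> w \<in> path_set [yl, (0,0), e, ?bl]"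
    by (rule cross_tracks[of 5 7 9 10 _ "[LT k, LC k, LU k]" _ "[LY, LZ, LB k]" ?tl ?ul yl ?bl]) (use k lp e Q0 in auto)
  then obtain w where w: "w \<in> closed_segment yl (0,0) \<or> w \<in> closed_segment (0,0) e \<or> w \<in> closed_segment e ?bl"
    "w \<in> closed_segment ?tl ?j1 \<or> w \<in> closed_segment ?j1 ?j2 \<or> w \<in> closed_segment ?j2 ?ul" by auto
  have wT: "w \<in> S (LT k) \<or> w \<in> S (LC k) \<or> w \<in> S (LU k)"
    using segD[of w ?tl ?j1 "LT k"] segD[of w ?j1 ?j2 "LC k"] segD[of w ?j2 ?ul "LU k"] w(2) k lp by auto
  have 1: "w \<in> S LY" "fst w \<le> 0" if "w \<in> closed_segment yl (0,0)"
    using segD[OF that, of LY] segment_fst[OF that] yl lp Q0 by auto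
  have 2: "w \<in> S LZ" "snd e \<le> snd w" "snd w \<le> 0" if "w \<in> closed_segment (0,0) e"
    using segD[OF that, of LZ] segment_snd[OF that] e Q0 by auto
  have 3: "w \<in> S (LB k)" if "w \<in> closed_segment e ?bl" using segD[OF that, of "LB k"] e lp k by auto
  have nT: "w \<notin> S (LT k)"
  proof
    assume wT: "w \<in> S (LT k)"
    from w(1) show False
    proof (rule disjE3)
      assume "w \<in> closed_segment yl (0,0)" then show False using 1(1) farD[OF far.TY[OF k] wT] by blast
    next
      assume a: "w \<in> closed_segment (0,0) e" show False using 2[OF a] T_Z(1)[OF k wT] by auto
    next
      assume "w \<in> closed_segment e ?bl" then show False using 3 farD[OF far.TB[OF k] wT] by blast
    qed
  qed
  have nU: "w \<notin> S (LU k)" using w(1) 1(1) 2(1) 3 farD[OF far.UY[OF k]] farD[OF far.UZ[OF k]] farD[OF far.UB[OF k]] by blast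
  have wC: "w \<in> S (LC k)" using wT nT nU by blast
  obtain y where y: "y \<in> S (LC k)" "y \<in> S LY" "0 < fst y" using C_facts[OF kN] by blast
  have "w \<notin> closed_segment yl (0,0)"
  proof
    assume a: "w \<in> closed_segment yl (0,0)"
    show False using 1[OF a] C_Y_unique[OF kN y(1,2) wC] y(3) by simp
  qed
  moreover have "w \<notin> closed_segment e ?bl" using 3 farD[OF far.CB[OF k] wC] by blast
  ultimately have "w \<in> closed_segment (0,0) e" using w by blast
  then show ?thesis using 2 C_Z_unique[OF kN z wC] by auto
qed

text \<open>The path along \<open>LY\<close> from piece 7 to \<open>LC k\<close> and then along
  \<open>LC k\<close> and \<open>LU k\<close> to piece 9 must cross the chord of
  \<open>LA (Suc k)\<close> and \<open>LD (Suc k)\<close>. Only \<open>LA (Suc k)\<close> may do so,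
  and only on the part in \<open>LY\<close>.\<close>

lemma next_A_le:
  assumes kN: "k < N" and y: "y \<in> S (LC k)" "y \<in> S LY" and a: "a \<in> S (LA (Suc k))" "a \<in> S LY"
  shows "fst a \<le> fst y"
proof -
  have k: "k \<le> N" and k': "Suc k \<le> N" using kN by auto
  note lp = label_pts[OF k] label_pts[OF k'] frame_pts
  let ?j2 = "mt (LC k) (LU k)" let ?ul = "pt (LU k) 9"
  let ?at = "pt (LA (Suc k)) 2" let ?i = "mt (LA (Suc k)) (LD (Suc k))" let ?dl = "pt (LD (Suc k)) 8"
  have "\<exists>w. w \<in> path_set [?at, ?i, ?dl] \<and> w \<in> path_set [yl, y, ?j2, ?ul]"
    by (rule cross_tracks[of 2 7 8 9 _ "[LA (Suc k), LD (Suc k)]" _ "[LY, LC k, LU k]" ?at ?dl yl ?ul]) (use k k' lp y in auto)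
  then obtain w where w: "w \<in> closed_segment yl y \<or> w \<in> closed_segment y ?j2 \<or> w \<in> closed_segment ?j2 ?ul"
    "w \<in> closed_segment ?at ?i \<or> w \<in> closed_segment ?i ?dl" by auto
  have wA: "w \<in> S (LA (Suc k)) \<or> w \<in> S (LD (Suc k))"
    using segD[of w ?at ?i "LA (Suc k)"] segD[of w ?i ?dl "LD (Suc k)"] w(2) k' lp by auto
  have "w \<notin> closed_segment y ?j2" "w \<notin> closed_segment ?j2 ?ul"
    using wA avoid[OF disjI1[OF far.CA'[OF kN]], of w y ?j2] avoid[OF disjI1[OF far.CD'[OF kN]], of w y ?j2]
      avoid[OF disjI1[OF far.UA'[OF kN]], of w ?j2 ?ul] avoid[OF disjI1[OF far.UD'[OF kN]], of w ?j2 ?ul] k lp y by auto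
  then have w1: "w \<in> closed_segment yl y" using w by blast
  have wY: "w \<in> S LY" using segD[OF w1, of LY] lp y by auto
  then have "w \<in> S (LA (Suc k))" using wA farD[OF far.DY[OF k'], of w] by blast
  then have wa: "w = a" using A_Y_unique[OF k' _ wY a] by blast
  obtain y' where y': "y' \<in> S (LC k)" "y' \<in> S LY" "0 < fst y'" using C_facts[OF kN] by blast
  then have "0 < fst y" using C_Y_unique[OF kN y y'(1,2)] by simp
  then show ?thesis using segment_fst[OF w1] yl wa by auto
qed

lemma next_B_le:
  assumes kN: "Suc k < N" and y: "y \<in> S (LC k)" "y \<in> S LY" and t: "t \<in> S (LB (Suc k))" "t \<in> S LY"
  shows "fst t \<le> fst y"
proof -
  have kN': "k < N" and k: "k \<le> N" and k': "Suc k \<le> N" using kN by auto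
  note lp = label_pts[OF k] label_pts[OF k'] frame_pts
  let ?j1 = "mt (LT k) (LC k)" let ?tl = "pt (LT k) 5"
  let ?bl = "pt (LB (Suc k)) 10" let ?i = "mt (LB (Suc k)) (LE (Suc k))" let ?el = "pt (LE (Suc k)) 6"
  have "\<exists>w. w \<in> path_set [yl, y, ?j1, ?tl] \<and> w \<in> path_set [?bl, ?i, ?el]"
    by (rule cross_tracks[of 5 6 7 10 _ "[LY, LC k, LT k]" _ "[LB (Suc k), LE (Suc k)]" ?tl yl ?el ?bl]) (use k k' lp y in auto)
  then obtain w where w: "w \<in> closed_segment yl y \<or> w \<in> closed_segment y ?j1 \<or> w \<in> closed_segment ?j1 ?tl"
    "w \<in> closed_segment ?bl ?i \<or> w \<in> closed_segment ?i ?el" by auto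
  have wB: "w \<in> S (LB (Suc k)) \<or> w \<in> S (LE (Suc k))"
    using segD[of w ?bl ?i "LB (Suc k)"] segD[of w ?i ?el "LE (Suc k)"] w(2) k' lp by auto
  have "w \<notin> closed_segment y ?j1" "w \<notin> closed_segment ?j1 ?tl"
    using wB avoid[OF disjI1[OF far.CB'[OF kN']], of w y ?j1] avoid[OF disjI1[OF far.CE'[OF kN']], of w y ?j1]
      avoid[OF disjI1[OF far.TB'[OF kN']], of w ?j1 ?tl] avoid[OF disjI1[OF far.TE'[OF kN']], of w ?j1 ?tl] k lp y by auto
  then have w1: "w \<in> closed_segment yl y" using w by blast
  have wY: "w \<in> S LY" using segD[OF w1, of LY] lp y by auto
  then have "w \<in> S (LB (Suc k))" using wB farD[OF far.EY[OF k'], of w] by blast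
  then have wt: "w = t" using B_Y_unique[OF kN _ wY t] by blast
  obtain y' where y': "y' \<in> S (LC k)" "y' \<in> S LY" "0 < fst y'" using C_facts[OF kN'] by blast
  then have "0 < fst y" using C_Y_unique[OF kN' y y'(1,2)] by simp
  then show ?thesis using segment_fst[OF w1] yl wt by auto
qed

text \<open>\<open>LW\<close> rises from piece 13 to \<open>LY\<close> and avoids \<open>LH\<close>
  as well as the first chord through \<open>LC 0\<close>; its crossing with \<open>LY\<close>
  therefore separates that of \<open>LC 0\<close> from that of \<open>LH\<close>.\<close>

lemma first_C_le:
  assumes N: "0 < N" and y: "y \<in> S (LC 0)" "y \<in> S LY"
  obtains p where "p \<in> S LH" "p \<in> S LY" "fst y \<le> fst p"
proof -
  note lp = label_pts[of 0] frame_pts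
  let ?tl = "pt (LT 0) 5" let ?j1 = "mt (LT 0) (LC 0)" let ?j2 = "mt (LC 0) (LU 0)" let ?ul = "pt (LU 0) 9"
  let ?w = "mt LW LY" let ?wb = "pt LW 13"
  have W: "?w \<in> S LW" "?w \<in> S LY" "?wb \<in> S LW" "?wb \<in> S (LP 13)" using mt[OF near.WY] pt[of LW 13] by auto
  obtain y' where y': "y' \<in> S (LC 0)" "y' \<in> S LY" "0 < fst y'" "fst y' \<le> fst yr" using C_facts[OF N] by blast
  then have yy: "0 < fst y" "fst y \<le> fst yr" using C_Y_unique[OF N y y'(1,2)] by auto
  have "\<exists>u. u \<in> path_set [?tl, ?j1, ?j2, ?ul] \<and> u \<in> path_set [yl, ?w, ?wb]"
    by (rule cross_tracks[of 5 7 9 13 _ "[LT 0, LC 0, LU 0]" _ "[LY, LW]" ?tl ?ul yl ?wb]) (use lp W in auto)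
  then obtain u where u: "u \<in> closed_segment yl ?w \<or> u \<in> closed_segment ?w ?wb"
    "u \<in> closed_segment ?tl ?j1 \<or> u \<in> closed_segment ?j1 ?j2 \<or> u \<in> closed_segment ?j2 ?ul" by auto
  have uT: "u \<in> S (LT 0) \<or> u \<in> S (LC 0) \<or> u \<in> S (LU 0)"
    using segD[of u ?tl ?j1 "LT 0"] segD[of u ?j1 ?j2 "LC 0"] segD[of u ?j2 ?ul "LU 0"] u(2) lp by auto
  have "u \<notin> closed_segment ?w ?wb"
    using uT avoid[OF disjI1[OF far.WT], of u ?w ?wb] avoid[OF disjI1[OF far.WC], of u ?w ?wb]
      avoid[OF disjI1[OF far.WU], of u ?w ?wb] W by auto
  then have u1: "u \<in> closed_segment yl ?w" using u by blast
  have uY: "u \<in> S LY" using segD[OF u1, of LY] lp W by auto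
  then have "u \<in> S (LC 0)" using uT farD[OF far.TY[of 0], of u] farD[OF far.UY[of 0], of u] by auto
  then have "u = y" using C_Y_unique[OF N _ uY y] by blast
  then have yw: "fst y \<le> fst ?w" using segment_fst[OF u1] yl yy by auto
  have H: "pt LH 3 \<in> S LH" "pt LH 3 \<in> S (LP 3)" "pt LH 14 \<in> S LH" "pt LH 14 \<in> S (LP 14)" using pt[of LH] by auto
  have "\<exists>u. u \<in> path_set [pt LH 3, pt LH 14] \<and> u \<in> path_set [?wb, ?w, yr]"
    by (rule cross_tracks[of 3 13 14 15 _ "[LH]" _ "[LW, LY]" "pt LH 3" "pt LH 14" ?wb yr]) (use lp W H in auto)
  then obtain p where p: "p \<in> closed_segment (pt LH 3) (pt LH 14)" "p \<in> closed_segment ?wb ?w \<or> p \<in> closed_segment ?w yr" by auto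
  have pH: "p \<in> S LH" using segD[OF p(1), of LH] H by auto
  have "p \<notin> closed_segment ?wb ?w" by (rule avoid[OF disjI1[OF far.WH] pH]) (use W in auto)
  then have p1: "p \<in> closed_segment ?w yr" using p by blast
  have "p \<in> S LY" using segD[OF p1, of LY] lp W by auto
  moreover have "fst y \<le> fst p" using segment_fst[OF p1] yw yy by auto
  ultimately show thesis using that[OF pH] by blast
qed

text \<open>Let u and f be the coordinates of \<open>LC (Suc k)\<close> on \<open>LX\<close> and
  \<open>LZ\<close>. Then u is at most the coordinate of \<open>LA (Suc k)\<close> on
  \<open>LX\<close>, this at most that on \<open>LY\<close>, and this at most \<open>y k\<close>;
  \<open>LB (Suc k)\<close> bounds f in the same way. Menelaus' theorem multiplies the two
  bounds.\<close>

lemma doubly_exponential: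
  assumes "0 < N"
  obtains y p where "\<And>k. k < N \<Longrightarrow> (y k, 0) \<in> S (LC k) \<and> (y k, 0) \<in> S LY \<and> 0 < y k"
    "(p, 0) \<in> S LH" "(p, 0) \<in> S LY" "y 0 \<le> p"
    "\<And>k. Suc k < N \<Longrightarrow> y (Suc k) / (1 + y (Suc k)) \<le> (y k / (1 + y k))\<^sup>2"
proof -
  have "\<exists>y. \<forall>k<N. (y k, 0) \<in> S (LC k) \<and> (y k, 0) \<in> S LY \<and> 0 < y k"
  proof -
    have "\<exists>v. (v, 0) \<in> S (LC k) \<and> (v, 0) \<in> S LY \<and> 0 < v" if kN: "k < N" for k
    proof -
      obtain y where "y \<in> S (LC k)" "y \<in> S LY" "0 < fst y" using C_facts[OF kN] by blast
      then show ?thesis using Y0[of y] by (intro exI[of _ "fst y"]) (metis prod.collapse)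
    qed
    then show ?thesis by metis
  qed
  then obtain y where y: "\<And>k. k < N \<Longrightarrow> (y k, 0) \<in> S (LC k) \<and> (y k, 0) \<in> S LY \<and> 0 < y k" by blast
  obtain q where q: "q \<in> S LH" "q \<in> S LY" "fst (y 0, 0::real) \<le> fst q"
    by (rule first_C_le[OF assms, of "(y 0, 0)"]) (use y assms in auto)
  have q': "(fst q, 0) = q" using Y0[OF q(2)] by (simp add: prod_eq_iff)
  have "y (Suc k) / (1 + y (Suc k)) \<le> (y k / (1 + y k))\<^sup>2" if k: "Suc k < N" for k
  proof -
    have kN: "k < N" and k': "Suc k \<le> N" using k by auto
    obtain z c where C: "z \<in> S (LC (Suc k))" "z \<in> S LZ" "snd z < 0" "c \<in> S (LC (Suc k))" "c \<in> S LX" "0 \<le> fst c"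
      using C_facts[OF k] by blast
    obtain a where a: "a \<in> S (LA (Suc k))" "a \<in> S LY" "0 < fst a" by (rule A_Y_ex[OF k'])
    obtain d where d: "d \<in> S (LA (Suc k))" "d \<in> S LX" "0 \<le> fst d" by (rule A_X_ex[OF k'])
    obtain e t where B: "e \<in> S (LB (Suc k))" "e \<in> S LZ" "snd e < 0" "t \<in> S (LB (Suc k))" "t \<in> S LY" using B_facts[OF k] by blast
    define u f v where "u = fst c" and "f = - snd z" and "v = y (Suc k)"
    have yk: "(y k, 0) \<in> S (LC k)" "(y k, 0) \<in> S LY" "0 < y k" using y[OF kN] by auto
    have "fst c \<le> fst d" by (rule C_le_A[OF k C(4,5) d])
    also have "\<dots> \<le> fst a" by (rule A_le[OF k' a(1,2) d])
    also have "\<dots> \<le> fst (y k, 0::real)" by (rule next_A_le[OF kN yk(1,2) a(1,2)])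
    finally have uy: "0 \<le> u" "u \<le> y k" using C by (auto simp: u_def)
    have "f \<le> - snd e" using C_le_B[OF k C(1,2) B(1-3)] by (simp add: f_def)
    also have "\<dots> \<le> fst t" by (rule B_le[OF k B])
    also have "\<dots> \<le> fst (y k, 0::real)" by (rule next_B_le[OF k yk(1,2) B(4,5)])
    finally have fy: "0 \<le> f" "f \<le> y k" using C by (auto simp: f_def)
    have "v * (1 + u + f) = u * f"
      using C_relation[OF k C(1,2), of "(v, 0)" c] y[OF k] C by (simp add: v_def u_def f_def)
    moreover have v: "0 < v" using y[OF k] by (simp add: v_def)
    ultimately have "v * ((1 + u) * (1 + f)) = (u * f) * (1 + v)" by (simp add: algebra_simps)
    then have "v / (1 + v) = (u * f) / ((1 + u) * (1 + f))" using v uy fy by (subst frac_eq_eq) auto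
    also have "\<dots> = (u / (1 + u)) * (f / (1 + f))" by simp
    also have "\<dots> \<le> (y k / (1 + y k)) * (y k / (1 + y k))"
      using uy fy yk(3) by (intro mult_mono) (auto simp: field_simps)
    finally show ?thesis by (simp add: v_def power2_eq_square)
  qed
  with y q q' that[of y "fst q"] show thesis by auto
qed

end

section \<open>Affine normalization of the frame\<close>

lemma segment_coordinate:
  fixes a b :: "real \<times> real"
  shows "\<exists>\<phi> :: real \<times> real \<Rightarrow> real. \<forall>w\<in>closed_segment a b. \<forall>z\<in>closed_segment a b. \<forall>z'\<in>closed_segment a b.
      w \<in> closed_segment z z' \<longleftrightarrow> min (\<phi> z) (\<phi> z') \<le> \<phi> w \<and> \<phi> w \<le> max (\<phi> z) (\<phi> z')"
proof (cases "a = b")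
  case True
  then show ?thesis by (intro exI[of _ "\<lambda>_. 0"]) auto
next
  case False
  define g where "g s = a + s *\<^sub>R (b - a)" for s
  define \<phi> where "\<phi> z = ((z - a) \<bullet> (b - a)) / ((b - a) \<bullet> (b - a))" for z
  have \<phi>g: "\<phi> (g s) = s" for s using False by (simp add: \<phi>_def g_def)
  have ex: "\<exists>s. z = g s" if "z \<in> closed_segment a b" for z
    using that by (auto simp: in_segment g_def algebra_simps)
  have gm: "g u \<in> closed_segment (g s) (g t) \<longleftrightarrow> u \<in> closed_segment s t" for s t u
  proof -
    have eq: "(1 - v) *\<^sub>R g s + v *\<^sub>R g t = g ((1 - v) * s + v * t)" for v
      by (simp add: g_def algebra_simps)
    have inj: "g x = g y \<longleftrightarrow> x = y" for x y using \<phi>g by metis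
    show ?thesis by (simp add: in_segment eq inj)
  qed
  show ?thesis
  proof (intro exI[of _ \<phi>] ballI)
    fix w z z' assume *: "w \<in> closed_segment a b" "z \<in> closed_segment a b" "z' \<in> closed_segment a b"
    obtain u s t where e: "w = g u" "z = g s" "z' = g t" using ex[OF *(1)] ex[OF *(2)] ex[OF *(3)] by blast
    show "w \<in> closed_segment z z' \<longleftrightarrow> min (\<phi> z) (\<phi> z') \<le> \<phi> w \<and> \<phi> w \<le> max (\<phi> z) (\<phi> z')"
      unfolding e gm \<phi>g by (auto simp: closed_segment_eq_real_ivl min_def max_def split: if_splits)
  qed
qed

text \<open>Positions on \<open>LZ\<close>: t and b are its attachment points, j the crossing with
  \<open>LJ\<close>, x and x' are points on \<open>LX\<close>, y and y' on \<open>LY\<close>, w is a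
  point common to all three segments. The negated hypotheses say that \<open>LX\<close> avoids t and
  j, and \<open>LY\<close> avoids b and j.\<close>

lemma betweenness_clash:
  fixes t b j x y x' y' w :: real
  assumes "min t j \<le> x" "x \<le> max t j" "min b j \<le> y" "y \<le> max b j"
    "min t b \<le> x'" "x' \<le> max t b" "min t b \<le> y'" "y' \<le> max t b"
    "\<not> (min x x' \<le> t \<and> t \<le> max x x')" "\<not> (min y y' \<le> b \<and> b \<le> max y y')"
    "\<not> (min x w \<le> j \<and> j \<le> max x w)" "\<not> (min y w \<le> j \<and> j \<le> max y w)"
  shows False
  using assms unfolding min_le_iff_disj le_max_iff_disj by argo

context config begin

text \<open>The argument of \<open>Z_ends\<close> before a frame is available. \<open>LX\<close> and
  \<open>LY\<close> meet \<open>LZ\<close> in convex sets avoiding \<open>LJ\<close>; with a common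
  point they would put both ends of \<open>LZ\<close> on the same side of the crossing with
  \<open>LJ\<close>, and each end would be nearer to that crossing than the other.\<close>

lemma no_triple_point:
  assumes W: "w \<in> S LX" "w \<in> S LY" "w \<in> S LZ"
  shows False
proof -
  have ok: "lab_ok N LX" "lab_ok N LY" "lab_ok N LZ" by auto
  obtain a b where ab: "S LZ = closed_segment a b" using seg[of LZ] by auto
  obtain \<phi> :: "real \<times> real \<Rightarrow> real" where "\<forall>w\<in>S LZ. \<forall>z\<in>S LZ. \<forall>z'\<in>S LZ.
      w \<in> closed_segment z z' \<longleftrightarrow> min (\<phi> z) (\<phi> z') \<le> \<phi> w \<and> \<phi> w \<le> max (\<phi> z) (\<phi> z')"
    unfolding ab using segment_coordinate by blast
  note \<phi> = this[rule_format]
  let ?zt = "pt LZ 1" let ?zb = "pt LZ 12" let ?xr = "pt LX 0" let ?xl = "pt LX 11" let ?yl = "pt LY 7" let ?yr = "pt LY 15"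
  let ?j = "mt LJ LZ" let ?jr = "pt LJ 16"
  have f: "?zt \<in> S LZ" "?zb \<in> S LZ" "?xr \<in> S LX" "?xl \<in> S LX" "?yl \<in> S LY" "?yr \<in> S LY"
    "?zt \<in> S (LP 1)" "?zb \<in> S (LP 12)" "?xr \<in> S (LP 0)" "?xl \<in> S (LP 11)" "?yl \<in> S (LP 7)" "?yr \<in> S (LP 15)"
    using pt[of LZ 1] pt[of LZ 12] pt[of LX 0] pt[of LX 11] pt[of LY 7] pt[of LY 15] by auto
  have j: "?j \<in> S LJ" "?j \<in> S LZ" "?jr \<in> S LJ" "?jr \<in> S (LP 16)" using mt[OF near.JZ] pt[of LJ 16] by auto
  have jn: "?j \<notin> S LX" "?j \<notin> S LY" using farD[OF far.JX j(1)] farD[OF far.JY j(1)] by blast+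
  have conv: "v \<in> S l" if "v \<in> S LZ" "z \<in> S LZ" "z' \<in> S LZ" "z \<in> S l" "z' \<in> S l" "lab_ok N l"
     "min (\<phi> z) (\<phi> z') \<le> \<phi> v" "\<phi> v \<le> max (\<phi> z) (\<phi> z')" for v z z' l
    using \<phi>[of v z z'] that subD[of v z z' l] by blast
  have "\<exists>z. z \<in> path_set [?xr, ?xl] \<and> z \<in> path_set [?zt, ?j, ?jr]"
    by (rule cross_tracks[of 0 1 11 16 _ "[LX]" _ "[LZ, LJ]" ?xr ?xl ?zt ?jr]) (use f j in auto)
  then obtain x where x: "x \<in> closed_segment ?xr ?xl" "x \<in> closed_segment ?zt ?j \<or> x \<in> closed_segment ?j ?jr" by auto
  have xX: "x \<in> S LX" using subD[OF x(1), of LX] f by auto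
  then have x2: "x \<in> closed_segment ?zt ?j" using x(2) subD[of x ?j ?jr LJ] j farD[OF far.JX, of x] by auto
  then have xZ: "x \<in> S LZ" using subD[OF x2, of LZ] f j by auto
  have "\<exists>z. z \<in> path_set [?yl, ?yr] \<and> z \<in> path_set [?zb, ?j, ?jr]"
    by (rule cross_tracks[of 7 12 15 16 _ "[LY]" _ "[LZ, LJ]" ?yl ?yr ?zb ?jr]) (use f j in auto)
  then obtain y where y: "y \<in> closed_segment ?yl ?yr" "y \<in> closed_segment ?zb ?j \<or> y \<in> closed_segment ?j ?jr" by auto
  have yY: "y \<in> S LY" using subD[OF y(1), of LY] f by auto
  then have y2: "y \<in> closed_segment ?zb ?j" using y(2) subD[of y ?j ?jr LJ] j farD[OF far.JY, of y] by auto
  then have yZ: "y \<in> S LZ" using subD[OF y2, of LZ] f j by auto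
  obtain x' where x': "x' \<in> S LX" "x' \<in> S LZ" "x' \<in> closed_segment ?zt ?zb" using meet_XZ[folded One_nat_def] by (elim exE conjE)
  obtain y' where y': "y' \<in> S LY" "y' \<in> S LZ" "y' \<in> closed_segment ?zt ?zb" using meet_ZY[folded One_nat_def] by (elim exE conjE)
  have zt: "?zt \<notin> S LX" using farD[OF far.inner_P[of N LX 1], of ?zt] f by auto
  have zb: "?zb \<notin> S LY" using farD[OF far.inner_P[of N LY 12], of ?zb] f by auto
  have 1: "min (\<phi> ?zt) (\<phi> ?j) \<le> \<phi> x" "\<phi> x \<le> max (\<phi> ?zt) (\<phi> ?j)" using \<phi>[OF xZ f(1) j(2)] x2 by auto
  have 2: "min (\<phi> ?zb) (\<phi> ?j) \<le> \<phi> y" "\<phi> y \<le> max (\<phi> ?zb) (\<phi> ?j)" using \<phi>[OF yZ f(2) j(2)] y2 by auto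
  have 3: "min (\<phi> ?zt) (\<phi> ?zb) \<le> \<phi> x'" "\<phi> x' \<le> max (\<phi> ?zt) (\<phi> ?zb)" using \<phi>[OF x'(2) f(1,2)] x' by auto
  have 4: "min (\<phi> ?zt) (\<phi> ?zb) \<le> \<phi> y'" "\<phi> y' \<le> max (\<phi> ?zt) (\<phi> ?zb)" using \<phi>[OF y'(2) f(1,2)] y' by auto
  have 5: "\<not> (min (\<phi> x) (\<phi> x') \<le> \<phi> ?zt \<and> \<phi> ?zt \<le> max (\<phi> x) (\<phi> x'))"
    using conv[OF f(1) xZ x'(2) xX x'(1) ok(1)] zt by auto
  have 6: "\<not> (min (\<phi> y) (\<phi> y') \<le> \<phi> ?zb \<and> \<phi> ?zb \<le> max (\<phi> y) (\<phi> y'))"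
    using conv[OF f(2) yZ y'(2) yY y'(1) ok(2)] zb by auto
  have 7: "\<not> (min (\<phi> x) (\<phi> w) \<le> \<phi> ?j \<and> \<phi> ?j \<le> max (\<phi> x) (\<phi> w))"
    using conv[OF j(2) xZ W(3) xX W(1) ok(1)] jn by auto
  have 8: "\<not> (min (\<phi> y) (\<phi> w) \<le> \<phi> ?j \<and> \<phi> ?j \<le> max (\<phi> y) (\<phi> w))"
    using conv[OF j(2) yZ W(3) yY W(2) ok(2)] jn by auto
  show False by (rule betweenness_clash[OF 1 2 3 4 5 6 7 8])
qed

text \<open>Of three collinear corners one is between the other two, hence by convexity on all three
  segments.\<close>

lemma frame_not_collinear:
  fixes P Q R :: "real \<times> real"
  assumes P: "P \<in> S LX" "P \<in> S LY" and Q: "Q \<in> S LY" "Q \<in> S LZ" and R: "R \<in> S LX" "R \<in> S LZ"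
  shows "fst (Q - P) * snd (R - Q) \<noteq> snd (Q - P) * fst (R - Q)"
proof
  assume eq: "fst (Q - P) * snd (R - Q) = snd (Q - P) * fst (R - Q)"
  have "P \<noteq> Q" using no_triple_point P Q by blast
  have "collinear {P, Q, R}"
  proof -
    define t where "t = (if fst (Q - P) \<noteq> 0 then fst (R - Q) / fst (Q - P) else snd (R - Q) / snd (Q - P))"
    have "fst (Q - P) \<noteq> 0 \<or> snd (Q - P) \<noteq> 0" using \<open>P \<noteq> Q\<close> by (auto simp: prod_eq_iff)
    then have "fst (R - Q) = t * fst (Q - P)" "snd (R - Q) = t * snd (Q - P)"
      using eq by (auto simp: t_def eq_divide_eq simp del: fst_diff snd_diff) (auto simp: field_simps simp del: fst_diff snd_diff)
    then have "R - Q = t *\<^sub>R (Q - P)" by (simp add: prod_eq_iff)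
    then have "R = P + (1 + t) *\<^sub>R (Q - P)" by (simp add: algebra_simps)
    moreover have "Q = P + 1 *\<^sub>R (Q - P)" "P = P + 0 *\<^sub>R (Q - P)" by simp_all
    ultimately show ?thesis unfolding collinear_alt by (metis insert_iff empty_iff)
  qed
  then consider "P \<in> closed_segment Q R" | "Q \<in> closed_segment R P" | "R \<in> closed_segment P Q"
    unfolding collinear_between_cases between_mem_segment by blast
  then show False
  proof cases
    case 1 then show ?thesis using subD[OF 1, of LZ] P Q R no_triple_point[of P] by auto
  next
    case 2 then show ?thesis using subD[OF 2, of LX] P Q R no_triple_point[of Q] by auto
  next
    case 3 then show ?thesis using subD[OF 3, of LY] P Q R no_triple_point[of R] by auto
  qed
qed

text \<open>Preimages under an affine bijection keep all incidences. \<open>T\<close> inverts the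
  linear part of \<open>g\<close> by Cramer's rule, with determinant \<open>D\<close>.\<close>

lemma normalize:
  fixes P Q R :: "real \<times> real"
  assumes P: "P \<in> S LX" "P \<in> S LY" and Q: "Q \<in> S LY" "Q \<in> S LZ" and R: "R \<in> S LX" "R \<in> S LZ"
  defines "g \<equiv> \<lambda>z. Q + fst z *\<^sub>R (Q - P) + snd z *\<^sub>R (R - Q)"
  shows "normal_config N (\<lambda>l. g -` S l)" "surj g"
proof -
  define D where "D = fst (Q - P) * snd (R - Q) - snd (Q - P) * fst (R - Q)"
  have D: "D \<noteq> 0" using frame_not_collinear[OF P Q R] by (simp add: D_def)
  define T :: "real \<times> real \<Rightarrow> real \<times> real" where
    "T z = ((fst z * snd (R - Q) - snd z * fst (R - Q)) / D, (fst (Q - P) * snd z - snd (Q - P) * fst z) / D)" for z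
  have Tadd: "T (u + v) = T u + T v" and Tsc: "T (c *\<^sub>R u) = c *\<^sub>R T u" for u v c
    by (auto simp: T_def prod_eq_iff add_divide_distrib diff_divide_distrib algebra_simps)
  have gT: "g (T (z - Q)) = z" for z
  proof -
    let ?a = "fst (Q - P)" and ?b = "snd (Q - P)" and ?c = "fst (R - Q)" and ?d = "snd (R - Q)" and ?x = "fst (z - Q)" and ?y = "snd (z - Q)"
    have 1: "(?x * ?d - ?y * ?c) * ?a + (?a * ?y - ?b * ?x) * ?c = ?x * D"
      "(?x * ?d - ?y * ?c) * ?b + (?a * ?y - ?b * ?x) * ?d = ?y * D" by (simp_all only: D_def) algebra+
    have "(?x * ?d - ?y * ?c) / D * ?a + (?a * ?y - ?b * ?x) / D * ?c = ?x"
      "(?x * ?d - ?y * ?c) / D * ?b + (?a * ?y - ?b * ?x) / D * ?d = ?y"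
      using 1 D by (simp_all add: add_divide_distrib[symmetric] eq_divide_eq)
    then have "fst (g (T (z - Q))) = fst z" "snd (g (T (z - Q))) = snd z"
      unfolding g_def T_def by simp_all
    then show ?thesis by (simp add: prod_eq_iff)
  qed
  have Tg: "T (g z - Q) = z" for z
  proof -
    have "T (Q - P) = (1, 0)" "T (R - Q) = (0, 1)" using D by (simp_all add: T_def D_def mult.commute)
    then have "T (g z - Q) = fst z *\<^sub>R (1, 0) + snd z *\<^sub>R (0, 1)"
      by (simp add: g_def Tadd Tsc)
    then show ?thesis by (simp add: prod_eq_iff)
  qed
  show sg: "surj g" using gT by (rule surjI)
  have img: "g -` closed_segment a b = closed_segment (T (a - Q)) (T (b - Q))" for a b
  proof -
    have lin: "(1 - u) *\<^sub>R g s + u *\<^sub>R g t = g ((1 - u) *\<^sub>R s + u *\<^sub>R t)" for u s t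
      by (simp add: g_def algebra_simps)
    have "g z \<in> closed_segment a b \<longleftrightarrow> z \<in> closed_segment (T (a - Q)) (T (b - Q))" for z
    proof -
      have "g z = g z' \<longleftrightarrow> z = z'" for z' using Tg by metis
      then show ?thesis
        using lin[of _ "T (a - Q)" "T (b - Q)"] by (simp add: in_segment gT)
    qed
    then show ?thesis by (simp only: set_eq_iff vimage_eq simp_thms)
  qed
  show "normal_config N (\<lambda>l. g -` S l)"
  proof
    show "\<exists>a b. g -` S l = closed_segment a b" if "lab_ok N l" for l using seg[OF that] img by metis
    show "g -` S a \<inter> g -` S b = {}" if "far N a b" for a b using far[OF that] by blast
    show "g -` S a \<inter> g -` S b \<noteq> {}" if "near N a b" for a b
      using near[OF that] sg by (metis surj_vimage_empty vimage_Int)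
    have "g (-1, 0) = P" "g (0, 0) = Q" "g (0, 1) = R" by (auto simp: g_def prod_eq_iff)
    then show "(-1, 0) \<in> g -` S LX" "(-1, 0) \<in> g -` S LY" "(0, 0) \<in> g -` S LY" "(0, 0) \<in> g -` S LZ"
      "(0, 1) \<in> g -` S LX" "(0, 1) \<in> g -` S LZ" using P Q R by auto
  qed
qed

text \<open>Only affine data leave the normalized picture. The parameters p and u are positions on
  \<open>LY\<close> measured from Q in units of Q - P, and the two determinant conditions say that
  neither \<open>LZ\<close> nor \<open>LC (N - 1)\<close> runs within the line of
  \<open>LY\<close>.\<close>

lemma gap:
  assumes N: "0 < N"
  obtains P Q R w :: "real \<times> real" and p u :: real where "S LX \<inter> S LY = {P}" "S LY \<inter> S LZ = {Q}" "P \<noteq> Q"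
    "Q + p *\<^sub>R (Q - P) \<in> S LH" "Q + p *\<^sub>R (Q - P) \<in> S LY"
    "Q + u *\<^sub>R (Q - P) \<in> S (LC (N - 1))" "Q + u *\<^sub>R (Q - P) \<in> S LY" "0 < u"
    "R \<in> S LZ" "fst (Q - P) * snd (R - Q) \<noteq> snd (Q - P) * fst (R - Q)"
    "w \<in> S (LC (N - 1))" "fst (Q - P) * snd (w - Q) \<noteq> snd (Q - P) * fst (w - Q)"
    "p \<le> 1 \<longrightarrow> u / (1 + u) \<le> (1 / 2) ^ (2 ^ (N - 1))"
proof -
  obtain P :: "real \<times> real" where P: "P \<in> S LX" "P \<in> S LY" using meet_XY by (elim exE conjE)
  obtain Q :: "real \<times> real" where Q: "Q \<in> S LY" "Q \<in> S LZ" using meet_ZY by (elim exE conjE)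
  obtain R :: "real \<times> real" where R: "R \<in> S LX" "R \<in> S LZ" using meet_XZ by (elim exE conjE)
  define g where "g z = Q + fst z *\<^sub>R (Q - P) + snd z *\<^sub>R (R - Q)" for z :: "real \<times> real"
  have g: "g = (\<lambda>z. Q + fst z *\<^sub>R (Q - P) + snd z *\<^sub>R (R - Q))" by (simp add: g_def fun_eq_iff)
  interpret n: normal_config N "\<lambda>l. g -` S l" unfolding g by (rule normalize[OF P Q R])
  have sg: "surj g" unfolding g by (rule normalize[OF P Q R])
  have g0: "g (-1, 0) = P" "g (0, 0) = Q" by (auto simp: g_def prod_eq_iff)
  have un: "S LX \<inter> S LY = {P}"
  proof -
    have "w = P" if w: "w \<in> S LX" "w \<in> S LY" for w
    proof -
      obtain z where z: "w = g z" using sg by (metis surjD)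
      then have "z = (-1, 0)" using n.XY[of z] w by auto
      then show ?thesis using z g0 by simp
    qed
    then show ?thesis using P by blast
  qed
  have un': "S LY \<inter> S LZ = {Q}"
  proof -
    have "w = Q" if w: "w \<in> S LY" "w \<in> S LZ" for w
    proof -
      obtain z where z: "w = g z" using sg by (metis surjD)
      then have "z = (0, 0)" using n.YZ[of z] w by auto
      then show ?thesis using z g0 by simp
    qed
    then show ?thesis using Q by blast
  qed
  have PQ: "P \<noteq> Q" using no_triple_point P Q by blast
  have gY: "g (v, 0) = Q + v *\<^sub>R (Q - P)" for v by (simp add: g_def)
  obtain y p where yp: "\<And>k. k < N \<Longrightarrow> (y k, 0) \<in> g -` S (LC k) \<and> (y k, 0) \<in> g -` S LY \<and> 0 < y k"
    "(p, 0) \<in> g -` S LH" "(p, 0) \<in> g -` S LY" "y 0 \<le> p"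
    "\<And>k. Suc k < N \<Longrightarrow> y (Suc k) / (1 + y (Suc k)) \<le> (y k / (1 + y k))\<^sup>2"
    by (rule n.doubly_exponential[OF N], rule that) blast+
  have dec: "y k / (1 + y k) \<le> (1 / 2) ^ (2 ^ k)" if "p \<le> 1" "k < N" for k
    using that(2)
  proof (induction k)
    case 0
    have "0 < y 0" "y 0 \<le> 1" using yp(1)[OF N] yp(4) that by auto
    then show ?case by (simp add: field_simps)
  next
    case (Suc k)
    have "0 < y k" using yp(1)[of k] Suc by auto
    have "y (Suc k) / (1 + y (Suc k)) \<le> (y k / (1 + y k))\<^sup>2" by (rule yp(5)[OF Suc(2)])
    also have "\<dots> \<le> ((1 / 2) ^ (2 ^ k))\<^sup>2" using Suc \<open>0 < y k\<close> by (intro power_mono) auto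
    also have "\<dots> = (1 / 2) ^ (2 ^ Suc k)" by (simp add: power_mult[symmetric] mult.commute)
    finally show ?case .
  qed
  have M: "N - 1 < N" using N by simp
  have "\<exists>z. z \<in> g -` S (LC (N - 1)) \<and> snd z < 0" using n.C_facts[OF M] by blast
  then obtain z where z: "g z \<in> S (LC (N - 1))" "snd z < 0" by auto
  have nc: "fst (Q - P) * snd (R - Q) \<noteq> snd (Q - P) * fst (R - Q)" by (rule frame_not_collinear[OF P Q R])
  have "fst (Q - P) * snd (g z - Q) - snd (Q - P) * fst (g z - Q)
      = snd z * (fst (Q - P) * snd (R - Q) - snd (Q - P) * fst (R - Q))"
    by (simp add: g_def algebra_simps)
  then have nc': "fst (Q - P) * snd (g z - Q) \<noteq> snd (Q - P) * fst (g z - Q)"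
    using nc z(2) by auto
  show thesis
    by (rule that[OF un un' PQ _ _ _ _ _ R(2) nc z(1) nc', of p "y (N - 1)"])
      (use yp(2,3) yp(1)[OF M] dec[OF _ M] in \<open>simp_all add: gY\<close>)
qed

end

subsection \<open>A drawing of the configuration\<close>

definition dirdet :: "real \<times> real \<Rightarrow> real \<times> real \<Rightarrow> real" where
  "dirdet u v = fst u * snd v - snd u * fst v"

lemma dirdet_simps:
  "dirdet (a + b) c = dirdet a c + dirdet b c" "dirdet c (a + b) = dirdet c a + dirdet c b"
  "dirdet (t *\<^sub>R a) c = t * dirdet a c" "dirdet c (t *\<^sub>R a) = t * dirdet c a"
  "dirdet (- a) c = - dirdet a c" "dirdet c (- a) = - dirdet c a"
  "dirdet a a = 0"
  by (simp_all add: dirdet_def algebra_simps)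

lemma dirdet_commute: "dirdet a b = - dirdet b a"
  by (simp add: dirdet_def)

definition orient :: "real \<times> real \<Rightarrow> real \<times> real \<Rightarrow> real \<times> real \<Rightarrow> real" where
  "orient p q r = (fst q - fst p) * (snd r - snd p) - (snd q - snd p) * (fst r - fst p)"

lemma orient_convex: "orient p q ((1 - t) *\<^sub>R a + t *\<^sub>R b) = (1 - t) * orient p q a + t * orient p q b"
  by (simp add: orient_def algebra_simps)

lemma orient_on: "z \<in> closed_segment p q \<Longrightarrow> orient p q z = 0"
  by (auto simp: in_segment orient_convex) (simp add: orient_def)

lemma orient_neg_disjoint:
  assumes "orient p q a < 0" "orient p q b < 0"
  shows "closed_segment p q \<inter> closed_segment a b = {}"
proof -
  have "orient p q z < 0" if zs: "z \<in> closed_segment a b" for z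
  proof -
    obtain t where t: "0 \<le> t" "t \<le> 1" and z: "z = (1 - t) *\<^sub>R a + t *\<^sub>R b" using zs unfolding in_segment by blast
    show ?thesis unfolding z orient_convex using convex_bound_lt[OF assms, of "1 - t" t] t by simp
  qed
  then show ?thesis using orient_on by fastforce
qed

lemma orient_swap: "orient q p z = - orient p q z"
  by (simp add: orient_def algebra_simps)

lemma orient_pos_disjoint:
  assumes "orient p q a > 0" "orient p q b > 0"
  shows "closed_segment p q \<inter> closed_segment a b = {}"
  using orient_neg_disjoint[of q p a b] assms by (simp add: orient_swap[of q p] closed_segment_commute)

text \<open>The corners of the ring on the square of half-width 4, counterclockwise: 0 to 7 on the
  top, 8 to 23 on the left, 24 to 27 on the bottom, 28 to 35 on the right side. The interval from
  corner 2 i to corner 2 i + 1 contains the ends of all segments attached to \<open>LP i\<close>.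
  Around the left end of \<open>LY\<close> the pieces 6, 7 and 8 have size d, because
  \<open>LE\<close> and \<open>LD\<close> run at distance d from \<open>LY\<close>.\<close>

definition ring_coord :: "real \<Rightarrow> nat \<Rightarrow> real" where
  "ring_coord d j = [7/2, 5/2, 2, - d, - (2 * d), - 2, - (5/2), - (7/2),
     7/2, 5/2, 2, 1, 2 * d, d / 2, d / 4, - (d / 4), - (d / 2), - (3 * d / 2), - (2 * d), - 1, - (3/2), - (21/8), - (11/4), - (7/2),
     - (7/2), 1/8, 1/4, 7/2, - (7/2), - (5/2), - 2, 1/8, 1/4, 1, 2, 7/2] ! j"

definition ring_pt :: "real \<Rightarrow> nat \<Rightarrow> real \<times> real" where
  "ring_pt d j = (if j < 8 then (ring_coord d j, 4) else if j < 24 then (- 4, ring_coord d j)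
     else if j < 28 then (ring_coord d j, - 4) else (4, ring_coord d j))"

definition spoke_tip :: "real \<Rightarrow> nat \<Rightarrow> real \<times> real" where
  "spoke_tip d j = (if j < 8 then (ring_coord d j, 8) else if j < 24 then (- 8, ring_coord d j)
     else if j < 28 then (ring_coord d j, - 8) else (8, ring_coord d j))"

definition piece :: "real \<Rightarrow> nat \<Rightarrow> (real \<times> real) set" where
  "piece d j = closed_segment (ring_pt d j) (ring_pt d (Suc j mod 36))"

lemma strict_mono_segment:
  fixes f :: "nat \<Rightarrow> real"
  assumes "\<And>j. m \<le> j \<Longrightarrow> j < n \<Longrightarrow> f j < f (Suc j)" "m \<le> i" "i < j" "j \<le> n"
  shows "f i < f j"
  using assms(3,4)
proof (induction j)
  case (Suc j)
  show ?case
  proof (cases "i = j")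
    case True then show ?thesis using assms(1,2) Suc by auto
  next
    case False
    then have "f i < f j" using Suc by auto
    also have "f j < f (Suc j)" using assms(1,2) Suc by auto
    finally show ?thesis .
  qed
qed auto

context
  fixes d :: real
  assumes d: "0 < d" "d < 1 / 100"
begin

lemma ring_coord_step:
  "j < 7 \<Longrightarrow> ring_coord d (Suc j) < ring_coord d j"
  "8 \<le> j \<Longrightarrow> j < 23 \<Longrightarrow> ring_coord d (Suc j) < ring_coord d j"
  "24 \<le> j \<Longrightarrow> j < 27 \<Longrightarrow> ring_coord d j < ring_coord d (Suc j)"
  "28 \<le> j \<Longrightarrow> j < 35 \<Longrightarrow> ring_coord d j < ring_coord d (Suc j)"
proof -
  have "\<forall>j\<in>{0..<7}. ring_coord d (Suc j) < ring_coord d j" "\<forall>j\<in>{8..<23}. ring_coord d (Suc j) < ring_coord d j"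
    "\<forall>j\<in>{24..<27}. ring_coord d j < ring_coord d (Suc j)" "\<forall>j\<in>{28..<35}. ring_coord d j < ring_coord d (Suc j)"
    using d by (simp_all add: ring_coord_def atLeastLessThan_nat_numeral ball_simps)
  then show "j < 7 \<Longrightarrow> ring_coord d (Suc j) < ring_coord d j"
    "8 \<le> j \<Longrightarrow> j < 23 \<Longrightarrow> ring_coord d (Suc j) < ring_coord d j"
    "24 \<le> j \<Longrightarrow> j < 27 \<Longrightarrow> ring_coord d j < ring_coord d (Suc j)"
    "28 \<le> j \<Longrightarrow> j < 35 \<Longrightarrow> ring_coord d j < ring_coord d (Suc j)" by auto
qed

lemma ring_coord_mono:
  "i < j \<Longrightarrow> j \<le> 7 \<Longrightarrow> ring_coord d j < ring_coord d i"
  "8 \<le> i \<Longrightarrow> i < j \<Longrightarrow> j \<le> 23 \<Longrightarrow> ring_coord d j < ring_coord d i"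
  "24 \<le> i \<Longrightarrow> i < j \<Longrightarrow> j \<le> 27 \<Longrightarrow> ring_coord d i < ring_coord d j"
  "28 \<le> i \<Longrightarrow> i < j \<Longrightarrow> j \<le> 35 \<Longrightarrow> ring_coord d i < ring_coord d j"
  using strict_mono_segment[of 0 7 "\<lambda>j. - ring_coord d j" i j] strict_mono_segment[of 8 23 "\<lambda>j. - ring_coord d j" i j]
    strict_mono_segment[of 24 27 "ring_coord d" i j] strict_mono_segment[of 28 35 "ring_coord d" i j] ring_coord_step
  by auto

lemma ring_coord_ends: "ring_coord d 0 = 7/2" "ring_coord d 7 = -7/2" "ring_coord d 8 = 7/2" "ring_coord d 23 = -7/2"
  "ring_coord d 24 = -7/2" "ring_coord d 27 = 7/2" "ring_coord d 28 = -7/2" "ring_coord d 35 = 7/2"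
  by (simp_all add: ring_coord_def)

lemma ring_coord_bounds:
  assumes "j < 36"
  shows "-7/2 \<le> ring_coord d j \<and> ring_coord d j \<le> 7/2"
proof -
  consider "j \<le> 7" | "8 \<le> j" "j \<le> 23" | "24 \<le> j" "j \<le> 27" | "28 \<le> j" "j \<le> 35" using assms by linarith
  then show ?thesis
  proof cases
    case 1
    then show ?thesis using ring_coord_mono(1)[of 0 j] ring_coord_mono(1)[of j 7] ring_coord_ends
      by (cases "j = 0"; cases "j = 7") auto
  next
    case 2
    then show ?thesis using ring_coord_mono(2)[of 8 j] ring_coord_mono(2)[of j 23] ring_coord_ends
      by (cases "j = 8"; cases "j = 23") auto
  next
    case 3
    then show ?thesis using ring_coord_mono(3)[of 24 j] ring_coord_mono(3)[of j 27] ring_coord_ends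
      by (cases "j = 24"; cases "j = 27") auto
  next
    case 4
    then show ?thesis using ring_coord_mono(4)[of 28 j] ring_coord_mono(4)[of j 35] ring_coord_ends
      by (cases "j = 28"; cases "j = 35") auto
  qed
qed

lemma piece_cases:
  assumes "z \<in> piece d j" "j < 36"
  obtains (top) "j < 7" "snd z = 4" "ring_coord d (Suc j) \<le> fst z" "fst z \<le> ring_coord d j"
  | (top_left) "j = 7" "-4 \<le> fst z" "fst z \<le> -7/2" "7/2 \<le> snd z" "snd z \<le> 4"
  | (left) "8 \<le> j" "j < 23" "fst z = -4" "ring_coord d (Suc j) \<le> snd z" "snd z \<le> ring_coord d j"
  | (bottom_left) "j = 23" "-4 \<le> fst z" "fst z \<le> -7/2" "-4 \<le> snd z" "snd z \<le> -7/2"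
  | (bottom) "24 \<le> j" "j < 27" "snd z = -4" "ring_coord d j \<le> fst z" "fst z \<le> ring_coord d (Suc j)"
  | (bottom_right) "j = 27" "7/2 \<le> fst z" "fst z \<le> 4" "-4 \<le> snd z" "snd z \<le> -7/2"
  | (right) "28 \<le> j" "j < 35" "fst z = 4" "ring_coord d j \<le> snd z" "snd z \<le> ring_coord d (Suc j)"
  | (top_right) "j = 35" "7/2 \<le> fst z" "fst z \<le> 4" "7/2 \<le> snd z" "snd z \<le> 4"
proof -
  have z: "z \<in> closed_segment (ring_pt d j) (ring_pt d (Suc j mod 36))" using assms by (simp add: piece_def)
  note b = segment_fst[OF z] segment_snd[OF z]
  consider "j < 7" | "j = 7" | "8 \<le> j" "j < 23" | "j = 23" | "24 \<le> j" "j < 27" | "j = 27" | "28 \<le> j" "j < 35" | "j = 35"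
    using assms(2) by linarith
  then show ?thesis
  proof cases
    case 1 then show ?thesis using top b ring_coord_step(1)[of j] by (auto simp: ring_pt_def)
  next
    case 2 then show ?thesis using top_left b ring_coord_ends by (auto simp: ring_pt_def)
  next
    case 3 then show ?thesis using left b ring_coord_step(2)[of j] by (auto simp: ring_pt_def)
  next
    case 4 then show ?thesis using bottom_left b ring_coord_ends by (auto simp: ring_pt_def)
  next
    case 5 then show ?thesis using bottom b ring_coord_step(3)[of j] by (auto simp: ring_pt_def)
  next
    case 6 then show ?thesis using bottom_right b ring_coord_ends by (auto simp: ring_pt_def)
  next
    case 7 then show ?thesis using right b ring_coord_step(4)[of j] by (auto simp: ring_pt_def)
  next
    case 8 then show ?thesis using top_right b ring_coord_ends by (auto simp: ring_pt_def)
  qed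
qed

lemma piece_disjoint_less:
  assumes "i < j" "j < 36" "j \<noteq> Suc i" "\<not> (i = 0 \<and> j = 35)"
  shows "piece d i \<inter> piece d j = {}"
proof -
  have False if z: "z \<in> piece d i" "z \<in> piece d j" for z
  proof -
    have i: "i < 36" "Suc i < 36" and ij: "Suc i < j" using assms by auto
    note e = ring_coord_bounds[OF i(1)] ring_coord_bounds[OF i(2)] ring_coord_bounds[OF assms(2)]
    have e': "j \<noteq> 35 \<longrightarrow> -7/2 \<le> ring_coord d (Suc j) \<and> ring_coord d (Suc j) \<le> 7/2"
      using ring_coord_bounds[of "Suc j"] assms(2) by auto
    show False
    proof (rule piece_cases[OF z(1) i(1)])
      assume c: "i < 7" "snd z = 4" "ring_coord d (Suc i) \<le> fst z" "fst z \<le> ring_coord d i"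
      have m: "j \<le> 7 \<longrightarrow> ring_coord d j < ring_coord d (Suc i)" "i \<noteq> 0 \<longrightarrow> ring_coord d i < 7/2"
        "j = 7 \<longrightarrow> -7/2 < ring_coord d (Suc i)"
        using ring_coord_mono(1)[of "Suc i" j] ring_coord_mono(1)[of 0 i] ij c ring_coord_ends by auto
      show False by (rule piece_cases[OF z(2) assms(2)]) (use c m e e' ij assms in auto)
    next
      assume c: "i = 7" "-4 \<le> fst z" "fst z \<le> -7/2" "7/2 \<le> snd z" "snd z \<le> 4"
      have m: "j \<le> 23 \<longrightarrow> ring_coord d j < 7/2" using ring_coord_mono(2)[of 8 j] ij c ring_coord_ends by auto
      show False by (rule piece_cases[OF z(2) assms(2)]) (use c m e e' ij assms in auto)
    next
      assume c: "8 \<le> i" "i < 23" "fst z = -4" "ring_coord d (Suc i) \<le> snd z" "snd z \<le> ring_coord d i"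
      have m: "j \<le> 23 \<longrightarrow> ring_coord d j < ring_coord d (Suc i)" "j = 23 \<longrightarrow> -7/2 < ring_coord d (Suc i)"
        using ring_coord_mono(2)[of "Suc i" j] ij c ring_coord_ends by auto
      show False by (rule piece_cases[OF z(2) assms(2)]) (use c m e e' ij assms in auto)
    next
      assume c: "i = 23" "-4 \<le> fst z" "fst z \<le> -7/2" "-4 \<le> snd z" "snd z \<le> -7/2"
      have m: "j \<le> 27 \<longrightarrow> -7/2 < ring_coord d j" using ring_coord_mono(3)[of 24 j] ij c ring_coord_ends by auto
      show False by (rule piece_cases[OF z(2) assms(2)]) (use c m e e' ij assms in auto)
    next
      assume c: "24 \<le> i" "i < 27" "snd z = -4" "ring_coord d i \<le> fst z" "fst z \<le> ring_coord d (Suc i)"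
      have m: "j \<le> 27 \<longrightarrow> ring_coord d (Suc i) < ring_coord d j" "j = 27 \<longrightarrow> ring_coord d (Suc i) < 7/2"
        using ring_coord_mono(3)[of "Suc i" j] ij c ring_coord_ends by auto
      show False by (rule piece_cases[OF z(2) assms(2)]) (use c m e e' ij assms in auto)
    next
      assume c: "i = 27" "7/2 \<le> fst z" "fst z \<le> 4" "-4 \<le> snd z" "snd z \<le> -7/2"
      have m: "j \<le> 35 \<longrightarrow> -7/2 < ring_coord d j" using ring_coord_mono(4)[of 28 j] ij c ring_coord_ends by auto
      show False by (rule piece_cases[OF z(2) assms(2)]) (use c m e e' ij assms in auto)
    next
      assume c: "28 \<le> i" "i < 35" "fst z = 4" "ring_coord d i \<le> snd z" "snd z \<le> ring_coord d (Suc i)"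
      have m: "j \<le> 35 \<longrightarrow> ring_coord d (Suc i) < ring_coord d j" "j = 35 \<longrightarrow> ring_coord d (Suc i) < 7/2"
        using ring_coord_mono(4)[of "Suc i" j] ij c ring_coord_ends by auto
      show False by (rule piece_cases[OF z(2) assms(2)]) (use c m e e' ij assms in auto)
    qed (use i in auto)
  qed
  then show ?thesis by blast
qed

lemma piece_disjoint:
  assumes "i < 36" "j < 36" "i \<noteq> j" "j \<noteq> Suc i mod 36" "i \<noteq> Suc j mod 36"
  shows "piece d i \<inter> piece d j = {}"
proof (cases "i < j")
  case True
  then have "j \<noteq> Suc i" "\<not> (i = 0 \<and> j = 35)" using assms by auto
  then show ?thesis using piece_disjoint_less[OF True assms(2)] by blast
next
  case False
  then have "j < i" "i \<noteq> Suc j" "\<not> (j = 0 \<and> i = 35)" using assms by auto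
  then show ?thesis using piece_disjoint_less[OF _ assms(1)] by blast
qed

lemma piece_box: "z \<in> piece d j \<Longrightarrow> j < 36 \<Longrightarrow> \<bar>fst z\<bar> \<le> 4 \<and> \<bar>snd z\<bar> \<le> 4"
  using ring_coord_bounds[of j] ring_coord_bounds[of "Suc j"] by (elim piece_cases[of z j]) auto

text \<open>The pieces that cut off the corners of the square, 7, 23, 27 and 35, have odd
  indices.\<close>

lemma even_piece_boundary: "z \<in> piece d (2 * i) \<Longrightarrow> i < 18 \<Longrightarrow> \<bar>fst z\<bar> = 4 \<or> \<bar>snd z\<bar> = 4"
  by (rule piece_cases[of z "2 * i"]) (auto, presburger+)

lemma spoke_cases:
  assumes "z \<in> closed_segment (ring_pt d j) (spoke_tip d j)"
  obtains "j < 8" "fst z = ring_coord d j" "4 \<le> snd z" "snd z \<le> 8"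
  | "8 \<le> j" "j < 24" "snd z = ring_coord d j" "-8 \<le> fst z" "fst z \<le> -4"
  | "24 \<le> j" "j < 28" "fst z = ring_coord d j" "-8 \<le> snd z" "snd z \<le> -4"
  | "28 \<le> j" "snd z = ring_coord d j" "4 \<le> fst z" "fst z \<le> 8"
proof -
  note b = segment_fst[OF assms] segment_snd[OF assms]
  consider "j < 8" | "8 \<le> j" "j < 24" | "24 \<le> j" "j < 28" | "28 \<le> j" by linarith
  then show ?thesis by cases (use b that in \<open>auto simp: ring_pt_def spoke_tip_def\<close>)
qed

lemma spoke_base:
  assumes "z \<in> closed_segment (ring_pt d j) (spoke_tip d j)" "\<bar>fst z\<bar> \<le> 4" "\<bar>snd z\<bar> \<le> 4"
  shows "z = ring_pt d j"
  by (rule spoke_cases[OF assms(1)]) (use assms(2,3) in \<open>auto simp: ring_pt_def prod_eq_iff\<close>)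

lemma spoke_piece:
  assumes "z \<in> closed_segment (ring_pt d i) (spoke_tip d i)" "z \<in> piece d j" "i < 36" "j < 36"
  shows "j = i \<or> j = Suc i mod 36 \<or> i = Suc j mod 36"
proof -
  have "z = ring_pt d i" using spoke_base[OF assms(1)] piece_box[OF assms(2,4)] by blast
  then have "z \<in> piece d i" by (simp add: piece_def)
  then show ?thesis using piece_disjoint[OF assms(3,4)] assms(2) by blast
qed

end

text \<open>\<open>LC k\<close> cuts the axes at distance about \<open>sc k\<close>, and \<open>dl N\<close> is negligible compared to all of them.\<close>

fun sc :: "nat \<Rightarrow> real" where
  "sc 0 = 1/16" | "sc (Suc k) = (sc k)^2 / 64"

definition dl :: "nat \<Rightarrow> real" where "dl N = (sc N)^2 / 100"

text \<open>Let s = \<open>sc k\<close> and d = \<open>dl N\<close>. \<open>LC k\<close> lies on the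
  line x = s (y + s), \<open>LA k\<close> on x = 8 s (2 - y) and \<open>LB k\<close> on x = 2 y + 16
  s. The horizontal \<open>LT k\<close> and \<open>LU k\<close> lead to the two ends of
  \<open>LC k\<close>; \<open>LD k\<close> and \<open>LE k\<close> are horizontal at heights - d and
  d and lead to the ends of \<open>LA k\<close> and \<open>LB k\<close>. \<open>LH\<close> is the
  mirror image of \<open>LX\<close>.\<close>

fun ends :: "nat \<Rightarrow> lab \<Rightarrow> (real \<times> real) \<times> (real \<times> real)" where
  "ends N LX = ((-4, -3), (3, 4))"
| "ends N LH = ((4, -3), (-3, 4))"
| "ends N LY = ((-4, 0), (4, 0))"
| "ends N LZ = ((0, 4), (0, -4))"
| "ends N LJ = ((4, 1/2), (-1/4, 1/2))"
| "ends N LW = ((1/2, -4), (1/2, 1/4))"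
| "ends N LG = ((-4, 3), (4, 3))"
| "ends N (LC k) = ((sc k * (sc k + 3/2), 3/2), (- ((sc k)^2 / 2), - 3/2 * sc k))"
| "ends N (LT k) = ((-4, 3/2), (sc k * (sc k + 3/2), 3/2))"
| "ends N (LU k) = ((-4, - 3/2 * sc k), (- ((sc k)^2 / 2), - 3/2 * sc k))"
| "ends N (LA k) = ((- 16 * sc k, 4), (16 * sc k + 8 * sc k * dl N, - dl N))"
| "ends N (LD k) = ((-4, - dl N), (16 * sc k + 8 * sc k * dl N, - dl N))"
| "ends N (LB k) = ((-4, - 2 - 8 * sc k), (16 * sc k + 2 * dl N, dl N))"
| "ends N (LE k) = ((-4, dl N), (16 * sc k + 2 * dl N, dl N))"
| "ends N (LP i) = (ring_pt (dl N) (2 * i), ring_pt (dl N) (Suc (2 * i) mod 36))"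
| "ends N (LQ i) = (ring_pt (dl N) (2 * i + 1), ring_pt (dl N) (Suc (2 * i + 1) mod 36))"
| "ends N (LR i) = (ring_pt (dl N) (2 * i), spoke_tip (dl N) (2 * i))"
| "ends N (LO i) = [((8, 8), (-8, 8)), ((-8, 8), (-8, -8)), ((-8, -8), (8, -8)), ((8, -8), (8, 8))] ! i"

definition draw :: "nat \<Rightarrow> lab \<Rightarrow> (real \<times> real) set" where
  "draw N l = closed_segment (fst (ends N l)) (snd (ends N l))"

lemma sc_pos: "0 < sc k" by (induction k) auto

lemma sc_le: "sc k \<le> 1/16"
proof (induction k)
  case (Suc k)
  have "sc k * sc k \<le> 1/16 * (1/16)" using Suc sc_pos[of k] by (intro mult_mono) auto
  then show ?case unfolding sc.simps power2_eq_square by linarith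
qed simp

lemma sc_antimono: "k \<le> n \<Longrightarrow> sc n \<le> sc k"
proof (rule lift_Suc_antimono_le)
  fix n
  have "sc n * sc n \<le> sc n * 1" using sc_pos[of n] sc_le[of n] by (intro mult_left_mono) auto
  then show "sc (Suc n) \<le> sc n" using sc_pos[of n] by (simp add: power2_eq_square)
qed

lemma dl_pos: "0 < dl N" using sc_pos[of N] by (simp add: dl_def)

lemma dl_le: "k \<le> N \<Longrightarrow> dl N \<le> (sc k)^2 / 100"
  using sc_antimono[of k N] sc_pos[of N] by (simp add: dl_def power_mono)

text \<open>The orientation determinants below are polynomials in s and d in which small monomials
  have to be dominated by larger ones. These comparisons allow linear arithmetic with the monomials
  as variables.\<close>

lemma small_bounds:
  assumes "k \<le> N"
  defines "s \<equiv> sc k" and "d \<equiv> dl N"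
  shows "0 < s" "s \<le> 1/16" "0 < d" "d \<le> s^2 / 100" "0 < s^2" "s^2 \<le> s / 16" "0 < s^3" "s^3 \<le> s^2 / 16" "0 < s^4" "s^4 \<le> s^3 / 16"
    "0 < s * d" "s * d \<le> d / 16" "0 < s^2 * d" "s^2 * d \<le> s * d / 16" "0 < s^3 * d" "s^3 * d \<le> s^2 * d / 16"
    "0 < d^2" "d^2 \<le> d / 16" "0 < s * d^2" "s * d^2 \<le> d / 16" "0 < s^2 * d^2" "s^2 * d^2 \<le> d / 16"
proof -
  have s: "0 < s" "s \<le> 1/16" unfolding s_def by (rule sc_pos sc_le)+
  have d: "0 < d" "d \<le> s^2 / 100" using dl_pos dl_le[OF assms(1)] by (simp_all add: s_def d_def)
  have m: "x * s \<le> x / 16" if "0 < x" for x using that s mult_left_mono[of s "1/16" x] by simp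
  have s2: "s^2 \<le> s / 16" using m[of s] s by (simp add: power2_eq_square)
  have d16: "d \<le> 1/16" using d s2 s by linarith
  have md: "x * d \<le> x / 16" if "0 < x" for x using that d16 mult_left_mono[of d "1/16" x] by simp
  show "0 < s" "s \<le> 1/16" "0 < d" "d \<le> s^2 / 100" "s^2 \<le> s / 16" by fact+
  show "0 < s^2" "0 < s^3" "0 < s^4" "0 < s * d" "0 < s^2 * d" "0 < s^3 * d" "0 < d^2" "0 < s * d^2" "0 < s^2 * d^2"
    using s d by auto
  show "s^3 \<le> s^2 / 16" "s^4 \<le> s^3 / 16" "s * d \<le> d / 16" "s^2 * d \<le> s * d / 16" "s^3 * d \<le> s^2 * d / 16" "d^2 \<le> d / 16"
    using m[of "s^2"] m[of "s^3"] m[of d] m[of "s * d"] m[of "s^2 * d"] md[of d] s d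
    by (simp_all add: eval_nat_numeral mult.assoc mult.left_commute mult.commute)
  have a: "s * d^2 \<le> d^2 / 16" "s^2 * d^2 \<le> s * d^2 / 16"
    using m[of "d^2"] m[of "s * d^2"] s d by (simp_all add: eval_nat_numeral mult.assoc mult.left_commute mult.commute)
  show "s * d^2 \<le> d / 16" "s^2 * d^2 \<le> d / 16" using a \<open>d^2 \<le> d / 16\<close> d by (linarith | smt (verit))+
qed

lemma dl_small: "0 < dl N" "dl N < 1/100"
proof -
  have "(sc N)^2 \<le> (1/16)^2" using sc_pos[of N] sc_le[of N] by (intro power_mono) auto
  then show "0 < dl N" "dl N < 1/100" using dl_pos by (auto simp: dl_def power2_eq_square)
qed

section \<open>Prescribed disjoint pairs in the drawing\<close>

lemma far_TX: "k \<le> N \<Longrightarrow> draw N LX \<inter> draw N (LT k) = {}"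
proof -
  assume "k \<le> N"
  then have k: "k \<le> N" .
  define s d where "s = sc k" and "d = dl N"
  note b = small_bounds[OF k, folded s_def d_def]
  have o0: "orient (fst (ends N LX)) (snd (ends N LX)) (fst (ends N (LT k))) = 63/2"
    unfolding ends.simps s_def[symmetric] d_def[symmetric] by (simp add: orient_def field_simps eval_nat_numeral)
  have o1: "orient (fst (ends N LX)) (snd (ends N LX)) (snd (ends N (LT k))) = 7/2 - 21/2 * (s) - 7 * (s^2)"
    unfolding ends.simps s_def[symmetric] d_def[symmetric] by (simp add: orient_def field_simps eval_nat_numeral)
  show ?thesis unfolding draw_def by (rule orient_pos_disjoint; unfold o0 o1; use b in linarith)
qed

lemma far_TA: "k \<le> N \<Longrightarrow> draw N (LA k) \<inter> draw N (LT k) = {}"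
proof -
  assume "k \<le> N"
  then have k: "k \<le> N" .
  define s d where "s = sc k" and "d = dl N"
  note b = small_bounds[OF k, folded s_def d_def]
  have o0: "orient (fst (ends N (LA k))) (snd (ends N (LA k))) (fst (ends N (LT k))) = - 16 - 4 * (d) - 16 * (s) - 4 * (s * d)"
    unfolding ends.simps s_def[symmetric] d_def[symmetric] by (simp add: orient_def field_simps eval_nat_numeral)
  have o1: "orient (fst (ends N (LA k))) (snd (ends N (LA k))) (snd (ends N (LT k))) = - 10 * (s) - 5/2 * (s * d) + 4 * (s^2) + (s^2 * d)"
    unfolding ends.simps s_def[symmetric] d_def[symmetric] by (simp add: orient_def field_simps eval_nat_numeral)
  show ?thesis unfolding draw_def by (rule orient_neg_disjoint; unfold o0 o1; use b in linarith)
qed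

lemma far_UA: "k \<le> N \<Longrightarrow> draw N (LA k) \<inter> draw N (LU k) = {}"
proof -
  assume "k \<le> N"
  then have k: "k \<le> N" .
  define s d where "s = sc k" and "d = dl N"
  note b = small_bounds[OF k, folded s_def d_def]
  have o0: "orient (fst (ends N (LA k))) (snd (ends N (LA k))) (fst (ends N (LU k))) = - 16 - 4 * (d) - 64 * (s) - 16 * (s * d) - 48 * (s^2) - 12 * (s^2 * d)"
    unfolding ends.simps s_def[symmetric] d_def[symmetric] by (simp add: orient_def field_simps eval_nat_numeral)
  have o1: "orient (fst (ends N (LA k))) (snd (ends N (LA k))) (snd (ends N (LU k))) = - 64 * (s) - 16 * (s * d) - 50 * (s^2) - 25/2 * (s^2 * d)"
    unfolding ends.simps s_def[symmetric] d_def[symmetric] by (simp add: orient_def field_simps eval_nat_numeral)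
  show ?thesis unfolding draw_def by (rule orient_neg_disjoint; unfold o0 o1; use b in linarith)
qed

lemma far_UB: "k \<le> N \<Longrightarrow> draw N (LB k) \<inter> draw N (LU k) = {}"
proof -
  assume "k \<le> N"
  then have k: "k \<le> N" .
  define s d where "s = sc k" and "d = dl N"
  note b = small_bounds[OF k, folded s_def d_def]
  have o0: "orient (fst (ends N (LB k))) (snd (ends N (LB k))) (fst (ends N (LU k))) = 8 + 4 * (d) + 58 * (s) + 13 * (s * d) + 104 * (s^2)"
    unfolding ends.simps s_def[symmetric] d_def[symmetric] by (simp add: orient_def field_simps eval_nat_numeral)
  have o1: "orient (fst (ends N (LB k))) (snd (ends N (LB k))) (snd (ends N (LU k))) = 26 * (s) + 13 * (s * d) + 105 * (s^2) + 1/2 * (s^2 * d) + 4 * (s^3)"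
    unfolding ends.simps s_def[symmetric] d_def[symmetric] by (simp add: orient_def field_simps eval_nat_numeral)
  show ?thesis unfolding draw_def by (rule orient_pos_disjoint; unfold o0 o1; use b in linarith)
qed

lemma far_CA: "k \<le> N \<Longrightarrow> draw N (LA k) \<inter> draw N (LC k) = {}"
proof -
  assume "k \<le> N"
  then have k: "k \<le> N" .
  define s d where "s = sc k" and "d = dl N"
  note b = small_bounds[OF k, folded s_def d_def]
  have o0: "orient (fst (ends N (LA k))) (snd (ends N (LA k))) (fst (ends N (LC k))) = - 10 * (s) - 5/2 * (s * d) + 4 * (s^2) + (s^2 * d)"
    unfolding ends.simps s_def[symmetric] d_def[symmetric] by (simp add: orient_def field_simps eval_nat_numeral)
  have o1: "orient (fst (ends N (LA k))) (snd (ends N (LA k))) (snd (ends N (LC k))) = - 64 * (s) - 16 * (s * d) - 50 * (s^2) - 25/2 * (s^2 * d)"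
    unfolding ends.simps s_def[symmetric] d_def[symmetric] by (simp add: orient_def field_simps eval_nat_numeral)
  show ?thesis unfolding draw_def by (rule orient_neg_disjoint; unfold o0 o1; use b in linarith)
qed

lemma far_CB: "k \<le> N \<Longrightarrow> draw N (LB k) \<inter> draw N (LC k) = {}"
proof -
  assume "k \<le> N"
  then have k: "k \<le> N" .
  define s d where "s = sc k" and "d = dl N"
  note b = small_bounds[OF k, folded s_def d_def]
  have o0: "orient (fst (ends N (LB k))) (snd (ends N (LB k))) (fst (ends N (LC k))) = 6 + 3 * (d) + 53 * (s) + 29/2 * (s * d) + 114 * (s^2) - (s^2 * d) - 8 * (s^3)"
    unfolding ends.simps s_def[symmetric] d_def[symmetric] by (simp add: orient_def field_simps eval_nat_numeral)
  have o1: "orient (fst (ends N (LB k))) (snd (ends N (LB k))) (snd (ends N (LC k))) = 26 * (s) + 13 * (s * d) + 105 * (s^2) + 1/2 * (s^2 * d) + 4 * (s^3)"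
    unfolding ends.simps s_def[symmetric] d_def[symmetric] by (simp add: orient_def field_simps eval_nat_numeral)
  show ?thesis unfolding draw_def by (rule orient_pos_disjoint; unfold o0 o1; use b in linarith)
qed

lemma far_TB: "k \<le> N \<Longrightarrow> draw N (LT k) \<inter> draw N (LB k) = {}"
proof -
  assume "k \<le> N"
  then have k: "k \<le> N" .
  define s d where "s = sc k" and "d = dl N"
  note b = small_bounds[OF k, folded s_def d_def]
  have o0: "orient (fst (ends N (LT k))) (snd (ends N (LT k))) (fst (ends N (LB k))) = - 14 - 149/4 * (s) - 31/2 * (s^2) - 8 * (s^3)"
    unfolding ends.simps s_def[symmetric] d_def[symmetric] by (simp add: orient_def field_simps eval_nat_numeral)
  have o1: "orient (fst (ends N (LT k))) (snd (ends N (LT k))) (snd (ends N (LB k))) = - 6 + 4 * (d) - 9/4 * (s) + 3/2 * (s * d) - 3/2 * (s^2) + (s^2 * d)"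
    unfolding ends.simps s_def[symmetric] d_def[symmetric] by (simp add: orient_def field_simps eval_nat_numeral)
  show ?thesis unfolding draw_def by (rule orient_neg_disjoint; unfold o0 o1; use b in linarith)
qed

text \<open>\<open>LC k\<close> crosses \<open>LY\<close> at \<open>(sc k)^2\<close> and
  \<open>LA (Suc k)\<close> at \<open>16 * sc (Suc k)\<close>, a quarter of it; this margin is the
  origin of the factor 1/64 in \<open>sc\<close>. \<open>LB (Suc k)\<close> crosses
  \<open>LY\<close> at the same place, and the margin also absorbs the terms in d.\<close>

lemma far_CA': "k < N \<Longrightarrow> draw N (LC k) \<inter> draw N (LA (Suc k)) = {}"
proof -
  assume "k < N"
  then have k: "k \<le> N" by simp
  define s d where "s = sc k" and "d = dl N"
  note b = small_bounds[OF k, folded s_def d_def]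
  have s': "sc (Suc k) = s^2 / 64" by (simp add: s_def)
  have o0: "orient (fst (ends N (LC k))) (snd (ends N (LC k))) (fst (ends N (LA (Suc k)))) = - 6 * (s) - 63/8 * (s^2) - 15/8 * (s^3)"
    unfolding ends.simps s' s_def[symmetric] d_def[symmetric] by (simp add: orient_def field_simps eval_nat_numeral)
  have o1: "orient (fst (ends N (LC k))) (snd (ends N (LC k))) (snd (ends N (LA (Suc k)))) = 3/2 * (s * d) - 9/8 * (s^2) + 27/16 * (s^2 * d) - 9/8 * (s^3) + 3/16 * (s^3 * d)"
    unfolding ends.simps s' s_def[symmetric] d_def[symmetric] by (simp add: orient_def field_simps eval_nat_numeral)
  show ?thesis unfolding draw_def by (rule orient_neg_disjoint; unfold o0 o1; use b in linarith)
qed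

lemma far_UA': "k < N \<Longrightarrow> draw N (LA (Suc k)) \<inter> draw N (LU k) = {}"
proof -
  assume "k < N"
  then have k: "k \<le> N" by simp
  define s d where "s = sc k" and "d = dl N"
  note b = small_bounds[OF k, folded s_def d_def]
  have s': "sc (Suc k) = s^2 / 64" by (simp add: s_def)
  have o0: "orient (fst (ends N (LA (Suc k)))) (snd (ends N (LA (Suc k)))) (fst (ends N (LU k))) = - 16 - 4 * (d) - (s^2) - 1/4 * (s^2 * d) - 3/4 * (s^3) - 3/16 * (s^3 * d)"
    unfolding ends.simps s' s_def[symmetric] d_def[symmetric] by (simp add: orient_def field_simps eval_nat_numeral)
  have o1: "orient (fst (ends N (LA (Suc k)))) (snd (ends N (LA (Suc k)))) (snd (ends N (LU k))) = - 3 * (s^2) - 3/4 * (s^2 * d) - 3/4 * (s^3) - 3/16 * (s^3 * d)"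
    unfolding ends.simps s' s_def[symmetric] d_def[symmetric] by (simp add: orient_def field_simps eval_nat_numeral)
  show ?thesis unfolding draw_def by (rule orient_neg_disjoint; unfold o0 o1; use b in linarith)
qed

lemma far_CD': "k < N \<Longrightarrow> draw N (LC k) \<inter> draw N (LD (Suc k)) = {}"
proof -
  assume "k < N"
  then have k: "k \<le> N" by simp
  define s d where "s = sc k" and "d = dl N"
  note b = small_bounds[OF k, folded s_def d_def]
  have s': "sc (Suc k) = s^2 / 64" by (simp add: s_def)
  have o0: "orient (fst (ends N (LC k))) (snd (ends N (LC k))) (fst (ends N (LD (Suc k)))) = - 6 - 6 * (s) + 3/2 * (s * d) - 3/2 * (s^2) + 3/2 * (s^2 * d) - 3/2 * (s^3)"
    unfolding ends.simps s' s_def[symmetric] d_def[symmetric] by (simp add: orient_def field_simps eval_nat_numeral)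
  have o1: "orient (fst (ends N (LC k))) (snd (ends N (LC k))) (snd (ends N (LD (Suc k)))) = 3/2 * (s * d) - 9/8 * (s^2) + 27/16 * (s^2 * d) - 9/8 * (s^3) + 3/16 * (s^3 * d)"
    unfolding ends.simps s' s_def[symmetric] d_def[symmetric] by (simp add: orient_def field_simps eval_nat_numeral)
  show ?thesis unfolding draw_def by (rule orient_neg_disjoint; unfold o0 o1; use b in linarith)
qed

lemma far_CB': "k < N \<Longrightarrow> draw N (LC k) \<inter> draw N (LB (Suc k)) = {}"
proof -
  assume "k < N"
  then have k: "k \<le> N" by simp
  define s d where "s = sc k" and "d = dl N"
  note b = small_bounds[OF k, folded s_def d_def]
  have s': "sc (Suc k) = s^2 / 64" by (simp add: s_def)
  have o0: "orient (fst (ends N (LC k))) (snd (ends N (LC k))) (fst (ends N (LB (Suc k)))) = - 6 - 3 * (s) + 3/2 * (s^2) - 21/16 * (s^3) + 3/16 * (s^4)"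
    unfolding ends.simps s' s_def[symmetric] d_def[symmetric] by (simp add: orient_def field_simps eval_nat_numeral)
  have o1: "orient (fst (ends N (LC k))) (snd (ends N (LC k))) (snd (ends N (LB (Suc k)))) = 3 * (d) + 3/2 * (s * d) - 9/8 * (s^2) - 3/2 * (s^2 * d) - 9/8 * (s^3)"
    unfolding ends.simps s' s_def[symmetric] d_def[symmetric] by (simp add: orient_def field_simps eval_nat_numeral)
  show ?thesis unfolding draw_def by (rule orient_neg_disjoint; unfold o0 o1; use b in linarith)
qed

lemma far_TB': "k < N \<Longrightarrow> draw N (LT k) \<inter> draw N (LB (Suc k)) = {}"
proof -
  assume "k < N"
  then have k: "k \<le> N" by simp
  define s d where "s = sc k" and "d = dl N"
  note b = small_bounds[OF k, folded s_def d_def]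
  have s': "sc (Suc k) = s^2 / 64" by (simp add: s_def)
  have o0: "orient (fst (ends N (LT k))) (snd (ends N (LT k))) (fst (ends N (LB (Suc k)))) = - 14 - 21/4 * (s) - 4 * (s^2) - 3/16 * (s^3) - 1/8 * (s^4)"
    unfolding ends.simps s' s_def[symmetric] d_def[symmetric] by (simp add: orient_def field_simps eval_nat_numeral)
  have o1: "orient (fst (ends N (LT k))) (snd (ends N (LT k))) (snd (ends N (LB (Suc k)))) = - 6 + 4 * (d) - 9/4 * (s) + 3/2 * (s * d) - 3/2 * (s^2) + (s^2 * d)"
    unfolding ends.simps s' s_def[symmetric] d_def[symmetric] by (simp add: orient_def field_simps eval_nat_numeral)
  show ?thesis unfolding draw_def by (rule orient_neg_disjoint; unfold o0 o1; use b in linarith)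
qed

lemma far_CE': "k < N \<Longrightarrow> draw N (LC k) \<inter> draw N (LE (Suc k)) = {}"
proof -
  assume "k < N"
  then have k: "k \<le> N" by simp
  define s d where "s = sc k" and "d = dl N"
  note b = small_bounds[OF k, folded s_def d_def]
  have s': "sc (Suc k) = s^2 / 64" by (simp add: s_def)
  have o0: "orient (fst (ends N (LC k))) (snd (ends N (LC k))) (fst (ends N (LE (Suc k)))) = - 6 - 6 * (s) - 3/2 * (s * d) - 3/2 * (s^2) - 3/2 * (s^2 * d) - 3/2 * (s^3)"
    unfolding ends.simps s' s_def[symmetric] d_def[symmetric] by (simp add: orient_def field_simps eval_nat_numeral)
  have o1: "orient (fst (ends N (LC k))) (snd (ends N (LC k))) (snd (ends N (LE (Suc k)))) = 3 * (d) + 3/2 * (s * d) - 9/8 * (s^2) - 3/2 * (s^2 * d) - 9/8 * (s^3)"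
    unfolding ends.simps s' s_def[symmetric] d_def[symmetric] by (simp add: orient_def field_simps eval_nat_numeral)
  show ?thesis unfolding draw_def by (rule orient_neg_disjoint; unfold o0 o1; use b in linarith)
qed

lemma far_DB': "k < N \<Longrightarrow> draw N (LB k) \<inter> draw N (LD (Suc k)) = {}"
proof -
  assume "k < N"
  then have k: "k \<le> N" by simp
  define s d where "s = sc k" and "d = dl N"
  note b = small_bounds[OF k, folded s_def d_def]
  have s': "sc (Suc k) = s^2 / 64" by (simp add: s_def)
  have o0: "orient (fst (ends N (LB k))) (snd (ends N (LB k))) (fst (ends N (LD (Suc k)))) = 8 - 2 * (d^2) + 64 * (s) + 128 * (s^2)"
    unfolding ends.simps s' s_def[symmetric] d_def[symmetric] by (simp add: orient_def field_simps eval_nat_numeral)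
  have o1: "orient (fst (ends N (LB k))) (snd (ends N (LB k))) (snd (ends N (LD (Suc k)))) = - 4 * (d) - 2 * (d^2) + 32 * (s) + 255/2 * (s^2) - 1/2 * (s^2 * d) - 1/8 * (s^2 * d^2) - 2 * (s^3) - (s^3 * d)"
    unfolding ends.simps s' s_def[symmetric] d_def[symmetric] by (simp add: orient_def field_simps eval_nat_numeral)
  show ?thesis unfolding draw_def by (rule orient_pos_disjoint; unfold o0 o1; use b in linarith)
qed

lemma fst_disjoint:
  "max (fst p) (fst q) < min (fst a) (fst b) \<Longrightarrow> closed_segment p q \<inter> closed_segment a (b :: real \<times> real) = {}"
proof -
  assume *: "max (fst p) (fst q) < min (fst a) (fst b)"
  have False if "z \<in> closed_segment p q" "z \<in> closed_segment a b" for z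
    using segment_fst[OF that(1)] segment_fst[OF that(2)] * by linarith
  then show ?thesis by blast
qed

lemma snd_disjoint:
  "max (snd p) (snd q) < min (snd a) (snd b) \<Longrightarrow> closed_segment p q \<inter> closed_segment a (b :: real \<times> real) = {}"
proof -
  assume *: "max (snd p) (snd q) < min (snd a) (snd b)"
  have False if "z \<in> closed_segment p q" "z \<in> closed_segment a b" for z
    using segment_snd[OF that(1)] segment_snd[OF that(2)] * by linarith
  then show ?thesis by blast
qed

lemma far_coordinate:
  "draw N LY \<inter> draw N LJ = {}"
  "draw N (LC 0) \<inter> draw N LW = {}" "draw N LW \<inter> draw N (LT 0) = {}" "draw N (LU 0) \<inter> draw N LW = {}"
  "k \<le> N \<Longrightarrow> draw N (LD k) \<inter> draw N LY = {}" "k \<le> N \<Longrightarrow> draw N LY \<inter> draw N (LE k) = {}"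
  "draw N LY \<inter> draw N (LT k) = {}" "draw N (LU k) \<inter> draw N LY = {}" "draw N (LU k) \<inter> draw N LZ = {}"
  "draw N (LT k) \<inter> draw N LG = {}"
  "k \<le> N \<Longrightarrow> draw N (LD j) \<inter> draw N (LT k) = {}" "draw N (LE j) \<inter> draw N (LT k) = {}"
  "draw N (LD j) \<inter> draw N (LE k) = {}"
  "k < N \<Longrightarrow> draw N (LU k) \<inter> draw N (LD (Suc k)) = {}"
proof -
  note s = sc_pos[of k] sc_le[of k] dl_small[of N] dl_le[of k N]
  have e: "sc k ^ 2 \<le> sc k / 16" using small_bounds(6)[of k k] by simp
  show "draw N LY \<inter> draw N LJ = {}" "draw N (LT k) \<inter> draw N LG = {}" "draw N LW \<inter> draw N (LT 0) = {}"
    "draw N LY \<inter> draw N (LT k) = {}" unfolding draw_def by (rule snd_disjoint; simp)+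
  show "draw N (LC 0) \<inter> draw N LW = {}" unfolding draw_def by (rule fst_disjoint) (simp add: power2_eq_square)
  show "draw N (LU 0) \<inter> draw N LW = {}" unfolding draw_def by (rule fst_disjoint) (simp add: power2_eq_square)
  show "draw N (LU k) \<inter> draw N LZ = {}" unfolding draw_def by (rule fst_disjoint) (use s in simp)
  show "draw N (LD k) \<inter> draw N LY = {}" unfolding draw_def by (rule snd_disjoint) (use s in simp)
  show "draw N LY \<inter> draw N (LE k) = {}" unfolding draw_def by (rule snd_disjoint) (use s in simp)
  show "draw N (LU k) \<inter> draw N LY = {}" unfolding draw_def by (rule snd_disjoint) (use s in simp)
  show "draw N (LD j) \<inter> draw N (LT k) = {}" unfolding draw_def by (rule snd_disjoint) (use s in simp)
  show "draw N (LE j) \<inter> draw N (LT k) = {}" unfolding draw_def by (rule snd_disjoint) (use s in simp)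
  show "draw N (LD j) \<inter> draw N (LE k) = {}" unfolding draw_def by (rule snd_disjoint) (use s in simp)
  show "draw N (LU k) \<inter> draw N (LD (Suc k)) = {}" if "k < N" unfolding draw_def by (rule snd_disjoint) (use s e that in \<open>simp; linarith\<close>)
qed

lemma far_JX: "draw N LX \<inter> draw N LJ = {}"
  unfolding draw_def by (rule orient_neg_disjoint) (simp_all add: orient_def)

lemma far_WH: "draw N LW \<inter> draw N LH = {}"
  using orient_neg_disjoint[of "(-3, 4)" "(4, -3)" "(1/2, -4)" "(1/2, 1/4)"]
    orient_pos_disjoint[of "(-3, 4)" "(4, -3)" "(1/2, -4)" "(1/2, 1/4)"]
  by (simp add: orient_def draw_def closed_segment_commute Int_commute)

text \<open>A proper convex combination of two numbers of modulus at most 4 has modulus 4 only if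
  both are 4 or both are -4; condition \<open>n\<close> excludes this in either coordinate.\<close>

lemma segment_square_boundary:
  fixes p q :: "real \<times> real"
  assumes z: "z \<in> closed_segment p q" "\<bar>fst z\<bar> = 4 \<or> \<bar>snd z\<bar> = 4"
    and p: "\<bar>fst p\<bar> \<le> 4" "\<bar>snd p\<bar> \<le> 4" and q: "\<bar>fst q\<bar> \<le> 4" "\<bar>snd q\<bar> \<le> 4"
    and n: "\<not> (\<bar>fst p\<bar> = 4 \<and> fst q = fst p)" "\<not> (\<bar>snd p\<bar> = 4 \<and> snd q = snd p)"
  shows "z = p \<or> z = q"
proof (rule ccontr)
  assume c: "\<not> (z = p \<or> z = q)"
  obtain t where t: "0 \<le> t" "t \<le> 1" and zt: "z = (1 - t) *\<^sub>R p + t *\<^sub>R q" using z(1) unfolding in_segment by blast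
  have "t \<noteq> 0" "t \<noteq> 1" using c zt by auto
  then have t: "0 < t" "0 < 1 - t" using t by auto
  have strict: "\<bar>(1 - t) * a + t * b\<bar> < 4" if "\<bar>a\<bar> \<le> 4" "\<bar>b\<bar> \<le> 4" "\<not> (\<bar>a\<bar> = 4 \<and> b = a)" for a b :: real
  proof -
    have "(1 - t) * a \<le> (1 - t) * 4" "t * b \<le> t * 4" "(1 - t) * (-4) \<le> (1 - t) * a" "t * (-4) \<le> t * b"
      by (rule mult_left_mono; use that t in linarith)+
    moreover have "a < 4 \<Longrightarrow> (1 - t) * a < (1 - t) * 4" "b < 4 \<Longrightarrow> t * b < t * 4"
      "-4 < a \<Longrightarrow> (1 - t) * (-4) < (1 - t) * a" "-4 < b \<Longrightarrow> t * (-4) < t * b"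
      by (rule mult_strict_left_mono; use t in linarith)+
    moreover have "(1 - t) * 4 + t * 4 = 4" "(1 - t) * (-4) + t * (-4) = -4" by (simp_all add: algebra_simps)
    moreover have "a < 4 \<or> b < 4" "-4 < a \<or> -4 < b" using that by auto
    ultimately show ?thesis by (smt (verit))
  qed
  have "\<bar>fst z\<bar> < 4" "\<bar>snd z\<bar> < 4" using strict[OF p(1) q(1) n(1)] strict[OF p(2) q(2) n(2)] by (simp_all add: zt)
  then show False using z(2) by auto
qed

text \<open>The first corner of the piece is excluded because the spoke \<open>LR i\<close> starts
  there, and inner segments must avoid the spokes.\<close>

definition contact :: "real \<Rightarrow> nat \<Rightarrow> real \<times> real \<Rightarrow> bool" where
  "contact d i z \<longleftrightarrow> z \<in> piece d (2 * i) \<and> z \<noteq> ring_pt d (2 * i)"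

lemma contactI:
  "i < 4 \<Longrightarrow> ring_coord d (Suc (2 * i)) \<le> x \<Longrightarrow> x < ring_coord d (2 * i) \<Longrightarrow> contact d i (x, 4)"
  "4 \<le> i \<Longrightarrow> i < 12 \<Longrightarrow> ring_coord d (Suc (2 * i)) \<le> x \<Longrightarrow> x < ring_coord d (2 * i) \<Longrightarrow> contact d i (- 4, x)"
  "12 \<le> i \<Longrightarrow> i < 14 \<Longrightarrow> ring_coord d (2 * i) < x \<Longrightarrow> x \<le> ring_coord d (Suc (2 * i)) \<Longrightarrow> contact d i (x, - 4)"
  "14 \<le> i \<Longrightarrow> i < 18 \<Longrightarrow> ring_coord d (2 * i) < x \<Longrightarrow> x \<le> ring_coord d (Suc (2 * i)) \<Longrightarrow> contact d i (4, x)"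
proof -
  show "contact d i (x, 4)" if "i < 4" "ring_coord d (Suc (2 * i)) \<le> x" "x < ring_coord d (2 * i)"
    using horizontal_segmentI[of "ring_coord d (2 * i)" "ring_coord d (Suc (2 * i))" x 4] that
    by (simp add: contact_def piece_def ring_pt_def)
  show "contact d i (- 4, x)" if "4 \<le> i" "i < 12" "ring_coord d (Suc (2 * i)) \<le> x" "x < ring_coord d (2 * i)"
    using vertical_segmentI[of "ring_coord d (2 * i)" "ring_coord d (Suc (2 * i))" x "-4"] that
    by (simp add: contact_def piece_def ring_pt_def)
  show "contact d i (x, - 4)" if "12 \<le> i" "i < 14" "ring_coord d (2 * i) < x" "x \<le> ring_coord d (Suc (2 * i))"
    using horizontal_segmentI[of "ring_coord d (2 * i)" "ring_coord d (Suc (2 * i))" x "-4"] that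
    by (simp add: contact_def piece_def ring_pt_def)
  show "contact d i (4, x)" if "14 \<le> i" "i < 18" "ring_coord d (2 * i) < x" "x \<le> ring_coord d (Suc (2 * i))"
    using vertical_segmentI[of "ring_coord d (2 * i)" "ring_coord d (Suc (2 * i))" x 4] that
    by (simp add: contact_def piece_def ring_pt_def)
qed

lemma contacts:
  assumes d: "0 < d" "d < 1/100"
  shows "contact d 0 (3, 4)" "contact d (Suc 0) (0, 4)" "contact d 3 (-3, 4)" "contact d 4 (-4, 3)" "contact d 5 (-4, 3/2)"
    "contact d 6 (-4, d)" "contact d 7 (-4, 0)" "contact d 8 (-4, - d)" "contact d 11 (-4, -3)"
    "contact d 12 (0, -4)" "contact d 13 (1/2, -4)" "contact d 14 (4, -3)" "contact d 15 (4, 0)" "contact d 16 (4, 1/2)"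
    "contact d 17 (4, 3)"
    "\<And>s. 2 * d < 16 * s \<Longrightarrow> s \<le> 1/16 \<Longrightarrow> contact d 2 (- 16 * s, 4)"
    "\<And>s. 2 * d < 3/2 * s \<Longrightarrow> s \<le> 1/16 \<Longrightarrow> contact d 9 (- 4, - 3/2 * s)"
    "\<And>s. 0 < s \<Longrightarrow> s \<le> 1/16 \<Longrightarrow> contact d 10 (- 4, - 2 - 8 * s)"
  using d by (auto intro!: contactI simp: ring_coord_def)

text \<open>Coarse bounds that suffice for the contacts with the ring, so that the case distinction
  in \<open>inner_contacts\<close> no longer mentions \<open>sc\<close>.\<close>

lemma ends_shape:
  assumes "k \<le> N"
  shows "\<exists>u v r. ends N (LC k) = ((u, 3/2), (- v, - r)) \<and> 0 < u \<and> u < 1 \<and> 0 < v \<and> v < 1 \<and> 0 < r \<and> r < 1"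
    "\<exists>u. ends N (LT k) = ((- 4, 3/2), (u, 3/2)) \<and> 0 < u \<and> u < 1"
    "\<exists>v r. ends N (LU k) = ((- 4, - r), (- v, - r)) \<and> 0 < v \<and> v < 1 \<and> 0 < r \<and> r < 1 \<and> contact (dl N) 9 (- 4, - r)"
    "\<exists>t w. ends N (LA k) = ((- t, 4), (w, - dl N)) \<and> 0 < t \<and> t \<le> 1 \<and> 0 < w \<and> w < 2 \<and> contact (dl N) 2 (- t, 4)"
    "\<exists>w. ends N (LD k) = ((- 4, - dl N), (w, - dl N)) \<and> 0 < w \<and> w < 2"
    "\<exists>r w. ends N (LB k) = ((- 4, - r), (w, dl N)) \<and> 0 < r \<and> r < 3 \<and> 0 < w \<and> w < 2 \<and> contact (dl N) 10 (- 4, - r)"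
    "\<exists>w. ends N (LE k) = ((- 4, dl N), (w, dl N)) \<and> 0 < w \<and> w < 2"
proof -
  note c = contacts[OF dl_small[of N]]
  define s d where "s = sc k" and "d = dl N"
  note b = small_bounds[OF assms, folded s_def d_def]
  have d: "dl N = d" "sc k = s" by (simp_all add: s_def d_def)
  have u: "0 < s * (s + 3/2)" "s * (s + 3/2) < 1"
    using b unfolding distrib_left power2_eq_square by linarith+
  have w: "0 < 16 * s + 8 * s * d" "16 * s + 8 * s * d < 2" using b by linarith+
  show "\<exists>u v r. ends N (LC k) = ((u, 3/2), (- v, - r)) \<and> 0 < u \<and> u < 1 \<and> 0 < v \<and> v < 1 \<and> 0 < r \<and> r < 1"
    by (rule exI[of _ "s * (s + 3/2)"], rule exI[of _ "s^2 / 2"], rule exI[of _ "3/2 * s"]) (use b u in \<open>simp add: d\<close>)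
  show "\<exists>u. ends N (LT k) = ((- 4, 3/2), (u, 3/2)) \<and> 0 < u \<and> u < 1" using u by (simp add: d)
  show "\<exists>v r. ends N (LU k) = ((- 4, - r), (- v, - r)) \<and> 0 < v \<and> v < 1 \<and> 0 < r \<and> r < 1 \<and> contact (dl N) 9 (- 4, - r)"
    by (rule exI[of _ "s^2 / 2"], rule exI[of _ "3/2 * s"]) (use b c(17)[of s] in \<open>simp add: d\<close>)
  show "\<exists>t w. ends N (LA k) = ((- t, 4), (w, - dl N)) \<and> 0 < t \<and> t \<le> 1 \<and> 0 < w \<and> w < 2 \<and> contact (dl N) 2 (- t, 4)"
    by (rule exI[of _ "16 * s"], rule exI[of _ "16 * s + 8 * s * d"]) (use b w c(16)[of s] in \<open>simp add: d\<close>)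
  show "\<exists>w. ends N (LD k) = ((- 4, - dl N), (w, - dl N)) \<and> 0 < w \<and> w < 2" using w by (simp add: d)
  show "\<exists>r w. ends N (LB k) = ((- 4, - r), (w, dl N)) \<and> 0 < r \<and> r < 3 \<and> 0 < w \<and> w < 2 \<and> contact (dl N) 10 (- 4, - r)"
    by (rule exI[of _ "2 + 8 * s"], rule exI[of _ "16 * s + 2 * d"]) (use b c(18)[of s] in \<open>simp add: d\<close>)
  show "\<exists>w. ends N (LE k) = ((- 4, dl N), (w, dl N)) \<and> 0 < w \<and> w < 2" using b by (simp add: d)
qed

lemma inner_contacts:
  assumes "inner N l"
  shows "\<bar>fst (fst (ends N l))\<bar> \<le> 4" "\<bar>snd (fst (ends N l))\<bar> \<le> 4" "\<bar>fst (snd (ends N l))\<bar> \<le> 4" "\<bar>snd (snd (ends N l))\<bar> \<le> 4"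
    "\<not> (\<bar>fst (fst (ends N l))\<bar> = 4 \<and> fst (snd (ends N l)) = fst (fst (ends N l)))"
    "\<not> (\<bar>snd (fst (ends N l))\<bar> = 4 \<and> snd (snd (ends N l)) = snd (fst (ends N l)))"
    "\<And>z. z = fst (ends N l) \<or> z = snd (ends N l) \<Longrightarrow> \<bar>fst z\<bar> = 4 \<or> \<bar>snd z\<bar> = 4 \<Longrightarrow> \<exists>i\<in>att l. contact (dl N) i z"
    "\<And>i. i \<in> att l \<Longrightarrow> contact (dl N) i (fst (ends N l)) \<or> contact (dl N) i (snd (ends N l))"
proof -
  note c = contacts(1-15)[OF dl_small[of N]] dl_small[of N]
  have *: "\<bar>fst (fst (ends N l))\<bar> \<le> 4 \<and> \<bar>snd (fst (ends N l))\<bar> \<le> 4 \<and> \<bar>fst (snd (ends N l))\<bar> \<le> 4 \<and> \<bar>snd (snd (ends N l))\<bar> \<le> 4 \<and>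
    \<not> (\<bar>fst (fst (ends N l))\<bar> = 4 \<and> fst (snd (ends N l)) = fst (fst (ends N l))) \<and> \<not> (\<bar>snd (fst (ends N l))\<bar> = 4 \<and> snd (snd (ends N l)) = snd (fst (ends N l))) \<and>
    (\<forall>z\<in>{(fst (ends N l)), (snd (ends N l))}. \<bar>fst z\<bar> < 4 \<and> \<bar>snd z\<bar> < 4 \<or> (\<exists>i\<in>att l. contact (dl N) i z)) \<and>
    (\<forall>i\<in>att l. contact (dl N) i (fst (ends N l)) \<or> contact (dl N) i (snd (ends N l)))"
  proof (cases l)
    case (LC k)
    with assms have "k \<le> N" by simp
    from ends_shape(1)[OF this] obtain u v r where "ends N (LC k) = ((u, 3/2), (- v, - r))" "0 < u" "u < 1" "0 < v" "v < 1" "0 < r" "r < 1"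
      by (elim exE conjE)
    then show ?thesis using c(16,17) by (simp add: LC c(1-15) del: ends.simps)
  next
    case (LA k)
    with assms have "k \<le> N" by simp
    from ends_shape(4)[OF this] obtain t w where "ends N (LA k) = ((- t, 4), (w, - dl N))" "0 < t" "t \<le> 1" "0 < w" "w < 2" "contact (dl N) 2 (- t, 4)"
      by (elim exE conjE)
    then show ?thesis using c(16,17) by (simp add: LA c(1-15) del: ends.simps)
  next
    case (LB k)
    with assms have "k \<le> N" by simp
    from ends_shape(6)[OF this] obtain r w where "ends N (LB k) = ((- 4, - r), (w, dl N))" "0 < r" "r < 3" "0 < w" "w < 2" "contact (dl N) 10 (- 4, - r)"
      by (elim exE conjE)
    then show ?thesis using c(16,17) by (simp add: LB c(1-15) del: ends.simps)
  next
    case (LD k)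
    with assms have "k \<le> N" by simp
    from ends_shape(5)[OF this] obtain w where "ends N (LD k) = ((- 4, - dl N), (w, - dl N))" "0 < w" "w < 2"
      by (elim exE conjE)
    then show ?thesis using c(16,17) by (simp add: LD c(1-15) del: ends.simps)
  next
    case (LE k)
    with assms have "k \<le> N" by simp
    from ends_shape(7)[OF this] obtain w where "ends N (LE k) = ((- 4, dl N), (w, dl N))" "0 < w" "w < 2"
      by (elim exE conjE)
    then show ?thesis using c(16,17) by (simp add: LE c(1-15) del: ends.simps)
  next
    case (LT k)
    with assms have "k \<le> N" by simp
    from ends_shape(2)[OF this] obtain u where "ends N (LT k) = ((- 4, 3/2), (u, 3/2))" "0 < u" "u < 1"
      by (elim exE conjE)
    then show ?thesis using c(16,17) by (simp add: LT c(1-15) del: ends.simps)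
  next
    case (LU k)
    with assms have "k \<le> N" by simp
    from ends_shape(3)[OF this] obtain v r where "ends N (LU k) = ((- 4, - r), (- v, - r))" "0 < v" "v < 1" "0 < r" "r < 1" "contact (dl N) 9 (- 4, - r)"
      by (elim exE conjE)
    then show ?thesis using c(16,17) by (simp add: LU c(1-15) del: ends.simps)
  qed (use assms in \<open>auto simp: c\<close>)
  note r1 = *[THEN conjunct2] note r2 = r1[THEN conjunct2] note r3 = r2[THEN conjunct2]
  note r4 = r3[THEN conjunct2] note r5 = r4[THEN conjunct2] note r6 = r5[THEN conjunct2]
  show "\<bar>fst (fst (ends N l))\<bar> \<le> 4" "\<bar>snd (fst (ends N l))\<bar> \<le> 4" "\<bar>fst (snd (ends N l))\<bar> \<le> 4" "\<bar>snd (snd (ends N l))\<bar> \<le> 4"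
    "\<not> (\<bar>fst (fst (ends N l))\<bar> = 4 \<and> fst (snd (ends N l)) = fst (fst (ends N l)))"
    "\<not> (\<bar>snd (fst (ends N l))\<bar> = 4 \<and> snd (snd (ends N l)) = snd (fst (ends N l)))"
    by (rule *[THEN conjunct1] r1[THEN conjunct1] r2[THEN conjunct1] r3[THEN conjunct1] r4[THEN conjunct1] r5[THEN conjunct1])+
  have 1: "\<forall>z\<in>{fst (ends N l), snd (ends N l)}. \<bar>fst z\<bar> < 4 \<and> \<bar>snd z\<bar> < 4 \<or> (\<exists>i\<in>att l. contact (dl N) i z)"
    and 2: "\<forall>i\<in>att l. contact (dl N) i (fst (ends N l)) \<or> contact (dl N) i (snd (ends N l))"
    by (rule r6[THEN conjunct1] r6[THEN conjunct2])+
  show "\<exists>i\<in>att l. contact (dl N) i z"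
    if z: "z = fst (ends N l) \<or> z = snd (ends N l)" "\<bar>fst z\<bar> = 4 \<or> \<bar>snd z\<bar> = 4" for z
  proof -
    have "z \<in> {fst (ends N l), snd (ends N l)}" using z(1) by simp
    then have "\<bar>fst z\<bar> < 4 \<and> \<bar>snd z\<bar> < 4 \<or> (\<exists>i\<in>att l. contact (dl N) i z)" by (rule bspec[OF 1])
    then show ?thesis using z(2) by (elim disjE conjE) simp_all
  qed
  show "contact (dl N) i (fst (ends N l)) \<or> contact (dl N) i (snd (ends N l))" if "i \<in> att l" for i
    using 2 that by blast
qed

lemma draw_P: "i < 18 \<Longrightarrow> draw N (LP i) = piece (dl N) (2 * i)" and draw_Q: "i < 18 \<Longrightarrow> draw N (LQ i) = piece (dl N) (2 * i + 1)"
  by (simp_all add: draw_def piece_def)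

lemma inner_square:
  assumes "inner N l" "z \<in> draw N l"
  shows "\<bar>fst z\<bar> \<le> 4" "\<bar>snd z\<bar> \<le> 4"
proof -
  have z: "z \<in> closed_segment (fst (ends N l)) (snd (ends N l))" using assms(2) by (simp add: draw_def)
  show "\<bar>fst z\<bar> \<le> 4" "\<bar>snd z\<bar> \<le> 4" using segment_fst[OF z] segment_snd[OF z] inner_contacts(1-4)[OF assms(1)] by linarith+
qed

lemma inner_boundary:
  assumes "inner N l" "z \<in> draw N l" "\<bar>fst z\<bar> = 4 \<or> \<bar>snd z\<bar> = 4"
  shows "\<exists>i\<in>att l. contact (dl N) i z"
  by (rule inner_contacts(7)[OF assms(1) segment_square_boundary[OF assms(2)[unfolded draw_def] assms(3) inner_contacts(1-6)[OF assms(1)]] assms(3)])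

lemma att_less: "i \<in> att l \<Longrightarrow> i < 18" by (cases l) auto

lemma ring_mods:
  assumes "i < 18"
  shows "Suc (2 * i) mod 36 = Suc (2 * i)" "Suc (2 * i + 1) mod 36 = (if i = 17 then 0 else 2 * i + 2)"
    "Suc i mod 18 = (if i = 17 then 0 else Suc i)"
  using assms by auto

text \<open>An inner segment reaches the boundary of the square only in contacts, and different even
  pieces are disjoint.\<close>

lemma far_inner_P:
  assumes "inner N l" "i < 18" "i \<notin> att l"
  shows "draw N l \<inter> draw N (LP i) = {}"
proof -
  have False if z: "z \<in> draw N l" "z \<in> draw N (LP i)" for z
  proof -
    have zp: "z \<in> piece (dl N) (2 * i)" using z(2) draw_P[OF assms(2)] by simp
    obtain j where j: "j \<in> att l" "z \<in> piece (dl N) (2 * j)"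
      using inner_boundary[OF assms(1) z(1) even_piece_boundary[OF dl_small zp assms(2)]] by (auto simp: contact_def)
    have "i \<noteq> j" "j < 18" using j(1) assms(3) att_less by blast+
    moreover have "2 * j \<noteq> Suc (2 * i) mod 36" "2 * i \<noteq> Suc (2 * j) mod 36"
      unfolding ring_mods(1)[OF assms(2)] ring_mods(1)[OF \<open>j < 18\<close>] by presburger+
    ultimately show False using piece_disjoint[OF dl_small, of "2 * i" "2 * j" N] j(2) zp assms(2) by auto
  qed
  then show ?thesis by blast
qed

text \<open>Within the square a spoke has only its base point, the first corner of an even piece,
  and this point is not a contact.\<close>

lemma far_inner_R:
  assumes "inner N l" "i < 18"
  shows "draw N l \<inter> draw N (LR i) = {}"
proof -
  have False if z: "z \<in> draw N l" "z \<in> draw N (LR i)" for z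
  proof -
    have "z = ring_pt (dl N) (2 * i)"
      by (rule spoke_base[OF dl_small _ inner_square[OF assms(1) z(1)]]) (use z(2) in \<open>simp add: draw_def\<close>)
    then have zp: "z \<in> piece (dl N) (2 * i)" by (simp add: piece_def)
    obtain j where j: "j \<in> att l" "contact (dl N) j z"
      using inner_boundary[OF assms(1) z(1) even_piece_boundary[OF dl_small zp assms(2)]] by blast
    then have "i \<noteq> j" "j < 18" using \<open>z = _\<close> att_less by (auto simp: contact_def)
    moreover have "2 * j \<noteq> Suc (2 * i) mod 36" "2 * i \<noteq> Suc (2 * j) mod 36"
      unfolding ring_mods(1)[OF assms(2)] ring_mods(1)[OF \<open>j < 18\<close>] by presburger+
    ultimately show False using piece_disjoint[OF dl_small, of "2 * i" "2 * j" N] j(2) zp assms(2) by (auto simp: contact_def)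
  qed
  then show ?thesis by blast
qed

lemma outer_cases:
  assumes "z \<in> draw N (LO i)" "i < 4"
  shows "\<bar>fst z\<bar> = 8 \<or> \<bar>snd z\<bar> = 8"
proof -
  have z: "z \<in> closed_segment (fst (ends N (LO i))) (snd (ends N (LO i)))" using assms(1) by (simp add: draw_def)
  note b = segment_fst[OF z] segment_snd[OF z]
  consider "i = 0" | "i = Suc 0" | "i = 2" | "i = 3" using assms(2) by linarith
  then show ?thesis by cases (use b in auto)
qed

lemma far_inner_O:
  assumes "inner N l" "i < 4"
  shows "draw N l \<inter> draw N (LO i) = {}"
proof -
  have False if "z \<in> draw N l" "z \<in> draw N (LO i)" for z
    using inner_square[OF assms(1) that(1)] outer_cases[OF that(2) assms(2)] by linarith
  then show ?thesis by blast
qed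

lemma far_ring:
  assumes "i < 18" "j < 18"
  shows "i \<noteq> j \<Longrightarrow> draw N (LP i) \<inter> draw N (LP j) = {}"
    "j \<noteq> i \<Longrightarrow> j \<noteq> Suc i mod 18 \<Longrightarrow> draw N (LQ i) \<inter> draw N (LP j) = {}"
    "i \<noteq> j \<Longrightarrow> draw N (LQ i) \<inter> draw N (LQ j) = {}"
proof -
  have *: "piece (dl N) m \<inter> piece (dl N) n = {}"
    if "m < 36" "n < 36" "m \<noteq> n" "n \<noteq> Suc m mod 36" "m \<noteq> Suc n mod 36" for m n
    by (rule piece_disjoint[OF dl_small that])
  note u = draw_P[OF assms(1)] draw_P[OF assms(2)] draw_Q[OF assms(1)] draw_Q[OF assms(2)]
  note r = ring_mods(1,2)[OF assms(1)] ring_mods(1,2)[OF assms(2)]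
  show "draw N (LP i) \<inter> draw N (LP j) = {}" if "i \<noteq> j"
    unfolding u by (rule *; (simp only: r)?; use assms that in presburger)
  show "draw N (LQ i) \<inter> draw N (LP j) = {}" if "j \<noteq> i" "j \<noteq> Suc i mod 18"
    unfolding u by (rule *; (simp only: r)?; use assms that[unfolded ring_mods(3)[OF assms(1)]] in presburger)
  show "draw N (LQ i) \<inter> draw N (LQ j) = {}" if "i \<noteq> j"
    unfolding u by (rule *; (simp only: r)?; use assms that in presburger)
qed

lemma far_outer_ring:
  assumes "i < 4" "j < 18"
  shows "draw N (LO i) \<inter> draw N (LP j) = {}" "draw N (LO i) \<inter> draw N (LQ j) = {}"
proof -
  have *: False if "z \<in> draw N (LO i)" "z \<in> piece (dl N) m" "m < 36" for z m
    using outer_cases[OF that(1) assms(1)] piece_box[OF dl_small that(2,3)] by linarith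
  show "draw N (LO i) \<inter> draw N (LP j) = {}" "draw N (LO i) \<inter> draw N (LQ j) = {}"
    unfolding draw_P[OF assms(2)] draw_Q[OF assms(2)] disjoint_iff
    using *[of _ "2 * j"] *[of _ "2 * j + 1"] assms(2) by (simp, blast)+
qed

lemma far_spoke:
  "i < 18 \<Longrightarrow> j < 18 \<Longrightarrow> i \<noteq> j \<Longrightarrow> draw N (LR i) \<inter> draw N (LP j) = {}"
  "i < 18 \<Longrightarrow> j < 18 \<Longrightarrow> j \<noteq> i \<Longrightarrow> Suc j mod 18 \<noteq> i \<Longrightarrow> draw N (LR i) \<inter> draw N (LQ j) = {}"
proof -
  have *: "draw N (LR i) \<inter> piece (dl N) m = {}" if "m < 36" "m \<noteq> 2 * i" "m \<noteq> Suc (2 * i) mod 36" "2 * i \<noteq> Suc m mod 36" "i < 18" for m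
    using spoke_piece[OF dl_small, of _ N "2 * i" m] that by (auto simp: draw_def)
  show "draw N (LR i) \<inter> draw N (LP j) = {}" if "i < 18" "j < 18" "i \<noteq> j"
    unfolding draw_P[OF that(2)]
    by (rule *; (simp only: ring_mods(1,2)[OF that(1)] ring_mods(1,2)[OF that(2)])?; use that in presburger)
  show "draw N (LR i) \<inter> draw N (LQ j) = {}" if "i < 18" "j < 18" "j \<noteq> i" "Suc j mod 18 \<noteq> i"
    unfolding draw_Q[OF that(2)]
    by (rule *; (simp only: ring_mods(1,2)[OF that(1)] ring_mods(1,2)[OF that(2)])?;
        use that(1-3) that(4)[unfolded ring_mods(3)[OF that(2)]] in presburger)
qed

lemma far_draw:
  assumes "far N a b"
  shows "draw N a \<inter> draw N b = {}"
  using assms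
proof (cases rule: far.cases)
  case inner_P then show ?thesis using far_inner_P by auto
next
  case inner_R then show ?thesis using far_inner_R by auto
next
  case inner_O then show ?thesis using far_inner_O by auto
next
  case PP then show ?thesis using far_ring(1) by auto
next
  case QP then show ?thesis using far_ring(2) by auto
next
  case QQ then show ?thesis using far_ring(3) by auto
next
  case OP then show ?thesis using far_outer_ring(1) by auto
next
  case OQ then show ?thesis using far_outer_ring(2) by auto
next
  case RP then show ?thesis using far_spoke(1) by auto
next
  case RQ then show ?thesis using far_spoke(2) by auto
next
  case JX then show ?thesis using far_JX by (simp add: Int_commute)
next
  case JY then show ?thesis using far_coordinate(1) by (simp add: Int_commute)
next
  case WH then show ?thesis using far_WH by simp
next
  case WC then show ?thesis using far_coordinate(2) by (simp add: Int_commute)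
next
  case WT then show ?thesis using far_coordinate(3) by simp
next
  case WU then show ?thesis using far_coordinate(4) by (simp add: Int_commute)
next
  case DY then show ?thesis using far_coordinate(5) by simp
next
  case EY then show ?thesis using far_coordinate(6) by (simp add: Int_commute)
next
  case TX then show ?thesis using far_TX by (simp add: Int_commute)
next
  case TY then show ?thesis using far_coordinate(7) by (simp add: Int_commute)
next
  case TG then show ?thesis using far_coordinate(10) by simp
next
  case TA then show ?thesis using far_TA by (simp add: Int_commute)
next
  case TD then show ?thesis using far_coordinate(11) by (simp add: Int_commute)
next
  case UY then show ?thesis using far_coordinate(8) by simp
next
  case UZ then show ?thesis using far_coordinate(9) by simp
next
  case UA then show ?thesis using far_UA by (simp add: Int_commute)
next
  case UB then show ?thesis using far_UB by (simp add: Int_commute)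
next
  case CA then show ?thesis using far_CA by (simp add: Int_commute)
next
  case CB then show ?thesis using far_CB by (simp add: Int_commute)
next
  case TB then show ?thesis using far_TB by simp
next
  case CA' then show ?thesis using far_CA' by simp
next
  case UA' then show ?thesis using far_UA' by (simp add: Int_commute)
next
  case CD' then show ?thesis using far_CD' by simp
next
  case UD' then show ?thesis using far_coordinate(14) by simp
next
  case (TD' k) then show ?thesis using far_coordinate(11)[of k N "Suc k"] by (simp add: Int_commute)
next
  case CB' then show ?thesis using far_CB' by simp
next
  case TB' then show ?thesis using far_TB' by simp
next
  case CE' then show ?thesis using far_CE' by simp
next
  case (TE' k) then show ?thesis using far_coordinate(12)[of N "Suc k" k] by (simp add: Int_commute)
next
  case DB' then show ?thesis using far_DB' by (simp add: Int_commute)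
next
  case DE' then show ?thesis using far_coordinate(13) by simp
qed

lemma near_draw:
  assumes "near N a b"
  shows "draw N a \<inter> draw N b \<noteq> {}"
proof -
  have meetI: "draw N a \<inter> draw N b \<noteq> {}" if "z \<in> draw N a" "z \<in> draw N b" for z a b using that by blast
  have e: "fst (ends N l) \<in> draw N l" "snd (ends N l) \<in> draw N l" for l by (simp_all add: draw_def)
  have h: "(x, y) \<in> closed_segment (u, y) (v, y)" if "min u v \<le> x" "x \<le> max u v" for x y u v :: real
    using horizontal_segmentI[OF that] .
  have v: "(x, y) \<in> closed_segment (x, u) (x, v)" if "min u v \<le> y" "y \<le> max u v" for x y u v :: real
    using vertical_segmentI[OF that] .
  show ?thesis using assms
  proof (cases rule: near.cases)
    case (inner_P i)
    have "i < 18" using inner_P att_less by auto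
    then show ?thesis using inner_contacts(8)[of N a i] inner_P e[of a] draw_P[of i N] by (auto simp: contact_def)
  next
    case (QP i) show ?thesis unfolding QP(1,2) by (rule meetI[of "snd (ends N (LP i))"]) (use QP e[of "LP i"] e[of "LQ i"] in simp_all)
  next
    case (QP' i)
    have "fst (ends N (LP (Suc i mod 18))) = snd (ends N (LQ i))" using QP'(3) ring_mods(2,3)[OF QP'(3)] by (auto split: if_splits)
    then show ?thesis unfolding QP'(1,2) using e by (intro meetI[of "snd (ends N (LQ i))"]) metis+
  next
    case (RP i) show ?thesis unfolding RP(1,2) by (rule meetI[of "fst (ends N (LP i))"]) (use e[of "LP i"] e[of "LR i"] in simp_all)
  next
    case (RO i)
    have b: "-7/2 \<le> ring_coord (dl N) (2 * i) \<and> ring_coord (dl N) (2 * i) \<le> 7/2"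
      by (rule ring_coord_bounds[OF dl_small]) (use RO in simp)
    consider "i \<le> 3" | "4 \<le> i" "i \<le> 11" | "12 \<le> i" "i \<le> 13" | "14 \<le> i" by linarith
    then have "spoke_tip (dl N) (2 * i) \<in> draw N (LO (side i))"
    proof cases
      case 1 then show ?thesis using b by (auto simp: spoke_tip_def side_def draw_def intro!: h)
    next
      case 2 then show ?thesis using b by (auto simp: spoke_tip_def side_def draw_def intro!: v)
    next
      case 3 then show ?thesis using b by (auto simp: spoke_tip_def side_def draw_def intro!: h)
    next
      case 4 then show ?thesis using b by (auto simp: spoke_tip_def side_def draw_def intro!: v)
    qed
    then show ?thesis unfolding RO(1,2) using e(2)[of "LR i"] by (intro meetI[of "spoke_tip (dl N) (2 * i)"]) simp_all
  next
    case (OO i)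
    then have "i = 0 \<or> i = Suc 0 \<or> i = 2" by linarith
    then have "snd (ends N (LO i)) = fst (ends N (LO (Suc i)))" by auto
    then show ?thesis unfolding OO(1,2) using e by (intro meetI[of "snd (ends N (LO i))"]) metis+
  next
    case JZ
    have "(0, 1/2) \<in> draw N LJ" "(0, 1/2) \<in> draw N LZ" by (auto simp: draw_def intro!: h v)
    then show ?thesis unfolding JZ by blast
  next
    case WY
    have "(1/2, 0) \<in> draw N LW" "(1/2, 0) \<in> draw N LY" by (auto simp: draw_def intro!: h v)
    then show ?thesis unfolding WY by blast
  next
    case (TC k)
    have "snd (ends N (LT k)) = fst (ends N (LC k))" by simp
    then show ?thesis unfolding TC(1,2) using e by (intro meetI[of "snd (ends N (LT k))"]) metis+
  next
    case (CU k)
    have "snd (ends N (LC k)) = snd (ends N (LU k))" by simp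
    then show ?thesis unfolding CU(1,2) using e by (intro meetI[of "snd (ends N (LC k))"]) metis+
  next
    case (AD k)
    have "snd (ends N (LA k)) = snd (ends N (LD k))" by simp
    then show ?thesis unfolding AD(1,2) using e by (intro meetI[of "snd (ends N (LA k))"]) metis+
  next
    case (BE k)
    have "snd (ends N (LB k)) = snd (ends N (LE k))" by simp
    then show ?thesis unfolding BE(1,2) using e by (intro meetI[of "snd (ends N (LB k))"]) metis+
  next
    case (TZ k)
    have "(0, 3/2) \<in> draw N (LT k)" "(0, 3/2) \<in> draw N LZ" using sc_pos[of k] by (auto simp: draw_def le_max_iff_disj intro!: h v)
    then show ?thesis unfolding TZ by blast
  qed
qed

text \<open>If two consecutive corners coincided, the piece ending in the first and the piece
  starting in the second would share a point, although they are not neighbours.\<close>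

lemma ring_pt_neq:
  assumes "j < 36"
  shows "ring_pt (dl N) j \<noteq> ring_pt (dl N) (Suc j mod 36)"
proof
  assume eq: "ring_pt (dl N) j = ring_pt (dl N) (Suc j mod 36)"
  let ?j = "Suc j mod 36" let ?k = "(if j = 0 then 35 else j - 1)"
  have m: "?j = (if j = 35 then 0 else Suc j)" "Suc ?k mod 36 = j" using assms by auto
  have "ring_pt (dl N) j \<in> piece (dl N) ?k" using m(2) by (simp add: piece_def)
  moreover have "ring_pt (dl N) j \<in> piece (dl N) ?j" using eq by (simp add: piece_def)
  moreover have "piece (dl N) ?k \<inter> piece (dl N) ?j = {}"
  proof -
    consider "j = 0" | "j = 34" | "j = 35" | "0 < j" "j < 34" using assms by linarith
    then have "?k < 36 \<and> ?j < 36 \<and> ?k \<noteq> ?j \<and> ?j \<noteq> Suc ?k mod 36 \<and> ?k \<noteq> Suc ?j mod 36" by cases auto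
    then show ?thesis using piece_disjoint[OF dl_small] by blast
  qed
  ultimately show False by blast
qed

lemma ends_neq:
  assumes "lab_ok N l"
  shows "fst (ends N l) \<noteq> snd (ends N l)"
proof -
  have pos: "0 < sc k * (sc k + 3/2)" "0 < 16 * sc k + 8 * sc k * dl N" "0 < 16 * sc k + 2 * dl N" for k
    using sc_pos[of k] dl_pos[of N] by (auto intro!: add_pos_pos)
  show ?thesis
  proof (cases l)
    case (LP i) then show ?thesis using assms ring_pt_neq[of "2 * i" N] by simp
  next
    case (LQ i) then show ?thesis using assms ring_pt_neq[of "2 * i + 1" N] by simp
  next
    case (LO i)
    then have "i = 0 \<or> i = Suc 0 \<or> i = 2 \<or> i = 3" using assms by auto
    then show ?thesis using LO by auto
  next
    case (LC k) then show ?thesis using sc_pos[of k] by simp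
  next
    case (LU k) then show ?thesis using ends_shape(3)[of k N] assms by auto
  next
    case (LT k) then show ?thesis using pos(1)[of k] by simp
  next
    case (LD k) then show ?thesis using pos(2)[of k] by simp
  next
    case (LE k) then show ?thesis using pos(3)[of k] by simp
  next
    case (LA k) then show ?thesis using dl_pos[of N] by simp
  next
    case (LB k) then show ?thesis using pos(3)[of k] by simp
  qed (auto simp: ring_pt_def spoke_tip_def)
qed

section \<open>The mirror image of the drawing\<close>

definition mirror :: "real \<times> real \<Rightarrow> real \<times> real" where "mirror z = (- fst z, snd z)"

lemma mirror_mirror [simp]: "mirror (mirror z) = z" by (simp add: mirror_def)
lemma inj_mirror: "inj mirror" by (rule inj_on_inverseI[of _ mirror]) simp

lemma mirror_segment: "mirror ` closed_segment a b = closed_segment (mirror a) (mirror b)"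
proof (rule closed_segment_linear_image[symmetric])
  show "linear mirror" by (rule linearI) (auto simp: mirror_def)
qed

lemma mirror_draw: "mirror ` draw N LX = draw N LH" "mirror ` draw N LH = draw N LX"
  "mirror ` draw N LY = draw N LY" "mirror ` draw N LZ = draw N LZ"
  unfolding draw_def mirror_segment by (simp_all add: mirror_def closed_segment_commute[of "(4, 0)"])

lemma draw_nonempty: "draw N l \<noteq> {}" by (simp add: draw_def)

subsection \<open>Integer realizations of two mirrored copies\<close>

lemma Ints_dirdet: "u \<in> \<int> \<times> \<int> \<Longrightarrow> v \<in> \<int> \<times> \<int> \<Longrightarrow> dirdet u v \<in> \<int>"
  by (auto simp: dirdet_def)

lemma Ints_diff_pair: "u \<in> \<int> \<times> \<int> \<Longrightarrow> v \<in> \<int> \<times> \<int> \<Longrightarrow> u - v \<in> \<int> \<times> \<int>"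
  by (auto simp: mem_Times_iff)

lemma dirdet_bound:
  assumes "\<bar>fst u\<bar> \<le> b" "\<bar>snd u\<bar> \<le> b" "\<bar>fst v\<bar> \<le> b" "\<bar>snd v\<bar> \<le> b"
  shows "\<bar>dirdet u v\<bar> \<le> 2 * b^2"
proof -
  have "\<bar>fst u * snd v\<bar> \<le> b * b" "\<bar>snd u * fst v\<bar> \<le> b * b"
    using assms unfolding abs_mult by (intro mult_mono; linarith)+
  then show ?thesis unfolding dirdet_def power2_eq_square by linarith
qed

text \<open>By Cramer's rule the parameter t of p on the second line has the denominator
  \<open>dirdet (c' - c) (y' - y)\<close>. The product of this denominator and the determinant for z
  is therefore an integer, and it is nonzero.\<close>

lemma crossing_height:
  assumes i: "c \<in> \<int> \<times> \<int>" "c' \<in> \<int> \<times> \<int>" "y \<in> \<int> \<times> \<int>" "y' \<in> \<int> \<times> \<int>" "z \<in> \<int> \<times> \<int>" "z' \<in> \<int> \<times> \<int>"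
    and p: "p \<in> closed_segment c c'" "p \<in> closed_segment y y'"
    and D: "dirdet (c' - c) (y' - y) \<noteq> 0" and nz: "dirdet (z' - z) (p - z) \<noteq> 0"
  shows "1 \<le> \<bar>dirdet (c' - c) (y' - y)\<bar> * \<bar>dirdet (z' - z) (p - z)\<bar>"
proof -
  obtain s where s: "p = (1 - s) *\<^sub>R c + s *\<^sub>R c'" using p(1) unfolding in_segment by blast
  obtain t where t: "p = (1 - t) *\<^sub>R y + t *\<^sub>R y'" using p(2) unfolding in_segment by blast
  define m where "m = dirdet (c' - c) (c - y)"
  have "dirdet (c' - c) (p - c) = 0" unfolding s dirdet_def by (simp add: algebra_simps)
  moreover have "dirdet (c' - c) (p - c) = dirdet (c' - c) (y - c) + t * dirdet (c' - c) (y' - y)"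
    unfolding t dirdet_def by (simp add: algebra_simps)
  ultimately have tD: "t * dirdet (c' - c) (y' - y) = m" unfolding m_def dirdet_def by (simp add: algebra_simps)
  have "dirdet (z' - z) (p - z) = dirdet (z' - z) (y - z) + t * dirdet (z' - z) (y' - y)"
    unfolding t dirdet_def by (simp add: algebra_simps)
  then have "dirdet (c' - c) (y' - y) * dirdet (z' - z) (p - z)
      = dirdet (c' - c) (y' - y) * dirdet (z' - z) (y - z) + (t * dirdet (c' - c) (y' - y)) * dirdet (z' - z) (y' - y)"
    by (simp add: algebra_simps)
  also have "\<dots> = dirdet (c' - c) (y' - y) * dirdet (z' - z) (y - z) + m * dirdet (z' - z) (y' - y)" by (simp only: tD)
  also have "\<dots> \<in> \<int>" unfolding m_def using i by (intro Ints_add Ints_mult Ints_dirdet Ints_diff_pair)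
  finally have "dirdet (c' - c) (y' - y) * dirdet (z' - z) (p - z) \<in> \<int>" .
  then show ?thesis using Ints_nonzero_abs_ge1[of "dirdet (c' - c) (y' - y) * dirdet (z' - z) (p - z)"] D nz by (simp add: abs_mult)
qed

text \<open>The two copies are indexed by \<open>bool\<close>. They share \<open>Y\<close> and \<open>Z\<close>, and \<open>H\<close> in either copy is \<open>X\<close> in the other.\<close>

definition ver :: "bool \<Rightarrow> lab \<Rightarrow> bool \<times> lab" where
  "ver b l = (case l of LY \<Rightarrow> (True, LY) | LZ \<Rightarrow> (True, LZ) | LX \<Rightarrow> (b, LX) | LH \<Rightarrow> (\<not> b, LX) | _ \<Rightarrow> (b, l))"

definition fam :: "nat \<Rightarrow> bool \<times> lab \<Rightarrow> (real \<times> real) set" where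
  "fam N v = (if fst v then draw N (snd v) else mirror ` draw N (snd v))"

lemma fam_ver: "fam N (ver b l) = (if b then draw N l else mirror ` draw N l)"
  by (cases l; cases b) (simp_all add: fam_def ver_def mirror_draw)

definition vset :: "nat \<Rightarrow> (bool \<times> lab) set" where
  "vset N = {ver b l | b l. lab_ok N l}"

lemma fam_segment: "v \<in> vset N \<Longrightarrow> is_segment (fam N v)"
proof -
  assume "v \<in> vset N"
  then obtain b l where v: "v = ver b l" "lab_ok N l" by (auto simp: vset_def)
  have ne: "fst (ends N l) \<noteq> snd (ends N l)" "mirror (fst (ends N l)) \<noteq> mirror (snd (ends N l))"
    using ends_neq[OF v(2)] inj_mirror by (auto dest: injD)
  show ?thesis unfolding v(1) fam_ver draw_def is_segment_def mirror_segment
    using ne by (cases b) (simp_all only: if_True if_False, blast+)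
qed

lemma vset_card: "finite (vset N)" "card (vset N) \<le> 144 + 14 * N"
proof -
  define ls where "ls = [LX, LY, LZ, LH, LJ, LW, LG] @ concat (map (\<lambda>f. map f [0..<Suc N]) [LA, LB, LC, LD, LE, LT, LU])
    @ concat (map (\<lambda>f. map f [0..<18]) [LP, LQ, LR]) @ map LO [0..<4]"
  have "lab_ok N l \<Longrightarrow> l \<in> set ls" for l by (cases l) (auto simp: ls_def simp del: upt_Suc)
  then have sub: "vset N \<subseteq> (\<lambda>(b, l). ver b l) ` (UNIV \<times> set ls)" by (force simp: vset_def)
  then show "finite (vset N)" by (rule finite_subset) auto
  have "card (vset N) \<le> card ((\<lambda>(b, l). ver b l) ` (UNIV \<times> set ls))" using sub by (intro card_mono) auto
  also have "\<dots> \<le> card ((UNIV :: bool set) \<times> set ls)" by (rule card_image_le) auto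
  also have "\<dots> = 2 * card (set ls)" by (simp add: card_cartesian_product)
  also have "\<dots> \<le> 2 * length ls" by (simp add: card_length)
  also have "length ls = 72 + 7 * N" by (simp add: ls_def del: upt_Suc)
  finally show "card (vset N) \<le> 144 + 14 * N" by simp
qed

text \<open>Let u be the position of the last \<open>LC\<close> on \<open>LY\<close> in units of Q -
  P. In a copy with p \<le> 1 the fraction u / (1 + u) is doubly exponentially small, whereas
  integer endpoints in the box force u to be at least 1 / (64 k^4).\<close>

lemma doubly_exponential_box:
  fixes A :: "bool \<times> lab \<Rightarrow> (real \<times> real) set"
  assumes N: "0 < N" and iseg: "\<And>v. v \<in> vset N \<Longrightarrow> is_integer_segment (A v)"
    and adj: "\<And>u v. u \<in> vset N \<Longrightarrow> v \<in> vset N \<Longrightarrow> u \<noteq> v \<Longrightarrow> A u \<inter> A v \<noteq> {} \<longleftrightarrow> fam N u \<inter> fam N v \<noteq> {}"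
    and box: "\<And>v. v \<in> vset N \<Longrightarrow> A v \<subseteq> {- real k..real k} \<times> {- real k..real k}"
  shows "2 ^ (2 ^ (N - 1)) \<le> 1 + 64 * real k ^ 4"
proof -
  have V: "lab_ok N l \<Longrightarrow> ver b l \<in> vset N" for b l by (auto simp: vset_def)
  have ok: "lab_ok N a \<and> lab_ok N b" if "far N a b \<or> near N a b" for a b
  proof -
    have i: "inner N l \<Longrightarrow> lab_ok N l" for l by (cases l) auto
    have a: "i \<in> att l \<Longrightarrow> i < 18" for i l by (rule att_less)
    show ?thesis using that
    proof
      assume "far N a b" then show ?thesis by cases (auto intro: i)
    next
      assume "near N a b" then show ?thesis by cases (auto intro: i dest: a simp: side_def)
    qed
  qed
  have ne: "A v \<noteq> {}" if "v \<in> vset N" for v using iseg[OF that] by (auto simp: is_integer_segment_def)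
  have cfg: "config N (\<lambda>l. A (ver b l))" for b
  proof
    have inj: "inj mirror" by (rule inj_mirror)
    show "\<exists>p q. A (ver b l) = closed_segment p q" if "lab_ok N l" for l
      using iseg[OF V[OF that, of b]] by (auto simp: is_integer_segment_def)
    show "A (ver b l) \<inter> A (ver b m) = {}" if "far N l m" for l m
    proof -
      have *: "fam N (ver b l) \<inter> fam N (ver b m) = {}"
        using far_draw[OF that] by (auto simp: fam_ver image_Int[OF inj, symmetric])
      have "fam N (ver b l) \<noteq> {}" using draw_nonempty by (simp add: fam_ver)
      with * have "ver b l \<noteq> ver b m" by auto
      then show ?thesis using adj[of "ver b l" "ver b m"] V ok that * by auto
    qed
    show "A (ver b l) \<inter> A (ver b m) \<noteq> {}" if "near N l m" for l m
    proof -
      have "fam N (ver b l) \<inter> fam N (ver b m) \<noteq> {}"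
        using near_draw[OF that] by (auto simp: fam_ver image_Int[OF inj, symmetric])
      then show ?thesis using adj[of "ver b l" "ver b m"] ne[of "ver b l"] V ok that by (cases "ver b l = ver b m") auto
    qed
  qed
  have frame: "\<exists>P Q p. A (ver b LX) \<inter> A (ver b LY) = {P} \<and> A (ver b LY) \<inter> A (ver b LZ) = {Q} \<and> P \<noteq> Q \<and>
    Q + p *\<^sub>R (Q - P) \<in> A (ver b LH) \<and> Q + p *\<^sub>R (Q - P) \<in> A (ver b LY) \<and>
    (p \<le> 1 \<longrightarrow> (2::real) ^ (2 ^ (N - 1)) \<le> 1 + 64 * real k ^ 4)" for b
  proof -
    interpret config N "\<lambda>l. A (ver b l)" by (rule cfg)
    obtain P Q R w p u where g: "A (ver b LX) \<inter> A (ver b LY) = {P}" "A (ver b LY) \<inter> A (ver b LZ) = {Q}" "P \<noteq> Q"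
      "Q + p *\<^sub>R (Q - P) \<in> A (ver b LH)" "Q + p *\<^sub>R (Q - P) \<in> A (ver b LY)"
      "Q + u *\<^sub>R (Q - P) \<in> A (ver b (LC (N - 1)))" "Q + u *\<^sub>R (Q - P) \<in> A (ver b LY)" "0 < u"
      "R \<in> A (ver b LZ)" "fst (Q - P) * snd (R - Q) \<noteq> snd (Q - P) * fst (R - Q)"
      "w \<in> A (ver b (LC (N - 1)))" "fst (Q - P) * snd (w - Q) \<noteq> snd (Q - P) * fst (w - Q)"
      "p \<le> 1 \<longrightarrow> u / (1 + u) \<le> (1 / 2) ^ (2 ^ (N - 1))"
      by (rule gap[OF N])
    define Y where "Y = Q + u *\<^sub>R (Q - P)"
    have okl: "lab_ok N LX" "lab_ok N LY" "lab_ok N LZ" "lab_ok N (LC (N - 1))" by auto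
    have ints: "\<exists>a a'. a \<in> \<int> \<times> \<int> \<and> a' \<in> \<int> \<times> \<int> \<and> A (ver b l) = closed_segment a a'" if "lab_ok N l" for l
      using iseg[OF V[OF that, of b]] unfolding is_integer_segment_def by blast
    obtain c c' where c: "c \<in> \<int> \<times> \<int>" "c' \<in> \<int> \<times> \<int>" "A (ver b (LC (N - 1))) = closed_segment c c'" using ints[OF okl(4)] by blast
    obtain y y' where y: "y \<in> \<int> \<times> \<int>" "y' \<in> \<int> \<times> \<int>" "A (ver b LY) = closed_segment y y'" using ints[OF okl(2)] by blast
    obtain z z' where z: "z \<in> \<int> \<times> \<int>" "z' \<in> \<int> \<times> \<int>" "A (ver b LZ) = closed_segment z z'" using ints[OF okl(3)] by blast
    have B: "\<bar>fst q\<bar> \<le> real k \<and> \<bar>snd q\<bar> \<le> real k" if "q \<in> A (ver b l)" "lab_ok N l" for q l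
      using box[OF V[OF that(2), of b]] that(1) by (auto simp: abs_le_iff)
    have bound: "\<bar>dirdet (q - r) (s - t)\<bar> \<le> 8 * (real k)^2"
      if "q \<in> A (ver b l)" "r \<in> A (ver b l)" "s \<in> A (ver b m)" "t \<in> A (ver b n)" "lab_ok N l" "lab_ok N m" "lab_ok N n" for q r s t l m n
    proof -
      have "\<bar>dirdet (q - r) (s - t)\<bar> \<le> 2 * (2 * real k)^2"
        by (rule dirdet_bound; unfold fst_diff snd_diff;
            use B[OF that(1,5)] B[OF that(2,5)] B[OF that(3,6)] B[OF that(4,7)] in linarith)
      then show ?thesis by simp
    qed
    have Pm: "P \<in> A (ver b LX)" "P \<in> closed_segment y y'" and Qm: "Q \<in> closed_segment y y'" "Q \<in> closed_segment z z'"
      using g(1,2) y(3) z(3) by auto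
    have Ym: "Y \<in> closed_segment c c'" "Y \<in> closed_segment y y'" using g(6,7) c(3) y(3) by (auto simp: Y_def)
    have Rm: "R \<in> closed_segment z z'" and wm: "w \<in> closed_segment c c'" using g c z by auto
    have par: "\<exists>t. q - r = t *\<^sub>R (e' - e)" if q: "q \<in> closed_segment e e'" and r: "r \<in> closed_segment e e'" for q r e e' :: "real \<times> real"
    proof -
      obtain s where s: "q = (1 - s) *\<^sub>R e + s *\<^sub>R e'" using q unfolding in_segment by blast
      obtain t where t: "r = (1 - t) *\<^sub>R e + t *\<^sub>R e'" using r unfolding in_segment by blast
      show ?thesis by (rule exI[of _ "s - t"]) (simp add: s t algebra_simps)
    qed
    obtain a1 where a1: "Q - P = a1 *\<^sub>R (y' - y)" using par[OF Qm(1) Pm(2)] by blast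
    obtain a2 where a2: "w - Y = a2 *\<^sub>R (c' - c)" using par[OF wm Ym(1)] by blast
    obtain a3 where a3: "R - Q = a3 *\<^sub>R (z' - z)" using par[OF Rm Qm(2)] by blast
    obtain a4 where a4: "Q - z = a4 *\<^sub>R (z' - z)" using par[OF Qm(2), of z] by auto
    have "dirdet (Q - P) (w - Q) = - (a1 * a2) * dirdet (c' - c) (y' - y)"
    proof -
      have "w - Q = (w - Y) + u *\<^sub>R (Q - P)" by (simp add: Y_def)
      also have "\<dots> = a2 *\<^sub>R (c' - c) + (u * a1) *\<^sub>R (y' - y)" unfolding a1 a2 by simp
      finally have e: "w - Q = a2 *\<^sub>R (c' - c) + (u * a1) *\<^sub>R (y' - y)" .
      show ?thesis unfolding a1 e dirdet_simps using dirdet_commute[of "y' - y" "c' - c"] by simp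
    qed
    then have D: "dirdet (c' - c) (y' - y) \<noteq> 0" using g(12) by (auto simp: dirdet_def)
    have nP: "dirdet (Q - P) (z' - z) \<noteq> 0"
    proof -
      have "dirdet (Q - P) (R - Q) \<noteq> 0" using g(10) by (simp add: dirdet_def)
      then show ?thesis unfolding a3 dirdet_simps by simp
    qed
    have hP: "dirdet (z' - z) (P - z) = dirdet (Q - P) (z' - z)"
    proof -
      have "P - z = (Q - z) + - (Q - P)" by simp
      then have e: "P - z = a4 *\<^sub>R (z' - z) + - (Q - P)" unfolding a4 .
      show ?thesis unfolding e dirdet_simps using dirdet_commute[of "Q - P" "z' - z"] by simp
    qed
    have hY: "dirdet (z' - z) (Y - z) = - u * dirdet (Q - P) (z' - z)"
    proof -
      have "Y - z = (Q - z) + u *\<^sub>R (Q - P)" by (simp add: Y_def)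
      then have e: "Y - z = a4 *\<^sub>R (z' - z) + u *\<^sub>R (Q - P)" unfolding a4 .
      show ?thesis unfolding e dirdet_simps using dirdet_commute[of "Q - P" "z' - z"] by simp
    qed
    \<comment> \<open>By \<open>hP\<close> and \<open>hY\<close>, u is the ratio of the distances of
      \<open>Y\<close> and \<open>P\<close> from the line of \<open>LZ\<close>. The first is bounded
      below by integrality, the second above by the box.\<close>
    have "dirdet (z' - z) (Y - z) \<noteq> 0" using nP g(8) hY by simp
    note one = crossing_height[OF c(1,2) y(1,2) z(1,2) Ym D this]
    let ?k = "8 * (real k)^2"
    have b1: "\<bar>dirdet (c' - c) (y' - y)\<bar> \<le> ?k" by (rule bound[OF _ _ _ _ okl(4,2,2)]) (simp_all only: c y ends_in_segment)
    have b2: "\<bar>dirdet (Q - P) (z' - z)\<bar> \<le> ?k" by (rule bound[OF _ _ _ _ okl(2,3,3)]) (use Pm Qm in \<open>simp_all add: y z\<close>)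
    have "1 \<le> \<bar>dirdet (c' - c) (y' - y)\<bar> * (u * \<bar>dirdet (Q - P) (z' - z)\<bar>)"
      using one g(8) by (simp add: hY abs_mult)
    also have "\<dots> \<le> ?k * (u * ?k)" using b1 b2 g(8) by (intro mult_mono mult_left_mono) auto
    finally have u1: "1 \<le> u * (64 * real k ^ 4)" by (simp add: eval_nat_numeral algebra_simps)
    have "(2::real) ^ (2 ^ (N - 1)) \<le> 1 + 64 * real k ^ 4" if "p \<le> 1"
    proof -
      have "u * (2::real) ^ (2 ^ (N - 1)) \<le> 1 + u"
        using g(13) that g(8) by (simp add: field_simps power_divide)
      also have "\<dots> \<le> u * (1 + 64 * real k ^ 4)" using u1 by (simp add: algebra_simps)
      finally show ?thesis using g(8) by simp
    qed
    then show ?thesis using g(1-5) by blast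
  qed
  obtain P Q p where 1: "A (ver True LX) \<inter> A (ver True LY) = {P}" "A (ver True LY) \<inter> A (ver True LZ) = {Q}" "P \<noteq> Q"
    "Q + p *\<^sub>R (Q - P) \<in> A (ver True LH)" "Q + p *\<^sub>R (Q - P) \<in> A (ver True LY)"
    "p \<le> 1 \<longrightarrow> (2::real) ^ (2 ^ (N - 1)) \<le> 1 + 64 * real k ^ 4" using frame[of True] by blast
  obtain P' Q' p' where 2: "A (ver False LX) \<inter> A (ver False LY) = {P'}" "A (ver False LY) \<inter> A (ver False LZ) = {Q'}" "P' \<noteq> Q'"
    "Q' + p' *\<^sub>R (Q' - P') \<in> A (ver False LH)" "Q' + p' *\<^sub>R (Q' - P') \<in> A (ver False LY)"
    "p' \<le> 1 \<longrightarrow> (2::real) ^ (2 ^ (N - 1)) \<le> 1 + 64 * real k ^ 4" using frame[of False] by blast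
  have v: "ver True LH = ver False LX" "ver False LH = ver True LX" "ver False LY = ver True LY" "ver False LZ = ver True LZ"
    by (simp_all add: ver_def)
  \<comment> \<open>\<open>LH\<close> of each copy is \<open>LX\<close> of the other and
    \<open>LY\<close> is shared. So the point with parameter p is the corner P' of the other copy,
    and the point with parameter p' is P; this gives p p' = 1.\<close>
  have Q: "Q' = Q" using 1(2) 2(2) v by auto
  have e1: "Q + p *\<^sub>R (Q - P) = P'" using 1(4,5) 2(1) v by auto
  have e2: "Q + p' *\<^sub>R (Q - P') = P" using 2(4,5) 1(1) v Q by auto
  have "Q - P = (p * p') *\<^sub>R (Q - P)"
  proof -
    have 1: "Q - P' = - p *\<^sub>R (Q - P)" using e1[symmetric] by simp
    have "Q - P = - p' *\<^sub>R (Q - P')" using e2[symmetric] by simp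
    also have "\<dots> = (p * p') *\<^sub>R (Q - P)" unfolding 1 by simp
    finally show ?thesis .
  qed
  then have "(1 - p * p') *\<^sub>R (Q - P) = 0" by (simp add: algebra_simps)
  then have pp: "p * p' = 1" using 1(3) by auto
  have "p \<le> 1 \<or> p' \<le> 1"
  proof (rule ccontr)
    assume "\<not> (p \<le> 1 \<or> p' \<le> 1)"
    then have "1 < p" "1 < p'" by auto
    then show False using pp less_1_mult[of p p'] by simp
  qed
  then show ?thesis using 1(6) 2(6) by blast
qed

text \<open>Absorbing the constants lowers the inner exponent from N - 1 to N - 2, and the fourth
  root lowers it by two more.\<close>

lemma doubly_exponential_size:
  assumes "(2::real) ^ (2 ^ (N - 1)) \<le> 1 + 64 * real k ^ 4" "5 \<le> N"
  shows "(2::real) ^ (2 ^ (N - 4)) \<le> real k"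
proof (rule ccontr)
  let ?x = "(2::real) ^ (2 ^ (N - 4))"
  assume "\<not> ?x \<le> real k"
  then have "real k ^ 4 \<le> ?x ^ 4" by (intro power_mono) auto
  also have "?x ^ 4 = 2 ^ (2 ^ (N - 2))"
  proof -
    have "2 ^ (N - 4) * 4 = (2::nat) ^ (N - 4 + 2)" by (simp add: power_add)
    also have "N - 4 + 2 = N - 2" using assms by simp
    finally show ?thesis by (simp add: power_mult[symmetric])
  qed
  finally have "(2::real) ^ (2 ^ (N - 1)) \<le> 1 + 64 * 2 ^ (2 ^ (N - 2))" using assms(1) by simp
  also have "\<dots> < 2 ^ 7 * 2 ^ (2 ^ (N - 2))"
  proof -
    have "(1::real) \<le> 2 ^ (2 ^ (N - 2))" by simp
    moreover have "(2::real) ^ 7 * 2 ^ (2 ^ (N - 2)) = 128 * 2 ^ (2 ^ (N - 2))" by simp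
    ultimately show ?thesis by linarith
  qed
  also have "\<dots> \<le> 2 ^ (2 ^ (N - 2)) * 2 ^ (2 ^ (N - 2))"
  proof -
    have "(2::nat) ^ 3 \<le> 2 ^ (N - 2)" using assms(2) by (intro power_increasing) auto
    then have "(2::real) ^ 7 \<le> 2 ^ (2 ^ (N - 2))" by (intro power_increasing) auto
    then show ?thesis by (intro mult_right_mono) auto
  qed
  also have "\<dots> = 2 ^ (2 ^ (N - 1))"
  proof -
    have "N - 1 = Suc (N - 2)" using assms by simp
    then show ?thesis by (simp add: power_add[symmetric] mult_2)
  qed
  finally show False by simp
qed

section \<open>The lower bound in terms of \<open>f_SEG\<close>\<close>

lemma with_proj_iso_refl:
  assumes "wf_digraph (with_proj (G :: 'a pair_pre_digraph))"
  shows "digraph_iso (with_proj G) (with_proj G)"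
  unfolding digraph_iso_def
proof (intro exI[of _ "\<lparr>iso_verts = id, iso_arcs = id, iso_head = fst \<circ> prod.swap, iso_tail = fst\<rparr>"] conjI)
  show "pre_digraph.digraph_isomorphism (with_proj G) \<lparr>iso_verts = id, iso_arcs = id, iso_head = fst \<circ> prod.swap, iso_tail = fst\<rparr>"
    using assms by (auto simp: pre_digraph.digraph_isomorphism_def)
  show "with_proj G = app_iso \<lparr>iso_verts = id, iso_arcs = id, iso_head = fst \<circ> prod.swap, iso_tail = fst\<rparr> (with_proj G)"
    by (auto simp: app_iso_def with_proj_def fun_eq_iff)
qed

lemma intersection_graph_in_SEG:
  assumes "finite I" "\<And>i. i \<in> I \<Longrightarrow> is_segment (A i)"
  shows "intersection_graph I A \<in> SEG (card I)"
proof -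
  have "wf_digraph (with_proj (intersection_graph I A))"
    by unfold_locales (auto simp: intersection_graph_def)
  from with_proj_iso_refl[OF this] show ?thesis
    unfolding SEG_def segment_graph_def using assms by (auto simp: intersection_graph_def)
qed

lemma box_sizeI:
  assumes "finite F" "\<And>S. S \<in> F \<Longrightarrow> bounded S"
  shows "\<forall>S\<in>F. S \<subseteq> {- real (box_size F)..real (box_size F)} \<times> {- real (box_size F)..real (box_size F)}"
proof -
  have "bounded (\<Union>F)" using assms by blast
  then obtain B where B: "\<And>z. z \<in> \<Union>F \<Longrightarrow> norm z \<le> B" unfolding bounded_iff by blast
  obtain k :: nat where k: "B \<le> real k" using real_arch_simple by blast
  have "S \<subseteq> {- real k..real k} \<times> {- real k..real k}" if "S \<in> F" for S
  proof
    fix z assume "z \<in> S"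
    then have "norm z \<le> real k" using B[of z] that k by fastforce
    then have "\<bar>fst z\<bar> \<le> real k" "\<bar>snd z\<bar> \<le> real k"
      using norm_fst_le[of "fst z" "snd z"] norm_snd_le[of "snd z" "fst z"] by (auto simp del: norm_fst_le norm_snd_le)
    then show "z \<in> {- real k..real k} \<times> {- real k..real k}" by (auto simp: mem_Times_iff)
  qed
  then show ?thesis unfolding box_size_def
    by (intro LeastI[of "\<lambda>k. \<forall>S\<in>F. S \<subseteq> {- real k..real k} \<times> {- real k..real k}" k]) blast
qed

lemma f_SEG_graph_attained:
  assumes "integer_SEG_realization A0 G" "finite (pverts G)"
  obtains A where "integer_SEG_realization A G"
    "\<And>v. v \<in> pverts G \<Longrightarrow> A v \<subseteq> {- real (f_SEG_graph G)..real (f_SEG_graph G)} \<times> {- real (f_SEG_graph G)..real (f_SEG_graph G)}"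
proof -
  have "\<exists>A. integer_SEG_realization A G \<and> f_SEG_graph G = box_size (A ` pverts G)"
    unfolding f_SEG_graph_def
    by (rule LeastI_ex[of "\<lambda>m. \<exists>A. integer_SEG_realization A G \<and> m = box_size (A ` pverts G)"]) (use assms(1) in blast)
  then obtain A where A: "integer_SEG_realization A G" "f_SEG_graph G = box_size (A ` pverts G)" by blast
  have "bounded S" if SA: "S \<in> A ` pverts G" for S
  proof -
    obtain v where "v \<in> pverts G" "S = A v" using SA by blast
    then have "is_integer_segment S" using A(1) by (simp add: integer_SEG_realization_def)
    then obtain a b where "S = closed_segment a b" unfolding is_integer_segment_def by blast
    then show ?thesis by (simp add: bounded_closed_segment)
  qed
  then show thesis using that[OF A(1)] box_sizeI[of "A ` pverts G"] assms(2) A(2) by auto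
qed

text \<open>\<open>ex\<close> and \<open>fin\<close> are supplied by the upper bound. They ensure
  that the least element in \<open>f_SEG_graph\<close> and the maximum in \<open>f_SEG\<close>
  exist.\<close>

lemma lower_bound:
  assumes N: "5 \<le> N" and n: "144 + 14 * N \<le> n"
    and ex: "\<And>G. G \<in> SEG n \<Longrightarrow> \<exists>A. integer_SEG_realization A G"
    and fin: "finite (f_SEG_graph ` SEG n)"
  shows "(2::real) ^ (2 ^ (N - 4)) \<le> real (f_SEG n)"
proof -
  have "card (vset N) \<le> card {..<n}" using vset_card[of N] n by simp
  then obtain e where e: "inj_on e (vset N)" "e ` vset N \<subseteq> {..<n}"
    using card_le_inj[OF vset_card(1)] by blast
  \<comment> \<open>Surplus vertices receive further copies of \<open>LX\<close>, which brings the
    graph to exactly n vertices.\<close>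
  define d where "d i = (if i \<in> e ` vset N then inv_into (vset N) e i else (True, LX))" for i
  have "ver True LX \<in> vset N" unfolding vset_def by (rule CollectI, rule exI[of _ True], rule exI[of _ LX]) simp
  then have LX: "(True, LX) \<in> vset N" by (simp add: ver_def)
  have dV: "d i \<in> vset N" for i using LX inv_into_into[of i e "vset N"] by (simp add: d_def)
  have de: "d (e v) = v" if "v \<in> vset N" for v using that e(1) by (simp add: d_def)
  define G where "G = intersection_graph {..<n} (\<lambda>i. fam N (d i))"
  have G: "G \<in> SEG n" using intersection_graph_in_SEG[of "{..<n}" "\<lambda>i. fam N (d i)"] fam_segment[OF dV] by (simp add: G_def)
  have Gv: "pverts G = {..<n}" by (simp add: G_def intersection_graph_def)
  define k where "k = f_SEG_graph G"
  obtain A0 where "integer_SEG_realization A0 G" using ex[OF G] by blast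
  then obtain A where A: "integer_SEG_realization A G" "\<And>v. v < n \<Longrightarrow> A v \<subseteq> {- real k..real k} \<times> {- real k..real k}"
    using f_SEG_graph_attained[of A0 G] Gv unfolding k_def by auto
  have eV: "e v < n" if "v \<in> vset N" for v using that e(2) by auto
  have eq: "intersection_graph {..<n} A = G" using A(1) Gv by (simp add: integer_SEG_realization_def realizes_def)
  have adj: "A i \<inter> A j \<noteq> {} \<longleftrightarrow> fam N (d i) \<inter> fam N (d j) \<noteq> {}" if "i < n" "j < n" "i \<noteq> j" for i j
  proof -
    have "(i, j) \<in> parcs (intersection_graph {..<n} A) \<longleftrightarrow> (i, j) \<in> parcs G" using eq by simp
    then show ?thesis using that by (simp add: G_def intersection_graph_def)
  qed
  have "(2::real) ^ (2 ^ (N - 1)) \<le> 1 + 64 * real k ^ 4"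
  proof (rule doubly_exponential_box[of N "\<lambda>v. A (e v)"])
    show "is_integer_segment (A (e v))" if "v \<in> vset N" for v
      using A(1) eV[OF that] Gv by (simp add: integer_SEG_realization_def)
    show "A (e u) \<inter> A (e v) \<noteq> {} \<longleftrightarrow> fam N u \<inter> fam N v \<noteq> {}" if "u \<in> vset N" "v \<in> vset N" "u \<noteq> v" for u v
      using adj[OF eV[OF that(1)] eV[OF that(2)]] de that e(1) by (auto dest: inj_onD)
  qed (use N A(2) eV in auto)
  then have "(2::real) ^ (2 ^ (N - 4)) \<le> real k" by (rule doubly_exponential_size[OF _ N])
  also have "k \<le> f_SEG n" unfolding k_def f_SEG_def using fin G by (intro Max_ge) auto
  finally show ?thesis by simp
qed

lemma lower_bound_powr:
  assumes n: "448 \<le> n"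
    and ex: "\<And>G. G \<in> SEG n \<Longrightarrow> \<exists>A. integer_SEG_realization A G"
    and fin: "finite (f_SEG_graph ` SEG n)"
  shows "2 powr (2 powr (1/28 * real n)) \<le> real (f_SEG n)"
proof -
  \<comment> \<open>The largest N for which the two copies, by \<open>vset_card\<close>, fit into n
    vertices. For n \<ge> 448 it satisfies N - 4 \<ge> n / 28.\<close>
  define N where "N = (n - 144) div 14"
  have N: "21 \<le> N" "144 + 14 * N \<le> n" "n < 144 + 14 * N + 14" using n by (auto simp: N_def)
  have "1/28 * real n \<le> real (N - 4)" using N by simp
  then have "2 powr (1/28 * real n) \<le> 2 powr real (N - 4)" by simp
  also have "\<dots> = real (2 ^ (N - 4))" by (simp add: powr_realpow)
  finally have "2 powr (2 powr (1/28 * real n)) \<le> 2 powr real (2 ^ (N - 4))" by simp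
  also have "\<dots> = (2::real) ^ (2 ^ (N - 4))" by (subst powr_realpow) auto
  also have "\<dots> \<le> real (f_SEG n)" using lower_bound[OF _ N(2) ex fin] N(1) by simp
  finally show ?thesis .
qed

subsection \<open>Gordan's and Caratheodory's theorems\<close>

lemma small_multiple:
  fixes b c :: "'i \<Rightarrow> real"
  assumes "finite A" "\<And>i. i \<in> A \<Longrightarrow> 0 < b i"
  shows "\<exists>e>0. \<forall>i\<in>A. e * c i < b i"
  using assms
proof (induction A rule: finite_induct)
  case empty
  show ?case by (rule exI[of _ 1]) simp
next
  case (insert a A)
  obtain e where e: "e > 0" "\<forall>i\<in>A. e * c i < b i" using insert by auto
  define f where "f = min e (b a / (2 * (\<bar>c a\<bar> + 1)))"
  have ba: "0 < b a" using insert by simp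
  have f: "0 < f" "f \<le> e" using e ba by (simp_all add: f_def)
  have "f * c i < b i" if "i \<in> A" for i
  proof (cases "c i \<le> 0")
    case True
    then have "f * c i \<le> 0" using f by (simp add: mult_nonneg_nonpos)
    then show ?thesis using insert that by (meson insertI2 le_less_trans)
  next
    case False
    then have "f * c i \<le> e * c i" using f by (intro mult_right_mono) auto
    then show ?thesis using e that by fastforce
  qed
  moreover have "f * c a < b a"
  proof -
    have "f * c a \<le> f * (\<bar>c a\<bar> + 1)" using f by (intro mult_left_mono) auto
    also have "\<dots> \<le> b a / (2 * (\<bar>c a\<bar> + 1)) * (\<bar>c a\<bar> + 1)" by (intro mult_right_mono) (auto simp: f_def)
    also have "\<dots> = b a / 2" by (simp add: field_simps)
    finally show ?thesis using ba by simp
  qed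
  ultimately show ?case using f by blast
qed

text \<open>Induction on the number of vectors. Let d be positive on \<open>A\<close> and s its
  product with the new vector. For s = 0 a small multiple of \<open>g a\<close> is added to d. For s
  < 0 the vectors are projected along \<open>g a\<close> onto the hyperplane orthogonal to d, up to
  the factor - s; the projections are \<open>g'\<close>, and the induction hypothesis is applied to
  them.\<close>

lemma gordan:
  fixes g :: "'i \<Rightarrow> nat \<Rightarrow> real"
  assumes "finite A"
  shows "(\<exists>d. \<forall>i\<in>A. 0 < (\<Sum>j<m. d j * g i j)) \<or>
    (\<exists>l. (\<forall>i\<in>A. 0 \<le> l i) \<and> (\<Sum>i\<in>A. l i) = 1 \<and> (\<forall>j<m. (\<Sum>i\<in>A. l i * g i j) = 0))"
  using assms
proof (induction A arbitrary: g rule: finite_induct)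
  case (insert a A)
  let ?ip = "\<lambda>d v. \<Sum>j<m. (d j :: real) * v j"
  have sep: ?case if "\<forall>i\<in>insert a A. 0 < ?ip d (g i)" for d using that by blast
  have comb: ?case if "\<forall>i\<in>insert a A. 0 \<le> l i" "0 < sum l (insert a A)" "\<forall>j<m. (\<Sum>i\<in>insert a A. l i * g i j) = 0" for l
  proof -
    define l' where "l' i = l i / sum l (insert a A)" for i
    have "\<forall>i\<in>insert a A. 0 \<le> l' i" using that by (simp add: l'_def)
    moreover have "sum l' (insert a A) = 1" using that(2) by (simp add: l'_def sum_divide_distrib[symmetric])
    moreover have "(\<Sum>i\<in>insert a A. l' i * g i j) = 0" if "j < m" for j
    proof -
      have "(\<Sum>i\<in>insert a A. l' i * g i j) = (\<Sum>i\<in>insert a A. l i * g i j) / sum l (insert a A)"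
        unfolding l'_def sum_divide_distrib by (intro sum.cong) auto
      then show ?thesis using \<open>\<forall>j<m. (\<Sum>i\<in>insert a A. l i * g i j) = 0\<close> that by simp
    qed
    ultimately show ?thesis by blast
  qed
  consider d where "\<forall>i\<in>A. 0 < ?ip d (g i)"
    | l where "\<forall>i\<in>A. 0 \<le> l i" "sum l A = 1" "\<forall>j<m. (\<Sum>i\<in>A. l i * g i j) = 0"
    using insert.IH[of g] by blast
  then show ?case
  proof cases
    case (2 l)
    define l' where "l' i = (if i = a then 0 else l i)" for i
    have e: "(\<Sum>i\<in>A. l' i * h i) = (\<Sum>i\<in>A. l i * h i)" for h using insert(2) by (intro sum.cong) (auto simp: l'_def)
    have "sum l' A = sum l A" using e[of "\<lambda>_. 1"] by simp
    then show ?thesis using insert 2 by (intro comb[of l']) (auto simp: e, auto simp: l'_def)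
  next
    case (1 d)
    define s where "s = ?ip d (g a)"
    consider "s > 0" | "s = 0" | "s < 0" by linarith
    then show ?thesis
    proof cases
      assume "s > 0" then show ?thesis using 1 by (intro sep[of d]) (auto simp: s_def)
    next
      assume s0: "s = 0"
      show ?thesis
      proof (cases "\<forall>j<m. g a j = 0")
        case True
        show ?thesis
        proof (rule comb[of "\<lambda>i. if i = a then 1 else 0"])
          have z: "sum f A = 0" if "\<And>i. i \<in> A \<Longrightarrow> f i = 0" for f :: "'i \<Rightarrow> real" using that by simp
          have "\<And>i. i \<in> A \<Longrightarrow> i \<noteq> a" using insert by blast
          then show "0 < (\<Sum>i\<in>insert a A. if i = a then 1 else (0::real))"
            "\<forall>j<m. (\<Sum>i\<in>insert a A. (if i = a then 1 else 0) * g i j) = 0"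
            using insert(1,2) True by (simp_all add: z)
        qed auto
      next
        case False
        then obtain j0 where j0: "j0 < m" "g a j0 \<noteq> 0" by blast
        have "0 < (\<Sum>j<m. g a j * g a j)" by (rule sum_pos2[of _ j0]) (use j0 in \<open>auto simp: zero_less_mult_iff linorder_neq_iff\<close>)
        moreover obtain e where e: "e > 0" "\<forall>i\<in>A. e * (- ?ip (g a) (g i)) < ?ip d (g i)"
          using small_multiple[OF insert(1), of "\<lambda>i. ?ip d (g i)" "\<lambda>i. - ?ip (g a) (g i)"] 1 by blast
        moreover have ip: "?ip (\<lambda>j. d j + e * g a j) v = ?ip d v + e * ?ip (g a) v" for v
          by (simp add: sum.distrib sum_distrib_left algebra_simps)
        ultimately have "0 < ?ip (\<lambda>j. d j + e * g a j) (g i)" if "i \<in> insert a A" for i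
          using that s0 by (auto simp: ip s_def)
        then show ?thesis by (intro sep[of "\<lambda>j. d j + e * g a j"]) blast
      qed
    next
      assume s: "s < 0"
      define t where "t i = ?ip d (g i)" for i
      define g' where "g' i j = t i * g a j - s * g i j" for i j
      have ip': "?ip c (g' i) = t i * ?ip c (g a) - s * ?ip c (g i)" for c i
        by (simp add: g'_def sum_subtractf sum_distrib_left algebra_simps)
      consider c where "\<forall>i\<in>A. 0 < ?ip c (g' i)"
        | l where "\<forall>i\<in>A. 0 \<le> l i" "sum l A = 1" "\<forall>j<m. (\<Sum>i\<in>A. l i * g' i j) = 0"
        using insert.IH[of g'] by blast
      then show ?thesis
      proof cases
        case (1 c)
        \<comment> \<open>This makes \<open>c + q d\<close> orthogonal to \<open>g a\<close>. As s <
          0, subtracting a small multiple of d makes the product with \<open>g a\<close> positive,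
          and it stays positive on \<open>A\<close>.\<close>
        define q where "q = ?ip c (g a) / - s"
        obtain e where e: "e > 0" "\<forall>i\<in>A. e * ?ip d (g i) < ?ip c (g' i) / - s"
          using small_multiple[OF insert(1), of "\<lambda>i. ?ip c (g' i) / - s" "\<lambda>i. ?ip d (g i)"] 1 s
          by (metis neg_0_less_iff_less zero_less_divide_iff)
        have ip: "?ip (\<lambda>j. c j + r * d j) v = ?ip c v + r * ?ip d v" for v r
          by (simp add: sum.distrib sum_distrib_left algebra_simps)
        have "0 < ?ip (\<lambda>j. c j + (q - e) * d j) (g i)" if "i \<in> insert a A" for i
        proof (cases "i = a")
          case True
          have "?ip c (g a) + q * s = 0" using s by (simp add: q_def)
          moreover have "e * s < 0" using e s by (simp add: mult_pos_neg)
          ultimately show ?thesis unfolding ip True s_def[symmetric] by (simp add: algebra_simps)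
        next
          case False
          then have "e * ?ip d (g i) < ?ip c (g' i) / - s" using e that by blast
          also have "\<dots> = ?ip c (g i) + q * ?ip d (g i)" unfolding ip' q_def t_def[symmetric] using s by (simp add: field_simps)
          finally show ?thesis unfolding ip by (simp add: algebra_simps)
        qed
        then show ?thesis by (intro sep[of "\<lambda>j. c j + (q - e) * d j"]) blast
      next
        case (2 l)
        \<comment> \<open>The relation between the projections is rewritten in the original vectors:
          the summands \<open>t i\<close> are collected in the coefficient of
          \<open>g a\<close>.\<close>
        define l' where "l' i = (if i = a then (\<Sum>i\<in>A. l i * t i) else - s * l i)" for i
        have na: "i \<in> A \<Longrightarrow> i \<noteq> a" for i using insert by blast
        have nn: "0 \<le> (\<Sum>i\<in>A. l i * t i)" using 1 2 unfolding t_def[symmetric]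
          by (intro sum_nonneg mult_nonneg_nonneg) (auto intro: less_imp_le)
        have e: "(\<Sum>i\<in>A. l' i * h i) = - s * (\<Sum>i\<in>A. l i * h i)" for h
          unfolding sum_distrib_left using na by (intro sum.cong) (auto simp: l'_def)
        have "sum l' A = - s" using e[of "\<lambda>_. 1"] 2 by simp
        then have "0 < sum l' (insert a A)" using insert(1,2) nn s by (simp add: l'_def)
        moreover have "(\<Sum>i\<in>insert a A. l' i * g i j) = 0" if "j < m" for j
        proof -
          have "(\<Sum>i\<in>insert a A. l' i * g i j) = (\<Sum>i\<in>A. l i * g' i j)"
            using insert(1,2) by (simp add: e) (simp add: l'_def g'_def sum_subtractf sum_distrib_left sum_distrib_right algebra_simps)
          then show ?thesis using 2 that by simp
        qed
        ultimately show ?thesis using 2 nn s by (intro comb[of l']) (auto simp: l'_def mult_nonpos_nonneg)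
      qed
    qed
  qed
qed simp

text \<open>Gaussian elimination: a vector with nonzero coordinate n is used to clear that
  coordinate in all others.\<close>

lemma linear_dependence:
  fixes v :: "'i \<Rightarrow> nat \<Rightarrow> real"
  assumes "finite I" "n < card I"
  shows "\<exists>\<mu>. (\<exists>i\<in>I. \<mu> i \<noteq> 0) \<and> (\<forall>j<n. (\<Sum>i\<in>I. \<mu> i * v i j) = 0)"
  using assms
proof (induction n arbitrary: I v)
  case 0
  then have "\<exists>i. i \<in> I" by (auto simp: card_gt_0_iff)
  then show ?case by (intro exI[of _ "\<lambda>_. 1"]) auto
next
  case (Suc n)
  show ?case
  proof (cases "\<forall>i\<in>I. v i n = 0")
    case True
    obtain \<mu> where "\<exists>i\<in>I. \<mu> i \<noteq> 0" "\<forall>j<n. (\<Sum>i\<in>I. \<mu> i * v i j) = 0" using Suc.IH[of I v] Suc.prems by auto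
    moreover have "(\<Sum>i\<in>I. \<mu> i * v i n) = 0" using True by simp
    ultimately show ?thesis by (metis less_Suc_eq)
  next
    case False
    then obtain a where a: "a \<in> I" "v a n \<noteq> 0" by blast
    define J where "J = I - {a}"
    have J: "finite J" "n < card J" "I = insert a J" "a \<notin> J" using Suc.prems a by (auto simp: J_def)
    obtain \<mu> where \<mu>: "\<exists>i\<in>J. \<mu> i \<noteq> 0" "\<forall>j<n. (\<Sum>i\<in>J. \<mu> i * (v i j - v i n / v a n * v a j)) = 0"
      using Suc.IH[OF J(1,2), of "\<lambda>i j. v i j - v i n / v a n * v a j"] by blast
    define \<nu> where "\<nu> i = (if i = a then - (\<Sum>i\<in>J. \<mu> i * v i n) / v a n else \<mu> i)" for i
    have e: "(\<Sum>i\<in>J. \<nu> i * h i) = (\<Sum>i\<in>J. \<mu> i * h i)" for h using J(4) by (intro sum.cong) (auto simp: \<nu>_def)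
    have s: "(\<Sum>i\<in>I. \<nu> i * v i j) = (\<Sum>i\<in>J. \<mu> i * (v i j - v i n / v a n * v a j))" for j
      unfolding J(3) using J(1,4)
      by (simp add: e) (simp add: \<nu>_def sum_subtractf sum_distrib_left sum_distrib_right sum_divide_distrib algebra_simps)
    have "(\<Sum>i\<in>I. \<nu> i * v i n) = 0" using a unfolding s by simp
    then have "\<forall>j<Suc n. (\<Sum>i\<in>I. \<nu> i * v i j) = 0" using \<mu>(2) s by (auto simp: less_Suc_eq)
    moreover have "\<exists>i\<in>I. \<nu> i \<noteq> 0" using \<mu>(1) J by (auto simp: \<nu>_def)
    ultimately show ?thesis by blast
  qed
qed

text \<open>More than m + 1 vectors have an affine dependence \<open>\<mu>\<close>. The convex
  combination is moved along it until the first coefficient vanishes, and that vector is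
  removed.\<close>

lemma caratheodory:
  fixes g :: "'i \<Rightarrow> nat \<Rightarrow> real"
  assumes A: "finite A" and l: "\<forall>i\<in>A. 0 \<le> l i" "(\<Sum>i\<in>A. l i) = 1" "\<forall>j<m. (\<Sum>i\<in>A. l i * g i j) = 0"
  shows "\<exists>I l. I \<subseteq> A \<and> card I \<le> Suc m \<and> (\<forall>i\<in>I. 0 \<le> l i) \<and> (\<Sum>i\<in>I. l i) = (1::real) \<and> (\<forall>j<m. (\<Sum>i\<in>I. l i * g i j) = 0)"
  using assms
proof (induction "card A" arbitrary: A l rule: less_induct)
  case less
  note A = less.prems(1) and l = less.prems(2-4)
  show ?case
  proof (cases "card A \<le> Suc m")
    case True then show ?thesis using l by blast
  next
    case False
    \<comment> \<open>The additional coordinate m, constantly 1, makes the coefficients of the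
      dependence sum to 0.\<close>
    then obtain \<mu> where \<mu>: "\<exists>i\<in>A. \<mu> i \<noteq> 0" "\<forall>j<Suc m. (\<Sum>i\<in>A. \<mu> i * (if j = m then 1 else g i j)) = 0"
      using linear_dependence[OF A, of "Suc m" "\<lambda>i j. if j = m then 1 else g i j"] by auto
    have \<mu>0: "sum \<mu> A = 0" using \<mu>(2)[rule_format, of m] by simp
    have \<mu>g: "(\<Sum>i\<in>A. \<mu> i * g i j) = 0" if "j < m" for j using \<mu>(2)[rule_format, of j] that by simp
    define B where "B = {i\<in>A. 0 < \<mu> i}"
    have "B \<noteq> {}"
    proof
      assume "B = {}"
      then have "\<And>i. i \<in> A \<Longrightarrow> 0 \<le> - \<mu> i" by (force simp: B_def)
      moreover have "(\<Sum>i\<in>A. - \<mu> i) = 0" using \<mu>0 by (simp add: sum_negf)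
      ultimately have "\<forall>i\<in>A. - \<mu> i = 0" using sum_nonneg_eq_0_iff[OF A, of "\<lambda>i. - \<mu> i"] by blast
      then show False using \<mu>(1) by auto
    qed
    have B: "finite B" using A by (simp add: B_def)
    obtain b where b: "b \<in> B" "\<And>i. i \<in> B \<Longrightarrow> l b / \<mu> b \<le> l i / \<mu> i"
      using arg_min_if_finite[OF B \<open>B \<noteq> {}\<close>, of "\<lambda>i. l i / \<mu> i"] by (metis not_le)
    define t where "t = l b / \<mu> b"
    have bA: "b \<in> A" "0 < \<mu> b" using b(1) by (auto simp: B_def)
    have t: "0 \<le> t" using l bA by (simp add: t_def)
    define l' where "l' i = l i - t * \<mu> i" for i
    have l'b: "l' b = 0" using bA by (simp add: l'_def t_def)
    have "0 \<le> l' i" if "i \<in> A" for i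
    proof (cases "0 < \<mu> i")
      case True
      then have "t \<le> l i / \<mu> i" using b(2)[of i] that by (simp add: B_def t_def)
      then show ?thesis using True by (simp add: l'_def field_simps)
    next
      case False
      then have "t * \<mu> i \<le> 0" using t by (simp add: mult_nonneg_nonpos)
      moreover have "0 \<le> l i" using l that by blast
      ultimately show ?thesis unfolding l'_def by linarith
    qed
    moreover have s: "(\<Sum>i\<in>A - {b}. l' i * h i) = (\<Sum>i\<in>A. l i * h i) - t * (\<Sum>i\<in>A. \<mu> i * h i)" for h
    proof -
      have "(\<Sum>i\<in>A - {b}. l' i * h i) = (\<Sum>i\<in>A. l' i * h i)" using l'b bA A by (simp add: sum.remove)
      then show ?thesis by (simp add: l'_def sum_subtractf sum_distrib_left algebra_simps)
    qed
    moreover have "(\<Sum>i\<in>A - {b}. l' i) = 1" using s[of "\<lambda>_. 1"] \<mu>0 l by simp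
    moreover have "\<forall>j<m. (\<Sum>i\<in>A - {b}. l' i * g i j) = 0" using s \<mu>g l by simp
    moreover have "card (A - {b}) < card A" using A bA by (meson card_Diff1_less)
    ultimately obtain I l'' where "I \<subseteq> A - {b}" "card I \<le> Suc m" "\<forall>i\<in>I. 0 \<le> l'' i" "(\<Sum>i\<in>I. l'' i) = (1::real)"
      "\<forall>j<m. (\<Sum>i\<in>I. l'' i * g i j) = 0"
      using less.hyps[of "A - {b}" l'] A by auto
    then show ?thesis by blast
  qed
qed

subsection \<open>Algebraic dependence of integer polynomials\<close>

definition exps :: "nat \<Rightarrow> nat \<Rightarrow> (nat \<Rightarrow> nat) set" where
  "exps M d = {e. (\<forall>i\<ge>M. e i = 0) \<and> (\<Sum>i<M. e i) \<le> d}"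

definition monom_val :: "nat \<Rightarrow> (nat \<Rightarrow> nat) \<Rightarrow> (nat \<Rightarrow> real) \<Rightarrow> real" where
  "monom_val M e x = (\<Prod>i<M. x i ^ e i)"

lemma exps_le: "e \<in> exps M d \<Longrightarrow> e i \<le> d"
proof -
  assume e: "e \<in> exps M d"
  show "e i \<le> d"
  proof (cases "i < M")
    case True
    then have "e i \<le> (\<Sum>i<M. e i)" by (intro member_le_sum) auto
    then show ?thesis using e by (simp add: exps_def)
  next
    case False then show ?thesis using e by (simp add: exps_def)
  qed
qed

lemma exps_subset: "exps M d \<subseteq> (\<lambda>f i. if i < M then f i else 0) ` ({..<M} \<rightarrow>\<^sub>E {..d})"
proof
  fix e assume e: "e \<in> exps M d"
  have "e = (\<lambda>i. if i < M then restrict e {..<M} i else 0)" using e by (auto simp: exps_def)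
  moreover have "restrict e {..<M} \<in> {..<M} \<rightarrow>\<^sub>E {..d}" using exps_le[OF e] by auto
  ultimately show "e \<in> (\<lambda>f i. if i < M then f i else 0) ` ({..<M} \<rightarrow>\<^sub>E {..d})" by blast
qed

lemma finite_exps [simp]: "finite (exps M d)"
  by (rule finite_subset[OF exps_subset]) (auto intro!: finite_imageI finite_PiE)

lemma card_exps_le: "card (exps M d) \<le> (d + 1) ^ M"
proof -
  have "card (exps M d) \<le> card ((\<lambda>f i. if i < M then f i else 0) ` ({..<M} \<rightarrow>\<^sub>E {..d}))"
    by (intro card_mono exps_subset finite_imageI finite_PiE) auto
  also have "\<dots> \<le> card ({..<M} \<rightarrow>\<^sub>E {..d})" by (intro card_image_le finite_PiE) auto
  also have "\<dots> = (d + 1) ^ M" by (simp add: card_PiE)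
  finally show ?thesis .
qed

lemma zero_exps [simp]: "(\<lambda>_. 0) \<in> exps M d"
  by (simp add: exps_def)

lemma add_exps: "e \<in> exps M d \<Longrightarrow> e' \<in> exps M d' \<Longrightarrow> (\<lambda>i. e i + e' i) \<in> exps M (d + d')"
  by (auto simp: exps_def sum.distrib add_mono)

text \<open>Exponents are split into quotients and remainders modulo 4. This crude factor replaces
  an estimate of binomial coefficients: with L = 2 * 4 ^ M there are at most half as many monomials
  of degree up to 4 L as products in \<open>algebraic_dependence\<close>.\<close>

lemma card_exps_times4: "card (exps M (4 * d)) \<le> 4 ^ M * card (exps M d)"
proof -
  define \<phi> where "\<phi> e = ((\<lambda>i\<in>{..<M}. e i mod 4), (\<lambda>i. e i div 4))" for e :: "nat \<Rightarrow> nat"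
  have "inj_on \<phi> (exps M (4 * d))"
  proof (rule inj_onI)
    fix e e' assume e: "e \<in> exps M (4 * d)" "e' \<in> exps M (4 * d)" and eq: "\<phi> e = \<phi> e'"
    show "e = e'"
    proof
      fix i
      show "e i = e' i"
      proof (cases "i < M")
        case True
        have "e i mod 4 = e' i mod 4" using eq True by (auto simp: \<phi>_def dest: restrict_apply' fun_cong[of _ _ i])
        moreover have "e i div 4 = e' i div 4" using eq by (auto simp: \<phi>_def dest: fun_cong[of _ _ i])
        ultimately show ?thesis by (metis div_mult_mod_eq)
      next
        case False then show ?thesis using e by (simp add: exps_def)
      qed
    qed
  qed
  moreover have "\<phi> ` exps M (4 * d) \<subseteq> ({..<M} \<rightarrow>\<^sub>E {..<4::nat}) \<times> exps M d"
  proof -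
    have "(\<lambda>i. e i div 4) \<in> exps M d" if e: "e \<in> exps M (4 * d)" for e
    proof -
      have "4 * (\<Sum>i<M. e i div 4) \<le> (\<Sum>i<M. e i)" unfolding sum_distrib_left by (intro sum_mono) auto
      then show ?thesis using e by (auto simp: exps_def)
    qed
    moreover have "(\<lambda>i\<in>{..<M}. e i mod 4) \<in> {..<M} \<rightarrow>\<^sub>E {..<4::nat}" for e :: "nat \<Rightarrow> nat" by (intro restrict_PiE_iff[THEN iffD2]) auto
    ultimately show ?thesis unfolding \<phi>_def by blast
  qed
  ultimately have "card (exps M (4 * d)) \<le> card (({..<M} \<rightarrow>\<^sub>E {..<4::nat}) \<times> exps M d)"
    by (rule card_inj_on_le) (intro finite_cartesian_product finite_PiE, auto)
  also have "\<dots> = 4 ^ M * card (exps M d)" by (simp add: card_cartesian_product card_PiE)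
  finally show ?thesis .
qed

text \<open>\<open>B\<close> bounds the sum of the absolute values of the coefficients. This norm is
  submultiplicative, so that products need no count of terms.\<close>

definition ipoly :: "nat \<Rightarrow> nat \<Rightarrow> int \<Rightarrow> ((nat \<Rightarrow> real) \<Rightarrow> real) \<Rightarrow> bool" where
  "ipoly M d B f \<longleftrightarrow> (\<exists>c :: (nat \<Rightarrow> nat) \<Rightarrow> int. (\<Sum>e\<in>exps M d. \<bar>c e\<bar>) \<le> B \<and>
     (\<forall>x. f x = (\<Sum>e\<in>exps M d. of_int (c e) * monom_val M e x)))"

lemma exps_mono: "d \<le> d' \<Longrightarrow> exps M d \<subseteq> exps M d'"
  by (auto simp: exps_def)

lemma ipoly_mono:
  assumes "ipoly M d B f" "d \<le> d'" "B \<le> B'"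
  shows "ipoly M d' B' f"
proof -
  obtain c where c: "(\<Sum>e\<in>exps M d. \<bar>c e\<bar>) \<le> B" "\<And>x. f x = (\<Sum>e\<in>exps M d. of_int (c e) * monom_val M e x)"
    using assms(1) unfolding ipoly_def by blast
  define c' where "c' e = (if e \<in> exps M d then c e else 0)" for e
  have sub: "exps M d \<subseteq> exps M d'" by (rule exps_mono[OF assms(2)])
  have "(\<Sum>e\<in>exps M d'. \<bar>c' e\<bar>) = (\<Sum>e\<in>exps M d. \<bar>c e\<bar>)"
    by (rule sum.mono_neutral_cong_right) (use sub in \<open>auto simp: c'_def\<close>)
  moreover have "f x = (\<Sum>e\<in>exps M d'. of_int (c' e) * monom_val M e x)" for x
    unfolding c(2) by (rule sum.mono_neutral_cong_left) (use sub in \<open>auto simp: c'_def\<close>)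
  ultimately show ?thesis unfolding ipoly_def using c(1) assms(3) by (intro exI[of _ c']) auto
qed

lemma ipoly_const: "\<bar>k\<bar> \<le> B \<Longrightarrow> ipoly M d B (\<lambda>_. of_int k)"
proof -
  assume k: "\<bar>k\<bar> \<le> B"
  define c where "c e = (if e = (\<lambda>_. 0) then k else 0)" for e :: "nat \<Rightarrow> nat"
  have "(\<Sum>e\<in>exps M d. \<bar>c e\<bar>) = (\<Sum>e\<in>{\<lambda>_. 0}. \<bar>c e\<bar>)"
    by (rule sum.mono_neutral_right) (auto simp: c_def)
  moreover have "(\<Sum>e\<in>exps M d. of_int (c e) * monom_val M e x) = (\<Sum>e\<in>{\<lambda>_. 0}. of_int (c e) * monom_val M e x)" for x
    by (rule sum.mono_neutral_right) (auto simp: c_def)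
  ultimately show ?thesis unfolding ipoly_def using k by (intro exI[of _ c]) (simp add: c_def monom_val_def)
qed

lemma ipoly_var: "i < M \<Longrightarrow> ipoly M 1 1 (\<lambda>x. x i)"
proof -
  assume i: "i < M"
  let ?u = "\<lambda>j. if j = i then 1 else 0 :: nat"
  define c where "c e = (if e = ?u then 1 else 0 :: int)" for e :: "nat \<Rightarrow> nat"
  have u: "?u \<in> exps M 1" using i by (auto simp: exps_def)
  have "(\<Sum>e\<in>exps M 1. \<bar>c e\<bar>) = (\<Sum>e\<in>{?u}. \<bar>c e\<bar>)"
    by (rule sum.mono_neutral_right) (use u in \<open>auto simp: c_def\<close>)
  moreover have "(\<Sum>e\<in>exps M 1. of_int (c e) * monom_val M e x) = (\<Sum>e\<in>{?u}. of_int (c e) * monom_val M e x)" for x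
    by (rule sum.mono_neutral_right) (use u in \<open>auto simp: c_def\<close>)
  moreover have "monom_val M ?u x = x i" for x
  proof -
    have "monom_val M ?u x = (\<Prod>j<M. if j = i then x i else 1)" unfolding monom_val_def by (intro prod.cong) auto
    then show ?thesis using i by simp
  qed
  ultimately show ?thesis unfolding ipoly_def by (intro exI[of _ c]) (simp add: c_def)
qed

lemma ipoly_add:
  assumes "ipoly M d B f" "ipoly M d C g"
  shows "ipoly M d (B + C) (\<lambda>x. f x + g x)"
proof -
  obtain a where a: "(\<Sum>e\<in>exps M d. \<bar>a e\<bar>) \<le> B" "\<And>x. f x = (\<Sum>e\<in>exps M d. of_int (a e) * monom_val M e x)"
    using assms(1) unfolding ipoly_def by blast
  obtain b where b: "(\<Sum>e\<in>exps M d. \<bar>b e\<bar>) \<le> C" "\<And>x. g x = (\<Sum>e\<in>exps M d. of_int (b e) * monom_val M e x)"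
    using assms(2) unfolding ipoly_def by blast
  have "(\<Sum>e\<in>exps M d. \<bar>a e + b e\<bar>) \<le> (\<Sum>e\<in>exps M d. \<bar>a e\<bar> + \<bar>b e\<bar>)" by (intro sum_mono) auto
  then have "(\<Sum>e\<in>exps M d. \<bar>a e + b e\<bar>) \<le> B + C" using a(1) b(1) by (simp add: sum.distrib)
  moreover have "f x + g x = (\<Sum>e\<in>exps M d. of_int (a e + b e) * monom_val M e x)" for x
    by (simp add: a(2) b(2) sum.distrib algebra_simps)
  ultimately show ?thesis unfolding ipoly_def by (intro exI[of _ "\<lambda>e. a e + b e"]) simp
qed

lemma ipoly_mult:
  assumes "ipoly M d B f" "ipoly M d' C g"
  shows "ipoly M (d + d') (B * C) (\<lambda>x. f x * g x)"
proof -
  obtain a where a: "(\<Sum>e\<in>exps M d. \<bar>a e\<bar>) \<le> B" "\<And>x. f x = (\<Sum>e\<in>exps M d. of_int (a e) * monom_val M e x)"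
    using assms(1) unfolding ipoly_def by blast
  obtain b where b: "(\<Sum>e\<in>exps M d'. \<bar>b e\<bar>) \<le> C" "\<And>x. g x = (\<Sum>e\<in>exps M d'. of_int (b e) * monom_val M e x)"
    using assms(2) unfolding ipoly_def by blast
  let ?P = "exps M d \<times> exps M d'"
  let ?s = "\<lambda>p :: (nat \<Rightarrow> nat) \<times> (nat \<Rightarrow> nat). (\<lambda>i. fst p i + snd p i)"
  define c where "c e = (\<Sum>p | p \<in> ?P \<and> ?s p = e. a (fst p) * b (snd p))" for e
  have sub: "?s ` ?P \<subseteq> exps M (d + d')" using add_exps by auto
  have "(\<Sum>e\<in>exps M (d + d'). \<bar>c e\<bar>) \<le> (\<Sum>e\<in>exps M (d + d'). \<Sum>p | p \<in> ?P \<and> ?s p = e. \<bar>a (fst p) * b (snd p)\<bar>)"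
    unfolding c_def by (intro sum_mono sum_abs)
  also have "\<dots> = (\<Sum>p\<in>?P. \<bar>a (fst p) * b (snd p)\<bar>)" by (rule sum.group[OF _ _ sub]) auto
  also have "\<dots> = (\<Sum>e\<in>exps M d. \<bar>a e\<bar>) * (\<Sum>e\<in>exps M d'. \<bar>b e\<bar>)"
    by (simp add: sum_product sum.cartesian_product abs_mult case_prod_unfold)
  also have "\<dots> \<le> B * C"
  proof (rule mult_mono[OF a(1) b(1)])
    have "0 \<le> (\<Sum>e\<in>exps M d. \<bar>a e\<bar>)" by (intro sum_nonneg) auto
    then show "0 \<le> B" using a(1) by linarith
  qed (intro sum_nonneg, auto)
  finally have "(\<Sum>e\<in>exps M (d + d'). \<bar>c e\<bar>) \<le> B * C" .
  moreover have "f x * g x = (\<Sum>e\<in>exps M (d + d'). of_int (c e) * monom_val M e x)" for x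
  proof -
    have "f x * g x = (\<Sum>p\<in>?P. of_int (a (fst p) * b (snd p)) * monom_val M (?s p) x)"
      unfolding a(2) b(2) sum_product sum.cartesian_product
      by (intro sum.cong) (auto simp: monom_val_def power_add prod.distrib algebra_simps)
    also have "\<dots> = (\<Sum>e\<in>exps M (d + d'). \<Sum>p | p \<in> ?P \<and> ?s p = e. of_int (a (fst p) * b (snd p)) * monom_val M (?s p) x)"
      by (rule sum.group[OF _ _ sub, symmetric]) auto
    also have "\<dots> = (\<Sum>e\<in>exps M (d + d'). of_int (c e) * monom_val M e x)"
      unfolding c_def of_int_sum sum_distrib_right by (intro sum.cong) auto
    finally show ?thesis .
  qed
  ultimately show ?thesis unfolding ipoly_def by (intro exI[of _ c]) simp
qed

lemma ipoly_scale:
  assumes "ipoly M d B f"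
  shows "ipoly M d (\<bar>k\<bar> * B) (\<lambda>x. of_int k * f x)"
  using ipoly_mult[OF ipoly_const[of k "\<bar>k\<bar>" M 0] assms] by simp

lemma ipoly_diff:
  assumes "ipoly M d B f" "ipoly M d C g"
  shows "ipoly M d (B + C) (\<lambda>x. f x - g x)"
  using ipoly_add[OF assms(1) ipoly_scale[OF assms(2), of "-1"]] by simp

lemma ipoly_sum:
  assumes "finite S" "\<And>s. s \<in> S \<Longrightarrow> ipoly M d (B s) (f s)"
  shows "ipoly M d (\<Sum>s\<in>S. B s) (\<lambda>x. \<Sum>s\<in>S. f s x)"
  using assms
proof (induction S rule: finite_induct)
  case empty show ?case using ipoly_const[of 0 0] by simp
next
  case (insert a S) then show ?case using ipoly_add[of M d "B a" "f a" "sum B S"] by simp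
qed

lemma ipoly_power:
  assumes "ipoly M d B f"
  shows "ipoly M (k * d) (B ^ k) (\<lambda>x. f x ^ k)"
proof (induction k)
  case 0 show ?case using ipoly_const[of 1 1] by simp
next
  case (Suc k) then show ?case using ipoly_mult[OF assms Suc] by simp
qed

lemma ipoly_prod_power:
  fixes n :: nat
  assumes "\<And>i. i < n \<Longrightarrow> ipoly M d B (f i)"
  shows "ipoly M ((\<Sum>i<n. k i) * d) (B ^ (\<Sum>i<n. k i)) (\<lambda>x. \<Prod>i<n. f i x ^ k i)"
  using assms
proof (induction n)
  case 0 show ?case using ipoly_const[of 1 1] by simp
next
  case (Suc n)
  have "ipoly M ((\<Sum>i<n. k i) * d + k n * d) (B ^ (\<Sum>i<n. k i) * B ^ k n) (\<lambda>x. (\<Prod>i<n. f i x ^ k i) * f n x ^ k n)"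
    by (intro ipoly_mult ipoly_power Suc.IH Suc.prems) auto
  then show ?case by (simp add: power_add add_mult_distrib)
qed

text \<open>Siegel's lemma: integer combinations of the products with coefficients in \<open>{0..H}\<close> outnumber
  the possible coefficient vectors, so that two of them coincide.\<close>

lemma algebraic_dependence:
  fixes M :: nat and f :: "nat \<Rightarrow> (nat \<Rightarrow> real) \<Rightarrow> real" and f0 :: "(nat \<Rightarrow> real) \<Rightarrow> real"
  defines "L \<equiv> 2 * 4 ^ M"
  assumes B: "1 \<le> B" and f0: "ipoly M 2 B f0" and f: "\<And>i. i < M \<Longrightarrow> ipoly M 2 B (f i)"
  defines "H \<equiv> 2 * int (L * card (exps M L)) * B ^ (2 * L)"
  shows "\<exists>c :: nat \<Rightarrow> (nat \<Rightarrow> nat) \<Rightarrow> int. (\<exists>a<L. \<exists>e\<in>exps M L. c a e \<noteq> 0) \<and> (\<forall>a<L. \<forall>e\<in>exps M L. \<bar>c a e\<bar> \<le> H) \<and>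
    (\<forall>x. (\<Sum>a<L. \<Sum>e\<in>exps M L. of_int (c a e) * (f0 x ^ a * (\<Prod>i<M. f i x ^ e i))) = 0)"
proof -
  let ?A = "{..<L} \<times> exps M L" and ?P = "exps M (4 * L)"
  have A: "finite ?A" and P: "finite ?P" by auto
  have cardA: "card ?A = L * card (exps M L)" by (simp add: card_cartesian_product)
  have AP: "2 * card ?P \<le> card ?A" using card_exps_times4[of M L] by (simp add: cardA L_def)
  have Ppos: "0 < card ?P" using zero_exps[of M "4 * L"] P unfolding card_gt_0_iff by blast
  define F where "F p x = f0 x ^ fst p * (\<Prod>i<M. f i x ^ snd p i)" for p :: "nat \<times> (nat \<Rightarrow> nat)" and x
  have "ipoly M (4 * L) (B ^ (2 * L)) (F p)" if p: "p \<in> ?A" for p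
  proof -
    obtain a e where pe: "p = (a, e)" "a < L" "e \<in> exps M L" using p by auto
    have s: "(\<Sum>i<M. e i) \<le> L" using pe by (simp add: exps_def)
    have "ipoly M (a * 2 + (\<Sum>i<M. e i) * 2) (B ^ a * B ^ (\<Sum>i<M. e i)) (F p)"
      unfolding F_def pe fst_conv snd_conv by (intro ipoly_mult ipoly_power ipoly_prod_power f0 f)
    then show ?thesis
    proof (rule ipoly_mono)
      show "a * 2 + (\<Sum>i<M. e i) * 2 \<le> 4 * L" using s pe by simp
      show "B ^ a * B ^ (\<Sum>i<M. e i) \<le> B ^ (2 * L)"
        unfolding power_add[symmetric] using B s pe by (intro power_increasing) auto
    qed
  qed
  note rep = this[unfolded ipoly_def]
  define k :: "nat \<times> (nat \<Rightarrow> nat) \<Rightarrow> (nat \<Rightarrow> nat) \<Rightarrow> int" where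
    "k p = (SOME k. (\<Sum>e\<in>?P. \<bar>k e\<bar>) \<le> B ^ (2 * L) \<and> (\<forall>x. F p x = (\<Sum>e\<in>?P. of_int (k e) * monom_val M e x)))" for p
  have k': "(\<Sum>e\<in>?P. \<bar>k p e\<bar>) \<le> B ^ (2 * L) \<and> (\<forall>x. F p x = (\<Sum>e\<in>?P. of_int (k p e) * monom_val M e x))" if p: "p \<in> ?A" for p
    unfolding k_def by (rule someI_ex[OF rep[OF p]])
  have k: "(\<Sum>e\<in>?P. \<bar>k p e\<bar>) \<le> B ^ (2 * L)" "F p x = (\<Sum>e\<in>?P. of_int (k p e) * monom_val M e x)" if "p \<in> ?A" for p x
    using k'[OF that] by simp_all
  have kb: "\<bar>k p e\<bar> \<le> B ^ (2 * L)" if "p \<in> ?A" "e \<in> ?P" for p e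
  proof -
    have "\<bar>k p e\<bar> \<le> (\<Sum>e\<in>?P. \<bar>k p e\<bar>)" by (rule member_le_sum) (use that P in auto)
    then show ?thesis using k(1)[OF that(1)] by simp
  qed
  have H0: "0 \<le> H" using B by (simp add: H_def)
  define K where "K = int (card ?A) * (H * B ^ (2 * L))"
  have K0: "0 \<le> K" using H0 B by (simp add: K_def)
  let ?D = "?A \<rightarrow>\<^sub>E {0..H}" and ?R = "?P \<rightarrow>\<^sub>E {- K..K}"
  define \<Phi> where "\<Phi> c = (\<lambda>e\<in>?P. \<Sum>p\<in>?A. c p * k p e)" for c :: "nat \<times> (nat \<Rightarrow> nat) \<Rightarrow> int"
  have img: "\<Phi> ` ?D \<subseteq> ?R"
  proof -
    have "\<bar>\<Sum>p\<in>?A. c p * k p e\<bar> \<le> K" if c: "c \<in> ?D" and e: "e \<in> ?P" for c e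
    proof -
      have "\<bar>\<Sum>p\<in>?A. c p * k p e\<bar> \<le> (\<Sum>p\<in>?A. H * B ^ (2 * L))"
      proof (rule order_trans[OF sum_abs], rule sum_mono)
        fix p assume p: "p \<in> ?A"
        then have "c p \<in> {0..H}" using c by (auto simp: PiE_def Pi_def)
        then show "\<bar>c p * k p e\<bar> \<le> H * B ^ (2 * L)" unfolding abs_mult using kb[OF p e] by (intro mult_mono) auto
      qed
      then show ?thesis by (simp add: K_def)
    qed
    then have in_range: "(\<Sum>p\<in>?A. c p * k p e) \<in> {- K..K}" if "c \<in> ?D" "e \<in> ?P" for c e
      using that unfolding atLeastAtMost_iff abs_le_iff by (simp only: neg_le_iff_le minus_le_iff simp_thms)
    show ?thesis
    proof (rule image_subsetI)
      fix c assume c: "c \<in> ?D"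
      show "\<Phi> c \<in> ?R"
        by (rule PiE_I) (simp_all only: \<Phi>_def restrict_apply if_True if_False in_range[OF c])
    qed
  qed
  have cardD: "card ?D = nat (H + 1) ^ card ?A" using H0 A by (simp add: card_PiE)
  have cardR: "card ?R = nat (2 * K + 1) ^ card ?P" using K0 P by (simp add: card_PiE)
  \<comment> \<open>\<open>H\<close> is twice the number of products times
    \<open>B ^ (2 * L)\<close>, chosen so that \<open>2 * K = H * H\<close>. Since there are at
    least twice as many products as monomials, coefficient choices outnumber the possible
    results.\<close>
  have "2 * K + 1 < (H + 1) ^ 2"
  proof -
    have "2 * K = H * H" by (simp add: K_def cardA H_def)
    moreover have "0 < H"
    proof -
      have "0 < card (exps M L)" using zero_exps[of M L] finite_exps unfolding card_gt_0_iff by blast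
      then show ?thesis using B by (simp add: H_def L_def)
    qed
    ultimately show ?thesis by (simp add: power2_eq_square algebra_simps)
  qed
  then have "nat (2 * K + 1) < nat (H + 1) ^ 2" using H0 K0 by (simp add: nat_less_iff nat_power_eq)
  then have "nat (2 * K + 1) ^ card ?P < (nat (H + 1) ^ 2) ^ card ?P" using Ppos by (intro power_strict_mono) auto
  also have "\<dots> = nat (H + 1) ^ (2 * card ?P)" by (simp add: power_mult)
  also have "\<dots> \<le> nat (H + 1) ^ card ?A" using AP H0 by (intro power_increasing) auto
  finally have "card ?R < card ?D" by (simp only: cardD cardR)
  moreover have "card (\<Phi> ` ?D) \<le> card ?R" using img P by (intro card_mono finite_PiE) auto
  ultimately have "\<not> inj_on \<Phi> ?D" by (intro pigeonhole) simp
  then obtain c1 c2 where c: "c1 \<in> ?D" "c2 \<in> ?D" "c1 \<noteq> c2" "\<Phi> c1 = \<Phi> c2" by (auto simp: inj_on_def)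
  define c where "c a e = c1 (a, e) - c2 (a, e)" for a e
  obtain q where q: "q \<in> ?A" "c1 q \<noteq> c2 q" using PiE_ext[OF c(1,2)] c(3) by blast
  have "\<exists>a<L. \<exists>e\<in>exps M L. c a e \<noteq> 0" using q by (intro exI[of _ "fst q"] conjI bexI[of _ "snd q"]) (auto simp: c_def)
  moreover have "\<bar>c a e\<bar> \<le> H" if "a < L" "e \<in> exps M L" for a e
  proof -
    have "c1 (a, e) \<in> {0..H}" "c2 (a, e) \<in> {0..H}" using c(1,2) that by (auto simp: PiE_def Pi_def)
    then show ?thesis by (auto simp: c_def)
  qed
  moreover have "(\<Sum>a<L. \<Sum>e\<in>exps M L. of_int (c a e) * (f0 x ^ a * (\<Prod>i<M. f i x ^ e i))) = 0" for x
  proof -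
    have "(\<Sum>a<L. \<Sum>e\<in>exps M L. of_int (c a e) * (f0 x ^ a * (\<Prod>i<M. f i x ^ e i)))
        = (\<Sum>p\<in>?A. of_int (c1 p - c2 p) * F p x)"
      by (simp add: sum.cartesian_product F_def c_def case_prod_unfold)
    also have "\<dots> = (\<Sum>p\<in>?A. \<Sum>e\<in>?P. of_int ((c1 p - c2 p) * k p e) * monom_val M e x)"
      by (intro sum.cong refl) (simp add: k(2) sum_distrib_left mult.assoc)
    also have "\<dots> = (\<Sum>e\<in>?P. of_int (\<Sum>p\<in>?A. (c1 p - c2 p) * k p e) * monom_val M e x)"
      by (subst sum.swap) (simp add: sum_distrib_right)
    also have "\<dots> = 0"
    proof (rule sum.neutral, rule ballI)
      fix e assume "e \<in> ?P"
      then have "(\<Sum>p\<in>?A. c1 p * k p e) = (\<Sum>p\<in>?A. c2 p * k p e)" using fun_cong[OF c(4), of e] by (simp add: \<Phi>_def)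
      then show "of_int (\<Sum>p\<in>?A. (c1 p - c2 p) * k p e) * monom_val M e x = 0" by (simp add: left_diff_distrib sum_subtractf)
    qed
    finally show ?thesis .
  qed
  ultimately show ?thesis by blast
qed

section \<open>Generic exponents and roots of limit polynomials\<close>

lemma digits_unique:
  fixes d d' :: "nat \<Rightarrow> nat"
  assumes "\<And>p. d p < b" "\<And>p. d' p < b" "(\<Sum>p<n. b ^ p * d p) = (\<Sum>p<n. b ^ p * d' p)" "p < n"
  shows "d p = d' p"
  using assms
proof (induction n arbitrary: d d' p)
  case (Suc n)
  have s: "(\<Sum>p<Suc n. b ^ p * f p) = f 0 + b * (\<Sum>p<n. b ^ p * f (Suc p))" for f
    by (simp add: sum.lessThan_Suc_shift sum_distrib_left mult.assoc del: sum.lessThan_Suc)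
  have eq: "d 0 + b * (\<Sum>p<n. b ^ p * d (Suc p)) = d' 0 + b * (\<Sum>p<n. b ^ p * d' (Suc p))"
    using Suc.prems(3) unfolding s .
  have b: "d 0 < b" "d' 0 < b" "b \<noteq> 0" using Suc.prems(1)[of 0] Suc.prems(2)[of 0] by auto
  have z: "d 0 = d' 0" using arg_cong[OF eq, of "\<lambda>x. x mod b"] b by simp
  then have "(\<Sum>p<n. b ^ p * d (Suc p)) = (\<Sum>p<n. b ^ p * d' (Suc p))" using eq b by simp
  then have "d (Suc q) = d' (Suc q)" if "q < n" for q
    using Suc.IH[of "\<lambda>p. d (Suc p)" "\<lambda>p. d' (Suc p)" q] Suc.prems(1,2) that by blast
  then show ?case using z Suc.prems(4) by (cases p) auto
qed simp

text \<open>The weights are distinct powers of D + 1, so that the weighted sum shows the exponents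
  as digits; \<open>\<pi>\<close> says which positions are in use.\<close>

lemma weights_unique:
  assumes e: "e \<in> exps M D" "e' \<in> exps M D" and \<pi>: "inj_on \<pi> {..<M}"
    and eq: "(\<Sum>i<M. (D + 1) ^ \<pi> i * e i) = (\<Sum>i<M. (D + 1) ^ \<pi> i * e' i)"
  shows "e = e'"
proof -
  obtain n where n: "\<pi> ` {..<M} \<subseteq> {..<n}" using finite_nat_iff_bounded[of "\<pi> ` {..<M}"] by auto
  define x where "x f p = (if p \<in> \<pi> ` {..<M} then f (inv_into {..<M} \<pi> p) else 0)" for f :: "nat \<Rightarrow> nat" and p
  have s: "(\<Sum>p<n. (D + 1) ^ p * x f p) = (\<Sum>i<M. (D + 1) ^ \<pi> i * f i)" for f
  proof -
    have "(\<Sum>p<n. (D + 1) ^ p * x f p) = (\<Sum>p\<in>\<pi> ` {..<M}. (D + 1) ^ p * x f p)"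
      by (rule sum.mono_neutral_right) (use n in \<open>auto simp: x_def\<close>)
    also have "\<dots> = (\<Sum>i<M. (D + 1) ^ \<pi> i * f i)"
      unfolding sum.reindex[OF \<pi>] by (intro sum.cong) (use \<pi> in \<open>auto simp: x_def\<close>)
    finally show ?thesis .
  qed
  have b: "x f p < D + 1" if "f \<in> exps M D" for f p using exps_le[OF that] by (auto simp: x_def less_Suc_eq_le)
  show ?thesis
  proof
    fix i
    show "e i = e' i"
    proof (cases "i < M")
      case True
      have "x e (\<pi> i) = x e' (\<pi> i)"
        by (rule digits_unique[of "x e" "D + 1" "x e'" n]) (use b e s eq n True in auto)
      then show ?thesis using True \<pi> by (simp add: x_def)
    next
      case False then show ?thesis using e by (simp add: exps_def)
    qed
  qed
qed

text \<open>Among the exponent vectors that occur with a nonzero coefficient, one has the least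
  weight \<open>W m\<close>, and only one by \<open>w\<close>. After division by
  \<open>s n ^ W m\<close> all other terms tend to 0, and what remains in the limit is the
  polynomial in t that belongs to \<open>m\<close>.\<close>

lemma limit_root:
  fixes c :: "nat \<Rightarrow> (nat \<Rightarrow> nat) \<Rightarrow> int" and w :: "nat \<Rightarrow> nat" and T s :: "nat \<Rightarrow> real" and u g :: "nat \<Rightarrow> nat \<Rightarrow> real"
  assumes nz: "a0 < L" "e0 \<in> exps M D" "c a0 e0 \<noteq> 0"
    and zero: "\<And>n. (\<Sum>a<L. \<Sum>e\<in>exps M D. of_int (c a e) * (T n ^ a * (\<Prod>i<M. g n i ^ e i))) = 0"
    and T: "T \<longlonglongrightarrow> t" and s: "\<And>n. 0 < s n" "s \<longlonglongrightarrow> 0"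
    and g: "\<And>n i. i < M \<Longrightarrow> g n i = s n ^ w i * u n i" and u: "\<And>i. i < M \<Longrightarrow> (\<lambda>n. u n i) \<longlonglongrightarrow> 1"
    and w: "\<And>e e'. e \<in> exps M D \<Longrightarrow> e' \<in> exps M D \<Longrightarrow> (\<Sum>i<M. w i * e i) = (\<Sum>i<M. w i * e' i) \<Longrightarrow> e = e'"
  shows "\<exists>e\<in>exps M D. (\<exists>a<L. c a e \<noteq> 0) \<and> (\<Sum>a<L. of_int (c a e) * t ^ a) = 0"
proof -
  define E where "E = {e\<in>exps M D. \<exists>a<L. c a e \<noteq> 0}"
  define W where "W e = (\<Sum>i<M. w i * e i)" for e :: "nat \<Rightarrow> nat"
  have E: "finite E" "E \<noteq> {}" using nz by (auto simp: E_def)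
  obtain m where m: "m \<in> E" "\<And>e. e \<in> E \<Longrightarrow> W m \<le> W e"
    using arg_min_if_finite[OF E, of W] by (metis not_le)
  have Wlt: "W m < W e" if "e \<in> E" "e \<noteq> m" for e
    using m(2)[OF that(1)] w[of m e] that m(1) unfolding W_def E_def by (metis (no_types, lifting) le_neq_implies_less mem_Collect_eq)
  define h where "h n e = s n ^ (W e - W m) * (\<Prod>i<M. u n i ^ e i) * (\<Sum>a<L. of_int (c a e) * T n ^ a)" for n and e
  have pg: "(\<Prod>i<M. g n i ^ e i) = s n ^ W e * (\<Prod>i<M. u n i ^ e i)" for n e
  proof -
    have "(\<Prod>i<M. g n i ^ e i) = (\<Prod>i<M. s n ^ (w i * e i) * u n i ^ e i)"
      by (intro prod.cong) (auto simp: g power_mult_distrib power_mult)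
    then show ?thesis by (simp add: prod.distrib W_def power_sum)
  qed
  have hz: "(\<Sum>e\<in>E. h n e) = 0" for n
  proof -
    have "0 = (\<Sum>e\<in>exps M D. \<Sum>a<L. of_int (c a e) * (T n ^ a * (\<Prod>i<M. g n i ^ e i)))"
      using zero[of n] by (subst (asm) sum.swap) simp
    also have "\<dots> = (\<Sum>e\<in>E. \<Sum>a<L. of_int (c a e) * (T n ^ a * (\<Prod>i<M. g n i ^ e i)))"
      by (rule sum.mono_neutral_right) (auto simp: E_def)
    also have "\<dots> = (\<Sum>e\<in>E. s n ^ W m * h n e)"
    proof (intro sum.cong refl)
      fix e assume e: "e \<in> E"
      have "s n ^ W e = s n ^ W m * s n ^ (W e - W m)" using m(2)[OF e] by (simp add: power_add[symmetric])
      then show "(\<Sum>a<L. of_int (c a e) * (T n ^ a * (\<Prod>i<M. g n i ^ e i))) = s n ^ W m * h n e"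
        unfolding pg h_def sum_distrib_left by (intro sum.cong) auto
    qed
    also have "\<dots> = s n ^ W m * (\<Sum>e\<in>E. h n e)" by (simp add: sum_distrib_left)
    finally show ?thesis using s(1)[of n] by simp
  qed
  define h' where "h' e = (if e = m then (\<Sum>a<L. of_int (c a e) * t ^ a) else 0)" for e
  have lim: "(\<lambda>n. h n e) \<longlonglongrightarrow> h' e" if e: "e \<in> E" for e
  proof -
    have 1: "(\<lambda>n. s n ^ (W e - W m)) \<longlonglongrightarrow> 0 ^ (W e - W m)" by (intro tendsto_intros s)
    have 2: "(\<lambda>n. \<Prod>i<M. u n i ^ e i) \<longlonglongrightarrow> (\<Prod>i<M. 1 ^ e i)" by (intro tendsto_intros) (use u in auto)
    have 3: "(\<lambda>n. \<Sum>a<L. of_int (c a e) * T n ^ a) \<longlonglongrightarrow> (\<Sum>a<L. of_int (c a e) * t ^ a)" by (intro tendsto_intros T)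
    have "(\<lambda>n. h n e) \<longlonglongrightarrow> 0 ^ (W e - W m) * (\<Prod>i<M. 1 ^ e i) * (\<Sum>a<L. of_int (c a e) * t ^ a)"
      unfolding h_def by (intro tendsto_mult 1 2 3)
    moreover have "0 ^ (W e - W m) * (\<Prod>i<M. 1 ^ e i) * (\<Sum>a<L. of_int (c a e) * t ^ a) = h' e"
      using Wlt[OF e] by (cases "e = m") (auto simp: h'_def)
    ultimately show ?thesis by simp
  qed
  have "(\<lambda>n. \<Sum>e\<in>E. h n e) \<longlonglongrightarrow> (\<Sum>e\<in>E. h' e)" by (intro tendsto_sum lim)
  then have "(\<Sum>e\<in>E. h' e) = 0" unfolding hz using LIMSEQ_unique tendsto_const by blast
  then have "(\<Sum>a<L. of_int (c a m) * t ^ a) = 0" using E(1) m(1) by (simp add: h'_def)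
  then show ?thesis using m(1) unfolding E_def by blast
qed

text \<open>Let k be the lowest exponent that occurs. The term of exponent k has an integer
  coefficient of modulus at least 1 and is balanced by fewer than L terms, each at most
  \<open>H * t ^ Suc k\<close>.\<close>

lemma positive_root_bound:
  fixes c :: "nat \<Rightarrow> int" and t :: real
  assumes nz: "a0 < L" "c a0 \<noteq> 0" and H: "\<And>a. a < L \<Longrightarrow> \<bar>c a\<bar> \<le> H"
    and root: "(\<Sum>a<L. of_int (c a) * t ^ a) = 0" and t: "0 < t" "t \<le> 1"
  shows "1 \<le> t * (real L * of_int H)"
proof -
  define k where "k = (LEAST a. c a \<noteq> 0)"
  have k1: "c k \<noteq> 0" unfolding k_def by (rule LeastI[of "\<lambda>a. c a \<noteq> 0", OF nz(2)])
  have k2: "k \<le> a0" unfolding k_def by (rule Least_le[of "\<lambda>a. c a \<noteq> 0", OF nz(2)])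
  have k3: "c a = 0" if "a < k" for a using not_less_Least[OF that[unfolded k_def]] by simp
  note k = k1 k2 k3
  have kL: "k < L" using k nz by simp
  have "0 = (\<Sum>a<L. of_int (c a) * t ^ a)" using root by simp
  also have "\<dots> = of_int (c k) * t ^ k + (\<Sum>a\<in>{..<L} - {k}. of_int (c a) * t ^ a)" using kL by (simp add: sum.remove)
  also have "(\<Sum>a\<in>{..<L} - {k}. of_int (c a) * t ^ a) = (\<Sum>a\<in>{k<..<L}. of_int (c a) * t ^ a)"
    by (rule sum.mono_neutral_right) (auto simp: k(3) not_less le_less)
  finally have eq: "of_int (c k) * t ^ k = - (\<Sum>a\<in>{k<..<L}. of_int (c a) * t ^ a)" by simp
  have H0: "0 \<le> H" using H[OF nz(1)] by linarith
  have "1 * t ^ k \<le> \<bar>of_int (c k)\<bar> * t ^ k" using k(1) t by (intro mult_right_mono) (auto simp flip: of_int_abs)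
  also have "\<dots> = \<bar>of_int (c k) * t ^ k\<bar>" using t by (simp add: abs_mult)
  also have "\<dots> \<le> (\<Sum>a\<in>{k<..<L}. \<bar>of_int (c a) * t ^ a\<bar>)" unfolding eq by simp
  also have "\<dots> \<le> (\<Sum>a\<in>{k<..<L}. of_int H * t ^ Suc k)"
  proof (rule sum_mono)
    fix a assume a: "a \<in> {k<..<L}"
    have "\<bar>of_int (c a)\<bar> \<le> (of_int H :: real)" using H[of a] a by (simp flip: of_int_abs)
    moreover have "t ^ a \<le> t ^ Suc k" using a t by (intro power_decreasing) auto
    ultimately show "\<bar>of_int (c a) * t ^ a\<bar> \<le> of_int H * t ^ Suc k" using t H0 by (auto simp: abs_mult intro!: mult_mono)
  qed
  also have "\<dots> = real (card {k<..<L}) * (of_int H * t ^ Suc k)" by simp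
  also have "\<dots> \<le> real L * (of_int H * t ^ Suc k)" using t H0 by (intro mult_right_mono) auto
  finally have "t ^ k * 1 \<le> t ^ k * (t * (real L * of_int H))" by (simp add: algebra_simps)
  then show ?thesis using t by simp
qed

subsection \<open>The largest value of the smallest quadratic form\<close>

text \<open>Coordinate m homogenizes: it is 1 on \<open>Box m\<close>, so that forms stand for
  arbitrary quadratic polynomials in the others. In \<open>integer_point\<close> it becomes the
  common denominator.\<close>

definition qf :: "nat \<Rightarrow> (nat \<Rightarrow> nat \<Rightarrow> int) \<Rightarrow> (nat \<Rightarrow> real) \<Rightarrow> real" where
  "qf m C x = (\<Sum>a\<le>m. \<Sum>b\<le>m. of_int (C a b) * (x a * x b))"

definition dqf :: "nat \<Rightarrow> (nat \<Rightarrow> nat \<Rightarrow> int) \<Rightarrow> (nat \<Rightarrow> real) \<Rightarrow> nat \<Rightarrow> real" where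
  "dqf m C x j = (\<Sum>b\<le>m. of_int (C j b + C b j) * x b)"

lemma qf_shift: "qf m C (\<lambda>a. x a + e * d a) = qf m C x + e * (\<Sum>j\<le>m. d j * dqf m C x j) + e^2 * qf m C d"
proof -
  have "qf m C (\<lambda>a. x a + e * d a) = (\<Sum>a\<le>m. \<Sum>b\<le>m. of_int (C a b) * (x a * x b)
      + (e * (of_int (C a b) * (d a * x b)) + e * (of_int (C a b) * (x a * d b))) + e^2 * (of_int (C a b) * (d a * d b)))"
    unfolding qf_def by (intro sum.cong refl) (simp add: algebra_simps power2_eq_square)
  also have "\<dots> = qf m C x + (e * (\<Sum>a\<le>m. \<Sum>b\<le>m. of_int (C a b) * (d a * x b)) + e * (\<Sum>a\<le>m. \<Sum>b\<le>m. of_int (C a b) * (x a * d b)))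
     + e^2 * qf m C d"
    unfolding qf_def sum.distrib by (simp add: sum_distrib_left)
  also have "(\<Sum>a\<le>m. \<Sum>b\<le>m. of_int (C a b) * (x a * d b)) = (\<Sum>b\<le>m. \<Sum>a\<le>m. of_int (C a b) * (x a * d b))" by (rule sum.swap)
  also have "e * (\<Sum>a\<le>m. \<Sum>b\<le>m. of_int (C a b) * (d a * x b)) + e * (\<Sum>b\<le>m. \<Sum>a\<le>m. of_int (C a b) * (x a * d b))
     = e * (\<Sum>j\<le>m. d j * dqf m C x j)"
    unfolding dqf_def sum_distrib_left distrib_left[symmetric] sum.distrib[symmetric]
    by (intro sum.cong refl arg_cong[of _ _ "(*) e"]) (simp add: algebra_simps)
  finally show ?thesis by simp
qed

text \<open>Coordinates beyond m are fixed, which makes the box a product of compact sets in the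
  space of sequences. The width 2 leaves room around points with coordinates below 3/2, used in
  \<open>kkt\<close>.\<close>

definition Box :: "nat \<Rightarrow> (nat \<Rightarrow> real) set" where
  "Box m = {x. \<forall>j. x j \<in> (if j < m then {-2..2} else if j = m then {1} else {0})}"

lemma compact_Box: "compact (Box m)"
proof -
  have "compactin (product_topology (\<lambda>_. euclidean) UNIV) (PiE UNIV (\<lambda>j. if j < m then {-2..2::real} else if j = m then {1} else {0}))"
    unfolding compactin_PiE by auto
  moreover have "PiE UNIV (\<lambda>j. if j < m then {-2..2::real} else if j = m then {1} else {0}) = Box m"
    by (auto simp: Box_def PiE_def Pi_def)
  ultimately show ?thesis by (simp add: euclidean_product_topology)
qed

lemma Box_nonempty: "Box m \<noteq> {}"
proof -
  have "(\<lambda>j. if j = m then 1 else 0) \<in> Box m" by (auto simp: Box_def)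
  then show ?thesis by blast
qed

lemma Box_iff: "x \<in> Box m \<longleftrightarrow> (\<forall>j<m. \<bar>x j\<bar> \<le> 2) \<and> x m = 1 \<and> (\<forall>j>m. x j = 0)"
proof
  assume "x \<in> Box m"
  then have *: "x j \<in> (if j < m then {-2..2} else if j = m then {1} else {0})" for j by (simp add: Box_def)
  have "\<bar>x j\<bar> \<le> 2" if "j < m" for j using *[of j] that by (simp add: abs_le_iff)
  moreover have "x m = 1" using *[of m] by simp
  moreover have "x j = 0" if "j > m" for j using *[of j] that by simp
  ultimately show "(\<forall>j<m. \<bar>x j\<bar> \<le> 2) \<and> x m = 1 \<and> (\<forall>j>m. x j = 0)" by blast
next
  assume *: "(\<forall>j<m. \<bar>x j\<bar> \<le> 2) \<and> x m = 1 \<and> (\<forall>j>m. x j = 0)"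
  show "x \<in> Box m" unfolding Box_def
  proof (rule CollectI, rule allI)
    fix j
    consider "j < m" | "j = m" | "j > m" by linarith
    then show "x j \<in> (if j < m then {-2..2} else if j = m then {1} else {0})"
    proof cases
      case 1
      then have "\<bar>x j\<bar> \<le> 2" using * by blast
      then show ?thesis using 1 by (simp add: abs_le_iff)
    qed (use * in auto)
  qed
qed

lemma Box_abs: "x \<in> Box m \<Longrightarrow> j < m \<Longrightarrow> \<bar>x j\<bar> \<le> 2"
  by (simp add: Box_iff)

lemma continuous_on_Min:
  fixes h :: "'k \<Rightarrow> 'a :: topological_space \<Rightarrow> real"
  assumes "finite K" "K \<noteq> {}" "\<And>k. k \<in> K \<Longrightarrow> continuous_on S (h k)"
  shows "continuous_on S (\<lambda>x. Min ((\<lambda>k. h k x) ` K))"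
  using assms
proof (induction K rule: finite_ne_induct)
  case (insert k K)
  then have "continuous_on S (\<lambda>x. min (h k x) (Min ((\<lambda>k. h k x) ` K)))" by (intro continuous_on_min) auto
  then show ?case using insert by simp
qed simp

text \<open>The maximum of the smallest \<open>h k\<close>, perturbed by the infinitesimals \<open>s ^ w p\<close>, \<open>p < m + q\<close>,
  whose exponents are powers of one base and hence generic.\<close>

locale maxmin =
  fixes m q :: nat and C :: "nat \<Rightarrow> nat \<Rightarrow> nat \<Rightarrow> int" and w :: "nat \<Rightarrow> nat"
  assumes m: "0 < m"
    and box: "\<And>j. j < m \<Longrightarrow> \<exists>k<q. \<forall>x. x m = 1 \<longrightarrow> qf m (C k) x = 1 - x j"
      "\<And>j. j < m \<Longrightarrow> \<exists>k<q. \<forall>x. x m = 1 \<longrightarrow> qf m (C k) x = 1 + x j"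
    and w: "\<And>p. 0 < w p"
begin

definition h :: "real \<Rightarrow> nat \<Rightarrow> (nat \<Rightarrow> real) \<Rightarrow> real" where
  "h s k x = qf m (C k) x - (\<Sum>j<m. s ^ w j * x j) - s ^ w (m + k)"

definition F :: "real \<Rightarrow> (nat \<Rightarrow> real) \<Rightarrow> real" where "F s x = Min ((\<lambda>k. h s k x) ` {..<q})"

lemma q: "0 < q" using box(1)[OF m] by auto

lemma F_le: "k < q \<Longrightarrow> F s x \<le> h s k x" unfolding F_def by (intro Min_le) auto

lemma F_attained: "\<exists>k<q. F s x = h s k x"
proof -
  have "F s x \<in> (\<lambda>k. h s k x) ` {..<q}" unfolding F_def using q by (intro Min_in) auto
  then show ?thesis by auto
qed

lemma h0: "h 0 k x = qf m (C k) x"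
  using w by (simp add: h_def zero_power)

lemma continuous_h: "continuous_on S (h s k)"
  unfolding h_def qf_def by (intro continuous_intros continuous_on_subset[OF continuous_on_product_coordinates subset_UNIV])

lemma F_max: "\<exists>x\<in>Box m. \<forall>y\<in>Box m. F s y \<le> F s x"
proof (rule continuous_attains_sup[OF compact_Box Box_nonempty])
  show "continuous_on (Box m) (F s)" unfolding F_def using q by (intro continuous_on_Min continuous_h) auto
qed

definition peak :: "real \<Rightarrow> nat \<Rightarrow> real" where "peak s = (SOME x. x \<in> Box m \<and> (\<forall>y\<in>Box m. F s y \<le> F s x))"

lemma peak: "peak s \<in> Box m" "y \<in> Box m \<Longrightarrow> F s y \<le> F s (peak s)"
proof -
  have "\<exists>x. x \<in> Box m \<and> (\<forall>y\<in>Box m. F s y \<le> F s x)" using F_max[of s] by blast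
  from someI_ex[OF this] show "peak s \<in> Box m" "y \<in> Box m \<Longrightarrow> F s y \<le> F s (peak s)" unfolding peak_def by auto
qed

lemma pow_le: "0 \<le> (s :: real) \<Longrightarrow> s \<le> 1 \<Longrightarrow> s ^ w p \<le> s"
  using power_decreasing[of 1 "w p" s] w[of p] by simp

lemma pert_bound:
  assumes "0 \<le> s" "s \<le> 1" "x \<in> Box m"
  shows "\<bar>(\<Sum>j<m. s ^ w j * x j) + s ^ w p\<bar> \<le> (2 * real m + 1) * s"
proof -
  have "\<bar>s ^ w j * x j\<bar> \<le> s * 2" if "j < m" for j
    unfolding abs_mult using Box_abs[OF assms(3) that] pow_le[OF assms(1,2), of j] assms by (intro mult_mono) auto
  then have "(\<Sum>j<m. \<bar>s ^ w j * x j\<bar>) \<le> (\<Sum>j<m. s * 2)" by (intro sum_mono) auto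
  then have "\<bar>\<Sum>j<m. s ^ w j * x j\<bar> \<le> 2 * real m * s" using order_trans[OF sum_abs[of "\<lambda>j. s ^ w j * x j" "{..<m}"]] by (simp add: mult.commute mult.left_commute)
  moreover have "\<bar>s ^ w p\<bar> \<le> s" using pow_le[OF assms(1,2), of p] assms(1) by simp
  ultimately show ?thesis by (simp add: algebra_simps)
qed

lemma h_diff:
  assumes "0 \<le> s" "s \<le> 1" "x \<in> Box m"
  shows "\<bar>h s k x - h 0 k x\<bar> \<le> (2 * real m + 1) * s"
  using pert_bound[OF assms, of "m + k"] unfolding h0 by (simp add: h_def)

lemma F_diff:
  assumes "0 \<le> s" "s \<le> 1" "x \<in> Box m"
  shows "\<bar>F s x - F 0 x\<bar> \<le> (2 * real m + 1) * s"
proof -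
  obtain k where k: "k < q" "F s x = h s k x" using F_attained by blast
  obtain l where l: "l < q" "F 0 x = h 0 l x" using F_attained by blast
  show ?thesis using F_le[OF k(1), of 0 x] F_le[OF l(1), of s x] h_diff[OF assms, of k] h_diff[OF assms, of l] k l by linarith
qed

definition top :: real where "top = F 0 (peak 0)"

lemma peak_diff:
  assumes "0 \<le> s" "s \<le> 1"
  shows "\<bar>F s (peak s) - top\<bar> \<le> (2 * real m + 1) * s"
  using F_diff[OF assms peak(1)[of s]] F_diff[OF assms peak(1)[of 0]] peak(2)[OF peak(1), of s 0] peak(2)[OF peak(1), of 0 s]
  unfolding top_def by linarith

text \<open>The forms \<open>1 - x j\<close> and \<open>1 + x j\<close> keep a maximizer of positive
  value in the interior of the box. No direction increases all active functions to first order,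
  since a short step would raise the minimum. So Gordan's theorem gives multipliers, and
  Caratheodory's theorem leaves at most m + 1 of them.\<close>

lemma kkt:
  assumes s: "0 < s" "(2 * real m + 1) * s < 1 / 2" and pos: "0 < F s (peak s)"
  shows "\<exists>I l. I \<subseteq> {..<q} \<and> card I \<le> Suc m \<and> sum l I = (1::real) \<and>
    (\<forall>k\<in>I. h s k (peak s) = F s (peak s)) \<and> (\<forall>j<m. (\<Sum>k\<in>I. l k * dqf m (C k) (peak s) j) = s ^ w j)"
proof -
  define x where "x = peak s"
  define t where "t = F s x"
  have s1: "s \<le> 1"
  proof -
    have "1 * s \<le> (2 * real m + 1) * s" using s by (intro mult_right_mono) auto
    then show ?thesis using s by linarith
  qed
  have xB: "x \<in> Box m" using peak(1) by (simp add: x_def)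
  have xm: "x m = 1" using xB by (simp add: Box_iff)
  define g where "g k j = dqf m (C k) x j - s ^ w j" for k j
  define A where "A = {k\<in>{..<q}. h s k x = t}"
  have A: "finite A" by (simp add: A_def)
  have inner: "\<bar>x j\<bar> < 3/2" if j: "j < m" for j
  proof -
    obtain k where k: "k < q" "\<And>x. x m = 1 \<Longrightarrow> qf m (C k) x = 1 - x j" using box(1)[OF j] by blast
    obtain k' where k': "k' < q" "\<And>x. x m = 1 \<Longrightarrow> qf m (C k') x = 1 + x j" using box(2)[OF j] by blast
    have "0 < h s k x" "0 < h s k' x" using F_le[OF k(1), of s x] F_le[OF k'(1), of s x] pos by (auto simp: x_def)
    moreover have "h 0 k x = 1 - x j" "h 0 k' x = 1 + x j" using k(2) k'(2) xm by (simp_all add: h0)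
    ultimately show ?thesis using h_diff[OF less_imp_le[OF s(1)] s1 xB, of k] h_diff[OF less_imp_le[OF s(1)] s1 xB, of k'] s(2) by linarith
  qed
  have "\<not> (\<exists>d. \<forall>k\<in>A. 0 < (\<Sum>j<m. d j * g k j))"
  proof
    assume "\<exists>d. \<forall>k\<in>A. 0 < (\<Sum>j<m. d j * g k j)"
    then obtain d where d: "\<And>k. k \<in> A \<Longrightarrow> 0 < (\<Sum>j<m. d j * g k j)" by blast
    define d' where "d' j = (if j < m then d j else 0)" for j
    define D where "D k = (\<Sum>j<m. d j * g k j)" for k
    have hs: "h s k (\<lambda>a. x a + e * d' a) = h s k x + e * D k + e^2 * qf m (C k) d'" for k e
    proof -
      have "(\<Sum>j\<le>m. d' j * dqf m (C k) x j) = (\<Sum>j<m. d j * dqf m (C k) x j)"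
        by (rule sum.mono_neutral_cong_right) (auto simp: d'_def)
      moreover have "(\<Sum>j<m. s ^ w j * (x j + e * d' j)) = (\<Sum>j<m. s ^ w j * x j) + e * (\<Sum>j<m. d j * s ^ w j)"
        unfolding sum_distrib_left sum.distrib[symmetric] by (intro sum.cong) (auto simp: d'_def algebra_simps)
      ultimately show ?thesis unfolding h_def qf_shift D_def g_def right_diff_distrib sum_subtractf by (simp add: algebra_simps)
    qed
    \<comment> \<open>Three limits on the step: \<open>e1\<close> for the quadratic terms of the
      active functions, \<open>e2\<close> to keep the inactive ones above \<open>t\<close>,
      \<open>e3\<close> to stay in the box.\<close>
    obtain e1 where e1: "e1 > 0" "\<forall>k\<in>A. e1 * (- qf m (C k) d') < D k"
      using small_multiple[OF A, of D "\<lambda>k. - qf m (C k) d'"] d unfolding D_def by blast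
    obtain e2 where e2: "e2 > 0" "\<forall>k\<in>{..<q} - A. e2 * (\<bar>D k\<bar> + \<bar>qf m (C k) d'\<bar>) < h s k x - t"
    proof -
      have "0 < h s k x - t" if "k \<in> {..<q} - A" for k
        using that F_le[of k s x] by (force simp: A_def t_def)
      then show ?thesis using small_multiple[of "{..<q} - A" "\<lambda>k. h s k x - t" "\<lambda>k. \<bar>D k\<bar> + \<bar>qf m (C k) d'\<bar>"] that by blast
    qed
    obtain e3 where e3: "e3 > 0" "\<forall>j\<in>{..<m}. e3 * \<bar>d' j\<bar> < 1/2"
      using small_multiple[of "{..<m}" "\<lambda>_. 1/2" "\<lambda>j. \<bar>d' j\<bar>"] by auto
    define e where "e = min (min e1 1) (min e2 e3)"
    have e: "0 < e" "e \<le> e1" "e \<le> 1" "e \<le> e2" "e \<le> e3" using e1 e2 e3 by (auto simp: e_def)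
    define y where "y = (\<lambda>a. x a + e * d' a)"
    have "y \<in> Box m"
    proof -
      have "\<bar>y j\<bar> \<le> 2" if "j < m" for j
      proof -
        have "e * \<bar>d' j\<bar> \<le> e3 * \<bar>d' j\<bar>" using e by (intro mult_right_mono) auto
        moreover have "e3 * \<bar>d' j\<bar> < 1/2" using e3 that by blast
        ultimately have "e * \<bar>d' j\<bar> < 1/2" by linarith
        then have "\<bar>e * d' j\<bar> < 1/2" using e by (simp add: abs_mult)
        then show ?thesis using inner[OF that] unfolding y_def by linarith
      qed
      moreover have "y j = x j" if "\<not> j < m" for j using that by (simp add: y_def d'_def)
      ultimately show ?thesis using xB unfolding Box_iff by auto
    qed
    moreover have "t < h s k y" if "k < q" for k
    proof (cases "k \<in> A")
      case True
      have "e * (- qf m (C k) d') \<le> max 0 (e1 * (- qf m (C k) d'))"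
      proof (cases "0 \<le> - qf m (C k) d'")
        case True then have "e * (- qf m (C k) d') \<le> e1 * (- qf m (C k) d')" using e by (intro mult_right_mono) auto
        then show ?thesis by simp
      next
        case False then have "e * (- qf m (C k) d') \<le> 0" using e by (intro mult_nonneg_nonpos) auto
        then show ?thesis by simp
      qed
      also have "\<dots> < D k" using e1 True d[OF True] by (auto simp: D_def)
      finally have "0 < e * (D k + e * qf m (C k) d')" using e by (simp add: mult_pos_pos)
      then show ?thesis using True unfolding y_def hs by (simp add: A_def algebra_simps power2_eq_square)
    next
      case False
      have "\<bar>e * D k + e^2 * qf m (C k) d'\<bar> \<le> e * (\<bar>D k\<bar> + \<bar>qf m (C k) d'\<bar>)"
      proof -
        have "e^2 * \<bar>qf m (C k) d'\<bar> \<le> e * \<bar>qf m (C k) d'\<bar>" using e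
          by (intro mult_right_mono) (auto simp: power2_eq_square mult_left_le)
        moreover have "\<bar>e * D k + e^2 * qf m (C k) d'\<bar> \<le> \<bar>e * D k\<bar> + \<bar>e^2 * qf m (C k) d'\<bar>" by (rule abs_triangle_ineq)
        ultimately show ?thesis using e by (simp add: abs_mult distrib_left)
      qed
      also have "\<dots> \<le> e2 * (\<bar>D k\<bar> + \<bar>qf m (C k) d'\<bar>)" using e by (intro mult_right_mono) auto
      also have "\<dots> < h s k x - t" using e2 that False by blast
      finally show ?thesis unfolding y_def hs by linarith
    qed
    moreover obtain k where "k < q" "F s y = h s k y" using F_attained by blast
    ultimately show False using peak(2)[of y s] unfolding t_def x_def by (metis not_le)
  qed
  then obtain l0 where "\<forall>i\<in>A. 0 \<le> l0 i" "(\<Sum>i\<in>A. l0 i) = 1" "\<forall>j<m. (\<Sum>i\<in>A. l0 i * g i j) = 0"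
    using gordan[OF A, of g m] by blast
  then obtain I l where Il: "I \<subseteq> A" "card I \<le> Suc m" "(\<Sum>i\<in>I. l i) = (1::real)" "\<forall>j<m. (\<Sum>i\<in>I. l i * g i j) = 0"
    using caratheodory[OF A, of l0 m g] by blast
  have "(\<Sum>k\<in>I. l k * dqf m (C k) x j) = s ^ w j" if "j < m" for j
  proof -
    have "0 = (\<Sum>k\<in>I. l k * dqf m (C k) x j) - sum l I * s ^ w j"
      using Il(4) that by (simp add: g_def right_diff_distrib sum_subtractf sum_distrib_right)
    then show ?thesis using Il(3) by simp
  qed
  then show ?thesis using Il unfolding A_def x_def t_def by (intro exI[of _ I] exI[of _ l]) auto
qed

end

text \<open>The largest value of L = 2 * 4 ^ M for the at most 2 m variables of
  \<open>top_bound\<close>. Correspondingly \<open>root_bound m\<close> majorizes the factor L * H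
  of \<open>positive_root_bound\<close>.\<close>

definition lim_deg :: "nat \<Rightarrow> nat" where "lim_deg m = 2 * 4 ^ (2 * m)"

definition root_bound :: "nat \<Rightarrow> nat" where
  "root_bound m = lim_deg m * (2 * (lim_deg m * (lim_deg m + 1) ^ (2 * m)) * (8 * (m + 1)^2) ^ (2 * lim_deg m))"

lemma ipoly_qf:
  assumes X: "\<And>a. a \<le> m \<Longrightarrow> ipoly M 1 1 (\<lambda>z. X z a)" and C: "\<And>a b. a \<le> m \<Longrightarrow> b \<le> m \<Longrightarrow> \<bar>C a b\<bar> \<le> 2"
  shows "ipoly M 2 (2 * (int m + 1)^2) (\<lambda>z. qf m C (X z))"
proof -
  have "ipoly M 2 2 (\<lambda>z. of_int (C a b) * (X z a * X z b))" if "a \<le> m" "b \<le> m" for a b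
  proof (rule ipoly_mono)
    show "ipoly M (1 + 1) (\<bar>C a b\<bar> * (1 * 1)) (\<lambda>z. of_int (C a b) * (X z a * X z b))"
      using that by (intro ipoly_scale ipoly_mult X)
  qed (use C that in auto)
  then have "ipoly M 2 (\<Sum>a\<le>m. \<Sum>b\<le>m. 2) (\<lambda>z. \<Sum>a\<le>m. \<Sum>b\<le>m. of_int (C a b) * (X z a * X z b))"
    by (intro ipoly_sum) auto
  then show ?thesis unfolding qf_def by (rule ipoly_mono) (simp_all add: power2_eq_square algebra_simps)
qed

lemma ipoly_dqf:
  assumes X: "\<And>a. a \<le> m \<Longrightarrow> ipoly M 1 1 (\<lambda>z. X z a)" and C: "\<And>a b. a \<le> m \<Longrightarrow> b \<le> m \<Longrightarrow> \<bar>C a b\<bar> \<le> 2" and j: "j \<le> m"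
  shows "ipoly M 1 (4 * (int m + 1)) (\<lambda>z. dqf m C (X z) j)"
proof -
  have "ipoly M 1 4 (\<lambda>z. of_int (C j b + C b j) * X z b)" if "b \<le> m" for b
  proof (rule ipoly_mono)
    show "ipoly M 1 (\<bar>C j b + C b j\<bar> * 1) (\<lambda>z. of_int (C j b + C b j) * X z b)"
      using that by (intro ipoly_scale X)
  qed (use C[OF j that] C[OF that j] in auto)
  then have "ipoly M 1 (\<Sum>b\<le>m. 4) (\<lambda>z. \<Sum>b\<le>m. of_int (C j b + C b j) * X z b)"
    by (intro ipoly_sum) auto
  then show ?thesis unfolding dqf_def by (rule ipoly_mono) simp_all
qed

lemma qf_cong: "(\<And>a. a \<le> m \<Longrightarrow> x a = y a) \<Longrightarrow> qf m C x = qf m C y"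
  unfolding qf_def by (intro sum.cong) auto

lemma dqf_cong: "(\<And>a. a \<le> m \<Longrightarrow> x a = y a) \<Longrightarrow> dqf m C x j = dqf m C y j"
  unfolding dqf_def by (intro sum.cong) auto

context maxmin begin

text \<open>There are finitely many index sets, hence one of them serves infinitely many members of
  a null sequence of perturbations.\<close>

lemma kkt_sequence:
  assumes pos: "0 < top"
  obtains s :: "nat \<Rightarrow> real" and J and l :: "nat \<Rightarrow> nat \<Rightarrow> real" where "\<And>n. 0 < s n" "\<And>n. s n \<le> 1" "s \<longlonglongrightarrow> 0"
    "J \<subseteq> {..<q}" "card J \<le> Suc m" "\<And>n. sum (l n) J = 1"
    "\<And>n k. k \<in> J \<Longrightarrow> h (s n) k (peak (s n)) = F (s n) (peak (s n))"
    "\<And>n j. j < m \<Longrightarrow> (\<Sum>k\<in>J. l n k * dqf m (C k) (peak (s n)) j) = s n ^ w j"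
proof -
  \<comment> \<open>For s up to \<open>\<delta>\<close> the perturbation is at most 1/4, as
    \<open>kkt\<close> requires, and at most half of \<open>top\<close>, which keeps the perturbed
    maximum positive.\<close>
  define \<delta> where "\<delta> = min (1/4) (top / 2) / (2 * real m + 1)"
  have \<delta>: "0 < \<delta>" "(2 * real m + 1) * \<delta> = min (1/4) (top / 2)" using pos by (auto simp: \<delta>_def)
  define s where "s n = \<delta> / (real n + 1)" for n
  have s: "0 < s n" "s n \<le> \<delta>" for n using \<delta> by (auto simp: s_def divide_le_eq mult_left_le)
  have ms: "(2 * real m + 1) * s n \<le> min (1/4) (top / 2)" for n
    using mult_left_mono[OF s(2)[of n], of "2 * real m + 1"] \<delta>(2) by simp
  have s1: "s n \<le> 1" for n
  proof -
    have "1 * s n \<le> (2 * real m + 1) * s n" using s(1)[of n] by (intro mult_right_mono) auto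
    then show ?thesis using ms[of n] by linarith
  qed
  have s0: "s \<longlonglongrightarrow> 0" unfolding s_def
    by (rule tendsto_divide_0[OF tendsto_const]) (rule filterlim_at_top_imp_at_infinity, real_asymp)
  define P where "P n I l \<longleftrightarrow> I \<subseteq> {..<q} \<and> card I \<le> Suc m \<and> sum l I = (1::real) \<and>
    (\<forall>k\<in>I. h (s n) k (peak (s n)) = F (s n) (peak (s n))) \<and> (\<forall>j<m. (\<Sum>k\<in>I. l k * dqf m (C k) (peak (s n)) j) = s n ^ w j)" for n I l
  have "\<exists>I l. P n I l" for n unfolding P_def
  proof (rule kkt[OF s(1)])
    show "(2 * real m + 1) * s n < 1 / 2" using ms[of n] by linarith
    show "0 < F (s n) (peak (s n))" using peak_diff[of "s n"] s(1)[of n] s1[of n] ms[of n] pos by linarith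
  qed
  then obtain I l where Il: "\<And>n. P n (I n) (l n)" by metis
  have fin: "finite (I ` UNIV)" by (rule finite_subset[of _ "Pow {..<q}"]) (use Il in \<open>auto simp: P_def\<close>)
  obtain n0 where "infinite {n \<in> UNIV. I n = I n0}" using pigeonhole_infinite[OF infinite_UNIV_nat fin] by blast
  then obtain r :: "nat \<Rightarrow> nat" where r: "strict_mono r" "\<And>n. I (r n) = I n0" using infinite_enumerate[of "{n \<in> UNIV. I n = I n0}"] by auto
  have P: "P (r n) (I n0) (l (r n))" for n using Il[of "r n"] r(2)[of n] by simp
  show thesis
  proof (rule that[of "\<lambda>n. s (r n)" "I n0" "\<lambda>n. l (r n)"])
    show "(\<lambda>n. s (r n)) \<longlonglongrightarrow> 0" using LIMSEQ_subseq_LIMSEQ[OF s0 r(1)] by (simp add: o_def)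
  qed (use s s1 P in \<open>auto simp: P_def\<close>)
qed

text \<open>The variables are the m coordinates and r \<le> m multipliers, that of \<open>i1\<close>
  being eliminated because the sum is 1. \<open>f0\<close> is the form of \<open>i1\<close>; the
  other M polynomials are the m components of the combined gradient and the r differences of forms.
  At the perturbed maximizers \<open>f0\<close> tends to \<open>top\<close> and the others behave
  like powers of s with distinct generic exponents, so \<open>limit_root\<close> applies to their
  algebraic dependence.\<close>

lemma top_bound:
  assumes pos: "0 < top" and Cb: "\<And>k a b. k < q \<Longrightarrow> a \<le> m \<Longrightarrow> b \<le> m \<Longrightarrow> \<bar>C k a b\<bar> \<le> 2"
    and wdef: "\<And>p. w p = (lim_deg m + 1) ^ p"
  shows "1 \<le> top * real (root_bound m)"
proof -
  obtain s J l where K: "\<And>n. 0 < s n" "\<And>n. s n \<le> 1" "s \<longlonglongrightarrow> 0"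
    "J \<subseteq> {..<q}" "card J \<le> Suc m" "\<And>n. sum (l n) J = (1::real)"
    "\<And>n k. k \<in> J \<Longrightarrow> h (s n) k (peak (s n)) = F (s n) (peak (s n))"
    "\<And>n j. j < m \<Longrightarrow> (\<Sum>k\<in>J. l n k * dqf m (C k) (peak (s n)) j) = s n ^ w j"
    by (rule kkt_sequence[OF pos], rule that) (assumption | blast)+
  have J: "finite J" "J \<noteq> {}" using K(4) finite_subset K(6)[of 0] by auto
  \<comment> \<open>With the largest index the perturbation of \<open>i1\<close> is of higher order
    than the others; the difference of a form and that of \<open>i1\<close> then behaves like the
    perturbation of the former, with leading coefficient 1.\<close>
  define i1 where "i1 = Max J"
  have i1: "i1 \<in> J" "\<And>k. k \<in> J \<Longrightarrow> k \<le> i1" using J by (auto simp: i1_def)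
  define r where "r = card (J - {i1})"
  have r: "r \<le> m" using K(5) i1 J by (simp add: r_def)
  obtain \<phi> where \<phi>: "bij_betw \<phi> {..<r} (J - {i1})"
    using ex_bij_betw_nat_finite[of "J - {i1}"] J by (auto simp: r_def atLeast0LessThan)
  have \<phi>J: "\<phi> k \<in> J" "\<phi> k < i1" if "k < r" for k
    using bij_betwE[OF \<phi>] that i1(2)[of "\<phi> k"] by (auto simp: le_less)
  define M where "M = m + r"
  define X where "X z = (\<lambda>a. if a < m then z a else 1 :: real)" for z :: "nat \<Rightarrow> real"
  define f0 where "f0 z = qf m (C i1) (X z)" for z
  define f where "f i z = (if i < m then (\<Sum>k<r. z (m + k) * dqf m (C (\<phi> k)) (X z) i) + (1 - (\<Sum>k<r. z (m + k))) * dqf m (C i1) (X z) i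
     else qf m (C (\<phi> (i - m))) (X z) - qf m (C i1) (X z))" for i and z :: "nat \<Rightarrow> real"
  define B :: int where "B = 8 * (int m + 1)^2"
  have Xp: "ipoly M 1 1 (\<lambda>z. X z a)" for a
    using ipoly_var[of a M] ipoly_const[of 1 1 M 1] by (cases "a < m") (simp_all add: X_def M_def)
  have Ci: "\<bar>C k a b\<bar> \<le> 2" if "k \<in> J" "a \<le> m" "b \<le> m" for k a b using Cb[of k a b] that K(4) by auto
  have zp: "ipoly M 1 1 (\<lambda>z. z (m + k))" if "k < r" for k using ipoly_var[of "m + k" M] that by (simp add: M_def)
  have f0p: "ipoly M 2 B f0" unfolding f0_def
    by (rule ipoly_mono[OF ipoly_qf[OF Xp Ci[OF i1(1)]]]) (auto simp: B_def)
  have fp: "ipoly M 2 B (f i)" if "i < M" for i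
  proof (cases "i < m")
    case True
    have "ipoly M (1 + 1) ((\<Sum>k<r. 1 * (4 * (int m + 1))) + (1 + (\<Sum>k<r. 1)) * (4 * (int m + 1)))
      (\<lambda>z. (\<Sum>k<r. z (m + k) * dqf m (C (\<phi> k)) (X z) i) + (1 - (\<Sum>k<r. z (m + k))) * dqf m (C i1) (X z) i)"
    proof (rule ipoly_add)
      show "ipoly M (1 + 1) (\<Sum>k<r. 1 * (4 * (int m + 1))) (\<lambda>z. \<Sum>k<r. z (m + k) * dqf m (C (\<phi> k)) (X z) i)"
        by (intro ipoly_sum ipoly_mult zp ipoly_dqf Xp Ci \<phi>J) (use True in auto)
      have "ipoly M 1 (1 + (\<Sum>k<r. 1)) (\<lambda>z. 1 - (\<Sum>k<r. z (m + k)))"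
        using ipoly_diff[OF ipoly_const[of 1 1 M 1] ipoly_sum[of "{..<r}" M 1 "\<lambda>_. 1" "\<lambda>k z. z (m + k)"]] zp by simp
      then show "ipoly M (1 + 1) ((1 + (\<Sum>k<r. 1)) * (4 * (int m + 1))) (\<lambda>z. (1 - (\<Sum>k<r. z (m + k))) * dqf m (C i1) (X z) i)"
        by (rule ipoly_mult) (intro ipoly_dqf Xp Ci i1, use True in auto)
    qed
    moreover have "(\<Sum>k<r. 1 * (4 * (int m + 1))) + (1 + (\<Sum>k<r. 1)) * (4 * (int m + 1)) \<le> B"
    proof -
      have "(2 * int r + 1) * (4 * (int m + 1)) \<le> (2 * (int m + 1)) * (4 * (int m + 1))" using r by (intro mult_right_mono) auto
      then show ?thesis by (simp add: B_def power2_eq_square algebra_simps)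
    qed
    ultimately show ?thesis using True unfolding f_def by (auto elim: ipoly_mono)
  next
    case False
    then have "\<phi> (i - m) \<in> J" using \<phi>J that by (simp add: M_def)
    then have "ipoly M 2 (2 * (int m + 1)^2 + 2 * (int m + 1)^2) (\<lambda>z. qf m (C (\<phi> (i - m))) (X z) - qf m (C i1) (X z))"
      by (intro ipoly_diff ipoly_qf Xp Ci i1)
    then show ?thesis using False unfolding f_def by (auto elim: ipoly_mono simp: B_def)
  qed
  define L :: nat where "L = 2 * 4 ^ M"
  define H where "H = 2 * int (L * card (exps M L)) * B ^ (2 * L)"
  have B1: "1 \<le> B"
  proof -
    have "0 < (int m + 1)^2" by simp
    then show ?thesis unfolding B_def by linarith
  qed
  have "\<exists>c :: nat \<Rightarrow> (nat \<Rightarrow> nat) \<Rightarrow> int. (\<exists>a<L. \<exists>e\<in>exps M L. c a e \<noteq> 0) \<and> (\<forall>a<L. \<forall>e\<in>exps M L. \<bar>c a e\<bar> \<le> H) \<and>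
    (\<forall>x. (\<Sum>a<L. \<Sum>e\<in>exps M L. of_int (c a e) * (f0 x ^ a * (\<Prod>i<M. f i x ^ e i))) = 0)"
    unfolding L_def H_def by (rule algebraic_dependence[OF B1 f0p fp])
  then obtain c :: "nat \<Rightarrow> (nat \<Rightarrow> nat) \<Rightarrow> int" where cc: "(\<exists>a<L. \<exists>e\<in>exps M L. c a e \<noteq> 0) \<and> (\<forall>a<L. \<forall>e\<in>exps M L. \<bar>c a e\<bar> \<le> H) \<and>
    (\<forall>x. (\<Sum>a<L. \<Sum>e\<in>exps M L. of_int (c a e) * (f0 x ^ a * (\<Prod>i<M. f i x ^ e i))) = 0)"
    by (rule exE)
  note c1 = cc[THEN conjunct1] and c2 = cc[THEN conjunct2, THEN conjunct1] and c3 = cc[THEN conjunct2, THEN conjunct2]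
  obtain a0 e0 where c0: "a0 < L" "e0 \<in> exps M L" "c a0 e0 \<noteq> 0" using c1 by blast
  note c = c0 c2[rule_format] c3[rule_format]
  define z where "z n p = (if p < m then peak (s n) p else l n (\<phi> (p - m)))" for n p
  have pm: "peak (s n) m = 1" for n using peak(1)[of "s n"] by (simp add: Box_iff)
  have Xz: "X (z n) a = peak (s n) a" if "a \<le> m" for n a using that pm by (auto simp: X_def z_def)
  have qX: "qf m D (X (z n)) = qf m D (peak (s n))" for n D by (intro qf_cong Xz)
  have dX: "dqf m D (X (z n)) j = dqf m D (peak (s n)) j" for n D j by (intro dqf_cong Xz)
  have sumJ: "(\<Sum>k<r. g (\<phi> k)) + g i1 = sum g J" for g :: "nat \<Rightarrow> real"
    using sum.reindex_bij_betw[OF \<phi>, of g] i1(1) J(1) by (simp add: sum.remove)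
  have qJ: "qf m (C k) (peak (s n)) = F (s n) (peak (s n)) + (\<Sum>j<m. s n ^ w j * peak (s n) j) + s n ^ w (m + k)" if "k \<in> J" for n k
    using K(7)[OF that, of n] by (simp add: h_def)
  define \<pi> where "\<pi> i = (if i < m then i else m + \<phi> (i - m))" for i
  define u where "u n i = (if i < m then 1 else 1 - s n ^ (w (m + i1) - w (m + \<phi> (i - m))))" for n i
  have wl: "w p < w p'" if "p < p'" for p p'
    unfolding wdef using that by (intro power_strict_increasing) (auto simp: lim_deg_def)
  have g: "f i (z n) = s n ^ w (\<pi> i) * u n i" if i: "i < M" for n i
  proof (cases "i < m")
    case True
    have "l n i1 = 1 - (\<Sum>k<r. l n (\<phi> k))" using sumJ[of "l n"] K(6)[of n] by simp
    then have "f i (z n) = (\<Sum>k<r. l n (\<phi> k) * dqf m (C (\<phi> k)) (peak (s n)) i) + l n i1 * dqf m (C i1) (peak (s n)) i"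
      using True unfolding f_def dX by (simp add: z_def)
    also have "\<dots> = (\<Sum>k\<in>J. l n k * dqf m (C k) (peak (s n)) i)" by (rule sumJ)
    also have "\<dots> = s n ^ w i" by (rule K(8)[OF True])
    finally show ?thesis using True by (simp add: \<pi>_def u_def)
  next
    case False
    then have k: "i - m < r" using i by (simp add: M_def)
    have "f i (z n) = s n ^ w (m + \<phi> (i - m)) - s n ^ w (m + i1)"
      using False unfolding f_def qX by (simp add: qJ[OF \<phi>J(1)[OF k]] qJ[OF i1(1)])
    also have "s n ^ w (m + i1) = s n ^ w (m + \<phi> (i - m)) * s n ^ (w (m + i1) - w (m + \<phi> (i - m)))"
      using wl[of "m + \<phi> (i - m)" "m + i1"] \<phi>J(2)[OF k] by (simp add: power_add[symmetric])
    finally show ?thesis using False by (simp add: \<pi>_def u_def algebra_simps)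
  qed
  have u: "(\<lambda>n. u n i) \<longlonglongrightarrow> 1" if i: "i < M" for i
  proof (cases "i < m")
    case False
    then have "0 < w (m + i1) - w (m + \<phi> (i - m))" using wl[of "m + \<phi> (i - m)" "m + i1"] \<phi>J(2)[of "i - m"] i by (simp add: M_def)
    moreover have "(\<lambda>n. 1 - s n ^ (w (m + i1) - w (m + \<phi> (i - m)))) \<longlonglongrightarrow> 1 - 0 ^ (w (m + i1) - w (m + \<phi> (i - m)))"
      by (intro tendsto_intros K(3))
    ultimately show ?thesis using False by (simp add: u_def zero_power)
  qed (simp add: u_def)
  have T: "(\<lambda>n. f0 (z n)) \<longlonglongrightarrow> top"
  proof -
    have "\<bar>f0 (z n) - top\<bar> \<le> 2 * (2 * real m + 1) * s n" for n
    proof -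
      have "f0 (z n) = F (s n) (peak (s n)) + ((\<Sum>j<m. s n ^ w j * peak (s n) j) + s n ^ w (m + i1))"
        unfolding f0_def qX qJ[OF i1(1)] by simp
      then show ?thesis
        using peak_diff[of "s n"] pert_bound[OF _ K(2) peak(1), of n "s n" "m + i1"] K(1)[of n] K(2)[of n] by linarith
    qed
    moreover have "(\<lambda>n. 2 * (2 * real m + 1) * s n) \<longlonglongrightarrow> 0" using tendsto_mult_left[OF K(3), of "2 * (2 * real m + 1)"] by simp
    ultimately have "(\<lambda>n. f0 (z n) - top) \<longlonglongrightarrow> 0"
      by (intro Lim_null_comparison[of "\<lambda>n. f0 (z n) - top" "\<lambda>n. 2 * (2 * real m + 1) * s n"]) (auto intro: always_eventually)
    then show ?thesis by (simp add: LIM_zero_iff)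
  qed
  have inj: "inj_on \<pi> {..<M}"
  proof (rule inj_onI)
    fix i i' assume i: "i \<in> {..<M}" "i' \<in> {..<M}" "\<pi> i = \<pi> i'"
    show "i = i'"
    proof (cases "i < m \<or> i' < m")
      case True then show ?thesis using i by (auto simp: \<pi>_def split: if_splits)
    next
      case False
      then have "\<phi> (i - m) = \<phi> (i' - m)" using i by (simp add: \<pi>_def)
      moreover have "i - m \<in> {..<r}" "i' - m \<in> {..<r}" using i False by (auto simp: M_def)
      ultimately have "i - m = i' - m" using bij_betw_imp_inj_on[OF \<phi>] by (auto dest: inj_onD)
      then show ?thesis using False by linarith
    qed
  qed
  have LD: "L \<le> lim_deg m" unfolding L_def lim_deg_def M_def using r by (intro mult_left_mono power_increasing) auto
  have "\<exists>e\<in>exps M L. (\<exists>a<L. c a e \<noteq> 0) \<and> (\<Sum>a<L. of_int (c a e) * top ^ a) = 0"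
  proof (rule limit_root[OF c(1-3) c(5) T K(1,3) g u])
    show "e = e'" if "e \<in> exps M L" "e' \<in> exps M L" "(\<Sum>i<M. w (\<pi> i) * e i) = (\<Sum>i<M. w (\<pi> i) * e' i)" for e e'
      using weights_unique[OF _ _ inj, of e "lim_deg m" e'] exps_mono[OF LD, of M] that unfolding wdef by auto
  qed
  then obtain e a where e: "e \<in> exps M L" "a < L" "c a e \<noteq> 0" "(\<Sum>a<L. of_int (c a e) * top ^ a) = 0" by blast
  \<comment> \<open>The forms \<open>1 - x 0\<close> and \<open>1 + x 0\<close> have sum 2, so the
    smaller one is at most 1.\<close>
  have top1: "top \<le> 1"
  proof -
    obtain k where k: "k < q" "\<And>x. x m = 1 \<Longrightarrow> qf m (C k) x = 1 - x 0" using box(1)[OF m] by blast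
    obtain k' where k': "k' < q" "\<And>x. x m = 1 \<Longrightarrow> qf m (C k') x = 1 + x 0" using box(2)[OF m] by blast
    have "peak 0 m = 1" using peak(1)[of 0] by (simp add: Box_iff)
    then show ?thesis using F_le[OF k(1), of 0 "peak 0"] F_le[OF k'(1), of 0 "peak 0"] k(2) k'(2) unfolding h0 top_def by simp
  qed
  have "1 \<le> top * (real L * of_int H)"
    by (rule positive_root_bound[OF e(2), of "\<lambda>a. c a e", OF e(3) c(4)[OF _ e(1)] e(4) pos top1])
  also have "real L * of_int H \<le> real (root_bound m)"
  proof -
    have "card (exps M L) \<le> (L + 1) ^ M" by (rule card_exps_le)
    also have "\<dots> \<le> (lim_deg m + 1) ^ M" using LD by (intro power_mono) auto
    also have "\<dots> \<le> (lim_deg m + 1) ^ (2 * m)" using r by (intro power_increasing) (auto simp: M_def)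
    finally have ce: "card (exps M L) \<le> (lim_deg m + 1) ^ (2 * m)" .
    have "B = int (8 * (m + 1)^2)" by (simp add: B_def)
    then have HH: "H = int (2 * (L * card (exps M L)) * (8 * (m + 1)^2) ^ (2 * L))" by (simp add: H_def)
    have "2 * (L * card (exps M L)) * (8 * (m + 1)^2) ^ (2 * L)
      \<le> 2 * (lim_deg m * (lim_deg m + 1) ^ (2 * m)) * (8 * (m + 1)^2) ^ (2 * lim_deg m)"
      using ce LD by (intro mult_le_mono power_increasing) auto
    then have "L * (2 * (L * card (exps M L)) * (8 * (m + 1)^2) ^ (2 * L)) \<le> root_bound m"
      unfolding root_bound_def by (rule mult_le_mono[OF LD])
    then have "real (L * (2 * (L * card (exps M L)) * (8 * (m + 1)^2) ^ (2 * L))) \<le> real (root_bound m)" by (rule of_nat_mono)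
    then show ?thesis unfolding HH by simp
  qed
  finally show ?thesis using pos by (simp add: mult_left_mono)
qed

end

text \<open>The number of grid steps per unit. By \<open>qf_grid\<close> rounding changes a form by
  at most \<open>4 * (m + 1)^2\<close> divided by this number, which is less than
  \<open>top\<close>.\<close>

definition grid_bound :: "nat \<Rightarrow> nat" where
  "grid_bound m = 4 * (m + 1)^2 * root_bound m + 1"

lemma qf_grid:
  assumes C: "\<And>a b. a \<le> m \<Longrightarrow> b \<le> m \<Longrightarrow> \<bar>C a b\<bar> \<le> 2"
    and x: "\<And>a. a \<le> m \<Longrightarrow> \<bar>x a\<bar> \<le> 1" and y: "\<And>a. a \<le> m \<Longrightarrow> \<bar>y a\<bar> \<le> 1" and xy: "\<And>a. a \<le> m \<Longrightarrow> \<bar>y a - x a\<bar> \<le> e"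
  shows "\<bar>qf m C y - qf m C x\<bar> \<le> 4 * (real m + 1)^2 * e"
proof -
  have "\<bar>of_int (C a b) * (y a * y b) - of_int (C a b) * (x a * x b)\<bar> \<le> 4 * e" if ab: "a \<le> m" "b \<le> m" for a b
  proof -
    have "y a * y b - x a * x b = y a * (y b - x b) + x b * (y a - x a)" by (simp add: algebra_simps)
    also have "\<bar>\<dots>\<bar> \<le> \<bar>y a\<bar> * \<bar>y b - x b\<bar> + \<bar>x b\<bar> * \<bar>y a - x a\<bar>" by (metis abs_mult abs_triangle_ineq)
    also have "\<dots> \<le> 1 * e + 1 * e" using x y xy ab by (intro add_mono mult_mono) auto
    finally have d: "\<bar>y a * y b - x a * x b\<bar> \<le> 2 * e" by simp
    have c: "\<bar>real_of_int (C a b)\<bar> \<le> 2" using C[OF ab] by linarith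
    have "\<bar>of_int (C a b) * (y a * y b) - of_int (C a b) * (x a * x b)\<bar> = \<bar>real_of_int (C a b)\<bar> * \<bar>y a * y b - x a * x b\<bar>"
      by (simp add: abs_mult[symmetric] right_diff_distrib)
    also have "\<dots> \<le> 2 * (2 * e)" using c d by (intro mult_mono) auto
    finally show ?thesis by simp
  qed
  then have "(\<Sum>a\<le>m. \<Sum>b\<le>m. \<bar>of_int (C a b) * (y a * y b) - of_int (C a b) * (x a * x b)\<bar>) \<le> (\<Sum>a\<le>m. \<Sum>b\<le>m. 4 * e)"
    by (intro sum_mono) auto
  moreover have "qf m C y - qf m C x = (\<Sum>a\<le>m. \<Sum>b\<le>m. of_int (C a b) * (y a * y b) - of_int (C a b) * (x a * x b))"
    by (simp add: qf_def sum_subtractf)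
  moreover have "\<bar>\<Sum>a\<le>m. \<Sum>b\<le>m. of_int (C a b) * (y a * y b) - of_int (C a b) * (x a * x b)\<bar>
      \<le> (\<Sum>a\<le>m. \<Sum>b\<le>m. \<bar>of_int (C a b) * (y a * y b) - of_int (C a b) * (x a * x b)\<bar>)"
    by (rule order_trans[OF sum_abs]) (intro sum_mono sum_abs)
  moreover have "(\<Sum>a\<le>m. \<Sum>b\<le>m. 4 * e) = 4 * (real m + 1)^2 * e" by (simp add: power2_eq_square algebra_simps)
  ultimately show ?thesis by linarith
qed

text \<open>The given point only shows that \<open>top\<close> is positive. The point that is
  rounded is the maximizer, where all forms are at least \<open>top\<close>.\<close>

theorem integer_point:
  fixes C :: "nat \<Rightarrow> nat \<Rightarrow> nat \<Rightarrow> int" and x0 :: "nat \<Rightarrow> real"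
  assumes m: "0 < m" and C: "\<And>k a b. k < q \<Longrightarrow> a \<le> m \<Longrightarrow> b \<le> m \<Longrightarrow> \<bar>C k a b\<bar> \<le> 2"
    and x0: "\<And>j. j < m \<Longrightarrow> \<bar>x0 j\<bar> < 1" "x0 m = 1" and pos: "\<And>k. k < q \<Longrightarrow> 0 < qf m (C k) x0"
  shows "\<exists>X :: nat \<Rightarrow> int. (\<forall>j\<le>m. \<bar>X j\<bar> \<le> int (grid_bound m)) \<and> 0 < X m \<and> (\<forall>k<q. 0 < qf m (C k) (\<lambda>j. of_int (X j)))"
proof -
  define E where "E \<sigma> j a b = (if a = m \<and> b = m then 1 else if a = j \<and> b = m then \<sigma> else 0 :: int)" for \<sigma> :: int and j a b :: nat
  have qE: "qf m (E \<sigma> j) x = 1 + of_int \<sigma> * x j" if "j < m" "x m = 1" for \<sigma> j x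
  proof -
    have "(\<Sum>b\<le>m. of_int (E \<sigma> j a b) * (x a * x b)) = (if a = m then 1 else 0) + (if a = j then of_int \<sigma> * x j else 0)"
      for a
    proof -
      have "(\<Sum>b\<le>m. of_int (E \<sigma> j a b) * (x a * x b)) = (\<Sum>b\<in>{m}. of_int (E \<sigma> j a b) * (x a * x b))"
        by (rule sum.mono_neutral_right) (auto simp: E_def)
      then show ?thesis using that by (simp add: E_def)
    qed
    then show ?thesis unfolding qf_def using that by (simp add: sum.distrib)
  qed
  define C' where "C' k = (if k < q then C k else if k < q + m then E (-1) (k - q) else E 1 (k - q - m))" for k
  interpret maxmin m "q + 2 * m" C' "\<lambda>p. (lim_deg m + 1) ^ p"
  proof
    show "\<exists>k<q + 2 * m. \<forall>x. x m = 1 \<longrightarrow> qf m (C' k) x = 1 - x j" if "j < m" for j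
      using qE[OF that, of _ "-1"] that by (intro exI[of _ "q + j"]) (auto simp: C'_def)
    show "\<exists>k<q + 2 * m. \<forall>x. x m = 1 \<longrightarrow> qf m (C' k) x = 1 + x j" if "j < m" for j
      using qE[OF that, of _ 1] that by (intro exI[of _ "q + m + j"]) (auto simp: C'_def)
  qed (use m in auto)
  define z where "z j = (if j \<le> m then x0 j else 0)" for j
  have zB: "z \<in> Box m" unfolding Box_iff z_def using x0 by (fastforce dest: x0(1))
  have qz: "qf m D z = qf m D x0" for D by (rule qf_cong) (simp add: z_def)
  have "0 < h 0 k z" if k: "k < q + 2 * m" for k
  proof -
    consider "k < q" | "q \<le> k" "k < q + m" | "q + m \<le> k" by linarith
    then show ?thesis
    proof cases
      case 1 then show ?thesis using pos unfolding h0 qz by (simp add: C'_def)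
    next
      case 2
      then have "k - q < m" by simp
      then show ?thesis using x0(1)[of "k - q"] qE[of "k - q" x0 "-1"] x0(2) 2 unfolding h0 qz by (simp add: C'_def abs_less_iff)
    next
      case 3
      then have "k - q - m < m" using k by simp
      then show ?thesis using x0(1)[of "k - q - m"] qE[of "k - q - m" x0 1] x0(2) 3 unfolding h0 qz by (simp add: C'_def abs_less_iff)
    qed
  qed
  then have "0 < F 0 z" using F_attained[of 0 z] by auto
  then have top0: "0 < top" using peak(2)[OF zB, of 0] unfolding top_def by linarith
  have R: "1 \<le> top * real (root_bound m)"
  proof (rule top_bound[OF top0])
    show "\<bar>C' k a b\<bar> \<le> 2" if "k < q + 2 * m" "a \<le> m" "b \<le> m" for k a b
      using C[of k a b] that by (auto simp: C'_def E_def)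
  qed simp
  define x where "x = peak 0"
  have xm: "x m = 1" using peak(1)[of 0] by (simp add: x_def Box_iff)
  have xk: "top \<le> qf m (C' k) x" if "k < q + 2 * m" for k
    using F_le[OF that, of 0 x] unfolding h0 top_def x_def .
  have x1: "\<bar>x a\<bar> \<le> 1" if "a \<le> m" for a
  proof (cases "a = m")
    case False
    then have a: "a < m" using that by simp
    have "0 < 1 + - 1 * x a" using xk[of "q + a"] qE[of a x "-1"] a xm top0 by (simp add: C'_def)
    moreover have "0 < 1 + x a" using xk[of "q + m + a"] qE[of a x 1] a xm top0 by (simp add: C'_def)
    ultimately show ?thesis by simp
  qed (simp add: xm)
  define Q where "Q = grid_bound m"
  have Q: "0 < Q" by (simp add: Q_def grid_bound_def)
  define X where "X j = \<lfloor>real Q * x j\<rfloor>" for j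
  have XQ: "\<bar>X a\<bar> \<le> int Q" if "a \<le> m" for a
  proof -
    have "real Q * x a \<le> real Q * 1" "real Q * (-1) \<le> real Q * x a"
      using x1[OF that] by (intro mult_left_mono; simp)+
    then have "X a \<le> int Q" "- int Q \<le> X a" unfolding X_def by (simp_all add: floor_le_iff le_floor_iff)
    then show ?thesis by simp
  qed
  \<comment> \<open>The homogenizing coordinate is rounded exactly and serves as denominator of all
    others.\<close>
  have Xm: "X m = int Q" by (simp add: X_def xm)
  define y where "y a = of_int (X a) / real Q" for a
  have y1: "\<bar>y a\<bar> \<le> 1" if "a \<le> m" for a
  proof -
    have "\<bar>real_of_int (X a)\<bar> \<le> real Q" using XQ[OF that] by linarith
    then show ?thesis using Q by (simp add: y_def)
  qed
  have yx: "\<bar>y a - x a\<bar> \<le> 1 / real Q" for a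
  proof -
    have "\<bar>of_int (X a) - real Q * x a\<bar> \<le> 1" unfolding X_def by linarith
    then have "\<bar>of_int (X a) - real Q * x a\<bar> / real Q \<le> 1 / real Q" using Q by (intro divide_right_mono) auto
    moreover have "y a - x a = (of_int (X a) - real Q * x a) / real Q" using Q by (simp add: y_def field_simps)
    ultimately show ?thesis by simp
  qed
  have "0 < qf m (C k) (\<lambda>j. of_int (X j))" if k: "k < q" for k
  proof -
    have "\<bar>qf m (C k) y - qf m (C k) x\<bar> \<le> 4 * (real m + 1)^2 * (1 / real Q)"
      by (rule qf_grid) (use C[OF k] x1 y1 yx in auto)
    moreover have "4 * (real m + 1)^2 * (1 / real Q) < top"
    proof -
      have "real Q = 4 * (real m + 1)^2 * real (root_bound m) + 1" by (simp add: Q_def grid_bound_def)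
      then have "top * real Q = 4 * (real m + 1)^2 * (top * real (root_bound m)) + top" by (simp add: algebra_simps)
      moreover have "4 * (real m + 1)^2 * 1 \<le> 4 * (real m + 1)^2 * (top * real (root_bound m))" using R by (intro mult_left_mono) auto
      ultimately have "4 * (real m + 1)^2 < top * real Q" using top0 by linarith
      then show ?thesis using Q by (simp add: field_simps)
    qed
    moreover have "top \<le> qf m (C k) x" using xk[of k] k by (simp add: C'_def)
    ultimately have "0 < qf m (C k) y" by linarith
    moreover have "qf m (C k) (\<lambda>j. of_int (X j)) = (real Q)^2 * qf m (C k) y"
      unfolding qf_def sum_distrib_left using Q by (intro sum.cong) (auto simp: y_def power2_eq_square)
    ultimately show ?thesis using Q by simp
  qed
  then show ?thesis using XQ Xm Q unfolding Q_def by (intro exI[of _ X]) auto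
qed

subsection \<open>Segments in general position\<close>

definition crossing :: "real \<times> real \<Rightarrow> real \<times> real \<Rightarrow> real \<times> real \<Rightarrow> real \<times> real \<Rightarrow> bool" where
  "crossing a b c d \<longleftrightarrow> orient a b c * orient a b d < 0 \<and> orient c d a * orient c d b < 0"

text \<open>Disjointness in general position: the line of one segment has the other segment strictly
  on one side.\<close>

definition separated :: "real \<times> real \<Rightarrow> real \<times> real \<Rightarrow> real \<times> real \<Rightarrow> real \<times> real \<Rightarrow> bool" where
  "separated a b c d \<longleftrightarrow> orient a b c * orient a b d > 0 \<or> orient c d a * orient c d b > 0"

lemma crossing_commute: "crossing a b c d \<longleftrightarrow> crossing c d a b"
  by (auto simp: crossing_def)

lemma separated_commute: "separated a b c d \<longleftrightarrow> separated c d a b"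
  by (auto simp: separated_def)

lemma separated_disjoint:
  assumes "separated a b c d"
  shows "closed_segment a b \<inter> closed_segment c d = {}"
proof -
  have *: "closed_segment a b \<inter> closed_segment c d = {}" if "orient a b c * orient a b d > 0" for a b c d
    using that orient_pos_disjoint[of a b c d] orient_neg_disjoint[of a b c d] by (auto simp: zero_less_mult_iff)
  show ?thesis using assms *[of a b c d] *[of c d a b] by (auto simp: separated_def Int_commute)
qed

lemma dirdet_identity: "dirdet u v *\<^sub>R w + dirdet v w *\<^sub>R u + dirdet w u *\<^sub>R v = 0"
  by (simp add: dirdet_def prod_eq_iff algebra_simps)

lemma opposite_fraction:
  assumes "x * y < (0::real)"
  shows "0 \<le> x / (x - y)" "x / (x - y) \<le> 1"
  using assms by (auto simp: mult_less_0_iff field_simps divide_le_eq zero_le_divide_iff)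

text \<open>Cramer's rule for the intersection of the two lines, in the form of
  \<open>dirdet_identity\<close>; the opposite signs put both parameters into the unit
  interval.\<close>

lemma crossing_meet:
  assumes "crossing a b c d"
  shows "closed_segment a b \<inter> closed_segment c d \<noteq> {}"
proof -
  let ?u = "b - a" and ?v = "d - c" and ?w = "a - c"
  have o: "orient c d a - orient c d b = dirdet ?u ?v" "orient a b c - orient a b d = - dirdet ?u ?v"
    "orient c d a = dirdet ?v ?w" "orient a b c = dirdet ?w ?u"
    by (simp_all add: orient_def dirdet_def algebra_simps)
  have x: "orient c d a * orient c d b < 0" "orient a b c * orient a b d < 0" using assms by (auto simp: crossing_def)
  define t where "t = orient c d a / (orient c d a - orient c d b)"
  define s where "s = orient a b c / (orient a b c - orient a b d)"
  have t: "0 \<le> t" "t \<le> 1" and s: "0 \<le> s" "s \<le> 1"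
    using opposite_fraction[OF x(1)] opposite_fraction[OF x(2)] by (simp_all add: t_def s_def)
  have D: "dirdet ?u ?v \<noteq> 0" using x o by (metis diff_self mult_less_0_iff order_less_irrefl eq_iff_diff_eq_0 less_asym)
  have "dirdet ?u ?v *\<^sub>R ((1 - t) *\<^sub>R a + t *\<^sub>R b) = dirdet ?u ?v *\<^sub>R ((1 - s) *\<^sub>R c + s *\<^sub>R d)"
  proof -
    have "dirdet ?u ?v * t = orient c d a" "dirdet ?u ?v * s = - orient a b c" using D by (simp_all add: t_def s_def o(1,2))
    then have 1: "dirdet ?u ?v * t = dirdet ?v ?w" "dirdet ?u ?v * s = - dirdet ?w ?u" by (simp_all only: o(3,4))
    have "dirdet ?u ?v *\<^sub>R ((1 - t) *\<^sub>R a + t *\<^sub>R b) - dirdet ?u ?v *\<^sub>R ((1 - s) *\<^sub>R c + s *\<^sub>R d)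
       = dirdet ?u ?v *\<^sub>R ((?w + t *\<^sub>R ?u) - s *\<^sub>R ?v)"
      unfolding scaleR_diff_right[symmetric] by (rule arg_cong[of _ _ "(*\<^sub>R) (dirdet ?u ?v)"]) (simp add: algebra_simps)
    also have "\<dots> = dirdet ?u ?v *\<^sub>R ?w + (dirdet ?u ?v * t) *\<^sub>R ?u - (dirdet ?u ?v * s) *\<^sub>R ?v"
      by (simp only: scaleR_diff_right scaleR_add_right scaleR_scaleR)
    also have "\<dots> = dirdet ?u ?v *\<^sub>R ?w + dirdet ?v ?w *\<^sub>R ?u + dirdet ?w ?u *\<^sub>R ?v"
      unfolding 1 by simp
    finally have "dirdet ?u ?v *\<^sub>R ((1 - t) *\<^sub>R a + t *\<^sub>R b) - dirdet ?u ?v *\<^sub>R ((1 - s) *\<^sub>R c + s *\<^sub>R d) = \<dots>" .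
    then show ?thesis unfolding dirdet_identity by simp
  qed
  then have "(1 - t) *\<^sub>R a + t *\<^sub>R b = (1 - s) *\<^sub>R c + s *\<^sub>R d" by (rule scaleR_left_imp_eq[OF D])
  then have "(1 - t) *\<^sub>R a + t *\<^sub>R b \<in> closed_segment a b \<inter> closed_segment c d"
    using t s unfolding in_segment Int_iff by blast
  then show ?thesis by blast
qed

lemma orient_on_line:
  "orient (c + a *\<^sub>R e) (c + b *\<^sub>R e) (c' + s *\<^sub>R e') = (b - a) * (dirdet e (c' - c) + s * dirdet e e')"
  by (simp add: orient_def dirdet_def algebra_simps)

definition perp :: "real \<times> real \<Rightarrow> real \<times> real" where "perp z = (- snd z, fst z)"

text \<open>A segment is given by an endpoint \<open>c\<close> and the vector \<open>d\<close> pointing to \<open>c\<close> from the other endpoint.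
  It is prolonged by the proportion \<open>\<eta>\<close> at both ends and turned about \<open>c\<close>, the slope of the turn being \<open>\<theta>\<close>.\<close>

definition tail :: "real \<times> real \<Rightarrow> real \<times> real \<Rightarrow> real \<Rightarrow> real \<Rightarrow> real \<times> real" where
  "tail c d \<eta> \<theta> = c + (- (1 + \<eta>)) *\<^sub>R (d + \<theta> *\<^sub>R perp d)"

definition head :: "real \<times> real \<Rightarrow> real \<times> real \<Rightarrow> real \<Rightarrow> real \<Rightarrow> real \<times> real" where
  "head c d \<eta> \<theta> = c + \<eta> *\<^sub>R (d + \<theta> *\<^sub>R perp d)"

text \<open>All four orientations are expressed by three determinants of the turned directions e, f
  and the offset w; the positive factor (1 + 2 \<eta>)^2 drops out.\<close>

lemma turned_pair:
  fixes cu du cv dv :: "real \<times> real" and \<eta> \<theta> \<theta>' :: real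
  assumes "0 < \<eta>"
  defines "e \<equiv> du + \<theta> *\<^sub>R perp du" and "f \<equiv> dv + \<theta>' *\<^sub>R perp dv" and "w \<equiv> cv - cu"
  shows "crossing (tail cu du \<eta> \<theta>) (head cu du \<eta> \<theta>) (tail cv dv \<eta> \<theta>') (head cv dv \<eta> \<theta>') \<longleftrightarrow>
      (dirdet e w - (1 + \<eta>) * dirdet e f) * (dirdet e w + \<eta> * dirdet e f) < 0 \<and>
      (dirdet f w - (1 + \<eta>) * dirdet e f) * (dirdet f w + \<eta> * dirdet e f) < 0" (is ?C)
    "separated (tail cu du \<eta> \<theta>) (head cu du \<eta> \<theta>) (tail cv dv \<eta> \<theta>') (head cv dv \<eta> \<theta>') \<longleftrightarrow>
      (dirdet e w - (1 + \<eta>) * dirdet e f) * (dirdet e w + \<eta> * dirdet e f) > 0 \<or>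
      (dirdet f w - (1 + \<eta>) * dirdet e f) * (dirdet f w + \<eta> * dirdet e f) > 0" (is ?S)
proof -
  have k: "0 < (1 + 2 * \<eta>)^2" using assms(1) by simp
  have fe: "dirdet f e = - dirdet e f" by (rule dirdet_commute)
  have fw: "dirdet f (cu - cv) = - dirdet f w" by (simp add: w_def dirdet_def algebra_simps)
  have 1: "orient (tail cu du \<eta> \<theta>) (head cu du \<eta> \<theta>) (tail cv dv \<eta> \<theta>') * orient (tail cu du \<eta> \<theta>) (head cu du \<eta> \<theta>) (head cv dv \<eta> \<theta>')
      = (1 + 2 * \<eta>)^2 * ((dirdet e w - (1 + \<eta>) * dirdet e f) * (dirdet e w + \<eta> * dirdet e f))"
    unfolding tail_def head_def e_def[symmetric] f_def[symmetric] orient_on_line w_def[symmetric]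
    by (simp add: power2_eq_square algebra_simps)
  have 2: "orient (tail cv dv \<eta> \<theta>') (head cv dv \<eta> \<theta>') (tail cu du \<eta> \<theta>) * orient (tail cv dv \<eta> \<theta>') (head cv dv \<eta> \<theta>') (head cu du \<eta> \<theta>)
      = (1 + 2 * \<eta>)^2 * ((dirdet f w - (1 + \<eta>) * dirdet e f) * (dirdet f w + \<eta> * dirdet e f))"
    unfolding tail_def head_def e_def[symmetric] f_def[symmetric] orient_on_line fe fw
    by (simp add: power2_eq_square algebra_simps)
  show ?C ?S unfolding crossing_def separated_def 1 2 using k by (simp_all add: mult_less_0_iff zero_less_mult_iff)
qed

definition good_pair where
  "good_pair cu du cv dv \<eta> \<theta> \<theta>' \<longleftrightarrow>
    (if closed_segment (cu - du) cu \<inter> closed_segment (cv - dv) cv \<noteq> {}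
     then crossing (tail cu du \<eta> \<theta>) (head cu du \<eta> \<theta>) (tail cv dv \<eta> \<theta>') (head cv dv \<eta> \<theta>')
     else separated (tail cu du \<eta> \<theta>) (head cu du \<eta> \<theta>) (tail cv dv \<eta> \<theta>') (head cv dv \<eta> \<theta>'))"

text \<open>Parameters are measured from the turning points cu and cv, hence the range from -1 to
  0.\<close>

lemma meet_iff:
  "closed_segment (cu - du) cu \<inter> closed_segment (cv - dv) cv \<noteq> {} \<longleftrightarrow>
    (\<exists>t s. -1 \<le> t \<and> t \<le> 0 \<and> -1 \<le> s \<and> s \<le> 0 \<and> t *\<^sub>R du = (cv - cu) + s *\<^sub>R dv)" (is "?L \<longleftrightarrow> ?R")
proof
  assume ?L
  then obtain z where z: "z \<in> closed_segment (cu - du) cu" "z \<in> closed_segment (cv - dv) cv" by blast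
  obtain t where t: "0 \<le> t" "t \<le> 1" "z = (1 - t) *\<^sub>R (cu - du) + t *\<^sub>R cu" using z(1) unfolding in_segment by blast
  obtain s where s: "0 \<le> s" "s \<le> 1" "z = (1 - s) *\<^sub>R (cv - dv) + s *\<^sub>R cv" using z(2) unfolding in_segment by blast
  have "(t - 1) *\<^sub>R du = z - cu" unfolding t(3) by (simp add: algebra_simps)
  moreover have "(s - 1) *\<^sub>R dv = z - cv" unfolding s(3) by (simp add: algebra_simps)
  ultimately have "(t - 1) *\<^sub>R du = (cv - cu) + (s - 1) *\<^sub>R dv" by simp
  then show ?R using t s by (intro exI[of _ "t - 1"] exI[of _ "s - 1"]) auto
next
  assume ?R
  then obtain t s where ts: "-1 \<le> t" "t \<le> 0" "-1 \<le> s" "s \<le> 0" "t *\<^sub>R du = (cv - cu) + s *\<^sub>R dv" by blast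
  have 1: "cu + t *\<^sub>R du \<in> closed_segment (cu - du) cu" unfolding in_segment
    by (rule exI[of _ "1 + t"]) (use ts in \<open>simp add: algebra_simps\<close>)
  have 2: "cv + s *\<^sub>R dv \<in> closed_segment (cv - dv) cv" unfolding in_segment
    by (rule exI[of _ "1 + s"]) (use ts in \<open>simp add: algebra_simps\<close>)
  have "cu + t *\<^sub>R du = cv + s *\<^sub>R dv" using ts(5) by (simp add: algebra_simps)
  then show ?L using 1 2 by auto
qed

lemma tendsto_signs:
  assumes "(f \<longlongrightarrow> l) (at_right (0::real))"
  shows "l < 0 \<Longrightarrow> eventually (\<lambda>\<epsilon>. f \<epsilon> < (0::real)) (at_right 0)" "0 < l \<Longrightarrow> eventually (\<lambda>\<epsilon>. 0 < f \<epsilon>) (at_right 0)"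
  using order_tendstoD[OF assms] by auto

lemma pow_tendsto: "0 < (i::nat) \<Longrightarrow> ((\<lambda>\<epsilon>. \<epsilon> ^ i) \<longlongrightarrow> 0) (at_right (0::real))"
  using tendsto_power[OF tendsto_ident_at[of 0 "{0<..}"], of i] by (simp add: zero_power)

text \<open>The lines meet at parameters t and s, and prolonging widens the admissible range from
  [-1, 0] to [-1 - \<eta>, \<eta>]. Parameters in the old range are interior to the new one; a
  parameter outside the old range stays outside the new one if \<eta> is small. Both are open
  conditions, stable under small turns.\<close>

lemma good_pair_transversal:
  fixes cu du cv dv :: "real \<times> real"
  assumes D: "dirdet du dv \<noteq> 0" and i: "0 < i" "0 < (j::nat)"
  shows "eventually (\<lambda>\<eta>. eventually (\<lambda>\<epsilon>. good_pair cu du cv dv \<eta> (\<epsilon> ^ i) (\<epsilon> ^ j)) (at_right 0)) (at_right 0)"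
proof -
  define w where "w = cv - cu"
  define e where "e \<epsilon> = du + (\<epsilon> ^ i) *\<^sub>R perp du" for \<epsilon> :: real
  define f where "f \<epsilon> = dv + (\<epsilon> ^ j) *\<^sub>R perp dv" for \<epsilon> :: real
  have lim: "((\<lambda>\<epsilon>. dirdet (e \<epsilon>) w) \<longlongrightarrow> dirdet du w) (at_right 0)" "((\<lambda>\<epsilon>. dirdet (f \<epsilon>) w) \<longlongrightarrow> dirdet dv w) (at_right 0)"
    "((\<lambda>\<epsilon>. dirdet (e \<epsilon>) (f \<epsilon>)) \<longlongrightarrow> dirdet du dv) (at_right 0)"
    unfolding e_def f_def dirdet_simps by (rule tendsto_eq_intros pow_tendsto i refl | simp)+
  have A: "((\<lambda>\<epsilon>. (dirdet (e \<epsilon>) w - (1 + \<eta>) * dirdet (e \<epsilon>) (f \<epsilon>)) * (dirdet (e \<epsilon>) w + \<eta> * dirdet (e \<epsilon>) (f \<epsilon>)))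
      \<longlongrightarrow> (dirdet du w - (1 + \<eta>) * dirdet du dv) * (dirdet du w + \<eta> * dirdet du dv)) (at_right 0)" for \<eta>
    by (intro tendsto_intros lim)
  have B: "((\<lambda>\<epsilon>. (dirdet (f \<epsilon>) w - (1 + \<eta>) * dirdet (e \<epsilon>) (f \<epsilon>)) * (dirdet (f \<epsilon>) w + \<eta> * dirdet (e \<epsilon>) (f \<epsilon>)))
      \<longlongrightarrow> (dirdet dv w - (1 + \<eta>) * dirdet du dv) * (dirdet dv w + \<eta> * dirdet du dv)) (at_right 0)" for \<eta>
    by (intro tendsto_intros lim)
  define s where "s = - dirdet du w / dirdet du dv"
  define t where "t = - dirdet dv w / dirdet du dv"
  have st: "dirdet du w = - s * dirdet du dv" "dirdet dv w = - t * dirdet du dv" using D by (simp_all add: s_def t_def)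
  have sol: "t' *\<^sub>R du = w + s' *\<^sub>R dv \<longleftrightarrow> t' = t \<and> s' = s" for t' s'
  proof
    assume eq: "t' *\<^sub>R du = w + s' *\<^sub>R dv"
    have "dirdet du (t' *\<^sub>R du) = dirdet du (w + s' *\<^sub>R dv)" "dirdet dv (t' *\<^sub>R du) = dirdet dv (w + s' *\<^sub>R dv)" using eq by simp_all
    then show "t' = t \<and> s' = s" using D dirdet_commute[of dv du] by (simp add: dirdet_simps s_def t_def field_simps)
  next
    assume ts': "t' = t \<and> s' = s"
    have "dirdet du dv *\<^sub>R (t *\<^sub>R du) = dirdet du dv *\<^sub>R (w + s *\<^sub>R dv)"
    proof -
      have "dirdet du dv *\<^sub>R w + dirdet dv w *\<^sub>R du + dirdet w du *\<^sub>R dv = 0" by (rule dirdet_identity)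
      moreover have "dirdet w du = s * dirdet du dv" using st(1) dirdet_commute[of w du] by simp
      ultimately show ?thesis unfolding st(2) by (simp add: algebra_simps)
    qed
    then have "t *\<^sub>R du = w + s *\<^sub>R dv" by (rule scaleR_left_imp_eq[OF D])
    with ts' show "t' *\<^sub>R du = w + s' *\<^sub>R dv" by simp
  qed
  have fac: "(- x * dirdet du dv - (1 + \<eta>) * dirdet du dv) * (- x * dirdet du dv + \<eta> * dirdet du dv)
     = (dirdet du dv)^2 * ((x + (1 + \<eta>)) * (x - \<eta>))" for x \<eta>
    by (simp add: power2_eq_square algebra_simps)
  have DD: "0 < (dirdet du dv)^2" using D by simp
  show ?thesis
  proof (cases "closed_segment (cu - du) cu \<inter> closed_segment (cv - dv) cv \<noteq> {}")
    case True
    then have r: "-1 \<le> t" "t \<le> 0" "-1 \<le> s" "s \<le> 0" unfolding meet_iff w_def[symmetric] sol by blast+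
    have "eventually (\<lambda>\<epsilon>. good_pair cu du cv dv \<eta> (\<epsilon> ^ i) (\<epsilon> ^ j)) (at_right 0)" if \<eta>: "0 < \<eta>" for \<eta>
    proof -
      have neg: "(x + (1 + \<eta>)) * (x - \<eta>) < 0" if "-1 \<le> x" "x \<le> 0" for x using that \<eta> by (intro mult_pos_neg) auto
      have "eventually (\<lambda>\<epsilon>. (dirdet (e \<epsilon>) w - (1 + \<eta>) * dirdet (e \<epsilon>) (f \<epsilon>)) * (dirdet (e \<epsilon>) w + \<eta> * dirdet (e \<epsilon>) (f \<epsilon>)) < 0) (at_right 0)"
        by (rule tendsto_signs(1)[OF A]) (unfold st fac, rule mult_pos_neg[OF DD neg[OF r(3,4)]])
      moreover have "eventually (\<lambda>\<epsilon>. (dirdet (f \<epsilon>) w - (1 + \<eta>) * dirdet (e \<epsilon>) (f \<epsilon>)) * (dirdet (f \<epsilon>) w + \<eta> * dirdet (e \<epsilon>) (f \<epsilon>)) < 0) (at_right 0)"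
        by (rule tendsto_signs(1)[OF B]) (unfold st fac, rule mult_pos_neg[OF DD neg[OF r(1,2)]])
      ultimately show ?thesis
        by eventually_elim (use True turned_pair(1)[OF \<eta>] in \<open>simp add: good_pair_def e_def f_def w_def\<close>)
    qed
    then show ?thesis by (rule eventually_mono[OF eventually_at_right_less])
  next
    case False
    then have not_both: "\<not> (-1 \<le> t \<and> t \<le> 0 \<and> -1 \<le> s \<and> s \<le> 0)" unfolding meet_iff w_def[symmetric] sol by blast
    have out: "eventually (\<lambda>\<eta>. 0 < (x + (1 + \<eta>)) * (x - \<eta>)) (at_right 0)" if "\<not> (-1 \<le> x \<and> x \<le> 0)" for x :: real
    proof (rule tendsto_signs(2))
      show "((\<lambda>\<eta>. (x + (1 + \<eta>)) * (x - \<eta>)) \<longlongrightarrow> (x + (1 + 0)) * (x - 0)) (at_right 0)"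
        by (intro tendsto_intros)
      show "0 < (x + (1 + 0)) * (x - 0)" using that by (auto simp: zero_less_mult_iff)
    qed
    have "eventually (\<lambda>\<eta>. 0 < (s + (1 + \<eta>)) * (s - \<eta>) \<or> 0 < (t + (1 + \<eta>)) * (t - \<eta>)) (at_right 0)"
    proof (cases "-1 \<le> s \<and> s \<le> 0")
      case True
      with not_both have "\<not> (-1 \<le> t \<and> t \<le> 0)" by blast
      from out[OF this] show ?thesis by (rule eventually_mono) simp
    next
      case False
      from out[OF this] show ?thesis by (rule eventually_mono) simp
    qed
    moreover have "eventually (\<lambda>\<eta>::real. 0 < \<eta>) (at_right 0)" by (rule eventually_at_right_less)
    ultimately show ?thesis
    proof eventually_elim
      case (elim \<eta>)
      from elim(1) show ?case
      proof
        assume *: "0 < (s + (1 + \<eta>)) * (s - \<eta>)"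
        have "eventually (\<lambda>\<epsilon>. 0 < (dirdet (e \<epsilon>) w - (1 + \<eta>) * dirdet (e \<epsilon>) (f \<epsilon>)) * (dirdet (e \<epsilon>) w + \<eta> * dirdet (e \<epsilon>) (f \<epsilon>))) (at_right 0)"
          by (rule tendsto_signs(2)[OF A]) (unfold st fac, rule mult_pos_pos[OF DD *])
        then show ?thesis by eventually_elim (use False turned_pair(2)[OF elim(2)] in \<open>simp add: good_pair_def e_def f_def w_def\<close>)
      next
        assume *: "0 < (t + (1 + \<eta>)) * (t - \<eta>)"
        have "eventually (\<lambda>\<epsilon>. 0 < (dirdet (f \<epsilon>) w - (1 + \<eta>) * dirdet (e \<epsilon>) (f \<epsilon>)) * (dirdet (f \<epsilon>) w + \<eta> * dirdet (e \<epsilon>) (f \<epsilon>))) (at_right 0)"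
          by (rule tendsto_signs(2)[OF B]) (unfold st fac, rule mult_pos_pos[OF DD *])
        then show ?thesis by eventually_elim (use False turned_pair(2)[OF elim(2)] in \<open>simp add: good_pair_def e_def f_def w_def\<close>)
      qed
    qed
  qed
qed

text \<open>The segments lie on different parallel lines, and the first product of
  \<open>turned_pair\<close> tends to the positive square of
  \<open>dirdet du (cv - cu)\<close>.\<close>

lemma good_pair_parallel:
  fixes cu du cv dv :: "real \<times> real"
  assumes D: "dirdet du dv = 0" "dirdet du (cv - cu) \<noteq> 0" and i: "0 < i" "0 < (j::nat)"
  shows "eventually (\<lambda>\<eta>. eventually (\<lambda>\<epsilon>. good_pair cu du cv dv \<eta> (\<epsilon> ^ i) (\<epsilon> ^ j)) (at_right 0)) (at_right 0)"
proof (rule eventually_mono[OF eventually_at_right_less])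
  fix \<eta> :: real assume \<eta>: "0 < \<eta>"
  define w where "w = cv - cu"
  define e where "e \<epsilon> = du + (\<epsilon> ^ i) *\<^sub>R perp du" for \<epsilon> :: real
  define f where "f \<epsilon> = dv + (\<epsilon> ^ j) *\<^sub>R perp dv" for \<epsilon> :: real
  have lim: "((\<lambda>\<epsilon>. dirdet (e \<epsilon>) w) \<longlongrightarrow> dirdet du w) (at_right 0)" "((\<lambda>\<epsilon>. dirdet (e \<epsilon>) (f \<epsilon>)) \<longlongrightarrow> dirdet du dv) (at_right 0)"
    unfolding e_def f_def dirdet_simps by (rule tendsto_eq_intros pow_tendsto i refl | simp)+
  have A: "((\<lambda>\<epsilon>. (dirdet (e \<epsilon>) w - (1 + \<eta>) * dirdet (e \<epsilon>) (f \<epsilon>)) * (dirdet (e \<epsilon>) w + \<eta> * dirdet (e \<epsilon>) (f \<epsilon>)))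
      \<longlongrightarrow> (dirdet du w - (1 + \<eta>) * dirdet du dv) * (dirdet du w + \<eta> * dirdet du dv)) (at_right 0)"
    by (intro tendsto_intros lim)
  have "\<not> (closed_segment (cu - du) cu \<inter> closed_segment (cv - dv) cv \<noteq> {})"
  proof
    assume "closed_segment (cu - du) cu \<inter> closed_segment (cv - dv) cv \<noteq> {}"
    then obtain t s where "t *\<^sub>R du = (cv - cu) + s *\<^sub>R dv" unfolding meet_iff by blast
    then have "dirdet du (t *\<^sub>R du) = dirdet du ((cv - cu) + s *\<^sub>R dv)" by simp
    then show False using D by (simp add: dirdet_simps)
  qed
  moreover have "eventually (\<lambda>\<epsilon>. 0 < (dirdet (e \<epsilon>) w - (1 + \<eta>) * dirdet (e \<epsilon>) (f \<epsilon>)) * (dirdet (e \<epsilon>) w + \<eta> * dirdet (e \<epsilon>) (f \<epsilon>))) (at_right 0)"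
    by (rule tendsto_signs(2)[OF A]) (use D in \<open>simp add: w_def zero_less_mult_iff linorder_neq_iff disj_commute\<close>)
  ultimately show "eventually (\<lambda>\<epsilon>. good_pair cu du cv dv \<eta> (\<epsilon> ^ i) (\<epsilon> ^ j)) (at_right 0)"
    by (auto elim!: eventually_mono simp: good_pair_def turned_pair(2)[OF \<eta>] e_def f_def w_def)
qed

text \<open>The turn of \<open>v\<close> is infinitesimal compared to that of \<open>u\<close>, so that the two lines meet close to
  the turning point \<open>c\<close> of \<open>u\<close>, which lies on \<open>v\<close> if the segments overlap.\<close>

lemma good_pair_collinear:
  fixes cu du cv dv :: "real \<times> real"
  assumes du: "du \<noteq> 0" and dv: "dv = \<kappa> *\<^sub>R du" "0 < \<kappa>" and w: "cv - cu = g *\<^sub>R du" "0 \<le> g" and ij: "0 < i" "i < (j::nat)"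
  shows "eventually (\<lambda>\<eta>. eventually (\<lambda>\<epsilon>. good_pair cu du cv dv \<eta> (\<epsilon> ^ i) (\<epsilon> ^ j)) (at_right 0)) (at_right 0)"
proof -
  define N where "N = dirdet du (perp du)"
  have N: "0 < N"
  proof -
    have "N = fst du * fst du + snd du * snd du" by (simp add: N_def dirdet_def perp_def)
    moreover have "fst du \<noteq> 0 \<or> snd du \<noteq> 0" using du by (auto simp: prod_eq_iff)
    ultimately show ?thesis by (simp add: sum_squares_gt_zero_iff)
  qed
  have dp: "dirdet du du = 0" "dirdet du (perp du) = N" "dirdet (perp du) du = - N" "dirdet (perp du) (perp du) = 0"
    by (simp_all add: N_def dirdet_simps dirdet_commute[of "perp du" du])
  define e where "e \<epsilon> = du + (\<epsilon> ^ i) *\<^sub>R perp du" for \<epsilon> :: real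
  define f where "f \<epsilon> = dv + (\<epsilon> ^ j) *\<^sub>R perp dv" for \<epsilon> :: real
  have pv: "perp dv = \<kappa> *\<^sub>R perp du" by (simp add: dv(1) perp_def)
  have pj: "\<epsilon> ^ j = \<epsilon> ^ i * \<epsilon> ^ (j - i)" for \<epsilon> :: real using ij by (simp add: power_add[symmetric])
  have f': "f \<epsilon> = \<kappa> *\<^sub>R (du + (\<epsilon> ^ j) *\<^sub>R perp du)" for \<epsilon> by (simp add: f_def pv) (simp add: dv(1) algebra_simps)
  have ew: "dirdet (e \<epsilon>) (cv - cu) = (\<epsilon> ^ i * N) * (- g)" for \<epsilon>
    unfolding e_def w(1) dirdet_simps dp by simp
  have fw: "dirdet (f \<epsilon>) (cv - cu) = (\<kappa> * (\<epsilon> ^ i * N)) * (- g * \<epsilon> ^ (j - i))" for \<epsilon>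
    unfolding f' w(1) dirdet_simps dp pj by (simp add: algebra_simps)
  have ef: "dirdet (e \<epsilon>) (f \<epsilon>) = \<kappa> * (\<epsilon> ^ i * N) * (\<epsilon> ^ (j - i) - 1)" for \<epsilon>
    unfolding e_def f' dirdet_simps dp pj by (simp add: algebra_simps)
  have A: "(dirdet (e \<epsilon>) (cv - cu) - (1 + \<eta>) * dirdet (e \<epsilon>) (f \<epsilon>)) * (dirdet (e \<epsilon>) (cv - cu) + \<eta> * dirdet (e \<epsilon>) (f \<epsilon>))
      = (\<epsilon> ^ i * N)^2 * ((- g - (1 + \<eta>) * \<kappa> * (\<epsilon> ^ (j - i) - 1)) * (- g + \<eta> * \<kappa> * (\<epsilon> ^ (j - i) - 1)))" for \<epsilon> \<eta>
    unfolding ew ef by (simp add: power2_eq_square algebra_simps)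
  have B: "(dirdet (f \<epsilon>) (cv - cu) - (1 + \<eta>) * dirdet (e \<epsilon>) (f \<epsilon>)) * (dirdet (f \<epsilon>) (cv - cu) + \<eta> * dirdet (e \<epsilon>) (f \<epsilon>))
      = (\<kappa> * (\<epsilon> ^ i * N))^2 * ((- g * \<epsilon> ^ (j - i) - (1 + \<eta>) * (\<epsilon> ^ (j - i) - 1)) * (- g * \<epsilon> ^ (j - i) + \<eta> * (\<epsilon> ^ (j - i) - 1)))" for \<epsilon> \<eta>
    unfolding fw ef by (simp add: power2_eq_square algebra_simps)
  have r: "((\<lambda>\<epsilon>. \<epsilon> ^ (j - i)) \<longlongrightarrow> 0) (at_right (0::real))" by (rule pow_tendsto) (use ij in simp)
  have limA: "((\<lambda>\<epsilon>. (- g - (1 + \<eta>) * \<kappa> * (\<epsilon> ^ (j - i) - 1)) * (- g + \<eta> * \<kappa> * (\<epsilon> ^ (j - i) - 1)))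
      \<longlongrightarrow> (- g - (1 + \<eta>) * \<kappa> * (0 - 1)) * (- g + \<eta> * \<kappa> * (0 - 1))) (at_right 0)" for \<eta>
    by (intro tendsto_intros r)
  have limB: "((\<lambda>\<epsilon>. (- g * \<epsilon> ^ (j - i) - (1 + \<eta>) * (\<epsilon> ^ (j - i) - 1)) * (- g * \<epsilon> ^ (j - i) + \<eta> * (\<epsilon> ^ (j - i) - 1)))
      \<longlongrightarrow> (- g * 0 - (1 + \<eta>) * (0 - 1)) * (- g * 0 + \<eta> * (0 - 1))) (at_right 0)" for \<eta>
    by (intro tendsto_intros r)
  have pos: "eventually (\<lambda>\<epsilon>::real. 0 < \<epsilon>) (at_right 0)" by (rule eventually_at_right_less)
  have meet: "closed_segment (cu - du) cu \<inter> closed_segment (cv - dv) cv \<noteq> {} \<longleftrightarrow> g \<le> \<kappa>"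
  proof -
    have "t *\<^sub>R du = (cv - cu) + s *\<^sub>R dv \<longleftrightarrow> t = g + s * \<kappa>" for t s
    proof -
      have "(cv - cu) + s *\<^sub>R dv = (g + s * \<kappa>) *\<^sub>R du" by (simp add: w(1) dv(1) algebra_simps)
      then show ?thesis using du by simp
    qed
    then have "closed_segment (cu - du) cu \<inter> closed_segment (cv - dv) cv \<noteq> {} \<longleftrightarrow>
        (\<exists>t s. -1 \<le> t \<and> t \<le> 0 \<and> -1 \<le> s \<and> s \<le> 0 \<and> t = g + s * \<kappa>)" unfolding meet_iff by simp
    also have "\<dots> \<longleftrightarrow> g \<le> \<kappa>"
    proof
      assume "\<exists>t s. -1 \<le> t \<and> t \<le> 0 \<and> -1 \<le> s \<and> s \<le> 0 \<and> t = g + s * \<kappa>"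
      then obtain t s where ts: "t \<le> 0" "-1 \<le> s" "t = g + s * \<kappa>" by blast
      have "-1 * \<kappa> \<le> s * \<kappa>" using ts dv by (intro mult_right_mono) auto
      then show "g \<le> \<kappa>" using ts by linarith
    next
      assume "g \<le> \<kappa>"
      then show "\<exists>t s. -1 \<le> t \<and> t \<le> 0 \<and> -1 \<le> s \<and> s \<le> 0 \<and> t = g + s * \<kappa>"
        using dv w by (intro exI[of _ 0] exI[of _ "- g / \<kappa>"]) (auto simp: field_simps)
    qed
    finally show ?thesis .
  qed
  show ?thesis
  proof (cases "g \<le> \<kappa>")
    case True
    have "eventually (\<lambda>\<epsilon>. good_pair cu du cv dv \<eta> (\<epsilon> ^ i) (\<epsilon> ^ j)) (at_right 0)" if \<eta>: "0 < \<eta>" for \<eta>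
    proof -
      have "0 < \<eta> * \<kappa>" using \<eta> dv by simp
      then have "(- g - (1 + \<eta>) * \<kappa> * (0 - 1)) * (- g + \<eta> * \<kappa> * (0 - 1)) < 0"
        using True w(2) by (intro mult_pos_neg) (auto simp: algebra_simps)
      from tendsto_signs(1)[OF limA this]
      have 1: "eventually (\<lambda>\<epsilon>. (- g - (1 + \<eta>) * \<kappa> * (\<epsilon> ^ (j - i) - 1)) * (- g + \<eta> * \<kappa> * (\<epsilon> ^ (j - i) - 1)) < 0) (at_right 0)" .
      have "(- g * 0 - (1 + \<eta>) * (0 - 1)) * (- g * 0 + \<eta> * (0 - 1)) < 0" using \<eta> by (intro mult_pos_neg) auto
      from tendsto_signs(1)[OF limB this]
      have 2: "eventually (\<lambda>\<epsilon>. (- g * \<epsilon> ^ (j - i) - (1 + \<eta>) * (\<epsilon> ^ (j - i) - 1)) * (- g * \<epsilon> ^ (j - i) + \<eta> * (\<epsilon> ^ (j - i) - 1)) < 0) (at_right 0)" .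
      from 1 2 pos show ?thesis
      proof eventually_elim
        case (elim \<epsilon>)
        have "0 < (\<epsilon> ^ i * N)^2" "0 < (\<kappa> * (\<epsilon> ^ i * N))^2" using elim N dv by simp_all
        then show ?case using elim True
          unfolding good_pair_def meet turned_pair(1)[OF \<eta>] e_def[symmetric] f_def[symmetric] A B by (simp add: mult_pos_neg)
      qed
    qed
    then show ?thesis by (rule eventually_mono[OF eventually_at_right_less])
  next
    case False
    have "((\<lambda>\<eta>. - g - (1 + \<eta>) * \<kappa> * (0 - 1)) \<longlongrightarrow> - g - (1 + 0) * \<kappa> * (0 - 1)) (at_right 0)" by (intro tendsto_intros)
    then have "eventually (\<lambda>\<eta>. - g - (1 + \<eta>) * \<kappa> * (0 - 1) < 0) (at_right 0)" by (rule tendsto_signs(1)) (use False in simp)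
    moreover have "eventually (\<lambda>\<eta>::real. 0 < \<eta>) (at_right 0)" by (rule eventually_at_right_less)
    ultimately show ?thesis
    proof eventually_elim
      case (elim \<eta>)
      have "0 < \<eta> * \<kappa>" using elim dv by simp
      then have "0 < (- g - (1 + \<eta>) * \<kappa> * (0 - 1)) * (- g + \<eta> * \<kappa> * (0 - 1))"
        using elim(1) w(2) by (intro mult_neg_neg) auto
      from tendsto_signs(2)[OF limA this] pos show ?case
      proof eventually_elim
        case (elim \<epsilon>)
        have "0 < (\<epsilon> ^ i * N)^2" using elim N by simp
        then show ?case using elim False
          unfolding good_pair_def meet turned_pair(2)[OF \<open>0 < \<eta>\<close>] e_def[symmetric] f_def[symmetric] A by simp
      qed
    qed
  qed
qed

lemma parallel_multiple:
  assumes "dirdet a b = 0" "a \<noteq> 0"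
  shows "\<exists>k. b = k *\<^sub>R a"
proof -
  have "b = (if fst a \<noteq> 0 then fst b / fst a else snd b / snd a) *\<^sub>R a"
    using assms by (auto simp: prod_eq_iff dirdet_def field_simps)
  then show ?thesis by blast
qed

text \<open>A linear functional \<open>\<phi> a\<close> that is nonconstant on every segment selects
  as turning point \<open>c v\<close> the end of larger value. The segments are ranked by this
  value, ties by index, and turned by \<open>\<epsilon> ^ \<rho> v\<close>. Among collinear segments
  the one of lower rank thus turns more and its turning point is not beyond the other's, as
  \<open>good_pair_collinear\<close> requires.\<close>

theorem generic_position:
  fixes p q :: "nat \<Rightarrow> real \<times> real"
  assumes pq: "\<And>v. v < n \<Longrightarrow> p v \<noteq> q v"
  shows "\<exists>p' q'. (\<forall>v<n. p' v \<noteq> q' v) \<and> (\<forall>u<n. \<forall>v<n. u \<noteq> v \<longrightarrow>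
    (if closed_segment (p u) (q u) \<inter> closed_segment (p v) (q v) \<noteq> {} then crossing (p' u) (q' u) (p' v) (q' v)
     else separated (p' u) (q' u) (p' v) (q' v)))"
proof -
  define \<phi> where "\<phi> a z = fst z + a * snd z" for a :: real and z :: "real \<times> real"
  obtain a where a: "\<And>v. v < n \<Longrightarrow> \<phi> a (q v - p v) \<noteq> 0"
  proof -
    have "finite ((\<lambda>v. - fst (q v - p v) / snd (q v - p v)) ` {..<n})" by simp
    then obtain a where a: "a \<notin> (\<lambda>v. - fst (q v - p v) / snd (q v - p v)) ` {..<n}"
      using ex_new_if_finite[OF infinite_UNIV_char_0] by blast
    have "\<phi> a (q v - p v) \<noteq> 0" if v: "v < n" for v
    proof
      assume z: "\<phi> a (q v - p v) = 0"
      show False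
      proof (cases "snd (q v - p v) = 0")
        case True
        then show False using z pq[OF v] by (auto simp: \<phi>_def prod_eq_iff)
      next
        case False
        then have "a = - fst (q v - p v) / snd (q v - p v)" using z unfolding \<phi>_def nonzero_eq_divide_eq[OF False] by linarith
        then show False using a v by blast
      qed
    qed
    then show ?thesis using that by blast
  qed
  have lin: "\<phi> a (x - y) = \<phi> a x - \<phi> a y" "\<phi> a (k *\<^sub>R x) = k * \<phi> a x" for x y k by (simp_all add: \<phi>_def algebra_simps)
  define c where "c v = (if \<phi> a (p v) < \<phi> a (q v) then q v else p v)" for v
  define d where "d v = (if \<phi> a (p v) < \<phi> a (q v) then q v - p v else p v - q v)" for v
  have seg: "closed_segment (c v - d v) (c v) = closed_segment (p v) (q v)" for v
    by (auto simp: c_def d_def closed_segment_commute)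
  have dpos: "0 < \<phi> a (d v)" if "v < n" for v using a[OF that] by (auto simp: d_def lin)
  have d0: "d v \<noteq> 0" if "v < n" for v using dpos[OF that] by (auto simp: \<phi>_def)
  define R where "R u v \<longleftrightarrow> \<phi> a (c u) < \<phi> a (c v) \<or> (\<phi> a (c u) = \<phi> a (c v) \<and> u < v)" for u v
  define \<rho> where "\<rho> v = Suc (card {w. w < n \<and> R w v})" for v
  have \<rho>: "\<rho> u < \<rho> v" if "R u v" "u < n" for u v
  proof -
    have "{w. w < n \<and> R w u} \<subset> {w. w < n \<and> R w v}" using that by (auto simp: R_def)
    then show ?thesis unfolding \<rho>_def by (intro Suc_mono psubset_card_mono) auto
  qed
  define good where "good \<eta> \<epsilon> u v \<longleftrightarrow> good_pair (c u) (d u) (c v) (d v) \<eta> (\<epsilon> ^ \<rho> u) (\<epsilon> ^ \<rho> v)" for \<eta> \<epsilon> u v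
  have ev: "eventually (\<lambda>\<eta>. eventually (\<lambda>\<epsilon>. good \<eta> \<epsilon> u v) (at_right 0)) (at_right 0)" if u: "u < n" and v: "v < n" and R: "R u v" for u v
  proof -
    have pos: "0 < \<rho> u" "0 < \<rho> v" by (simp_all add: \<rho>_def)
    show ?thesis
    proof (cases "dirdet (d u) (d v) = 0")
      case False
      then show ?thesis unfolding good_def by (rule good_pair_transversal) (rule pos)+
    next
      case True
      show ?thesis
      proof (cases "dirdet (d u) (c v - c u) = 0")
        case False
        with True show ?thesis unfolding good_def by (rule good_pair_parallel) (rule pos)+
      next
        case w: True
        obtain \<kappa> where k: "d v = \<kappa> *\<^sub>R d u" using parallel_multiple[OF True d0[OF u]] by blast
        obtain g where g: "c v - c u = g *\<^sub>R d u" using parallel_multiple[OF w d0[OF u]] by blast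
        have "0 < \<kappa> * \<phi> a (d u)" using dpos[OF v] by (simp add: k lin)
        then have k0: "0 < \<kappa>" using dpos[OF u] by (simp add: zero_less_mult_iff)
        have "0 \<le> \<phi> a (c v - c u)" using R by (auto simp: R_def lin)
        then have "0 \<le> g * \<phi> a (d u)" by (simp add: g lin)
        then have g0: "0 \<le> g" using dpos[OF u] by (simp add: zero_le_mult_iff)
        show ?thesis unfolding good_def by (rule good_pair_collinear[OF d0[OF u] k k0 g g0 pos(1) \<rho>[OF R u]])
      qed
    qed
  qed
  let ?P = "{(u, v). u < n \<and> v < n \<and> R u v}"
  have P: "finite ?P" by (rule finite_subset[of _ "{..<n} \<times> {..<n}"]) auto
  \<comment> \<open>The prolongation \<eta> is fixed first, and the turns \<epsilon> are chosen
    small depending on it; each choice serves the finitely many pairs at once.\<close>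
  have "eventually (\<lambda>\<eta>. \<forall>x\<in>?P. eventually (\<lambda>\<epsilon>. good \<eta> \<epsilon> (fst x) (snd x)) (at_right 0)) (at_right 0)"
    by (rule eventually_ball_finite[OF P]) (use ev in auto)
  moreover have "eventually (\<lambda>\<eta>::real. 0 < \<eta>) (at_right 0)" by (rule eventually_at_right_less)
  ultimately have "eventually (\<lambda>\<eta>. 0 < \<eta> \<and> (\<forall>x\<in>?P. eventually (\<lambda>\<epsilon>. good \<eta> \<epsilon> (fst x) (snd x)) (at_right 0))) (at_right 0)"
    by eventually_elim blast
  then obtain \<eta> :: real where \<eta>: "0 < \<eta>" "\<forall>x\<in>?P. eventually (\<lambda>\<epsilon>. good \<eta> \<epsilon> (fst x) (snd x)) (at_right 0)"
    using eventually_happens'[OF trivial_limit_at_right_real] by blast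
  have "eventually (\<lambda>\<epsilon>. \<forall>x\<in>?P. good \<eta> \<epsilon> (fst x) (snd x)) (at_right 0)"
    by (rule eventually_ball_finite[OF P \<eta>(2)])
  then obtain \<epsilon> where \<epsilon>: "\<forall>x\<in>?P. good \<eta> \<epsilon> (fst x) (snd x)"
    using eventually_happens'[OF trivial_limit_at_right_real] by blast
  define p' where "p' v = tail (c v) (d v) \<eta> (\<epsilon> ^ \<rho> v)" for v
  define q' where "q' v = head (c v) (d v) \<eta> (\<epsilon> ^ \<rho> v)" for v
  have ne: "p' v \<noteq> q' v" if v: "v < n" for v
  proof
    assume eq: "p' v = q' v"
    have "(x + \<eta> *\<^sub>R D) - (x + (- (1 + \<eta>)) *\<^sub>R D) = (\<eta> + (1 + \<eta>)) *\<^sub>R D" for x D :: "real \<times> real"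
      by (simp only: scaleR_left_distrib scaleR_minus_left) simp
    then have "q' v - p' v = (\<eta> + (1 + \<eta>)) *\<^sub>R (d v + \<epsilon> ^ \<rho> v *\<^sub>R perp (d v))"
      unfolding p'_def q'_def tail_def head_def .
    then have "(\<eta> + (1 + \<eta>)) *\<^sub>R (d v + \<epsilon> ^ \<rho> v *\<^sub>R perp (d v)) = 0" using eq by simp
    then have "d v + \<epsilon> ^ \<rho> v *\<^sub>R perp (d v) = 0" using \<eta>(1) by simp
    then have "dirdet (d v + \<epsilon> ^ \<rho> v *\<^sub>R perp (d v)) (perp (d v)) = 0" by (simp add: dirdet_def)
    then have "fst (d v) * fst (d v) + snd (d v) * snd (d v) = 0" by (simp add: dirdet_simps) (simp add: dirdet_def perp_def)
    then show False using d0[OF v] by (simp add: sum_squares_eq_zero_iff prod_eq_iff)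
  qed
  have pairs: "if closed_segment (p u) (q u) \<inter> closed_segment (p v) (q v) \<noteq> {} then crossing (p' u) (q' u) (p' v) (q' v)
     else separated (p' u) (q' u) (p' v) (q' v)" if uv: "u < n" "v < n" "u \<noteq> v" for u v
  proof -
    have *: "if closed_segment (p u) (q u) \<inter> closed_segment (p v) (q v) \<noteq> {} then crossing (p' u) (q' u) (p' v) (q' v)
     else separated (p' u) (q' u) (p' v) (q' v)" if "u < n" "v < n" "R u v" for u v
    proof -
      have "good \<eta> \<epsilon> u v" using bspec[OF \<epsilon>, of "(u, v)"] that by simp
      then show ?thesis unfolding good_def good_pair_def seg p'_def q'_def .
    qed
    have "R u v \<or> R v u" using uv(3) by (auto simp: R_def)
    then show ?thesis
    proof
      assume "R u v" then show ?thesis using *[of u v] uv by blast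
    next
      assume "R v u"
      then show ?thesis
        by (subst Int_commute, subst crossing_commute, subst separated_commute) (rule *[OF uv(2,1)])
    qed
  qed
  show ?thesis
    by (rule exI[of _ p'], rule exI[of _ q'], intro conjI allI impI) (erule ne, erule (2) pairs)
qed

subsection \<open>Integer endpoints\<close>

lemma sum_indicator:
  fixes x :: "nat \<Rightarrow> real"
  assumes "i \<le> m"
  shows "(\<Sum>b\<le>m. (if b = i then 1 else 0) * x b) = x i"
proof -
  have "(\<Sum>b\<le>m. (if b = i then 1 else 0) * x b) = (\<Sum>b\<le>m. if b = i then x i else 0)" by (intro sum.cong) auto
  then show ?thesis using assms by simp
qed

lemma qf_rows: "qf m C x = (\<Sum>a\<le>m. x a * (\<Sum>b\<le>m. of_int (C a b) * x b))"
  unfolding qf_def sum_distrib_left by (intro sum.cong) auto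

lemma qf_scale: "qf m (\<lambda>a b. \<sigma> * C a b) x = of_int \<sigma> * qf m C x"
  unfolding qf_def sum_distrib_left by (intro sum.cong) auto

text \<open>The coordinates of the endpoints of segment \<open>v\<close> are the variables \<open>4 v\<close> to \<open>4 v + 3\<close>.\<close>

definition point :: "(nat \<Rightarrow> real) \<Rightarrow> nat \<Rightarrow> real \<times> real" where
  "point x z = (x z, x (z + 1))"

text \<open>The six products in the expanded determinant. Each entry is a difference of two numbers
  0 or 1, and thus stays bounded by 2 also if the point z is an endpoint of the segment
  itself.\<close>

definition orient_matrix :: "nat \<Rightarrow> nat \<Rightarrow> nat \<Rightarrow> nat \<Rightarrow> int" where
  "orient_matrix p z a b =
    (if a = p + 2 then (if b = z + 1 then 1 else 0) - (if b = p + 1 then 1 else 0)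
     else if a = p then 0 - (if b = z + 1 then 1 else 0)
     else if a = p + 3 then (if b = p then 1 else 0) - (if b = z then 1 else 0)
     else if a = p + 1 then (if b = z then 1 else 0) - 0 else 0)"

lemma qf_orient_matrix:
  assumes "p + 3 \<le> m" "z + 1 \<le> m"
  shows "qf m (orient_matrix p z) x = orient (point x p) (point x (p + 2)) (point x z)"
proof -
  have i: "(\<Sum>b\<le>m. (if b = i then 1 else 0) * x b) = x i" if "i \<le> m" for i by (rule sum_indicator[OF that])
  have row: "(\<Sum>b\<le>m. of_int (orient_matrix p z a b) * x b) =
    (if a = p + 2 then x (z + 1) - x (p + 1) else if a = p then - x (z + 1) else if a = p + 3 then x p - x z
     else if a = p + 1 then x z else 0)" for a
    unfolding orient_matrix_def using assms
    by (simp add: left_diff_distrib sum_subtractf i sum_negf if_distrib[of of_int] cong: if_cong) (simp add: sum_negf i)?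
  have "qf m (orient_matrix p z) x = (\<Sum>a\<in>{p, p + 1, p + 2, p + 3}. x a * (if a = p + 2 then x (z + 1) - x (p + 1)
     else if a = p then - x (z + 1) else if a = p + 3 then x p - x z else if a = p + 1 then x z else 0))"
    unfolding qf_rows row by (rule sum.mono_neutral_right) (use assms in auto)
  then show ?thesis by (simp add: orient_def point_def algebra_simps eval_nat_numeral)
qed

text \<open>A form with the sign of a coordinate difference where \<open>x m\<close> is positive; it
  keeps the two endpoints of a segment distinct.\<close>

definition diff_matrix :: "nat \<Rightarrow> nat \<Rightarrow> nat \<Rightarrow> nat \<Rightarrow> nat \<Rightarrow> int" where
  "diff_matrix m i j a b = (if a = m then (if b = j then 1 else 0) - (if b = i then 1 else 0) else 0)"

lemma qf_diff_matrix:
  assumes "i \<le> m" "j \<le> m"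
  shows "qf m (diff_matrix m i j) x = x m * (x j - x i)"
proof -
  have i: "(\<Sum>b\<le>m. (if b = i then 1 else 0) * x b) = x i" if "i \<le> m" for i by (rule sum_indicator[OF that])
  have row: "(\<Sum>b\<le>m. of_int (diff_matrix m i j a b) * x b) = (if a = m then x j - x i else 0)" for a
    unfolding diff_matrix_def using assms
    by (simp add: left_diff_distrib sum_subtractf i if_distrib[of of_int] cong: if_cong)
  have "qf m (diff_matrix m i j) x = (\<Sum>a\<in>{m}. x a * (if a = m then x j - x i else 0))"
    unfolding qf_rows row by (rule sum.mono_neutral_right) auto
  then show ?thesis by simp
qed

lemma matrix_bounds: "\<bar>orient_matrix p z a b\<bar> \<le> 2" "\<bar>diff_matrix m i j a b\<bar> \<le> 2"
  by (auto simp: orient_matrix_def diff_matrix_def)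

lemma orient_scale: "orient (k *\<^sub>R p) (k *\<^sub>R q) (k *\<^sub>R r) = k^2 * orient p q r"
  by (simp add: orient_def power2_eq_square algebra_simps)

lemma sign_transfer:
  assumes "\<And>\<sigma> :: int. \<sigma> \<in> {1, -1} \<Longrightarrow> 0 < of_int \<sigma> * (a :: real) \<Longrightarrow> 0 < of_int \<sigma> * (b :: real)"
  shows "0 < a \<Longrightarrow> 0 < b" "a < 0 \<Longrightarrow> b < 0"
  using assms[of 1] assms[of "-1"] by auto

text \<open>\<open>integer_point\<close> is applied to all signed orientation and difference forms
  that are positive at the given endpoints, after scaling by K has brought all coordinates into the
  open interval from -1 to 1. Positivity of the same forms at the integer point transfers every
  strict sign.\<close>

theorem integer_segments:
  fixes p q :: "nat \<Rightarrow> real \<times> real"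
  assumes n: "0 < n" and pq: "\<And>v. v < n \<Longrightarrow> p v \<noteq> q v"
  shows "\<exists>a b :: nat \<Rightarrow> real \<times> real. \<forall>v<n.
    a v \<in> \<int> \<times> \<int> \<and> b v \<in> \<int> \<times> \<int> \<and> a v \<noteq> b v \<and>
    closed_segment (a v) (b v) \<subseteq> {- real (grid_bound (4 * n))..real (grid_bound (4 * n))} \<times> {- real (grid_bound (4 * n))..real (grid_bound (4 * n))} \<and>
    (\<forall>u<n. u \<noteq> v \<longrightarrow> (crossing (p u) (q u) (p v) (q v) \<longrightarrow> crossing (a u) (b u) (a v) (b v)) \<and>
      (separated (p u) (q u) (p v) (q v) \<longrightarrow> separated (a u) (b u) (a v) (b v)))"
proof -
  define m where "m = 4 * n"
  define K where "K = 1 + (\<Sum>v<n. norm (p v) + norm (q v))"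
  have K: "0 < K" unfolding K_def by (intro add_pos_nonneg sum_nonneg) auto
  have nK: "norm (p v) < K" "norm (q v) < K" if "v < n" for v
  proof -
    have "norm (p v) + norm (q v) \<le> (\<Sum>v<n. norm (p v) + norm (q v))" using that
      by (intro member_le_sum[of v "{..<n}" "\<lambda>v. norm (p v) + norm (q v)"]) auto
    then show "norm (p v) < K" "norm (q v) < K" unfolding K_def using norm_ge_zero[of "p v"] norm_ge_zero[of "q v"] by linarith+
  qed
  define coord where "coord j = [fst (p (j div 4)), snd (p (j div 4)), fst (q (j div 4)), snd (q (j div 4))] ! (j mod 4)" for j
  define x where "x j = (if j < m then coord j / K else 1)" for j
  have xpt: "point x (4 * v) = (1 / K) *\<^sub>R p v" "point x (4 * v + 2) = (1 / K) *\<^sub>R q v" if "v < n" for v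
  proof -
    have d: "(4 * v) div 4 = v" "(4 * v + 1) div 4 = v" "(4 * v + 2) div 4 = v" "(4 * v + 3) div 4 = v"
      by linarith+
    have r: "(4 * v) mod 4 = 0" "(4 * v + 1) mod 4 = 1" "(4 * v + 2) mod 4 = 2" "(4 * v + 3) mod 4 = 3"
      by (simp, presburger, presburger, presburger)
    have c: "coord (4 * v) = fst (p v)" "coord (4 * v + 1) = snd (p v)" "coord (4 * v + 2) = fst (q v)" "coord (4 * v + 3) = snd (q v)"
      unfolding coord_def d r by (simp_all add: numeral_2_eq_2 numeral_3_eq_3)
    have l: "4 * v < m" "4 * v + 1 < m" "4 * v + 2 < m" "4 * v + 3 < m" using that unfolding m_def by linarith+
    have s: "4 * v + 2 + 1 = 4 * v + 3" by linarith
    show "point x (4 * v) = (1 / K) *\<^sub>R p v"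
      unfolding point_def x_def c if_P[OF l(1)] if_P[OF l(2)] by (simp add: prod_eq_iff)
    show "point x (4 * v + 2) = (1 / K) *\<^sub>R q v"
      unfolding point_def s x_def c if_P[OF l(3)] if_P[OF l(4)] by (simp add: prod_eq_iff)
  qed
  have x1: "\<bar>x j\<bar> < 1" if "j < m" for j
  proof -
    have v: "j div 4 < n" using that by (simp add: m_def)
    have "j mod 4 < 4" by simp
    then have "j mod 4 = 0 \<or> j mod 4 = 1 \<or> j mod 4 = 2 \<or> j mod 4 = 3" by linarith
    then have "\<bar>coord j\<bar> \<le> norm (p (j div 4)) \<or> \<bar>coord j\<bar> \<le> norm (q (j div 4))"
      using norm_fst_le[of "fst (p (j div 4))" "snd (p (j div 4))"] norm_snd_le[of "snd (p (j div 4))" "fst (p (j div 4))"]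
        norm_fst_le[of "fst (q (j div 4))" "snd (q (j div 4))"] norm_snd_le[of "snd (q (j div 4))" "fst (q (j div 4))"]
      by (auto simp: coord_def)
    then have "\<bar>coord j\<bar> < K" using nK[OF v] by linarith
    then show ?thesis using K that by (simp add: x_def)
  qed
  \<comment> \<open>In \<open>M1\<close> the number e chooses the endpoint of v, 0 for the first and
    2 for the second; in \<open>M2\<close> its half chooses the coordinate. The last component is
    the sign.\<close>
  define T where "T = {..<n} \<times> {..<n} \<times> {0, 2::nat} \<times> {1, -1::int}"
  define M1 where "M1 t = (case t of (u, v, e, \<sigma>) \<Rightarrow> (\<lambda>a b. \<sigma> * orient_matrix (4 * u) (4 * v + e) a b))" for t :: "nat \<times> nat \<times> nat \<times> int"
  define M2 where "M2 t = (case t of (u, v, e, \<sigma>) \<Rightarrow> (\<lambda>a b. \<sigma> * diff_matrix m (4 * u + e div 2) (4 * u + 2 + e div 2) a b))" for t :: "nat \<times> nat \<times> nat \<times> int"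
  define F where "F = {C \<in> M1 ` T \<union> M2 ` T. 0 < qf m C x}"
  have finF: "finite F" unfolding F_def T_def by (intro finite_Collect_conjI disjI1) auto
  obtain q0 :: nat and C where C: "F = C ` {i. i < q0}"
    using finite_imp_nat_seg_image_inj_on[OF finF] by (elim exE conjE)
  have FC: "C k \<in> F" if "k < q0" for k using that C by blast
  have bound: "\<bar>C k a b\<bar> \<le> 2" if "k < q0" for k a b
  proof -
    have "C k \<in> M1 ` T \<union> M2 ` T" using FC[OF that] by (simp add: F_def)
    then obtain u v e \<sigma> where "(u, v, e, \<sigma>) \<in> T" "C k = M1 (u, v, e, \<sigma>) \<or> C k = M2 (u, v, e, \<sigma>)" by auto
    then have "\<sigma> = 1 \<or> \<sigma> = -1" "C k a b = \<sigma> * orient_matrix (4 * u) (4 * v + e) a b \<or> C k a b = \<sigma> * diff_matrix m (4 * u + e div 2) (4 * u + 2 + e div 2) a b"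
      by (auto simp: T_def M1_def M2_def)
    then show ?thesis using matrix_bounds by (auto simp: abs_mult)
  qed
  obtain X :: "nat \<Rightarrow> int" where X: "\<forall>j\<le>m. \<bar>X j\<bar> \<le> int (grid_bound m)" "0 < X m" "\<forall>k<q0. 0 < qf m (C k) (\<lambda>j. of_int (X j))"
    using integer_point[of m q0 C x] n bound x1 FC by (auto simp: m_def F_def x_def)
  define y where "y j = real_of_int (X j)" for j
  have pos: "0 < qf m D y" if "D \<in> F" for D using that X(3) unfolding C y_def by auto
  define a where "a v = point y (4 * v)" for v
  define b where "b v = point y (4 * v + 2)" for v
  have or: "0 < of_int \<sigma> * orient (a u) (b u) (point y (4 * v + e))"
    if "u < n" "v < n" "e \<in> {0, 2}" "\<sigma> \<in> {1, -1}" "0 < of_int \<sigma> * orient (point x (4 * u)) (point x (4 * u + 2)) (point x (4 * v + e))" for u v e \<sigma>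
  proof -
    have t: "(u, v, e, \<sigma>) \<in> T" using that by (auto simp: T_def)
    have le: "4 * u + 3 \<le> m" "4 * v + e + 1 \<le> m" using that by (auto simp: m_def)
    have qM: "qf m (M1 (u, v, e, \<sigma>)) z = of_int \<sigma> * orient (point z (4 * u)) (point z (4 * u + 2)) (point z (4 * v + e))" for z
      using qf_scale[of m \<sigma> "orient_matrix (4 * u) (4 * v + e)" z] qf_orient_matrix[OF le] by (simp add: M1_def)
    have "M1 (u, v, e, \<sigma>) \<in> F" using t that(5) unfolding F_def by (auto simp: qM)
    from pos[OF this] show ?thesis by (simp add: qM a_def b_def)
  qed
  have orx: "orient (point x (4 * u)) (point x (4 * u + 2)) (point x (4 * v)) = (1 / K)^2 * orient (p u) (q u) (p v)"
    "orient (point x (4 * u)) (point x (4 * u + 2)) (point x (4 * v + 2)) = (1 / K)^2 * orient (p u) (q u) (q v)" if "u < n" "v < n" for u v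
    unfolding xpt[OF that(1)] xpt[OF that(2)] orient_scale by simp_all
  have KK: "0 < (1 / K)^2" using K by simp
  have sign: "0 < orient (p u) (q u) (p v) \<Longrightarrow> 0 < orient (a u) (b u) (a v)" "orient (p u) (q u) (p v) < 0 \<Longrightarrow> orient (a u) (b u) (a v) < 0"
    "0 < orient (p u) (q u) (q v) \<Longrightarrow> 0 < orient (a u) (b u) (b v)" "orient (p u) (q u) (q v) < 0 \<Longrightarrow> orient (a u) (b u) (b v) < 0"
    if uv: "u < n" "v < n" for u v
  proof -
    have 1: "0 < of_int \<sigma> * orient (a u) (b u) (a v)" if "\<sigma> \<in> {1, -1}" "0 < of_int \<sigma> * orient (p u) (q u) (p v)" for \<sigma> :: int
    proof -
      have "0 < of_int \<sigma> * ((1 / K)^2 * orient (p u) (q u) (p v))" using mult_pos_pos[OF KK that(2)] by (simp only: mult.left_commute)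
      then show ?thesis using or[OF uv, of 0 \<sigma>, unfolded add_0_right orx(1)[OF uv] a_def[symmetric]] that(1) by blast
    qed
    have 2: "0 < of_int \<sigma> * orient (a u) (b u) (b v)" if "\<sigma> \<in> {1, -1}" "0 < of_int \<sigma> * orient (p u) (q u) (q v)" for \<sigma> :: int
    proof -
      have "0 < of_int \<sigma> * ((1 / K)^2 * orient (p u) (q u) (q v))" using mult_pos_pos[OF KK that(2)] by (simp only: mult.left_commute)
      then show ?thesis using or[OF uv, of 2 \<sigma>, unfolded add_0_right orx(2)[OF uv] b_def[symmetric]] that(1) by blast
    qed
    show "0 < orient (p u) (q u) (p v) \<Longrightarrow> 0 < orient (a u) (b u) (a v)" "orient (p u) (q u) (p v) < 0 \<Longrightarrow> orient (a u) (b u) (a v) < 0"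
      by (rule sign_transfer[OF 1], assumption+)+
    show "0 < orient (p u) (q u) (q v) \<Longrightarrow> 0 < orient (a u) (b u) (b v)" "orient (p u) (q u) (q v) < 0 \<Longrightarrow> orient (a u) (b u) (b v) < 0"
      by (rule sign_transfer[OF 2], assumption+)+
  qed
  have ne: "a v \<noteq> b v" if v: "v < n" for v
  proof -
    have xm: "x m = 1" by (simp add: x_def)
    have diff: "0 < of_int \<sigma> * (y (4 * v + 2 + e div 2) - y (4 * v + e div 2))"
      if "e \<in> {0, 2}" "\<sigma> \<in> {1, -1}" "0 < of_int \<sigma> * (x (4 * v + 2 + e div 2) - x (4 * v + e div 2))" for e and \<sigma> :: int
    proof -
      have t: "(v, v, e, \<sigma>) \<in> T" using that v by (auto simp: T_def)
      have le: "4 * v + e div 2 \<le> m" "4 * v + 2 + e div 2 \<le> m" using that v by (auto simp: m_def)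
      have qM: "qf m (M2 (v, v, e, \<sigma>)) z = z m * (of_int \<sigma> * (z (4 * v + 2 + e div 2) - z (4 * v + e div 2)))" for z
        using qf_scale[of m \<sigma> "diff_matrix m (4 * v + e div 2) (4 * v + 2 + e div 2)" z] qf_diff_matrix[OF le] by (simp add: M2_def)
      have "M2 (v, v, e, \<sigma>) \<in> F" using t that(3) xm unfolding F_def by (auto simp: qM)
      from pos[OF this] show ?thesis using X(2) unfolding qM by (simp add: zero_less_mult_iff y_def)
    qed
    have "point x (4 * v) \<noteq> point x (4 * v + 2)" unfolding xpt[OF v] using pq[OF v] K by simp
    then consider "x (4 * v) \<noteq> x (4 * v + 2)" | "x (4 * v + 1) \<noteq> x (4 * v + 3)" by (auto simp: point_def eval_nat_numeral)
    then show ?thesis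
    proof cases
      case 1
      then have "y (4 * v) \<noteq> y (4 * v + 2)" using diff[of 0 1] diff[of 0 "-1"] by (auto simp: linorder_neq_iff)
      then show ?thesis by (simp add: a_def b_def point_def)
    next
      case 2
      then have "y (4 * v + 1) \<noteq> y (4 * v + 3)" using diff[of 2 1] diff[of 2 "-1"] by (auto simp: linorder_neq_iff eval_nat_numeral)
      then show ?thesis by (simp add: a_def b_def point_def eval_nat_numeral)
    qed
  qed
  have ints: "a v \<in> \<int> \<times> \<int>" "b v \<in> \<int> \<times> \<int>" for v by (simp_all add: a_def b_def point_def y_def)
  have yb: "\<bar>y j\<bar> \<le> real (grid_bound m)" if "j \<le> m" for j
  proof -
    have "\<bar>X j\<bar> \<le> int (grid_bound m)" using X(1) that by blast
    then show ?thesis unfolding y_def by linarith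
  qed
  have box: "closed_segment (a v) (b v) \<subseteq> {- real (grid_bound m)..real (grid_bound m)} \<times> {- real (grid_bound m)..real (grid_bound m)}"
    if v: "v < n" for v
  proof (rule closed_segment_subset)
    have "4 * v \<le> m" "4 * v + 1 \<le> m" "4 * v + 2 \<le> m" "4 * v + 3 \<le> m" using v by (auto simp: m_def)
    note yb[OF this(1)] yb[OF this(2)] yb[OF this(3)] yb[OF this(4)]
    then show "a v \<in> {- real (grid_bound m)..real (grid_bound m)} \<times> {- real (grid_bound m)..real (grid_bound m)}"
      "b v \<in> {- real (grid_bound m)..real (grid_bound m)} \<times> {- real (grid_bound m)..real (grid_bound m)}"
      by (simp_all add: a_def b_def point_def abs_le_iff eval_nat_numeral)
    show "convex ({- real (grid_bound m)..real (grid_bound m)} \<times> {- real (grid_bound m)..real (grid_bound m)})"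
      by (intro convex_Times convex_real_interval)
  qed
  have pres: "(crossing (p u) (q u) (p v) (q v) \<longrightarrow> crossing (a u) (b u) (a v) (b v)) \<and>
      (separated (p u) (q u) (p v) (q v) \<longrightarrow> separated (a u) (b u) (a v) (b v))" if "u < n" "v < n" for u v
    using sign[OF that] sign[OF that(2,1)] unfolding crossing_def separated_def mult_less_0_iff zero_less_mult_iff by blast
  show ?thesis
    by (rule exI[of _ a], rule exI[of _ b]) (use ints ne box pres in \<open>simp add: m_def\<close>)
qed

section \<open>Segment graphs in a box of integer points, and the upper bound\<close>

lemma segment_graph_model:
  assumes "G \<in> SEG n"
  shows "\<exists>\<psi> (p :: nat \<Rightarrow> real \<times> real) q. bij_betw \<psi> {..<n} (pverts G) \<and> (\<forall>v<n. p v \<noteq> q v) \<and>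
    parcs G = {(\<psi> u, \<psi> v) | u v. u < n \<and> v < n \<and> u \<noteq> v \<and> closed_segment (p u) (q u) \<inter> closed_segment (p v) (q v) \<noteq> {}}"
proof -
  have c: "card (pverts G) = n" using assms by (simp add: SEG_def)
  obtain I :: "nat set" and A where I: "finite I" "\<forall>i\<in>I. is_segment (A i)"
    "digraph_iso (with_proj (intersection_graph I A)) (with_proj G)"
    using assms unfolding SEG_def segment_graph_def by (elim CollectE conjE exE)
  obtain f where f: "pre_digraph.digraph_isomorphism (with_proj (intersection_graph I A)) f"
    and G: "with_proj G = app_iso f (with_proj (intersection_graph I A))"
    using I(3) unfolding digraph_iso_def by (elim conjE exE)
  let ?E = "{(u, v). u \<in> I \<and> v \<in> I \<and> u \<noteq> v \<and> A u \<inter> A v \<noteq> {}}"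
  have V: "pverts G = iso_verts f ` I" and P: "parcs G = iso_arcs f ` ?E" and t: "iso_tail f = fst" and h: "iso_head f = snd"
    using G by (simp_all add: app_iso_def with_proj_def intersection_graph_def)
  have inj: "inj_on (iso_verts f) I"
    and ends: "\<forall>e\<in>?E. iso_verts f (fst e) = fst (iso_arcs f e) \<and> iso_verts f (snd e) = snd (iso_arcs f e)"
    using f by (simp_all add: pre_digraph.digraph_isomorphism_def with_proj_def intersection_graph_def t h)
  \<comment> \<open>Arcs are pairs of vertices with the projections as tail and head, so the
    isomorphism acts on them through its vertex map.\<close>
  have P': "parcs G = (\<lambda>(u, v). (iso_verts f u, iso_verts f v)) ` ?E"
    unfolding P by (intro image_cong refl) (use ends in \<open>force simp: prod_eq_iff\<close>)
  have "card I = n" using c inj V card_image by fastforce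
  then obtain g where g: "bij_betw g {..<n} I" using I(1) ex_bij_betw_nat_finite[of I] by (auto simp: atLeast0LessThan)
  have gI: "g v \<in> I" if "v < n" for v using g that by (auto simp: bij_betw_def)
  have Ig: "I = g ` {..<n}" and gi: "inj_on g {..<n}" using g by (simp_all add: bij_betw_def)
  have "\<forall>v. \<exists>a b. v < n \<longrightarrow> a \<noteq> b \<and> A (g v) = closed_segment a b" using gI I(2) unfolding is_segment_def by meson
  then obtain p q where pq: "\<And>v. v < n \<Longrightarrow> p v \<noteq> q v \<and> A (g v) = closed_segment (p v) (q v)" by metis
  show ?thesis
  proof (rule exI[of _ "iso_verts f \<circ> g"], rule exI[of _ p], rule exI[of _ q], intro conjI allI impI)
    show "bij_betw (iso_verts f \<circ> g) {..<n} (pverts G)"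
      by (rule bij_betw_trans[OF g]) (simp add: inj V bij_betw_def)
    show "p v \<noteq> q v" if "v < n" for v using pq[OF that] by blast
    have "?E = {(g u, g v) | u v. u < n \<and> v < n \<and> u \<noteq> v \<and> closed_segment (p u) (q u) \<inter> closed_segment (p v) (q v) \<noteq> {}}"
      unfolding Ig using pq gi by (fastforce dest: inj_onD)
    moreover have img: "h ` {k u v | u v. Q u v} = {h (k u v) | u v. Q u v}" for h :: "nat \<times> nat \<Rightarrow> 'a \<times> 'a" and k and Q :: "nat \<Rightarrow> nat \<Rightarrow> bool"
      by blast
    ultimately show "parcs G = {((iso_verts f \<circ> g) u, (iso_verts f \<circ> g) v) | u v. u < n \<and> v < n \<and> u \<noteq> v \<and>
        closed_segment (p u) (q u) \<inter> closed_segment (p v) (q v) \<noteq> {}}"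
      unfolding P' using img[of "\<lambda>(u, v). (iso_verts f u, iso_verts f v)" "\<lambda>u v. (g u, g v)"] by simp
  qed
qed

lemma integer_realization_in_box:
  assumes G: "G \<in> SEG n" and n: "0 < n"
  obtains A where "integer_SEG_realization A G"
    "\<And>v. v \<in> pverts G \<Longrightarrow> A v \<subseteq> {- real (grid_bound (4 * n))..real (grid_bound (4 * n))} \<times> {- real (grid_bound (4 * n))..real (grid_bound (4 * n))}"
proof -
  obtain \<psi> p q where \<psi>: "bij_betw \<psi> {..<n} (pverts G)" and pq': "\<forall>v<n. p v \<noteq> (q v :: real \<times> real)"
    and E: "parcs G = {(\<psi> u, \<psi> v) | u v. u < n \<and> v < n \<and> u \<noteq> v \<and> closed_segment (p u) (q u) \<inter> closed_segment (p v) (q v) \<noteq> {}}"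
    using segment_graph_model[OF G] by (elim exE conjE)
  have pq: "p v \<noteq> q v" if "v < n" for v using pq' that by blast
  obtain p' q' where p'q': "\<forall>v<n. p' v \<noteq> q' v" and gp: "\<forall>u<n. \<forall>v<n. u \<noteq> v \<longrightarrow>
    (if closed_segment (p u) (q u) \<inter> closed_segment (p v) (q v) \<noteq> {} then crossing (p' u) (q' u) (p' v) (q' v)
     else separated (p' u) (q' u) (p' v) (q' v))" by (rule exE[OF generic_position[of n p q]], erule pq, elim exE conjE)
  have ne: "p' v \<noteq> q' v" if "v < n" for v using p'q' that by blast
  let ?B = "{- real (grid_bound (4 * n))..real (grid_bound (4 * n))} \<times> {- real (grid_bound (4 * n))..real (grid_bound (4 * n))}"
  obtain a b where ab: "\<forall>v<n. a v \<in> \<int> \<times> \<int> \<and> b v \<in> \<int> \<times> \<int> \<and> a v \<noteq> b v \<and> closed_segment (a v) (b v) \<subseteq> ?B \<and>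
    (\<forall>u<n. u \<noteq> v \<longrightarrow> (crossing (p' u) (q' u) (p' v) (q' v) \<longrightarrow> crossing (a u) (b u) (a v) (b v)) \<and>
      (separated (p' u) (q' u) (p' v) (q' v) \<longrightarrow> separated (a u) (b u) (a v) (b v)))"
    by (rule exE[OF integer_segments[of n p' q', OF n]], erule ne, elim exE)
  have abv: "a v \<in> \<int> \<times> \<int> \<and> b v \<in> \<int> \<times> \<int> \<and> a v \<noteq> b v \<and> closed_segment (a v) (b v) \<subseteq> ?B" if "v < n" for v
    using mp[OF spec[OF ab] that] by (elim conjE, intro conjI)
  have meet: "closed_segment (a u) (b u) \<inter> closed_segment (a v) (b v) \<noteq> {} \<longleftrightarrow> closed_segment (p u) (q u) \<inter> closed_segment (p v) (q v) \<noteq> {}"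
    if "u < n" "v < n" "u \<noteq> v" for u v
  proof (cases "closed_segment (p u) (q u) \<inter> closed_segment (p v) (q v) \<noteq> {}")
    case True
    then have "crossing (p' u) (q' u) (p' v) (q' v)" using gp that by simp
    then have "crossing (a u) (b u) (a v) (b v)" using ab that by blast
    then show ?thesis using True crossing_meet by blast
  next
    case False
    then have "separated (p' u) (q' u) (p' v) (q' v)" using gp that by simp
    then have "separated (a u) (b u) (a v) (b v)" using ab that by blast
    then show ?thesis using False separated_disjoint by blast
  qed
  define A where "A x = (let v = inv_into {..<n} \<psi> x in closed_segment (a v) (b v))" for x
  have A\<psi>: "A (\<psi> v) = closed_segment (a v) (b v)" if "v < n" for v
    using \<psi> that by (simp add: A_def bij_betw_def)
  have V: "pverts G = \<psi> ` {..<n}" and inj: "inj_on \<psi> {..<n}" using \<psi> by (simp_all add: bij_betw_def)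
  have "{(x, y). x \<in> \<psi> ` {..<n} \<and> y \<in> \<psi> ` {..<n} \<and> x \<noteq> y \<and> A x \<inter> A y \<noteq> {}} = parcs G"
    unfolding E
  proof (intro equalityI subsetI; clarify)
    fix u v assume uv: "u < n" "v < n" "\<psi> u \<noteq> \<psi> v" "A (\<psi> u) \<inter> A (\<psi> v) \<noteq> {}"
    then have "u \<noteq> v" by blast
    then show "\<exists>u' v'. (\<psi> u, \<psi> v) = (\<psi> u', \<psi> v') \<and> u' < n \<and> v' < n \<and> u' \<noteq> v' \<and> closed_segment (p u') (q u') \<inter> closed_segment (p v') (q v') \<noteq> {}"
      using uv meet[of u v] A\<psi> by (intro exI[of _ u] exI[of _ v]) simp
  next
    fix u v assume uv: "u < n" "v < n" "u \<noteq> v" "closed_segment (p u) (q u) \<inter> closed_segment (p v) (q v) \<noteq> {}"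
    then have "\<psi> u \<noteq> \<psi> v" using inj by (auto dest: inj_onD)
    then show "\<psi> u \<in> \<psi> ` {..<n} \<and> \<psi> v \<in> \<psi> ` {..<n} \<and> \<psi> u \<noteq> \<psi> v \<and> A (\<psi> u) \<inter> A (\<psi> v) \<noteq> {}"
      using uv meet[of u v] A\<psi> by simp
  qed
  then have "realizes A G" by (simp add: realizes_def intersection_graph_def V)
  moreover have "\<forall>x\<in>pverts G. is_integer_segment (A x)"
  proof
    fix x assume "x \<in> pverts G"
    then obtain v where v: "v < n" "x = \<psi> v" unfolding V by blast
    note w = abv[OF v(1)]
    show "is_integer_segment (A x)" unfolding v(2) A\<psi>[OF v(1)] is_integer_segment_def
      by (rule bexI[of _ "a v"], rule bexI[of _ "b v"]) (use w in auto)
  qed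
  moreover have "A x \<subseteq> ?B" if x: "x \<in> pverts G" for x
  proof -
    obtain v where v: "v < n" "x = \<psi> v" using x unfolding V by blast
    show ?thesis unfolding v(2) A\<psi>[OF v(1)] using abv[OF v(1)] by (elim conjE)
  qed
  ultimately show thesis using that[of A] by (simp add: integer_SEG_realization_def)
qed

lemma f_SEG_graph_le:
  assumes "integer_SEG_realization A G" "\<And>v. v \<in> pverts G \<Longrightarrow> A v \<subseteq> {- real k..real k} \<times> {- real k..real k}"
  shows "f_SEG_graph G \<le> k"
proof -
  have "f_SEG_graph G \<le> box_size (A ` pverts G)"
    unfolding f_SEG_graph_def by (rule Least_le) (use assms(1) in blast)
  also have "\<dots> \<le> k" unfolding box_size_def by (rule Least_le) (use assms(2) in blast)
  finally show ?thesis .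
qed

lemma SEG_nonempty: "SEG n \<noteq> {}"
proof -
  have "is_segment (closed_segment (0, 0) (1, 0))" unfolding is_segment_def by (metis prod.inject zero_neq_one)
  then show ?thesis using intersection_graph_in_SEG[of "{..<n}" "\<lambda>_. closed_segment (0, 0) (1, 0)"] by auto
qed

text \<open>With t = 2 ^ m the degree bound \<open>L\<close> is 2 t^4, and all factors are powers of
  2 with exponents polynomial in t. Their total exponent is at most 32 t^5, hence at most t^10, and
  2 ^ (t ^ 10) is the right-hand side.\<close>

lemma grid_bound_le:
  assumes "1 \<le> m"
  shows "grid_bound m \<le> 2 ^ (2 ^ (10 * m))"
proof -
  define t :: nat where "t = 2 ^ m"
  define L where "L = lim_deg m"
  have t2: "2 \<le> t" using power_increasing[of 1 m "2::nat"] assms by (simp add: t_def)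
  have mt: "m + 1 \<le> t" using less_exp[of m] unfolding t_def by linarith
  have tt: "t \<le> 2 ^ t" by simp
  have L: "L = 2 * t ^ 4" unfolding L_def lim_deg_def t_def
    using power_mult[of 4 2 m] power_mult[of "2::nat" 2 "2 * m"] power_mult[of "2::nat" m 4] by (simp add: mult.commute)
  have L2: "L \<le> t ^ 5"
  proof -
    have "L \<le> t * t ^ 4" unfolding L using t2 by simp
    then show ?thesis by (simp add: eval_nat_numeral)
  qed
  have e5: "t ^ 5 \<le> 2 ^ (5 * t)" using power_mono[OF tt, of 5] by (simp add: power_mult[symmetric] mult.commute)
  have L1: "L + 1 \<le> 2 ^ (6 * t)"
  proof -
    have "L + 1 \<le> 2 * 2 ^ (5 * t)" using L2 e5 one_le_power[of "2::nat" "5 * t"] by linarith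
    also have "\<dots> = 2 ^ (5 * t + 1)" by simp
    also have "\<dots> \<le> 2 ^ (6 * t)" using t2 by (intro power_increasing) auto
    finally show ?thesis .
  qed
  have m8: "8 * (m + 1)^2 \<le> 2 ^ (4 * t)"
  proof -
    have "(m + 1)^2 \<le> t^2" using mt by (rule power_mono) simp
    also have "\<dots> \<le> (2 ^ t)^2" using tt by (rule power_mono) simp
    finally have "8 * (m + 1)^2 \<le> 8 * (2 ^ t)^2" by simp
    also have "\<dots> = 2 ^ (2 * t + 3)" by (simp add: power_mult[symmetric] power_add mult.commute)
    also have "\<dots> \<le> 2 ^ (4 * t)" using t2 by (intro power_increasing) auto
    finally show ?thesis .
  qed
  have a: "(L + 1) ^ (2 * m) \<le> 2 ^ (12 * t * m)" using power_mono[OF L1, of "2 * m"] by (simp add: power_mult[symmetric] ac_simps)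
  have b: "(8 * (m + 1)^2) ^ (2 * L) \<le> 2 ^ (8 * t * L)" using power_mono[OF m8, of "2 * L"] by (simp add: power_mult[symmetric] ac_simps)
  have L': "L \<le> 2 ^ (6 * t)" using L1 by linarith
  have "root_bound m \<le> 2 ^ (6 * t) * (2 * (2 ^ (6 * t) * 2 ^ (12 * t * m)) * 2 ^ (8 * t * L))"
    unfolding root_bound_def L_def[symmetric] by (intro mult_mono a b L' order_refl) auto
  also have "\<dots> = 2 ^ (12 * t + 1 + 12 * t * m + 8 * t * L)"
    by (simp add: power_add[symmetric] algebra_simps flip: power_Suc)
  finally have r: "root_bound m \<le> 2 ^ (12 * t + 1 + 12 * t * m + 8 * t * L)" .
  have "4 * (m + 1)^2 \<le> 2 ^ (4 * t)" using m8 by linarith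
  from mult_mono[OF this r] have "4 * (m + 1)^2 * root_bound m \<le> 2 ^ (16 * t + 1 + 12 * t * m + 8 * t * L)"
    by (simp add: power_add[symmetric] algebra_simps)
  then have "grid_bound m \<le> 2 * 2 ^ (16 * t + 1 + 12 * t * m + 8 * t * L)"
    unfolding grid_bound_def using one_le_power[of "2::nat" "16 * t + 1 + 12 * t * m + 8 * t * L"] by linarith
  also have "\<dots> = 2 ^ (16 * t + 2 + 12 * t * m + 8 * t * L)" by simp
  also have "\<dots> \<le> 2 ^ (t ^ 10)"
  proof (intro power_increasing)
    have "12 * t * m \<le> 12 * t * t" "8 * t * L = 16 * (t * t ^ 4)" using mt unfolding L by (simp_all add: ac_simps)
    moreover have p: "16 \<le> t ^ 4" "8 \<le> t ^ 3" "32 \<le> t ^ 5" using power_mono[OF t2, of 4] power_mono[OF t2, of 3] power_mono[OF t2, of 5] by auto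
    moreover have "16 * t \<le> t ^ 5" "8 * (t * t) \<le> t ^ 5"
      using mult_le_mono[OF p(1) order_refl[of t]] mult_le_mono[OF p(2) order_refl[of "t * t"]] by (simp_all add: eval_nat_numeral)
    moreover have "t * t ^ 4 = t ^ 5" by (simp add: eval_nat_numeral)
    ultimately have "16 * t + 2 + 12 * t * m + 8 * t * L \<le> 32 * t ^ 5" by linarith
    also have "\<dots> \<le> t ^ 5 * t ^ 5" using p(3) by (rule mult_right_mono) simp
    finally show "16 * t + 2 + 12 * t * m + 8 * t * L \<le> t ^ 10" by (simp flip: power_add)
  qed simp
  finally show ?thesis by (simp add: t_def power_mult[symmetric] mult.commute)
qed

theorem theorem1p3:
  shows "\<exists>(c1::real) (c2::real) (n0::nat). c1 > 0 \<and> c2 > 0 \<and>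
    (\<forall>n\<ge>n0. 2 powr (2 powr (c1 * real n)) \<le> real (f_SEG n) \<and>
             real (f_SEG n) \<le> 2 powr (2 powr (c2 * real n)))"
proof (intro exI conjI allI impI)
  fix n :: nat assume n: "448 \<le> n"
  then have n0: "0 < n" by simp
  have le: "f_SEG_graph G \<le> grid_bound (4 * n)" if G: "G \<in> SEG n" for G
    by (rule integer_realization_in_box[OF G n0], rule f_SEG_graph_le)
  have fin: "finite (f_SEG_graph ` SEG n)"
    by (rule finite_subset[of _ "{..grid_bound (4 * n)}"]) (use le in auto)
  have ex: "\<exists>A. integer_SEG_realization A G" if G: "G \<in> SEG n" for G
    by (rule integer_realization_in_box[OF G n0]) (rule exI)
  show "2 powr (2 powr (1 / 28 * real n)) \<le> real (f_SEG n)" by (rule lower_bound_powr[OF n ex fin])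
  have "f_SEG n \<le> grid_bound (4 * n)" unfolding f_SEG_def using fin SEG_nonempty le by (subst Max_le_iff) auto
  \<comment> \<open>Four coordinates per segment turn the constant 10 of
    \<open>grid_bound_le\<close> into 40.\<close>
  also have "\<dots> \<le> 2 ^ (2 ^ (40 * n))" using grid_bound_le[of "4 * n"] n0 by simp
  finally have "real (f_SEG n) \<le> real (2 ^ (2 ^ (40 * n)))" by (simp only: of_nat_le_iff)
  also have "\<dots> = 2 powr (2 powr (40 * real n))"
    using powr_realpow[of 2 "40 * n"] powr_realpow[of 2 "2 ^ (40 * n)"] by simp
  finally show "real (f_SEG n) \<le> 2 powr (2 powr (40 * real n))" .
qed auto

end
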